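(* For all $n\ge1$, the abscissa of convergence of the subgroup zeta function $\zeta_{H_n(\mathbb Z)}(s)$ is $\alpha_n=2n$. Moreover, for $n\ge2$, the pole of (the meromorphic continuation of) $\zeta_{H_n(\mathbb Z)}(s)$ at $s=2n$ is simple and $$s_N(H_n(\mathbb Z))\sim\frac{R_n}{2n}\,N^{2n}\qquad(N\to\infty).$$
   Context: Heisenberg group: $H_n(\mathbb Z)$ is the Heisenberg group of degree $n$ over $\mathbb Z$, i.e. the $n$-fold central amalgamated power of the group $H(\mathbb Z)$ of upper unitriangular $3\times3$ integer matrices (the $n$ copies of $H(\mathbb Z)$ commute pairwise and their centres are identified). Equivalently, $H_n(\mathbb Z)$ is the group on $\mathbb Z^n\times\mathbb Z^n\times\mathbb Z$ with $(a,b,c)(a',b',c')=(a+a',b+b',c+c'+\sum_i a_ib'_i)$. Subgroup growth: $a_m(G)$ is the number of subgroups of index $m$ in $G$; $\zeta_G(s)=\sum_{m\ge1}a_m(G)m^{-s}$; $s_N(G)=\sum_{m\le N}a_m(G)$. The abscissa of convergence is the infimum of the real $a$ such that the series converges for $\operatorname{Re}(s)>a$. It is known that $\zeta_{H_n(\mathbb Z)}(s)$ admits some meromorphic continuation beyond its abscissa of convergence. Hyperoctahedral group: $B_n$ is the group of signed permutations of $\{\pm1,\dots,\pm n\}$ (bijections $g$ with $g(-i)=-g(i)$), with Coxeter generators $s_0$ (changing the sign of $1$) and $s_i=(i,i+1)$ for $1\le i\le n-1$. Put $g(0)=0$; $\ell$ is the Coxeter length; $\mathrm{Des}_B(g)=\{i\in\{0,\dots,n-1\}\mid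 g(i)>g(i+1)\}$; $\mathrm{des}_B(g)=|\mathrm{Des}_B(g)|$; $\mathrm{neg}(g)=\#\{i\in\{1,\dots,n\}\mid g(i)<0\}$. With $c_i=\frac{n(n+5)-i(i+1)}2$, set $$C(g)=n\,\mathrm{neg}(g)-\ell(g)+\sum_{i\in\mathrm{Des}_B(g)}c_i,\qquad D(g)=(n+1)\,\mathrm{des}_B(g)+\mathrm{neg}(g),$$ $$N_n(X,Y)=\sum_{g\in B_n}(-1)^{\mathrm{neg}(g)}X^{C(g)}Y^{D(g)}.$$ The constant $R_n$ (for $n\ge2$), with $p$ ranging over all primes and $\zeta$ the Riemann zeta function, is $$R_n=\Bigl(\prod_pN_n(p,p^{-2n})\Bigr)\prod_{i=0}^{2n-2}\zeta(2n-i)\prod_{i=0}^n\zeta\Bigl(2n^2-\tbinom{n+1}2+\tbinom{i+1}2\Bigr).$$ *)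

theory Defs
  imports
    "HOL-Complex_Analysis.Complex_Analysis"
    "HOL-Algebra.Coset"
    "HOL-Combinatorics.Permutations"
    "HOL-Computational_Algebra.Primes"
    "HOL-Library.Extended_Real"
    "HOL-Library.Landau_Symbols"
begin

section \<open>The Heisenberg group of degree \<open>n\<close> over the integers\<close>

text \<open>Vectors in \<open>\<int>\<^sup>n\<close> are functions \<open>nat \<Rightarrow> int\<close> vanishing outside \<open>{..<n}\<close>, so that equality in
  the carrier is equality of coordinate vectors.\<close>

definition int_vecs :: "nat \<Rightarrow> (nat \<Rightarrow> int) set" where
  "int_vecs n = {a. \<forall>i\<ge>n. a i = 0}"

definition heisenberg :: "nat \<Rightarrow> ((nat \<Rightarrow> int) \<times> (nat \<Rightarrow> int) \<times> int) monoid" where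
  "heisenberg n =
     \<lparr>carrier = int_vecs n \<times> int_vecs n \<times> UNIV,
      monoid.mult = (\<lambda>(a, b, c) (a', b', c').
        (\<lambda>i. a i + a' i, \<lambda>i. b i + b' i, c + c' + (\<Sum>i<n. a i * b' i))),
      one = (\<lambda>_. 0, \<lambda>_. 0, 0)\<rparr>"

lemma group_heisenberg: "group (heisenberg n)"
proof (rule groupI)
  fix x assume "x \<in> carrier (heisenberg n)"
  then obtain a b c where x: "x = (a, b, c)" "a \<in> int_vecs n" "b \<in> int_vecs n"
    by (auto simp: heisenberg_def)
  let ?y = "(\<lambda>i. - a i, \<lambda>i. - b i, - c + (\<Sum>i<n. a i * b i))"
  have "?y \<in> carrier (heisenberg n)" and "?y \<otimes>\<^bsub>heisenberg n\<^esub> x = \<one>\<^bsub>heisenberg n\<^esub>"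
    using x by (auto simp: heisenberg_def int_vecs_def sum_negf)
  then show "\<exists>y\<in>carrier (heisenberg n). y \<otimes>\<^bsub>heisenberg n\<^esub> x = \<one>\<^bsub>heisenberg n\<^esub>"
    by blast
qed (auto simp: heisenberg_def int_vecs_def distrib_left distrib_right sum.distrib add_ac)


section \<open>Subgroup growth\<close>

text \<open>For finitely generated \<open>G\<close>, such as \<open>heisenberg n\<close>, the counted sets are finite.\<close>

definition num_subgroups_of_index :: "('a, 'b) monoid_scheme \<Rightarrow> nat \<Rightarrow> nat" where
  "num_subgroups_of_index G m =
     card {H. subgroup H G \<and> finite (rcosets\<^bsub>G\<^esub> H) \<and> card (rcosets\<^bsub>G\<^esub> H) = m}"

definition num_subgroups_upto_index :: "('a, 'b) monoid_scheme \<Rightarrow> nat \<Rightarrow> nat" where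
  "num_subgroups_upto_index G N = (\<Sum>m=1..N. num_subgroups_of_index G m)"

definition subgroup_zeta_term :: "('a, 'b) monoid_scheme \<Rightarrow> complex \<Rightarrow> nat \<Rightarrow> complex" where
  "subgroup_zeta_term G s m = of_nat (num_subgroups_of_index G m) * of_nat m powr (- s)"

definition subgroup_zeta :: "('a, 'b) monoid_scheme \<Rightarrow> complex \<Rightarrow> complex" where
  "subgroup_zeta G s = (\<Sum>k. subgroup_zeta_term G s (Suc k))"

definition subgroup_zeta_abscissa :: "('a, 'b) monoid_scheme \<Rightarrow> ereal" where
  "subgroup_zeta_abscissa G =
     Inf {ereal a | a. \<forall>s. Re s > a \<longrightarrow> summable (\<lambda>k. subgroup_zeta_term G s (Suc k))}"

text \<open>\<open>F\<close> is a meromorphic continuation of the subgroup zeta function of \<open>G\<close> to the region \<open>U\<close>.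
  Connectedness makes \<open>F\<close> unique up to its values on a discrete set.\<close>

definition meromorphic_continuation ::
  "('a, 'b) monoid_scheme \<Rightarrow> complex set \<Rightarrow> (complex \<Rightarrow> complex) \<Rightarrow> bool" where
  "meromorphic_continuation G U F \<longleftrightarrow>
     open U \<and> connected U \<and> {s. ereal (Re s) > subgroup_zeta_abscissa G} \<subseteq> U \<and>
     F meromorphic_on U \<and>
     (\<forall>s. ereal (Re s) > subgroup_zeta_abscissa G \<longrightarrow> F s = subgroup_zeta G s)"


section \<open>The hyperoctahedral group\<close>

text \<open>Signed permutations are extended to all of \<open>int\<close> by the identity; in particular \<open>g 0 = 0\<close>.\<close>

definition hyperoctahedral :: "nat \<Rightarrow> (int \<Rightarrow> int) set" where
  "hyperoctahedral n =
     {g. g permutes {i. i \<noteq> 0 \<and> \<bar>i\<bar> \<le> int n} \<and> (\<forall>i. g (- i) = - g i)}"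

definition coxeter_gen :: "nat \<Rightarrow> int \<Rightarrow> int" where
  "coxeter_gen i =
     (if i = 0 then Transposition.transpose 1 (- 1)
      else Transposition.transpose (int i) (int i + 1) \<circ>
        Transposition.transpose (- int i) (- (int i + 1)))"

definition coxeter_length :: "nat \<Rightarrow> (int \<Rightarrow> int) \<Rightarrow> nat" where
  "coxeter_length n g =
     (LEAST k. \<exists>w. length w = k \<and> set w \<subseteq> {..<n} \<and> g = foldr (\<circ>) (map coxeter_gen w) id)"

definition Des_B :: "nat \<Rightarrow> (int \<Rightarrow> int) \<Rightarrow> nat set" where
  "Des_B n g = {i. i < n \<and> g (int i) > g (int i + 1)}"

definition des_B :: "nat \<Rightarrow> (int \<Rightarrow> int) \<Rightarrow> nat" where
  "des_B n g = card (Des_B n g)"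

definition neg_B :: "nat \<Rightarrow> (int \<Rightarrow> int) \<Rightarrow> nat" where
  "neg_B n g = card {i \<in> {1..n}. g (int i) < 0}"

text \<open>The division is exact, since \<open>n (n + 5)\<close> and \<open>i (i + 1)\<close> are both even.\<close>

definition c_coeff :: "nat \<Rightarrow> nat \<Rightarrow> int" where
  "c_coeff n i = (int n * (int n + 5) - int i * (int i + 1)) div 2"

definition C_stat :: "nat \<Rightarrow> (int \<Rightarrow> int) \<Rightarrow> int" where
  "C_stat n g =
     int n * int (neg_B n g) - int (coxeter_length n g) + (\<Sum>i\<in>Des_B n g. c_coeff n i)"

definition D_stat :: "nat \<Rightarrow> (int \<Rightarrow> int) \<Rightarrow> nat" where
  "D_stat n g = (n + 1) * des_B n g + neg_B n g"

definition N_poly :: "nat \<Rightarrow> real \<Rightarrow> real \<Rightarrow> real" where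
  "N_poly n X Y =
     (\<Sum>g\<in>hyperoctahedral n. (- 1) ^ neg_B n g * X powi C_stat n g * Y ^ D_stat n g)"


section \<open>The constant\<close>

text \<open>The Riemann zeta function by its Dirichlet series, hence only for real arguments greater
  than \<open>1\<close>; for \<open>n \<ge> 2\<close> all arguments in \<open>R_const n\<close> are at least \<open>2\<close>.\<close>

definition riemann_zeta :: "real \<Rightarrow> real" where
  "riemann_zeta s = (\<Sum>k. real (Suc k) powr (- s))"

definition R_const :: "nat \<Rightarrow> real" where
  "R_const n =
     (\<Prod>p. if prime p then N_poly n (real p) (real p powi (- 2 * int n)) else 1) *
     (\<Prod>i=0..2*n-2. riemann_zeta (2 * real n - real i)) *
     (\<Prod>i=0..n. riemann_zeta
        (2 * real n ^ 2 - real ((n + 1) choose 2) + real ((i + 1) choose 2)))"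

end

theory Submission
  imports Defs "HOL-Number_Theory.Cong"
begin

text \<open>A finite-index subgroup of the Heisenberg group meets the centre in \<open>k\<int>\<close> for some \<open>k \<ge> 1\<close>
and projects onto a full lattice \<open>L\<close> in \<open>\<int>\<close> to the power \<open>2 * n\<close>. Two elements of the subgroup
commute up to the value of the symplectic form on their projections, so that form vanishes modulo
\<open>k\<close> on \<open>L\<close>; conversely, for such \<open>k\<close> and \<open>L\<close> the subgroup is recovered from central coordinates of a
basis of \<open>L\<close>, chosen freely modulo \<open>k\<close>. Hence (\<open>num_subgroups_subgroup_data\<close>) the subgroups of index
\<open>m\<close> correspond to the triples of \<open>k\<close>, a matrix \<open>M\<close> in Hermite normal form that is isotropic modulo
\<open>k\<close>, and a vector of \<open>2 * n\<close> central coordinates modulo \<open>k\<close>, with \<open>k * det M = m\<close>.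

For fixed \<open>k\<close>, all columns of \<open>M\<close> but the last are summed with weight \<open>1 / det ^ (2 * n)\<close>, while the
last column is equidistributed modulo \<open>k\<close>. This gives \<open>central_density n k * X ^ (2 * n) / (2 * n)\<close>
subgroups of index at most \<open>X\<close> with this \<open>k\<close>, with an error of lower order in \<open>X\<close> that grows with
\<open>k\<close> (\<open>central_count_approx\<close>). The density splits column by column: by the Euclidean algorithm a
column of a Hermite normal form, weighted by a power of its diagonal entry, behaves like a uniform
column modulo \<open>k\<close> times a zeta value (\<open>column_sum\<close>, \<open>hnf_sum\<close>). So \<open>central_density n k\<close> is a
product of zeta values times the probability \<open>iso_prob n k\<close> that a random square matrix modulo \<open>k\<close>
is isotropic (\<open>central_density_eq\<close>).

The error cannot be summed over \<open>k\<close> as it stands. Isotropy forces two divisibilities by \<open>k\<close>, between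
diagonal entries of outer and of middle columns; for \<open>n \<ge> 2\<close> they are independent and yield a
bound with the summable factor \<open>k powr (- 3 / 2)\<close>. The geometric mean of the two estimates is
summable and still saves a power of \<open>X\<close> (\<open>sum_central_count_asymptotics\<close>). One of the two
divisibilities alone gives, for every \<open>n\<close>, the upper bound for the abscissa; subgroups containing
the centre and having a special lattice give the lower bound (\<open>abscissa_heisenberg\<close>). Abel summation
turns the power saving into a continuation past the pole, and uniqueness of continuation transfers
the simple pole to every other continuation (\<open>dirichlet_sums\<close>,
\<open>is_simple_pole_unique_continuation\<close>).

It remains to recognise the constant. The isotropy probability is multiplicative in \<open>k\<close>. For a power
of a prime \<open>p\<close>, removing pivot columns and dividing the others by \<open>p\<close> gives a recursion in the
exponent (\<open>van_prob_prime_power\<close>). On the hyperoctahedral side, a code of signed permutations by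
\<open>r j < 2 * j\<close> turns length, negative entries and descents into simple statistics, and cutting at the
largest chosen descent gives a recursion (\<open>desc_series_rec\<close>) with the same coefficients
(\<open>block_sum_closed\<close>, \<open>wsol_Suc\<close>). So each local factor of the sum of isotropy probabilities is the
polynomial \<open>N_poly\<close> divided by a product of Euler factors of zeta functions (\<open>iso_prob_local_sums\<close>),
and the Euler product gives \<open>R_const_eq\<close>.\<close>

section \<open>Averages over residue cubes\<close>

definition cube :: "nat set \<Rightarrow> nat \<Rightarrow> (nat \<Rightarrow> int) set" where
  "cube I q = {v. \<forall>i. if i \<in> I then 0 \<le> v i \<and> v i < int q else v i = 0}"

text \<open>The mean of \<open>F\<close> over the vectors supported on \<open>I\<close>, with entries reduced modulo \<open>q\<close>; for functions of
period \<open>q\<close> this is the expectation over uniform residue vectors.\<close>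

definition avg :: "nat set \<Rightarrow> nat \<Rightarrow> ((nat \<Rightarrow> int) \<Rightarrow> real) \<Rightarrow> real" where
  "avg I q F = (\<Sum>v\<in>cube I q. F v) / real q ^ card I"

definition periodic :: "nat \<Rightarrow> ((nat \<Rightarrow> int) \<Rightarrow> 'b) \<Rightarrow> bool" where
  "periodic q F \<longleftrightarrow> (\<forall>v w. (\<forall>i. [v i = w i] (mod int q)) \<longrightarrow> F v = F w)"

definition rowop :: "nat \<Rightarrow> nat \<Rightarrow> int \<Rightarrow> (nat \<Rightarrow> int) \<Rightarrow> nat \<Rightarrow> int" where
  "rowop i j c v = v(i := v i + c * v j)"

lemma cube_empty: "cube {} q = {\<lambda>_. 0}"
  by (auto simp: cube_def)

text \<open>The coordinate \<open>x\<close> of a vector is split off, so that statements on cubes reduce to one coordinate at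
a time.\<close>

lemma sum_cube_insert:
  assumes "x \<notin> I"
  shows "(\<Sum>v\<in>cube (insert x I) q. F v) = (\<Sum>a<q. \<Sum>v\<in>cube I q. F (v(x := int a)))"
proof -
  have "(\<Sum>v\<in>cube (insert x I) q. F v) = (\<Sum>(a, v)\<in>{..<q} \<times> cube I q. F (v(x := int a)))"
    by (rule sum.reindex_bij_witness[of _ "\<lambda>(a, v). v(x := int a)" "\<lambda>v. (nat (v x), v(x := 0))"])
       (use assms in \<open>auto simp: cube_def fun_eq_iff split: if_splits\<close>)
  then show ?thesis by (simp add: sum.cartesian_product)
qed

lemma cube_insert:
  assumes "x \<notin> I"
  shows "cube (insert x I) q = (\<lambda>(a, v). v(x := int a)) ` ({..<q} \<times> cube I q)"
proof (intro equalityI subsetI)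
  fix v assume v: "v \<in> cube (insert x I) q"
  then have "v = (\<lambda>(a, v). v(x := int a)) (nat (v x), v(x := 0))"
    by (auto simp: cube_def fun_eq_iff)
  moreover have "(nat (v x), v(x := 0)) \<in> {..<q} \<times> cube I q"
    using v assms by (auto simp: cube_def split: if_splits)
  ultimately show "v \<in> (\<lambda>(a, v). v(x := int a)) ` ({..<q} \<times> cube I q)" by blast
qed (use assms in \<open>auto simp: cube_def split: if_splits\<close>)

lemma finite_cube: "finite I \<Longrightarrow> finite (cube I q)"
  by (induction I rule: finite_induct) (auto simp: cube_empty cube_insert)

lemma card_cube: "finite I \<Longrightarrow> card (cube I q) = q ^ card I"
proof (induction I rule: finite_induct)
  case (insert x I)
  have "card (cube (insert x I) q) = (\<Sum>v\<in>cube (insert x I) q. 1)" by simp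
  also have "\<dots> = (\<Sum>a<q. \<Sum>v\<in>cube I q. 1)" by (rule sum_cube_insert) (use insert in auto)
  finally show ?case using insert by simp
qed (simp add: cube_empty)

lemma avg_empty: "avg {} q F = F (\<lambda>_. 0)"
  by (simp add: avg_def cube_empty)

lemma avg_insert:
  assumes "finite I" "x \<notin> I"
  shows "avg (insert x I) q F = (\<Sum>a<q. avg I q (\<lambda>v. F (v(x := int a)))) / real q"
  using assms by (simp add: avg_def sum_cube_insert sum_divide_distrib[symmetric] mult.commute)

lemma avg_cong: "(\<And>v. v \<in> cube I q \<Longrightarrow> F v = G v) \<Longrightarrow> avg I q F = avg I q G"
  by (simp add: avg_def)

lemma avg_mono: "(\<And>v. v \<in> cube I q \<Longrightarrow> F v \<le> G v) \<Longrightarrow> avg I q F \<le> avg I q G"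
  by (auto simp: avg_def intro!: divide_right_mono sum_mono)

lemma avg_const: "finite I \<Longrightarrow> q > 0 \<Longrightarrow> avg I q (\<lambda>_. c) = c"
  by (simp add: avg_def card_cube)

lemma avg_nonneg: "(\<And>v. F v \<ge> 0) \<Longrightarrow> avg I q F \<ge> 0"
  by (auto simp: avg_def intro!: divide_nonneg_nonneg sum_nonneg)

lemma avg_le_1:
  assumes "\<And>v. F v \<le> 1" "finite I" "q > 0"
  shows "avg I q F \<le> 1"
  using avg_mono[of I q F "\<lambda>_. 1"] assms by (simp add: avg_const)

lemma avg_swap: "avg I q (\<lambda>v. avg J r (\<lambda>w. F v w)) = avg J r (\<lambda>w. avg I q (\<lambda>v. F v w))"
  by (simp add: avg_def sum_divide_distrib[symmetric] sum.swap[of _ "cube I q"] mult.commute)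

lemma avg_cmult: "avg I q (\<lambda>v. c * F v) = c * avg I q F"
  by (simp add: avg_def sum_distrib_left)

lemma periodic_D: "periodic q F \<Longrightarrow> (\<And>i. [v i = w i] (mod int q)) \<Longrightarrow> F v = F w"
  unfolding periodic_def by blast

lemma periodic_upd: "periodic q F \<Longrightarrow> periodic q (\<lambda>v. F (v(x := a)))"
  unfolding periodic_def by (metis cong_refl fun_upd_apply)

lemma sum_periodic_mult:
  fixes f :: "int \<Rightarrow> real"
  assumes "\<And>x. f (x + int d) = f x"
  shows "(\<Sum>a<d * m. f (int a)) = real m * (\<Sum>a<d. f (int a))"
proof -
  have shift: "f (x + int d * int j) = f x" for x j
  proof (induction j)
    case (Suc j)
    have "f (x + int d * int (Suc j)) = f ((x + int d * int j) + int d)"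
      by (simp add: algebra_simps)
    with assms Suc show ?case by simp
  qed simp
  show ?thesis
  proof (induction m)
    case (Suc m)
    have "(\<Sum>a<d * Suc m. f (int a)) = (\<Sum>a<d * m. f (int a)) + (\<Sum>a=d*m..<d*m+d. f (int a))"
      by (metis (no_types, lifting) add.commute le_add1 lessThan_atLeast0 mult_Suc_right sum.atLeastLessThan_concat zero_le)
    also have "(\<Sum>a=d*m..<d*m+d. f (int a)) = (\<Sum>a<d. f (int a + int d * int m))"
      using sum.shift_bounds_nat_ivl[of "\<lambda>a. f (int a)" 0 "d*m" d]
      by (simp add: lessThan_atLeast0 add.commute mult.commute)
    finally show ?case using Suc by (simp add: shift algebra_simps)
  qed simp
qed

lemma periodic_real:
  fixes F :: "(nat \<Rightarrow> int) \<Rightarrow> 'b"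
  assumes "periodic d F" shows "F (v(x := a + int d)) = F (v(x := a))"
  by (rule periodic_D[OF assms]) (auto simp: cong_def)

lemma avg_period:
  assumes "finite I" "periodic d F" "m > 0" "d > 0"
  shows "avg I (d * m) F = avg I d F"
  using assms(1,2)
proof (induction I arbitrary: F rule: finite_induct)
  case (insert x I)
  have "(\<Sum>a<d * m. avg I (d * m) (\<lambda>v. F (v(x := int a))))
      = (\<Sum>a<d * m. avg I d (\<lambda>v. F (v(x := int a))))"
    using insert by (intro sum.cong) (auto intro: periodic_upd)
  also have "\<dots> = real m * (\<Sum>a<d. avg I d (\<lambda>v. F (v(x := int a))))"
    by (rule sum_periodic_mult[where f = "\<lambda>z. avg I d (\<lambda>v. F (v(x := z)))"])
       (simp only: periodic_real[OF insert.prems])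
  finally show ?case using insert assms(3,4) by (simp add: avg_insert)
qed (simp add: avg_empty)

text \<open>Both means equal the mean over the common multiple \<open>d * k\<close>. This is how a sum over a box of side
\<open>d\<close>, given by a Hermite normal form, becomes an average modulo \<open>k\<close>.\<close>

lemma avg_period2:
  assumes "finite I" "periodic d F" "periodic k F" "d > 0" "k > 0"
  shows "avg I d F = avg I k F"
  using avg_period[OF assms(1,2), of k] avg_period[OF assms(1,3), of d] assms
  by (simp add: mult.commute)

text \<open>An elementary row operation only translates one coordinate by a multiple of another, and a translate
of a full period has the same mean.\<close>

lemma avg_rowop:
  assumes "periodic q F" "q > 0" "i \<in> I" "j \<in> I" "i \<noteq> j"
  shows "avg I q (\<lambda>v. F (rowop i j c v)) = avg I q F"
proof -
  have "(\<Sum>v\<in>cube I q. F (rowop i j c v)) = (\<Sum>v\<in>cube I q. F v)"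
  proof (rule sum.reindex_bij_witness[of _ "\<lambda>v. v(i := (v i - c * v j) mod int q)"
        "\<lambda>v. v(i := (v i + c * v j) mod int q)"])
    fix v assume v: "v \<in> cube I q"
    then have vi: "v i mod int q = v i" using assms by (auto simp: cube_def split: if_splits)
    show "(v(i := (v i - c * v j) mod int q))(i := ((v(i := (v i - c * v j) mod int q)) i +
        c * (v(i := (v i - c * v j) mod int q)) j) mod int q) = v"
      using assms vi by (auto simp: fun_eq_iff mod_simps)
    show "(v(i := (v i + c * v j) mod int q))(i := ((v(i := (v i + c * v j) mod int q)) i -
        c * (v(i := (v i + c * v j) mod int q)) j) mod int q) = v"
      using assms vi by (auto simp: fun_eq_iff mod_simps)
    show "v(i := (v i - c * v j) mod int q) \<in> cube I q" "v(i := (v i + c * v j) mod int q) \<in> cube I q"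
      using v assms by (auto simp: cube_def)
    show "F (v(i := (v i + c * v j) mod int q)) = F (rowop i j c v)"
      by (rule periodic_D[OF assms(1)]) (auto simp: rowop_def cong_def)
  qed
  then show ?thesis by (simp add: avg_def)
qed

lemma sum_cube_multiples:
  assumes "p > 0"
  shows "(\<Sum>v | v \<in> cube I (p * m) \<and> (\<forall>i\<in>I. int p dvd v i). F v) = (\<Sum>w\<in>cube I m. F (\<lambda>i. int p * w i))"
proof (rule sum.reindex_bij_witness[of _ "\<lambda>w i. int p * w i" "\<lambda>v i. v i div int p"])
  fix v assume "v \<in> {v \<in> cube I (p * m). \<forall>i\<in>I. int p dvd v i}"
  then have v: "v \<in> cube I (p * m)" "\<And>i. i \<in> I \<Longrightarrow> int p dvd v i" by auto
  have d: "int p dvd v i" for i using v by (cases "i \<in> I") (auto simp: cube_def)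
  then show *: "(\<lambda>i. int p * (v i div int p)) = v" by (simp add: fun_eq_iff)
  have "int p * (v i div int p) < int p * int m" if "i \<in> I" for i
    using v(1) that d[of i] unfolding cube_def by (auto dest!: spec[of _ i])
  then have "v i div int p < int m" if "i \<in> I" for i
    using that assms by (simp add: mult_less_cancel_left)
  then show "(\<lambda>i. v i div int p) \<in> cube I m"
    using v assms by (auto simp: cube_def pos_imp_zdiv_nonneg_iff split: if_splits)
  show "F (\<lambda>i. int p * (v i div int p)) = F v" by (simp only: *)
qed (use assms in \<open>auto simp: cube_def mult_less_cancel_left split: if_splits\<close>)

text \<open>The Euclidean algorithm on the entries of \<open>v\<close>, by induction on the sum of their absolute values: as
long as two entries are nonzero, one of them can be reduced. The index \<open>s\<close> provides a zero entry
through which the last nonzero one can change its sign.\<close>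

lemma euclid_single:
  fixes F :: "(nat \<Rightarrow> int) \<Rightarrow> 'b"
  assumes el: "\<And>v i j c. i \<in> I \<Longrightarrow> j \<in> I \<Longrightarrow> i \<noteq> j \<Longrightarrow> F (rowop i j c v) = F v"
    and I: "finite I" "r \<in> I" "s \<in> I" "r \<noteq> s"
  shows "F v = F (\<lambda>i. if i \<in> I then if i = r then Gcd (v ` I) else 0 else v i)"
proof (induction "\<Sum>i\<in>I. nat \<bar>v i\<bar>" arbitrary: v rule: less_induct)
  case less
  show ?case
  proof (cases "\<exists>i j. i \<in> I \<and> j \<in> I \<and> i \<noteq> j \<and> v i \<noteq> 0 \<and> v j \<noteq> 0 \<and> \<bar>v j\<bar> \<le> \<bar>v i\<bar>")
    case True
    then obtain i j where ij: "i \<in> I" "j \<in> I" "i \<noteq> j" "v i \<noteq> 0" "v j \<noteq> 0" "\<bar>v j\<bar> \<le> \<bar>v i\<bar>"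
      by blast
    define c where "c = - sgn (v i) * sgn (v j)"
    define w where "w = rowop i j c v"
    have wi: "\<bar>w i\<bar> < \<bar>v i\<bar>" using ij by (auto simp: w_def rowop_def c_def sgn_if split: if_splits)
    have wo: "w l = v l" if "l \<noteq> i" for l using that by (simp add: w_def rowop_def)
    have "(\<Sum>l\<in>I. nat \<bar>w l\<bar>) < (\<Sum>l\<in>I. nat \<bar>v l\<bar>)"
    proof (rule sum_strict_mono_ex1)
      show "\<forall>l\<in>I. nat \<bar>w l\<bar> \<le> nat \<bar>v l\<bar>"
      proof
        fix l assume "l \<in> I"
        show "nat \<bar>w l\<bar> \<le> nat \<bar>v l\<bar>" using wi wo[of l] by (cases "l = i") auto
      qed
      show "\<exists>l\<in>I. nat \<bar>w l\<bar> < nat \<bar>v l\<bar>" using wi ij by (intro bexI[of _ i]) auto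
    qed (rule I)
    from less[OF this] have "F w = F (\<lambda>l. if l \<in> I then if l = r then Gcd (w ` I) else 0 else w l)" .
    moreover have "F w = F v" using el ij by (simp add: w_def)
    moreover have g: "Gcd (w ` I) = Gcd (v ` I)"
    proof -
      have dv: "(\<forall>l\<in>I. d dvd w l) \<longleftrightarrow> (\<forall>l\<in>I. d dvd v l)" for d
      proof -
        have "w i = v i + c * v j" by (simp add: w_def rowop_def)
        then have "d dvd w i \<longleftrightarrow> d dvd v i" if "d dvd v j"
          using that by (simp add: dvd_add_left_iff)
        moreover have "w j = v j" using wo ij by auto
        ultimately have "d dvd w i \<and> d dvd w j \<longleftrightarrow> d dvd v i \<and> d dvd v j" by auto
        moreover have eq: "(\<forall>l\<in>I. d dvd u l) \<longleftrightarrow> (d dvd u i \<and> d dvd u j) \<and> (\<forall>l\<in>I-{i,j}. d dvd u l)" for u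
          using ij by blast
        moreover have "(\<forall>l\<in>I-{i,j}. d dvd w l) \<longleftrightarrow> (\<forall>l\<in>I-{i,j}. d dvd v l)" using wo by auto
        ultimately show ?thesis using eq[of w] eq[of v] by argo
      qed
      show ?thesis
      proof (rule Gcd_eqI)
        fix b assume "b \<in> w ` I"
        then obtain l where l: "l \<in> I" "b = w l" by blast
        have "\<forall>l\<in>I. Gcd (v ` I) dvd v l" by simp
        then show "Gcd (v ` I) dvd b" using dv l by blast
      next
        fix d assume "\<And>b. b \<in> w ` I \<Longrightarrow> d dvd b"
        then have "\<forall>l\<in>I. d dvd v l" using dv by blast
        then show "d dvd Gcd (v ` I)" by (auto intro: Gcd_greatest)
      qed auto
    qed
    moreover have "(\<lambda>l. if l \<in> I then if l = r then Gcd (w ` I) else 0 else w l)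
        = (\<lambda>l. if l \<in> I then if l = r then Gcd (v ` I) else 0 else v l)"
    proof
      fix l
      show "(if l \<in> I then if l = r then Gcd (w ` I) else 0 else w l)
          = (if l \<in> I then if l = r then Gcd (v ` I) else 0 else v l)"
        using wo[of l] ij(1) by (cases "l \<in> I") (auto simp: g)
    qed
    ultimately show ?thesis by (simp only:)
  next
    case False
    have uniq: "\<And>i j. i \<in> I \<Longrightarrow> j \<in> I \<Longrightarrow> v i \<noteq> 0 \<Longrightarrow> v j \<noteq> 0 \<Longrightarrow> i = j"
    proof (rule ccontr)
      fix i j assume "i \<in> I" "j \<in> I" "v i \<noteq> 0" "v j \<noteq> 0" "i \<noteq> j"
      then show False using False linear[of "\<bar>v j\<bar>" "\<bar>v i\<bar>"] by blast
    qed
    have move: "F (u(j := u i, i := 0)) = F u" if "i \<in> I" "j \<in> I" "i \<noteq> j" "u j = 0" for u i j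
    proof -
      have "u(j := u i, i := 0) = rowop i j (-1) (rowop j i 1 u)"
        using that by (auto simp: rowop_def fun_eq_iff)
      moreover have "F (rowop i j (-1) (rowop j i 1 u)) = F (rowop j i 1 u)" by (rule el[OF that(1-3)])
      moreover have "F (rowop j i 1 u) = F u" by (rule el[OF that(2,1) that(3)[symmetric]])
      ultimately show ?thesis by (simp only:)
    qed
    obtain u where u: "F v = F u" "\<And>i. i \<in> I \<Longrightarrow> i \<noteq> r \<Longrightarrow> u i = 0" "\<And>i. i \<notin> I \<Longrightarrow> u i = v i"
        "Gcd (v ` I) = \<bar>u r\<bar>"
    proof (cases "\<exists>i\<in>I. v i \<noteq> 0")
      case True
      then obtain i where i: "i \<in> I" "v i \<noteq> 0" by blast
      have oth: "v l = 0" if "l \<in> I" "l \<noteq> i" for l using uniq i that by blast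
      have g: "Gcd (v ` I) = \<bar>v i\<bar>"
      proof (rule Gcd_eqI)
        fix b assume "b \<in> v ` I"
        then obtain l where "l \<in> I" "b = v l" by blast
        then show "\<bar>v i\<bar> dvd b" using oth by (cases "l = i") auto
      next
        fix d assume "\<And>b. b \<in> v ` I \<Longrightarrow> d dvd b"
        then have "d dvd v i" using i by blast
        then show "d dvd \<bar>v i\<bar>" by simp
      qed auto
      show ?thesis
      proof (cases "i = r")
        case True
        then show ?thesis using that[of v] g oth by auto
      next
        case False
        have "F v = F (v(r := v i, i := 0))" using move[of i r v] False oth i I by simp
        moreover have "(v(r := v i, i := 0)) l = 0" if "l \<in> I" "l \<noteq> r" for l using that oth by auto
        moreover have "(v(r := v i, i := 0)) l = v l" if "l \<notin> I" for l using that i I by auto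
        moreover have "Gcd (v ` I) = \<bar>(v(r := v i, i := 0)) r\<bar>" using g False by simp
        ultimately show ?thesis by (rule that)
      qed
    next
      case False
      then have "v ` I \<subseteq> {0}" by auto
      then have "Gcd (v ` I) = 0" by (simp add: Gcd_0_iff)
      then show ?thesis using that[of v] False I by auto
    qed
    have neg: "F (u(r := \<bar>u r\<bar>)) = F u"
    proof (cases "u r \<ge> 0")
      case False
      have "F (u(s := u r, r := 0)) = F u" using move[of r s u] u I by auto
      moreover have "u(r := \<bar>u r\<bar>) = rowop s r 1 (rowop r s (-1) (u(s := u r, r := 0)))"
        using False I u(2)[of s] by (auto simp: rowop_def fun_eq_iff)
      moreover have "F (rowop s r 1 (rowop r s (-1) (u(s := u r, r := 0)))) = F (rowop r s (-1) (u(s := u r, r := 0)))"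
        by (rule el[OF I(3,2) I(4)[symmetric]])
      moreover have "F (rowop r s (-1) (u(s := u r, r := 0))) = F (u(s := u r, r := 0))"
        by (rule el[OF I(2-4)])
      ultimately show ?thesis by (simp only:)
    qed simp
    have "u(r := \<bar>u r\<bar>) = (\<lambda>i. if i \<in> I then if i = r then Gcd (v ` I) else 0 else v i)"
      using u I by (auto simp: fun_eq_iff)
    with neg u(1) show ?thesis by simp
  qed
qed

text \<open>Since \<open>F\<close> only sees residues, the entry \<open>s\<close>, which is zero after the reduction, may be replaced by
\<open>q\<close>; a second run then brings the gcd with \<open>q\<close> to place \<open>r\<close>.\<close>

lemma euclid_mod:
  fixes F :: "(nat \<Rightarrow> int) \<Rightarrow> 'b"
  assumes el: "\<And>v i j c. i \<in> I \<Longrightarrow> j \<in> I \<Longrightarrow> i \<noteq> j \<Longrightarrow> F (rowop i j c v) = F v"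
    and I: "finite I" "r \<in> I" "s \<in> I" "r \<noteq> s" and periodic: "periodic q F"
  shows "F v = F (\<lambda>i. if i \<in> I then if i = r then gcd (int q) (Gcd (v ` I)) else 0 else v i)"
proof -
  define g where "g = Gcd (v ` I)"
  define w where "w = (\<lambda>i. if i \<in> I then if i = r then g else 0 else v i)"
  have "F v = F w" unfolding w_def g_def by (rule euclid_single[OF el I])
  also have "\<dots> = F (w(s := int q))"
    by (rule periodic_D[OF periodic]) (use I in \<open>auto simp: w_def cong_def\<close>)
  also have "\<dots> = F (\<lambda>i. if i \<in> I then if i = r then Gcd ((w(s := int q)) ` I) else 0 else (w(s := int q)) i)"
    by (rule euclid_single[OF el I])
  also have "Gcd ((w(s := int q)) ` I) = gcd (int q) g"
  proof (rule Gcd_eqI)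
    fix b assume "b \<in> (w(s := int q)) ` I"
    then show "gcd (int q) g dvd b" using I by (auto simp: w_def)
  next
    fix d assume d: "\<And>b. b \<in> (w(s := int q)) ` I \<Longrightarrow> d dvd b"
    have "d dvd (w(s := int q)) r" "d dvd (w(s := int q)) s" using d I by blast+
    then show "d dvd gcd (int q) g" using I by (auto simp: w_def)
  qed auto
  also have "(\<lambda>i. if i \<in> I then if i = r then gcd (int q) g else 0 else (w(s := int q)) i)
      = (\<lambda>i. if i \<in> I then if i = r then gcd (int q) g else 0 else v i)"
    using I by (auto simp: w_def)
  finally show ?thesis unfolding g_def .
qed

text \<open>Complete periods contribute exactly their mean, and the incomplete one an error of at most its
length.\<close>

lemma sum_periodic_approx:
  fixes f :: "int \<Rightarrow> real"
  assumes p: "\<And>x. f (x + int k) = f x" and b: "\<And>x. 0 \<le> f x" "\<And>x. f x \<le> 1" and "k > 0"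
  shows "\<bar>(\<Sum>a<d. f (int a)) - real d * ((\<Sum>a<k. f (int a)) / real k)\<bar> \<le> real k"
proof -
  define m where "m = (\<Sum>a<k. f (int a)) / real k"
  have m: "0 \<le> m" "m \<le> 1"
  proof -
    have "(\<Sum>a<k. f (int a)) \<le> (\<Sum>a<k. 1)" by (intro sum_mono b)
    then show "m \<le> 1" using \<open>k > 0\<close> by (simp add: m_def)
  qed (auto simp: m_def intro!: divide_nonneg_nonneg sum_nonneg b)
  define e where "e = d div k" define r where "r = d mod k"
  have d: "d = k * e + r" by (simp add: e_def r_def)
  have "(\<Sum>a<d. f (int a)) = (\<Sum>a<k * e. f (int a)) + (\<Sum>a=k*e..<d. f (int a))"
    using d by (metis (no_types, lifting) le_add1 lessThan_atLeast0 sum.atLeastLessThan_concat zero_le)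
  also have "(\<Sum>a<k * e. f (int a)) = real (k * e) * m"
    using sum_periodic_mult[of f k e, OF p] \<open>k > 0\<close> by (simp add: m_def)
  finally have "(\<Sum>a<d. f (int a)) - real d * m = (\<Sum>a=k*e..<d. f (int a)) - real r * m"
    using d by (simp add: algebra_simps)
  moreover have "(\<Sum>a=k*e..<d. f (int a)) \<le> (\<Sum>a=k*e..<d. 1)" by (intro sum_mono b)
  moreover have "(\<Sum>a=k*e..<d. f (int a)) \<ge> 0" by (intro sum_nonneg b)
  moreover have "real r * m \<le> real r * 1" using m by (intro mult_left_mono) auto
  moreover have "real r * m \<ge> 0" using m by auto
  moreover have "r < k" using \<open>k > 0\<close> by (simp add: r_def)
  moreover have "(\<Sum>a=k*e..<d. 1::real) = real r" using d by simp
  ultimately show ?thesis unfolding m_def by (smt (verit, best) of_nat_less_iff)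
qed

text \<open>Equidistribution in a box that is not a multiple of the period, by changing one coordinate at a
time. The factor \<open>real d\<close> on the left avoids the exponent \<open>card I - 1\<close>.\<close>

lemma cube_approx:
  assumes "finite I" "periodic k F" "\<And>v. 0 \<le> F v" "\<And>v. F v \<le> 1" "k > 0" "d > 0"
  shows "real d * \<bar>(\<Sum>v\<in>cube I d. F v) - real d ^ card I * avg I k F\<bar> \<le> real (card I) * real k * real d ^ card I"
  using assms(1-4)
proof (induction I arbitrary: F rule: finite_induct)
  case (insert x I)
  define A where "A = (\<lambda>a. avg I k (\<lambda>v. F (v(x := a))))"
  define S where "S = (\<lambda>a. \<Sum>v\<in>cube I d. F (v(x := int a)))"
  define n where "n = card I"
  have IH: "real d * \<bar>S a - real d ^ n * A (int a)\<bar> \<le> real n * real k * real d ^ n" for a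
    unfolding S_def A_def n_def by (rule insert.IH) (use insert.prems in \<open>auto intro: periodic_upd simp del: fun_upd_apply\<close>)
  have A: "\<bar>(\<Sum>a<d. A (int a)) - real d * ((\<Sum>a<k. A (int a)) / real k)\<bar> \<le> real k"
  proof (rule sum_periodic_approx)
    show "A (a + int k) = A a" for a by (simp only: A_def periodic_real[OF insert.prems(1)])
    show "A a \<le> 1" for a unfolding A_def by (rule avg_le_1) (use insert assms in auto)
  qed (use insert assms in \<open>auto simp: A_def intro: avg_nonneg\<close>)
  have "(\<Sum>v\<in>cube (insert x I) d. F v) = (\<Sum>a<d. S a)"
    using insert by (simp add: sum_cube_insert S_def)
  moreover have "avg (insert x I) k F = (\<Sum>a<k. A (int a)) / real k"
    using insert by (simp add: avg_insert A_def)
  ultimately have "(\<Sum>v\<in>cube (insert x I) d. F v) - real d ^ card (insert x I) * avg (insert x I) k F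
     = (\<Sum>a<d. S a - real d ^ n * A (int a)) + real d ^ n * ((\<Sum>a<d. A (int a)) - real d * ((\<Sum>a<k. A (int a)) / real k))"
    (is "?L = ?R1 + real d ^ n * ?R2")
  proof -
    have "?R1 = (\<Sum>a<d. S a) - real d ^ n * (\<Sum>a<d. A (int a))"
      by (simp add: sum_subtractf sum_distrib_left)
    moreover have "card (insert x I) = Suc n" using insert by (simp add: n_def)
    moreover have "\<And>a b e g dn :: real. a - (real d * dn) * e = (a - dn * g) + dn * (g - real d * e)"
      by (simp add: algebra_simps)
    ultimately show ?thesis
      using \<open>(\<Sum>v\<in>cube (insert x I) d. F v) = (\<Sum>a<d. S a)\<close>
        \<open>avg (insert x I) k F = (\<Sum>a<k. A (int a)) / real k\<close>
      by (simp only: power_Suc)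
  qed
  then have "real d * \<bar>?L\<bar> \<le> real d * \<bar>?R1\<bar> + real d * (real d ^ n * \<bar>?R2\<bar>)"
    by (smt (verit) abs_mult distrib_left mult_left_mono of_nat_0_le_iff zero_le_power abs_of_nonneg)
  also have "real d * \<bar>?R1\<bar> \<le> (\<Sum>a<d. real d * \<bar>S a - real d ^ n * A (int a)\<bar>)"
    by (subst sum_distrib_left[symmetric]) (intro mult_left_mono sum_abs, simp)
  also have "\<dots> \<le> (\<Sum>a<d. real n * real k * real d ^ n)" by (intro sum_mono IH)
  also have "real d * (real d ^ n * \<bar>?R2\<bar>) \<le> real d * (real d ^ n * real k)"
    by (intro mult_left_mono A) auto
  finally show ?case using insert by (simp add: n_def algebra_simps)
qed (simp add: avg_empty cube_empty)

section \<open>Dirichlet series with power-law partial sums\<close>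

text \<open>Summation by parts, in the form that leaves the partial sums of \<open>A\<close> as coefficients.\<close>

lemma abel_summation:
  fixes A :: "nat \<Rightarrow> 'a :: comm_ring_1"
  shows "(\<Sum>m=1..M. A m * f m) = (\<Sum>j=1..M. A j) * f (Suc M) + (\<Sum>m=1..M. (\<Sum>j=1..m. A j) * (f m - f (Suc m)))"
  by (induction M) (simp_all add: algebra_simps)

lemma powr_diff_le:
  fixes s x :: real
  assumes "s \<ge> 0" "x \<ge> 1"
  shows "x powr (-s) - (x + 1) powr (-s) \<le> s * x powr (-s - 1)"
proof -
  have "\<exists>z>x. z < x + 1 \<and> (x + 1) powr (-s) - x powr (-s) = (x + 1 - x) * (-s * z powr (-s - 1))"
    by (rule MVT2) (use assms in \<open>auto intro!: derivative_eq_intros\<close>)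
  then obtain z where z: "z > x" "(x + 1) powr (-s) - x powr (-s) = -s * z powr (-s - 1)" by auto
  have "z powr (-s - 1) \<le> x powr (-s - 1)" using z assms by (intro powr_mono2') auto
  then have "s * z powr (-s - 1) \<le> s * x powr (-s - 1)" using assms by (intro mult_left_mono)
  with z show ?thesis by linarith
qed

lemma summable_powr_Suc: "e < -1 \<Longrightarrow> summable (\<lambda>m. real (Suc m) powr e)"
  using summable_real_powr_iff[of e] by (subst summable_Suc_iff) auto

text \<open>Partial summation bounds the series of norms by that of \<open>m powr (b - Re s - 1)\<close>.\<close>

lemma dirichlet_summable:
  fixes A :: "nat \<Rightarrow> real"
  assumes A: "\<And>m. A m \<ge> 0" and S: "\<And>M. M \<ge> 1 \<Longrightarrow> (\<Sum>m=1..M. A m) \<le> K * real M powr b"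
    and b: "b \<ge> 0" and s: "Re s > b"
  shows "summable (\<lambda>k. of_real (A (Suc k)) * of_nat (Suc k) powr (- s) :: complex)"
proof -
  define \<sigma> where "\<sigma> = Re s"
  have K: "K \<ge> 0" using S[of 1] A[of 1] by simp
  define T where "T = (\<Sum>m. K * \<sigma> * real (Suc m) powr (b - \<sigma> - 1))"
  have sm: "summable (\<lambda>m. K * \<sigma> * real (Suc m) powr (b - \<sigma> - 1))"
    by (intro summable_mult summable_powr_Suc) (use s in \<open>simp add: \<sigma>_def\<close>)
  have bound: "(\<Sum>k<M. A (Suc k) * real (Suc k) powr (- \<sigma>)) \<le> K + T" for M
  proof -
    have "(\<Sum>k<M. A (Suc k) * real (Suc k) powr (- \<sigma>)) = (\<Sum>m=1..M. A m * real m powr (- \<sigma>))"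
      by (rule sum.reindex_bij_witness[of _ "\<lambda>m. m - 1" Suc]) auto
    also have "\<dots> = (\<Sum>j=1..M. A j) * real (Suc M) powr (- \<sigma>)
        + (\<Sum>m=1..M. (\<Sum>j=1..m. A j) * (real m powr (- \<sigma>) - real (Suc m) powr (- \<sigma>)))"
      by (rule abel_summation)
    also have "(\<Sum>j=1..M. A j) * real (Suc M) powr (- \<sigma>) \<le> K"
    proof (cases "M = 0")
      case False
      then have "(\<Sum>j=1..M. A j) * real (Suc M) powr (- \<sigma>) \<le> (K * real M powr b) * real (Suc M) powr (- \<sigma>)"
        by (intro mult_right_mono S) auto
      also have "\<dots> \<le> (K * real (Suc M) powr b) * real (Suc M) powr (- b)"
        using K b s by (intro mult_mono powr_mono powr_mono2) (auto simp: \<sigma>_def)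
      also have "\<dots> = K" by (simp flip: powr_add add: mult.assoc)
      finally show ?thesis .
    qed (use K in simp)
    also have "(\<Sum>m=1..M. (\<Sum>j=1..m. A j) * (real m powr (- \<sigma>) - real (Suc m) powr (- \<sigma>)))
       \<le> (\<Sum>m=1..M. K * \<sigma> * real m powr (b - \<sigma> - 1))"
    proof (rule sum_mono)
      fix m assume "m \<in> {1..M}"
      then have m: "m \<ge> 1" by simp
      have "real m powr (- \<sigma>) - real (Suc m) powr (- \<sigma>) \<le> \<sigma> * real m powr (- \<sigma> - 1)"
        using powr_diff_le[of \<sigma> "real m"] m b s by (simp add: \<sigma>_def add.commute)
      moreover have "real m powr (- \<sigma>) - real (Suc m) powr (- \<sigma>) \<ge> 0"
        using m b s powr_mono2'[of "- \<sigma>" "real m" "real (Suc m)"] by (simp add: \<sigma>_def)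
      ultimately have "(\<Sum>j=1..m. A j) * (real m powr (- \<sigma>) - real (Suc m) powr (- \<sigma>))
          \<le> (K * real m powr b) * (\<sigma> * real m powr (- \<sigma> - 1))"
        using S[OF m] K by (intro mult_mono) auto
      also have "\<dots> = K * \<sigma> * real m powr (b - \<sigma> - 1)"
        using m by (simp flip: powr_add add: mult_ac) (simp add: algebra_simps)
      finally show "(\<Sum>j=1..m. A j) * (real m powr (- \<sigma>) - real (Suc m) powr (- \<sigma>)) \<le> K * \<sigma> * real m powr (b - \<sigma> - 1)" .
    qed
    also have "(\<Sum>m=1..M. K * \<sigma> * real m powr (b - \<sigma> - 1)) = (\<Sum>k<M. K * \<sigma> * real (Suc k) powr (b - \<sigma> - 1))"
      by (rule sum.reindex_bij_witness[of _ Suc "\<lambda>m. m - 1"]) auto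
    also have "\<dots> \<le> T" unfolding T_def
      by (rule sum_le_suminf[OF sm]) (use K b s in \<open>auto simp: \<sigma>_def\<close>)
    finally show ?thesis by simp
  qed
  have "summable (\<lambda>k. A (Suc k) * real (Suc k) powr (- \<sigma>))"
    by (rule summableI_nonneg_bounded[OF _ bound]) (use A in auto)
  then have "summable (\<lambda>k. norm (of_real (A (Suc k)) * of_nat (Suc k) powr (- s) :: complex))"
    using A by (simp add: norm_mult norm_powr_real_powr \<sigma>_def)
  then show ?thesis by (rule summable_norm_cancel)
qed

text \<open>At the point \<open>N\<close> the terms dominate those of the harmonic series.\<close>

lemma dirichlet_not_summable:
  fixes A :: "nat \<Rightarrow> real"
  assumes A: "\<And>m. m \<ge> 1 \<Longrightarrow> A m \<ge> real m ^ (N - 1)" and N: "N \<ge> 1"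
  shows "\<not> summable (\<lambda>k. of_real (A (Suc k)) * of_nat (Suc k) powr (- of_nat N) :: complex)"
proof
  assume "summable (\<lambda>k. of_real (A (Suc k)) * of_nat (Suc k) powr (- of_nat N) :: complex)"
  then have "summable (\<lambda>k. Re (of_real (A (Suc k)) * of_nat (Suc k) powr (- of_nat N)))"
    by (rule summable_Re)
  moreover have "Re (of_real (A (Suc k)) * of_nat (Suc k) powr (- of_nat N)) = A (Suc k) / real (Suc k) ^ N" for k
  proof -
    have "(of_nat (Suc k) :: complex) powr (- of_nat N) = of_real (1 / real (Suc k) ^ N)"
      by (simp add: powr_minus powr_nat' divide_inverse del: of_nat_Suc)
    then show ?thesis by (simp only: flip: of_real_mult) simp
  qed
  ultimately have "summable (\<lambda>k. A (Suc k) / real (Suc k) ^ N)" by (simp only:)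
  then have "summable (\<lambda>k. inverse (real (Suc k)))"
  proof (rule summable_comparison_test'[where N = 0])
    fix k :: nat
    have "inverse (real (Suc k)) = real (Suc k) ^ (N - 1) / real (Suc k) ^ N"
      using N by (cases N) (simp_all add: field_simps del: of_nat_Suc)
    also have "\<dots> \<le> A (Suc k) / real (Suc k) ^ N" by (intro divide_right_mono A) auto
    finally show "norm (inverse (real (Suc k))) \<le> A (Suc k) / real (Suc k) ^ N" by simp
  qed
  then show False using not_summable_harmonic[where ?'a = real] by (subst (asm) summable_Suc_iff) simp
qed

text \<open>The \<open>m\<close>-th summand of the integral of \<open>(S x - C * x ^ N) * s * x powr (- s - 1)\<close>, multiplied by
\<open>s - N\<close>: the step function \<open>S\<close> is constant between \<open>m\<close> and \<open>Suc m\<close>, and \<open>C * x ^ N\<close> integrates to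
the second summand.\<close>

definition cont_term :: "(nat \<Rightarrow> real) \<Rightarrow> nat \<Rightarrow> real \<Rightarrow> complex \<Rightarrow> nat \<Rightarrow> complex" where
  "cont_term S N C s m = (s - of_nat N) * of_real (S m) * (of_nat m powr (- s) - of_nat (Suc m) powr (- s))
     + of_real C * s * (of_nat (Suc m) powr (of_nat N - s) - of_nat m powr (of_nat N - s))"

text \<open>Replacing \<open>S m\<close> by \<open>C * x ^ N\<close> with \<open>x\<close> between \<open>m\<close> and \<open>Suc m\<close> costs a relative error of order
\<open>1 / m\<close>, no worse than the error term of \<open>S\<close> itself because \<open>d \<le> 1\<close>; what is left is the
integral of the error term.\<close>

lemma cont_term_bound:
  assumes S: "\<bar>S m - C * real m ^ N\<bar> \<le> K * real m powr (real N - d)" and d: "0 < d" "d \<le> 1"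
    and m: "m \<ge> 1" and s: "Re s \<ge> 0" and N: "N \<ge> 1"
  shows "norm (cont_term S N C s m) \<le> norm s * norm (s - of_nat N) * ((K + \<bar>C\<bar> * real N * 2 ^ N) * real m powr (real N - d - Re s - 1))"
proof -
  define \<phi> where "\<phi> = (\<lambda>z. - (s - of_nat N) * of_real (S m) * z powr (- s) + of_real C * s * z powr (of_nat N - s))"
  define \<phi>' where "\<phi>' = (\<lambda>z. s * (s - of_nat N) * z powr (- s - 1) * (of_real (S m) - of_real C * z ^ N))"
  define I where "I = closed_segment (of_nat m :: complex) (of_nat (Suc m))"
  define B where "B = norm s * norm (s - of_nat N) * ((K + \<bar>C\<bar> * real N * 2 ^ N) * real m powr (real N - d - Re s - 1))"
  have I: "\<exists>x. z = of_real x \<and> real m \<le> x \<and> x \<le> real (Suc m)" if "z \<in> I" for z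
  proof -
    from that obtain u where u: "0 \<le> u" "u \<le> 1" "z = (1 - u) *\<^sub>R of_nat m + u *\<^sub>R of_nat (Suc m)"
      unfolding I_def closed_segment_def by blast
    have "z = of_real (real m + u)" unfolding u by (simp add: scaleR_conv_of_real algebra_simps)
    with u show ?thesis by (intro exI[of _ "real m + u"]) auto
  qed
  have "norm (\<phi> (of_nat (Suc m)) - \<phi> (of_nat m)) \<le> B * norm (of_nat (Suc m) - of_nat m :: complex)"
  proof (rule field_differentiable_bound[of I \<phi> \<phi>' B])
    show "convex I" by (simp add: I_def)
    fix z assume "z \<in> I"
    then obtain x where x: "z = of_real x" "real m \<le> x" "x \<le> real (Suc m)" using I by blast
    have x0: "x > 0" using x m by linarith
    have z: "z \<notin> \<real>\<^sub>\<le>\<^sub>0" using x0 x by (auto simp: complex_nonpos_Reals_iff)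
    have e: "z powr (of_nat N - s - 1) = z powr (- s - 1) * z ^ N"
    proof -
      have "z powr (of_nat N - s - 1) = z powr ((- s - 1) + of_nat N)" by (simp add: algebra_simps)
      also have "\<dots> = z powr (- s - 1) * z powr (of_nat N)" by (rule powr_add)
      also have "z powr (of_nat N) = z ^ N" using x0 x by (intro powr_nat') auto
      finally show ?thesis .
    qed
    have "(\<phi> has_field_derivative (- (s - of_nat N) * of_real (S m) * ((- s) * z powr (- s - 1))
        + of_real C * s * ((of_nat N - s) * z powr (of_nat N - s - 1)))) (at z)"
      unfolding \<phi>_def by (intro derivative_intros DERIV_cmult DERIV_add has_field_derivative_powr z)
    also have "- (s - of_nat N) * of_real (S m) * ((- s) * z powr (- s - 1))
        + of_real C * s * ((of_nat N - s) * z powr (of_nat N - s - 1)) = \<phi>' z"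
      unfolding e \<phi>'_def by (simp add: algebra_simps)
    finally show "(\<phi> has_field_derivative \<phi>' z) (at z within I)" by (rule has_field_derivative_at_within)
    have "norm (of_real (S m) - of_real C * z ^ N) = \<bar>S m - C * x ^ N\<bar>"
      unfolding x by (simp flip: of_real_power of_real_mult of_real_diff)
    also have "\<dots> \<le> \<bar>S m - C * real m ^ N\<bar> + \<bar>C\<bar> * (x ^ N - real m ^ N)"
    proof -
      have "x ^ N \<ge> real m ^ N" using x by (intro power_mono) auto
      then have "\<bar>C * real m ^ N - C * x ^ N\<bar> = \<bar>C\<bar> * (x ^ N - real m ^ N)"
        by (simp add: abs_mult flip: right_diff_distrib)
      then show ?thesis by linarith
    qed
    finally have n1: "norm (of_real (S m) - of_real C * z ^ N) \<le> \<bar>S m - C * real m ^ N\<bar> + \<bar>C\<bar> * (x ^ N - real m ^ N)" .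
    have "x ^ N - real m ^ N \<le> real N * 2 ^ N * real m powr (real N - d)"
    proof -
      have "x ^ N - real m ^ N \<le> real (Suc m) ^ N - real m ^ N" using x by (intro diff_right_mono power_mono) auto
      also have "real (Suc m) ^ N - real m ^ N \<le> real N * real (Suc m) ^ (N - 1)"
      proof -
        have "real (Suc m) ^ N - real m ^ N = (real (Suc m) - real m) * (\<Sum>i<N. real m ^ (N - Suc i) * real (Suc m) ^ i)"
          by (rule power_diff_sumr2)
        also have "(\<Sum>i<N. real m ^ (N - Suc i) * real (Suc m) ^ i) \<le> (\<Sum>i<N. real (Suc m) ^ (N - 1))"
        proof (rule sum_mono)
          fix i assume "i \<in> {..<N}"
          then have "N - 1 = (N - Suc i) + i" by auto
          moreover have "real m ^ (N - Suc i) * real (Suc m) ^ i \<le> real (Suc m) ^ (N - Suc i) * real (Suc m) ^ i"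
            by (intro mult_right_mono power_mono) auto
          ultimately show "real m ^ (N - Suc i) * real (Suc m) ^ i \<le> real (Suc m) ^ (N - 1)"
            by (metis power_add)
        qed
        finally show ?thesis by simp
      qed
      also have "real N * real (Suc m) ^ (N - 1) \<le> real N * (2 ^ N * real m powr (real N - d))"
      proof (rule mult_left_mono)
        have "real (Suc m) ^ (N - 1) \<le> (2 * real m) ^ (N - 1)" using m by (intro power_mono) auto
        also have "\<dots> \<le> 2 ^ N * real m powr (real N - d)"
        proof -
        have "real m ^ (N - 1) = real m powr (real N - 1)" using m N by (simp flip: powr_realpow add: of_nat_diff)
        also have "\<dots> \<le> real m powr (real N - d)" using m d by (intro powr_mono) auto
        finally have "real m ^ (N - 1) \<le> real m powr (real N - d)" .
        moreover have "(2::real) ^ (N - 1) \<le> 2 ^ N" by (intro power_increasing) auto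
        ultimately show ?thesis unfolding power_mult_distrib by (intro mult_mono) auto
        qed
        finally show "real (Suc m) ^ (N - 1) \<le> 2 ^ N * real m powr (real N - d)" .
      qed simp
      finally show ?thesis by (simp add: mult.assoc)
    qed
    then have "\<bar>C\<bar> * (x ^ N - real m ^ N) \<le> \<bar>C\<bar> * (real N * 2 ^ N * real m powr (real N - d))"
      by (rule mult_left_mono) simp
    with n1 S have 1: "norm (of_real (S m) - of_real C * z ^ N) \<le> (K + \<bar>C\<bar> * real N * 2 ^ N) * real m powr (real N - d)"
      by (simp add: algebra_simps)
    have "norm (z powr (- s - 1)) = x powr (- Re s - 1)"
      using x x0 by (simp add: norm_powr_real_powr)
    also have "\<dots> \<le> real m powr (- Re s - 1)" using x m s by (intro powr_mono2') auto
    finally have "norm (\<phi>' z) \<le> norm s * norm (s - of_nat N) * real m powr (- Re s - 1) * ((K + \<bar>C\<bar> * real N * 2 ^ N) * real m powr (real N - d))"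
      unfolding \<phi>'_def norm_mult using 1 by (intro mult_mono) auto
    also have "\<dots> = B" unfolding B_def
      by (simp flip: powr_add add: mult_ac) (simp add: algebra_simps flip: powr_add)
    finally show "norm (\<phi>' z) \<le> B" .
  qed (auto simp: I_def)
  moreover have "\<phi> (of_nat (Suc m)) - \<phi> (of_nat m) = cont_term S N C s m"
    unfolding \<phi>_def cont_term_def by (simp add: algebra_simps)
  ultimately show ?thesis by (simp add: B_def)
qed

text \<open>A meromorphic continuation is determined near \<open>z\<close> by its values to the right of \<open>z\<close>, by the identity
theorem on a punctured disc around \<open>z\<close>. There it is \<open>h s / (s - z)\<close>, with \<open>h z \<noteq> 0\<close>.\<close>

lemma is_simple_pole_unique_continuation:
  assumes h: "h holomorphic_on B" "open B" "z \<in> B" "h z \<noteq> 0"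
    and F: "F meromorphic_on U" "z \<in> U"
    and eq: "\<And>s. s \<in> B \<Longrightarrow> Re s > Re z \<Longrightarrow> F s = h s / (s - z)"
  shows "is_pole F z \<and> zorder F z = - 1"
proof -
  define F0 where "F0 = (\<lambda>s. h s / (s - z))"
  have "is_pole (\<lambda>w. h w / (w - z) ^ 1) z" by (rule is_pole_basic[OF h]) simp
  then have pole: "is_pole F0 z" by (simp add: F0_def)
  have ord: "zorder F0 z = - 1"
    by (rule zorder_eqI[OF h(2,3,1,4)]) (simp add: F0_def power_int_minus divide_inverse)
  have "h meromorphic_on {z}"
    using analytic_on_imp_meromorphic_on[of h "{z}"] h by (auto simp: analytic_at)
  then have m0: "F0 meromorphic_on {z}" unfolding F0_def by (intro meromorphic_intros) auto
  have mF: "F meromorphic_on {z}" using F meromorphic_on_subset by blast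
  have "(\<lambda>s. F s - F0 s) meromorphic_on {z}" by (intro meromorphic_intros mF m0)
  then have iso: "isolated_singularity_at (\<lambda>s. F s - F0 s) z" "not_essential (\<lambda>s. F s - F0 s) z"
    by (simp_all add: meromorphic_at_iff)
  have "\<exists>\<^sub>F s in at z. F s - F0 s = 0"
    unfolding frequently_at
  proof (intro allI impI)
    fix d :: real assume d: "d > 0"
    obtain e where e: "e > 0" "ball z e \<subseteq> B" using h(2,3) open_contains_ball by blast
    define s where "s = z + of_real (min d e / 2)"
    have "dist s z < d" "dist s z < e" "s \<noteq> z" "Re s > Re z"
      using d e(1) by (auto simp: s_def dist_norm)
    moreover from this have "s \<in> B" using e(2) by (auto simp: dist_commute)
    ultimately show "\<exists>s\<in>UNIV. s \<noteq> z \<and> dist s z < d \<and> F s - F0 s = 0"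
      using eq[of s] by (intro bexI[of _ s]) (auto simp: F0_def)
  qed
  then have "\<forall>\<^sub>F s in at z. F s - F0 s = 0"
    by (rule not_essential_frequently_0_imp_eventually_0[OF iso])
  then have ev: "\<forall>\<^sub>F s in at z. F s = F0 s" by eventually_elim simp
  then show ?thesis using is_pole_cong[OF ev refl] zorder_cong[OF ev refl] pole ord by simp
qed

context
  fixes A :: "nat \<Rightarrow> real" and N :: nat and C K d :: real
  assumes N: "N \<ge> 1" and d: "0 < d" "d \<le> 1"
    and S: "\<And>M. M \<ge> 1 \<Longrightarrow> \<bar>(\<Sum>m=1..M. A m) - C * real M ^ N\<bar> \<le> K * real M powr (real N - d)"
begin

definition S_sum :: "nat \<Rightarrow> real" where "S_sum M = (\<Sum>m=1..M. A m)"

text \<open>The Dirichlet series with coefficients \<open>A\<close>, multiplied by \<open>s - N\<close> and extended to the left of its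
abscissa.\<close>

definition cont_fun :: "complex \<Rightarrow> complex" where
  "cont_fun s = of_real C * s + (\<Sum>m. cont_term S_sum N C s (Suc m))"

lemma K_nonneg: "K \<ge> 0"
  using S[of 1] abs_ge_zero order_trans by fastforce

lemma cont_bound:
  assumes "Re s \<ge> 0"
  shows "norm (cont_term S_sum N C s (Suc m)) \<le> norm s * norm (s - of_nat N) * ((K + \<bar>C\<bar> * real N * 2 ^ N) * real (Suc m) powr (real N - d - Re s - 1))"
  by (rule cont_term_bound) (use S[of "Suc m"] assms d N in \<open>auto simp: S_sum_def\<close>)

text \<open>The terms are entire and by \<open>cont_bound\<close> their series converges locally uniformly in the half-plane.\<close>

lemma cont_fun_holomorphic: "cont_fun holomorphic_on {s. Re s > real N - d}"
proof (rule holomorphic_uniform_sequence[where f = "\<lambda>n s. of_real C * s + (\<Sum>m<n. cont_term S_sum N C s (Suc m))"])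
  show "open {s. Re s > real N - d}" by (rule open_halfspace_Re_gt)
  show "(\<lambda>s. of_real C * s + (\<Sum>m<n. cont_term S_sum N C s (Suc m))) holomorphic_on {s. Re s > real N - d}" for n
    unfolding cont_term_def by (intro holomorphic_intros) (auto simp del: of_nat_Suc)
  fix x :: complex assume x: "x \<in> {s. Re s > real N - d}"
  define e where "e = (Re x - (real N - d)) / 2"
  have e: "e > 0" using x by (simp add: e_def)
  define B where "B = (norm x + e) * (norm x + e + real N)"
  define M where "M = (\<lambda>m. B * ((K + \<bar>C\<bar> * real N * 2 ^ N) * real (Suc m) powr (- e - 1)))"
  have sub: "Re s \<ge> real N - d + e \<and> norm s \<le> norm x + e" if "s \<in> cball x e" for s
  proof -
    have "norm (s - x) \<le> e" using that by (simp add: dist_norm norm_minus_commute)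
    moreover have "\<bar>Re (s - x)\<bar> \<le> norm (s - x)" by (rule abs_Re_le_cmod)
    moreover have "norm s \<le> norm x + norm (s - x)" by norm
    ultimately show ?thesis by (auto simp: e_def field_simps)
  qed
  have "uniform_limit (cball x e) (\<lambda>n s. \<Sum>m<n. cont_term S_sum N C s (Suc m)) (\<lambda>s. \<Sum>m. cont_term S_sum N C s (Suc m)) sequentially"
  proof (rule Weierstrass_m_test)
    show "summable M" unfolding M_def by (intro summable_mult summable_powr_Suc) (use e in simp)
    fix m s assume s: "s \<in> cball x e"
    have Re: "Re s \<ge> 0" using sub[OF s] d N e by linarith
    have "norm (s - of_nat N) \<le> norm s + real N" using norm_triangle_ineq4[of s "of_nat N"] by simp
    then have n: "norm (s - of_nat N) \<le> norm x + e + real N" using sub[OF s] by linarith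
    have p: "real (Suc m) powr (real N - d - Re s - 1) \<le> real (Suc m) powr (- e - 1)"
      using sub[OF s] by (intro powr_mono) auto
    have K2: "K + \<bar>C\<bar> * real N * 2 ^ N \<ge> 0" using K_nonneg by simp
    have "norm (cont_term S_sum N C s (Suc m)) \<le> norm s * norm (s - of_nat N) * ((K + \<bar>C\<bar> * real N * 2 ^ N) * real (Suc m) powr (real N - d - Re s - 1))"
      by (rule cont_bound[OF Re])
    also have "\<dots> \<le> M m" unfolding M_def B_def
      by (intro mult_mono n p conjunct2[OF sub[OF s]]) (use K2 e in auto)
    finally show "norm (cont_term S_sum N C s (Suc m)) \<le> M m" .
  qed
  then have "uniform_limit (cball x e) (\<lambda>n s. of_real C * s + (\<Sum>m<n. cont_term S_sum N C s (Suc m))) cont_fun sequentially"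
    unfolding cont_fun_def by (intro uniform_limit_intros)
  moreover have "cball x e \<subseteq> {s. Re s > real N - d}" using sub e by force
  ultimately show "\<exists>d'. 0 < d' \<and> cball x d' \<subseteq> {s. Re s > real N - d} \<and>
      uniform_limit (cball x d') (\<lambda>n s. of_real C * s + (\<Sum>m<n. cont_term S_sum N C s (Suc m))) cont_fun sequentially"
    using e by blast
qed

text \<open>At \<open>s = N\<close> both differences in \<open>cont_term\<close> disappear, since \<open>s - N = 0\<close> and \<open>x powr 0\<close> is constant.\<close>

lemma cont_fun_N: "cont_fun (of_nat N) = of_real C * of_nat N"
proof -
  have "cont_term S_sum N C (of_nat N) (Suc m) = 0" for m
    by (simp add: cont_term_def del: of_nat_Suc)
  then show ?thesis by (simp add: cont_fun_def)
qed

text \<open>Abel summation: the first parts of the terms give the Dirichlet series, and the second parts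
telescope to \<open>- C * s\<close>.\<close>

lemma dirichlet_sums:
  assumes s: "Re s > real N"
  shows "(\<lambda>k. of_real (A (Suc k)) * of_nat (Suc k) powr (- s)) sums (cont_fun s / (s - of_nat N))"
proof -
  have Re: "Re s \<ge> 0" using s by simp
  have ne: "s - of_nat N \<noteq> 0" using s by auto
  have "summable (\<lambda>m. norm (cont_term S_sum N C s (Suc m)))"
  proof (rule summable_comparison_test')
    show "summable (\<lambda>m. norm s * norm (s - of_nat N) * ((K + \<bar>C\<bar> * real N * 2 ^ N) * real (Suc m) powr (real N - d - Re s - 1)))"
      by (intro summable_mult summable_powr_Suc) (use s d in simp)
  qed (use cont_bound[OF Re] in simp)
  then have sm: "(\<lambda>M. \<Sum>m<M. cont_term S_sum N C s (Suc m)) \<longlonglongrightarrow> (\<Sum>m. cont_term S_sum N C s (Suc m))"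
    by (rule summable_LIMSEQ[OF summable_norm_cancel])
  have pw: "(\<lambda>M. real (Suc M) powr (real N - Re s)) \<longlonglongrightarrow> 0"
    by (rule tendsto_neg_powr[OF _ filterlim_compose[OF filterlim_real_sequentially filterlim_Suc]]) (use s in simp)
  have l1: "(\<lambda>M. of_nat (Suc M) powr (of_nat N - s) :: complex) \<longlonglongrightarrow> 0"
    by (rule Lim_null_comparison[OF _ pw]) (simp add: norm_powr_real_powr del: of_nat_Suc)
  have l2: "(\<lambda>M. of_real (S_sum M) * of_nat (Suc M) powr (- s) :: complex) \<longlonglongrightarrow> 0"
  proof (rule Lim_null_comparison)
    show "(\<lambda>M. (K + \<bar>C\<bar>) * real (Suc M) powr (real N - Re s)) \<longlonglongrightarrow> 0"
      using tendsto_mult_left[OF pw, of "K + \<bar>C\<bar>"] by simp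
    show "\<forall>\<^sub>F M in sequentially. norm (of_real (S_sum M) * of_nat (Suc M) powr (- s) :: complex) \<le> (K + \<bar>C\<bar>) * real (Suc M) powr (real N - Re s)"
      using eventually_ge_at_top[of "1::nat"]
    proof eventually_elim
      case (elim M)
      have "\<bar>S_sum M\<bar> \<le> \<bar>S_sum M - C * real M ^ N\<bar> + \<bar>C\<bar> * real M ^ N"
      proof -
        have "\<bar>C * real M ^ N\<bar> = \<bar>C\<bar> * real M ^ N" by (simp add: abs_mult)
        then show ?thesis by linarith
      qed
      also have "\<bar>S_sum M - C * real M ^ N\<bar> \<le> K * real M powr (real N - d)"
        using S[OF elim] by (simp add: S_sum_def)
      also have "\<dots> \<le> K * real M powr real N" using elim d K_nonneg by (intro mult_left_mono powr_mono) auto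
      also have "real M ^ N = real M powr real N" using elim by (simp add: powr_realpow)
      finally have "\<bar>S_sum M\<bar> \<le> (K + \<bar>C\<bar>) * real M powr real N" by (simp add: algebra_simps)
      also have "\<dots> \<le> (K + \<bar>C\<bar>) * real (Suc M) powr real N" using K_nonneg by (intro mult_left_mono powr_mono2) auto
      finally have "\<bar>S_sum M\<bar> * real (Suc M) powr (- Re s) \<le> (K + \<bar>C\<bar>) * real (Suc M) powr real N * real (Suc M) powr (- Re s)"
        by (intro mult_right_mono) auto
      also have "\<dots> = (K + \<bar>C\<bar>) * real (Suc M) powr (real N - Re s)"
        by (simp add: mult.assoc flip: powr_add)
      finally show ?case by (simp add: norm_mult norm_powr_real_powr del: of_nat_Suc)
    qed
  qed
  have id: "(\<Sum>k<M. of_real (A (Suc k)) * of_nat (Suc k) powr (- s))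
    = of_real (S_sum M) * of_nat (Suc M) powr (- s) + ((\<Sum>m<M. cont_term S_sum N C s (Suc m)) + of_real C * s
        - of_real C * s * of_nat (Suc M) powr (of_nat N - s)) / (s - of_nat N)" for M
  proof -
    have "(\<Sum>k<M. of_real (A (Suc k)) * of_nat (Suc k) powr (- s)) = (\<Sum>m=1..M. of_real (A m) * of_nat m powr (- s))"
      by (rule sum.reindex_bij_witness[of _ "\<lambda>m. m - 1" Suc]) auto
    also have "\<dots> = of_real (S_sum M) * of_nat (Suc M) powr (- s)
        + (\<Sum>m=1..M. of_real (S_sum m) * (of_nat m powr (- s) - of_nat (Suc m) powr (- s)))"
      unfolding S_sum_def of_real_sum by (rule abel_summation)
    also have "(\<Sum>m=1..M. of_real (S_sum m) * (of_nat m powr (- s) - of_nat (Suc m) powr (- s)))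
       = (\<Sum>m<M. of_real (S_sum (Suc m)) * (of_nat (Suc m) powr (- s) - of_nat (Suc (Suc m)) powr (- s)))"
      by (rule sum.reindex_bij_witness[of _ Suc "\<lambda>m. m - 1"]) auto
    also have "\<dots> = ((\<Sum>m<M. cont_term S_sum N C s (Suc m)) + of_real C * s
        - of_real C * s * of_nat (Suc M) powr (of_nat N - s)) / (s - of_nat N)"
    proof -
      have t: "(\<Sum>m<M. (of_nat (Suc (Suc m)) powr (of_nat N - s) - of_nat (Suc m) powr (of_nat N - s) :: complex))
         = of_nat (Suc M) powr (of_nat N - s) - 1"
        using sum_lessThan_telescope[of "\<lambda>m. of_nat (Suc m) powr (of_nat N - s) :: complex" M] by simp
      have "(\<Sum>m<M. cont_term S_sum N C s (Suc m)) = (s - of_nat N) * (\<Sum>m<M. of_real (S_sum (Suc m)) * (of_nat (Suc m) powr (- s) - of_nat (Suc (Suc m)) powr (- s)))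
          + of_real C * s * (of_nat (Suc M) powr (of_nat N - s) - 1)"
        unfolding t[symmetric] cont_term_def sum.distrib sum_distrib_left by (simp only: mult.assoc)
      then show ?thesis using ne by (simp add: field_simps del: of_nat_Suc)
    qed
    finally show ?thesis .
  qed
  have "(\<lambda>M. of_real (S_sum M) * of_nat (Suc M) powr (- s) + ((\<Sum>m<M. cont_term S_sum N C s (Suc m)) + of_real C * s
        - of_real C * s * of_nat (Suc M) powr (of_nat N - s)) / (s - of_nat N))
     \<longlonglongrightarrow> 0 + ((\<Sum>m. cont_term S_sum N C s (Suc m)) + of_real C * s - of_real C * s * 0) / (s - of_nat N)"
    by (intro tendsto_intros l1 l2 sm ne)
  then show ?thesis
    unfolding sums_def id by (simp add: cont_fun_def add.commute del: of_nat_Suc)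
qed

end

section \<open>Coxeter length through a code for signed permutations\<close>

text \<open>The number of values among \<open>g 1, ..., g m\<close> and their negatives that exceed \<open>x\<close>.\<close>

definition above :: "(int \<Rightarrow> int) \<Rightarrow> nat \<Rightarrow> int \<Rightarrow> nat" where
  "above g m x = (\<Sum>i=1..m. of_bool (g (int i) > x) + of_bool (- g (int i) > x))"

text \<open>A signed analogue of the Lehmer code. The summation range includes \<open>j\<close> itself, which contributes \<open>1\<close>
exactly when \<open>g j < 0\<close>; so \<open>code g j\<close> ranges over \<open>0, ..., 2 * j - 1\<close>, and it is at least \<open>j\<close>
exactly for negative \<open>g j\<close>.\<close>

definition code :: "(int \<Rightarrow> int) \<Rightarrow> nat \<Rightarrow> nat" where
  "code g j = above g j (g (int j))"

definition code_sum :: "nat \<Rightarrow> (int \<Rightarrow> int) \<Rightarrow> nat" where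
  "code_sum n g = (\<Sum>j=1..n. code g j)"

lemma above_Suc: "above g (Suc m) x = above g m x + of_bool (g (int (Suc m)) > x) + of_bool (- g (int (Suc m)) > x)"
  by (simp add: above_def)

lemma above_0: "above g 0 x = 0"
  by (simp add: above_def)

lemma above_cong: "(\<And>i. 1 \<le> i \<Longrightarrow> i \<le> m \<Longrightarrow> g (int i) = h (int i)) \<Longrightarrow> above g m x = above h m x"
  by (auto simp: above_def intro!: sum.cong)

lemma coxeter_gen_0: "j > 0 \<Longrightarrow> coxeter_gen 0 (int j) = (if j = 1 then - 1 else int j)"
  by (auto simp: coxeter_gen_def Transposition.transpose_def)

lemma coxeter_gen_pos:
  "i > 0 \<Longrightarrow> coxeter_gen i (int j) = (if j = i then int (Suc i) else if j = Suc i then int i else int j)"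
  by (auto simp: coxeter_gen_def Transposition.transpose_def)

lemma hyperoctahedral_odd: "g \<in> hyperoctahedral n \<Longrightarrow> g (- i) = - g i"
  by (simp add: hyperoctahedral_def)

lemma hyperoctahedral_0: "g \<in> hyperoctahedral n \<Longrightarrow> g 0 = 0"
  using hyperoctahedral_odd[of g n 0] by simp

lemma hyperoctahedral_inj: "g \<in> hyperoctahedral n \<Longrightarrow> g i = g j \<longleftrightarrow> i = j"
  unfolding hyperoctahedral_def by (auto dest: permutes_inj simp: inj_eq)

lemma hyperoctahedral_neq0: "g \<in> hyperoctahedral n \<Longrightarrow> g i = 0 \<longleftrightarrow> i = 0"
  using hyperoctahedral_inj[of g n i 0] hyperoctahedral_0[of g n] by auto

lemma hyperoctahedral_range: "g \<in> hyperoctahedral n \<Longrightarrow> \<bar>i\<bar> \<le> int n \<Longrightarrow> \<bar>g i\<bar> \<le> int n"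
  unfolding hyperoctahedral_def
  by (cases "i = 0") (use hyperoctahedral_0[of g n] permutes_in_image[of g _ i] in \<open>auto simp: hyperoctahedral_def\<close>)

lemma hyperoctahedral_abs_inj:
  assumes "g \<in> hyperoctahedral n" "\<bar>g i\<bar> = \<bar>g j\<bar>"
  shows "\<bar>i\<bar> = \<bar>j\<bar>"
proof -
  have "g i = g j \<or> g i = g (- j)" using assms hyperoctahedral_odd[OF assms(1)] by (auto simp: abs_eq_iff)
  then show ?thesis using hyperoctahedral_inj[OF assms(1)] by (auto simp: abs_eq_iff)
qed

lemma coxeter_gen_hyperoctahedral:
  assumes "i < n" shows "coxeter_gen i \<in> hyperoctahedral n"
proof (cases "i = 0")
  case True
  have "Transposition.transpose (1::int) (-1) permutes {j. j \<noteq> 0 \<and> \<bar>j\<bar> \<le> int n}"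
    by (rule permutes_swap_id) (use assms in auto)
  then show ?thesis using True by (auto simp: hyperoctahedral_def coxeter_gen_def Transposition.transpose_def)
next
  case False
  have "Transposition.transpose (int i) (int i + 1) permutes {j. j \<noteq> 0 \<and> \<bar>j\<bar> \<le> int n}"
    "Transposition.transpose (- int i) (- (int i + 1)) permutes {j. j \<noteq> 0 \<and> \<bar>j\<bar> \<le> int n}"
    by (rule permutes_swap_id; use assms False in auto)+
  then have "coxeter_gen i permutes {j. j \<noteq> 0 \<and> \<bar>j\<bar> \<le> int n}"
    using False by (simp add: coxeter_gen_def permutes_compose)
  moreover have "coxeter_gen i (- j) = - coxeter_gen i j" for j
    using False by (simp add: coxeter_gen_def Transposition.transpose_def)
  ultimately show ?thesis by (simp add: hyperoctahedral_def)
qed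

lemma hyperoctahedral_comp:
  "g \<in> hyperoctahedral n \<Longrightarrow> h \<in> hyperoctahedral n \<Longrightarrow> g \<circ> h \<in> hyperoctahedral n"
  by (auto simp: hyperoctahedral_def intro: permutes_compose)

lemma id_hyperoctahedral: "id \<in> hyperoctahedral n"
  by (auto simp: hyperoctahedral_def permutes_id)

lemma coxeter_gen_involution: "coxeter_gen i \<circ> coxeter_gen i = id"
  by (auto simp: coxeter_gen_def fun_eq_iff Transposition.transpose_def)

lemma sum_split_two:
  fixes f :: "nat \<Rightarrow> nat"
  assumes "1 \<le> i" "Suc i \<le> n"
  shows "(\<Sum>j=1..n. f j) = f i + f (Suc i) + (\<Sum>j\<in>{1..n} - {i, Suc i}. f j)"
proof -
  have "(\<Sum>j=1..n. f j) = f i + (\<Sum>j\<in>{1..n} - {i}. f j)"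
    by (rule sum.remove) (use assms in auto)
  also have "(\<Sum>j\<in>{1..n} - {i}. f j) = f (Suc i) + (\<Sum>j\<in>{1..n} - {i} - {Suc i}. f j)"
    by (rule sum.remove) (use assms in auto)
  also have "{1..n} - {i} - {Suc i} = {1..n} - {i, Suc i}" by auto
  finally show ?thesis by simp
qed

text \<open>Multiplying on the right by a generator exchanges two neighbouring values, or changes the sign of
the first one. Only the comparison of that one pair changes; all other contributions to the codes
are kept or exchanged.\<close>

lemma code_sum_comp_coxeter_gen:
  assumes g: "g \<in> hyperoctahedral n" and i: "i < n"
  shows "int (code_sum n (g \<circ> coxeter_gen i)) = int (code_sum n g) + (if g (int i) < g (int i + 1) then 1 else - 1)"
proof (cases "i = 0")
  case True
  define h where "h = g \<circ> coxeter_gen 0"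
  have h1: "h 1 = - g 1" using coxeter_gen_0[of 1] hyperoctahedral_odd[OF g, of 1] by (simp add: h_def)
  have h2: "h (int j) = g (int j)" if "j > 1" for j using coxeter_gen_0[of j] that by (simp add: h_def)
  have ab: "above h m x = above g m x" for m x
  proof (induction m)
    case (Suc m)
    then show ?case using h1 h2[of "Suc m"] by (cases m) (auto simp: above_Suc)
  qed (simp add: above_0)
  have "code_sum n h = code h 1 + (\<Sum>j\<in>{1..n} - {1}. code h j)"
    unfolding code_sum_def by (rule sum.remove) (use i in auto)
  moreover have "code_sum n g = code g 1 + (\<Sum>j\<in>{1..n} - {1}. code g j)"
    unfolding code_sum_def by (rule sum.remove) (use i in auto)
  moreover have "(\<Sum>j\<in>{1..n} - {1}. code h j) = (\<Sum>j\<in>{1..n} - {1}. code g j)"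
    by (rule sum.cong) (auto simp: code_def ab h2)
  moreover have "code h 1 = of_bool (g 1 > 0)" "code g 1 = of_bool (g 1 < 0)"
    using h1 by (simp_all add: code_def above_def)
  moreover have "g 1 \<noteq> 0" using hyperoctahedral_neq0[OF g] by simp
  ultimately show ?thesis using True hyperoctahedral_0[OF g] by (auto simp: h_def)
next
  case False
  define h where "h = g \<circ> coxeter_gen i"
  have hi: "h (int i) = g (int (Suc i))" "h (int (Suc i)) = g (int i)"
    using False coxeter_gen_pos[of i i] coxeter_gen_pos[of i "Suc i"] by (simp_all add: h_def)
  have ho: "h (int j) = g (int j)" if "j \<noteq> i" "j \<noteq> Suc i" for j
    using that False coxeter_gen_pos[of i j] by (simp add: h_def)
  have lt: "above h m x = above g m x" if "m < i" for m x
    by (rule above_cong) (use that ho in auto)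
  obtain i' where i': "i = Suc i'" using False by (cases i) auto
  have a1: "above h i x = above g i' x + of_bool (g (int (Suc i)) > x) + of_bool (- g (int (Suc i)) > x)" for x
    using lt[of i'] hi by (simp add: i' above_Suc)
  have a2: "above h (Suc i) x = above g (Suc i) x" for x
    using a1[of x] hi i' by (simp add: above_Suc)
  have ge: "above h m x = above g m x" if "m \<ge> Suc i" for m x
    using that
  proof (induction m rule: dec_induct)
    case (step m)
    then show ?case using ho[of "Suc m"] by (simp add: above_Suc)
  qed (rule a2)
  have "(\<Sum>j\<in>{1..n} - {i, Suc i}. code h j) = (\<Sum>j\<in>{1..n} - {i, Suc i}. code g j)"
  proof (rule sum.cong)
    fix j assume "j \<in> {1..n} - {i, Suc i}"
    then show "code h j = code g j" using ho[of j] lt[of j] ge[of j] by (cases "j < i") (auto simp: code_def)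
  qed simp
  moreover have "code h i = above g i' (g (int (Suc i))) + of_bool (- g (int (Suc i)) > g (int (Suc i)))"
    using a1 hi by (simp add: code_def)
  moreover have "code g i = above g i' (g (int i)) + of_bool (- g (int i) > g (int i))"
    by (simp add: code_def i' above_Suc)
  moreover have "code h (Suc i) = above g i' (g (int i)) + of_bool (- g (int i) > g (int i))
      + of_bool (g (int (Suc i)) > g (int i)) + of_bool (- g (int (Suc i)) > g (int i))"
    unfolding code_def hi a2 by (simp add: i' above_Suc)
  moreover have "code g (Suc i) = above g i' (g (int (Suc i))) + of_bool (- g (int (Suc i)) > g (int (Suc i)))
      + of_bool (g (int i) > g (int (Suc i))) + of_bool (- g (int i) > g (int (Suc i)))"
    by (simp add: code_def i' above_Suc)
  moreover have "g (int i) \<noteq> g (int (Suc i))" using hyperoctahedral_inj[OF g] by auto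
  moreover have "code_sum n h = code h i + code h (Suc i) + (\<Sum>j\<in>{1..n} - {i, Suc i}. code h j)"
    "code_sum n g = code g i + code g (Suc i) + (\<Sum>j\<in>{1..n} - {i, Suc i}. code g j)"
    unfolding code_sum_def by (rule sum_split_two; use i False in auto)+
  ultimately show ?thesis
    by (auto simp: h_def[symmetric] add.commute[of 1])
qed

text \<open>An increasing sequence \<open>0 < g 1 < ... < g n \<le> n\<close> of integers has no room to differ from the
identity.\<close>

lemma no_descent_id:
  assumes g: "g \<in> hyperoctahedral n" and nd: "\<And>i. i < n \<Longrightarrow> g (int i) < g (int i + 1)"
  shows "g = id"
proof -
  have up: "g (int i) \<ge> int i" if "i \<le> n" for i
    using that
  proof (induction i)
    case (Suc i)
    then show ?case using nd[of i] by (simp add: add.commute[of 1])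
  qed (simp add: hyperoctahedral_0[OF g])
  have down: "g (int (n - i)) \<le> int n - int i" if "i \<le> n" for i
    using that
  proof (induction i)
    case 0
    then show ?case using hyperoctahedral_range[OF g, of "int n"] by simp
  next
    case (Suc i)
    moreover have "int (n - Suc i) + 1 = int (n - i)" using Suc.prems by simp
    ultimately show ?case using nd[of "n - Suc i"] by simp
  qed
  have pos: "g (int i) = int i" if "i \<le> n" for i
    using up[of i] down[of "n - i"] that by simp
  show ?thesis
  proof
    fix i
    consider "\<bar>i\<bar> > int n" | "0 \<le> i" "i \<le> int n" | "i < 0" "- i \<le> int n" by linarith
    then show "g i = id i"
    proof cases
      case 1
      then show ?thesis using g by (auto simp: hyperoctahedral_def permutes_def)
    next
      case 2
      then show ?thesis using pos[of "nat i"] by simp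
    next
      case 3
      then show ?thesis using pos[of "nat (- i)"] hyperoctahedral_odd[OF g, of i] by simp
    qed
  qed
qed

lemma code_sum_id: "code_sum n id = 0"
  by (auto simp: code_sum_def code_def above_def)

lemma word_hyperoctahedral:
  "set w \<subseteq> {..<n} \<Longrightarrow> foldr (\<circ>) (map coxeter_gen w) id \<in> hyperoctahedral n"
  by (induction w) (auto intro!: hyperoctahedral_comp coxeter_gen_hyperoctahedral id_hyperoctahedral)

lemma foldr_comp_snoc: "foldr (\<circ>) (map c (w @ [i])) id = foldr (\<circ>) (map c w) id \<circ> c i"
  by (induction w) (simp_all add: comp_assoc)

text \<open>Each letter changes the sum of the codes by one, so a word is at least that long; and as long as \<open>g\<close>
is not the identity, it has a descent, at which a generator lowers the sum.\<close>

lemma coxeter_length_code_sum: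
  assumes g: "g \<in> hyperoctahedral n"
  shows "coxeter_length n g = code_sum n g"
  unfolding coxeter_length_def
proof (rule Least_equality)
  have "\<exists>w. length w = code_sum n g \<and> set w \<subseteq> {..<n} \<and> g = foldr (\<circ>) (map coxeter_gen w) id"
    using g
  proof (induction "code_sum n g" arbitrary: g)
    case 0
    have "g (int i) < g (int i + 1)" if "i < n" for i
      using code_sum_comp_coxeter_gen[OF 0(2) that] 0(1) by (auto split: if_splits)
    then have "g = id" using no_descent_id 0 by blast
    then show ?case using 0(1) by (intro exI[of _ "[]"]) simp
  next
    case (Suc k)
    have "\<exists>i<n. \<not> g (int i) < g (int i + 1)"
      using no_descent_id[OF Suc(3)] Suc(2) code_sum_id[of n] by force
    then obtain i where i: "i < n" "\<not> g (int i) < g (int i + 1)" by blast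
    define h where "h = g \<circ> coxeter_gen i"
    have h: "h \<in> hyperoctahedral n"
      unfolding h_def using Suc.prems i by (intro hyperoctahedral_comp coxeter_gen_hyperoctahedral)
    have k: "k = code_sum n h"
      using code_sum_comp_coxeter_gen[OF Suc(3) i(1)] i(2) Suc(2) by (simp add: h_def)
    from Suc(1)[OF k h] obtain w where w: "length w = code_sum n h" "set w \<subseteq> {..<n}"
      "h = foldr (\<circ>) (map coxeter_gen w) id" by blast
    have "g = h \<circ> coxeter_gen i" by (simp add: h_def comp_assoc coxeter_gen_involution)
    then have "g = foldr (\<circ>) (map coxeter_gen (w @ [i])) id" using w(3) by (simp only: foldr_comp_snoc)
    then show ?case using w i k Suc(2) by (intro exI[of _ "w @ [i]"]) simp
  qed
  then show "\<exists>w. length w = code_sum n g \<and> set w \<subseteq> {..<n} \<and> g = foldr (\<circ>) (map coxeter_gen w) id" .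
next
  fix k assume "\<exists>w. length w = k \<and> set w \<subseteq> {..<n} \<and> g = foldr (\<circ>) (map coxeter_gen w) id"
  then obtain w where w: "length w = k" "set w \<subseteq> {..<n}" "g = foldr (\<circ>) (map coxeter_gen w) id" by blast
  have "code_sum n (foldr (\<circ>) (map coxeter_gen w) id) \<le> length w"
    using w(2)
  proof (induction w rule: rev_induct)
    case (snoc i w)
    have "int (code_sum n (foldr (\<circ>) (map coxeter_gen w) id \<circ> coxeter_gen i))
        \<le> int (code_sum n (foldr (\<circ>) (map coxeter_gen w) id)) + 1"
      using code_sum_comp_coxeter_gen[OF word_hyperoctahedral[of w n], of i] snoc by (auto split: if_splits)
    moreover have "code_sum n (foldr (\<circ>) (map coxeter_gen w) id) \<le> length w"
      by (rule snoc.IH) (use snoc.prems in simp)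
    ultimately have "code_sum n (foldr (\<circ>) (map coxeter_gen w) id \<circ> coxeter_gen i) \<le> Suc (length w)"
      by linarith
    then show ?case unfolding foldr_comp_snoc by (simp only: length_append_singleton)
  qed (simp add: code_sum_id)
  then show "code_sum n g \<le> k" using w by simp
qed

text \<open>The number of values above \<open>g j\<close> among the earlier values and their negatives, recovered from the
code by removing the contribution of a negative sign.\<close>

definition red :: "nat \<Rightarrow> nat \<Rightarrow> nat" where
  "red j r = (if r \<ge> j then r - 1 else r)"

lemma above_mono: "y \<le> x \<Longrightarrow> above g m x \<le> above g m y"
  unfolding above_def by (intro sum_mono add_mono) (auto simp: of_bool_def)

lemma above_strict:
  assumes "y < x" "1 \<le> j" "j \<le> m" "g (int j) = x"
  shows "above g m x < above g m y"
  unfolding above_def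
proof (rule sum_strict_mono_ex1)
  show "\<exists>i\<in>{1..m}. of_bool (g (int i) > x) + of_bool (- g (int i) > x) < (of_bool (g (int i) > y) + of_bool (- g (int i) > y) :: nat)"
    using assms by (intro bexI[of _ j]) (auto simp: of_bool_def)
qed (use assms in \<open>auto simp: of_bool_def\<close>)

lemma code_Suc: "code g (Suc j) = above g j (g (int (Suc j))) + of_bool (g (int (Suc j)) < 0)"
  by (simp add: code_def above_Suc)

text \<open>Of each pair \<open>g i\<close>, \<open>- g i\<close> at most one element exceeds a positive \<open>x\<close>, and at least one exceeds a
negative \<open>x\<close>.\<close>

lemma above_bounds:
  assumes "\<And>i. 1 \<le> i \<Longrightarrow> i \<le> m \<Longrightarrow> \<bar>g (int i)\<bar> \<noteq> \<bar>x\<bar>"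
  shows "above g m x \<le> 2 * m" "x > 0 \<Longrightarrow> above g m x \<le> m" "x < 0 \<Longrightarrow> above g m x \<ge> m"
proof -
  have "above g m x \<le> (\<Sum>i=1..m. 2)" unfolding above_def by (intro sum_mono) (auto simp: of_bool_def)
  then show "above g m x \<le> 2 * m" by simp
  show "above g m x \<le> m" if "x > 0"
  proof -
    have "above g m x \<le> (\<Sum>i=1..m. 1)" unfolding above_def using that by (intro sum_mono) (auto simp: of_bool_def)
    then show ?thesis by simp
  qed
  show "above g m x \<ge> m" if "x < 0"
  proof -
    have "above g m x \<ge> (\<Sum>i=1..m. 1)" unfolding above_def
    proof (intro sum_mono)
      fix i assume "i \<in> {1..m}"
      then show "1 \<le> of_bool (x < g (int i)) + (of_bool (x < - g (int i)) :: nat)"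
        using assms[of i] that by (auto simp: of_bool_def)
    qed
    then show ?thesis by simp
  qed
qed

lemma
  assumes g: "\<And>i. 1 \<le> i \<Longrightarrow> i \<le> j \<Longrightarrow> \<bar>g (int i)\<bar> \<noteq> \<bar>g (int (Suc j))\<bar>" "g (int (Suc j)) \<noteq> 0"
  shows code_less: "code g (Suc j) < 2 * Suc j"
    and code_neg_iff: "Suc j \<le> code g (Suc j) \<longleftrightarrow> g (int (Suc j)) < 0"
    and red_code: "red (Suc j) (code g (Suc j)) = above g j (g (int (Suc j)))"
proof -
  note b = above_bounds[of j g "g (int (Suc j))", OF g(1)]
  show "code g (Suc j) < 2 * Suc j" using b(1) by (simp add: code_Suc)
  show *: "Suc j \<le> code g (Suc j) \<longleftrightarrow> g (int (Suc j)) < 0"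
    using b(2,3) g(2) by (cases "g (int (Suc j)) < 0") (auto simp: code_Suc)
  show "red (Suc j) (code g (Suc j)) = above g j (g (int (Suc j)))"
    using * by (auto simp: red_def code_Suc)
qed

lemma hyper_g:
  assumes "g \<in> hyperoctahedral n" "1 \<le> i" "i \<le> j"
  shows "\<bar>g (int i)\<bar> \<noteq> \<bar>g (int (Suc j))\<bar>"
  using hyperoctahedral_abs_inj[OF assms(1), of "int i" "int (Suc j)"] assms by auto

text \<open>Both sides compare positions in the set of the values \<open>g 1, ..., g j\<close> and their negatives: the
smaller of two numbers has more of them above it, and \<open>g j\<close> itself separates the two cases.\<close>

lemma descent_iff:
  assumes g: "g \<in> hyperoctahedral n" and j: "j \<ge> 1"
  shows "g (int j) > g (int j + 1) \<longleftrightarrow> \<not> red (Suc j) (code g (Suc j)) \<le> code g j"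
proof -
  have "g (int (Suc j)) \<noteq> 0" using hyperoctahedral_neq0[OF g] by simp
  then have r: "red (Suc j) (code g (Suc j)) = above g j (g (int (Suc j)))"
    using red_code hyper_g[OF g] by blast
  have c: "code g j = above g j (g (int j))" by (simp add: code_def)
  have "g (int j) \<noteq> g (int (Suc j))" using hyperoctahedral_inj[OF g] by auto
  moreover have "int j + 1 = int (Suc j)" by simp
  ultimately show ?thesis
    unfolding r c using above_mono[of "g (int j)" "g (int (Suc j))" g j]
      above_strict[of "g (int (Suc j))" "g (int j)" j j g] j
    by (metis linorder_neqE less_imp_le not_le order_refl)
qed

lemma descent_0_iff:
  assumes g: "g \<in> hyperoctahedral n"
  shows "g 0 > g 1 \<longleftrightarrow> code g 1 = 1"
  using hyperoctahedral_0[OF g] by (auto simp: code_def above_def)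

text \<open>The element with a given number of larger elements in a finite set of integers, which is what a code
prescribes.\<close>

lemma rank_ex1:
  fixes A :: "int set"
  assumes "finite A" "k < card A"
  shows "\<exists>!y. y \<in> A \<and> card {u\<in>A. u > y} = k"
proof -
  define rk where "rk = (\<lambda>y. card {u\<in>A. u > y})"
  have less: "rk y < rk x" if "x < y" "x \<in> A" "y \<in> A" for x y
    unfolding rk_def by (rule psubset_card_mono) (use that assms in auto)
  have inj: "inj_on rk A" by (rule inj_onI) (metis less linorder_neqE less_irrefl)
  have "rk ` A \<subseteq> {..<card A}"
  proof
    fix r assume "r \<in> rk ` A"
    then obtain y where "y \<in> A" "r = rk y" by blast
    moreover have "rk y < card A" unfolding rk_def by (rule psubset_card_mono) (use assms \<open>y \<in> A\<close> in auto)
    ultimately show "r \<in> {..<card A}" by simp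
  qed
  then have "rk ` A = {..<card A}" using card_image[OF inj] by (intro card_subset_eq) auto
  then have "k \<in> rk ` A" using assms by auto
  with inj show ?thesis unfolding rk_def inj_on_def by blast
qed

lemma pos_disjoint_neg:
  assumes "\<And>s::int. s \<in> A \<Longrightarrow> s > 0" "\<And>s. s \<in> B \<Longrightarrow> s > 0"
  shows "A \<inter> uminus ` B = {}"
  using assms by fastforce

lemma above_card:
  assumes "bij_betw (\<lambda>i. \<bar>g (int i)\<bar>) {1..n} S" "\<And>s. s \<in> S \<Longrightarrow> s > 0"
  shows "above g n x = card {u \<in> S \<union> uminus ` S. u > x}"
proof -
  have fin: "finite S" using assms(1) bij_betw_finite by blast
  have "above g n x = (\<Sum>i\<in>{1..n}. of_bool (\<bar>g (int i)\<bar> > x) + of_bool (- \<bar>g (int i)\<bar> > x))"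
    unfolding above_def by (rule sum.cong) (auto simp: of_bool_def abs_if)
  also have "\<dots> = (\<Sum>s\<in>S. of_bool (s > x) + of_bool (- s > x))"
    using sum.reindex_bij_betw[OF assms(1), of "\<lambda>s. of_bool (s > x) + of_bool (- s > x)"] .
  also have "\<dots> = card {s\<in>S. s > x} + card {s\<in>S. - s > x}"
    using fin by (simp add: sum.distrib of_bool_def sum.If_cases Int_def)
  also have "card {s\<in>S. - s > x} = card (uminus ` {s\<in>S. - s > x})"
    by (simp add: card_image)
  also have "card {s\<in>S. s > x} + card (uminus ` {s\<in>S. - s > x}) = card ({s\<in>S. s > x} \<union> uminus ` {s\<in>S. - s > x})"
    using fin pos_disjoint_neg[of "{s\<in>S. s > x}" "{s\<in>S. - s > x}"] assms(2)
    by (intro card_Un_disjoint[symmetric]) auto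
  also have "{s\<in>S. s > x} \<union> uminus ` {s\<in>S. - s > x} = {u \<in> S \<union> uminus ` S. u > x}" by auto
  finally show ?thesis .
qed

lemma card_pm:
  assumes "finite S" "\<And>s::int. s \<in> S \<Longrightarrow> s > 0"
  shows "card (S \<union> uminus ` S) = 2 * card S"
proof -
  have "card (S \<union> uminus ` S) = card S + card (uminus ` S)"
    by (rule card_Un_disjoint) (use assms pos_disjoint_neg[of S S] in auto)
  then show ?thesis by (simp add: card_image)
qed

lemma bij_restrict:
  assumes "bij_betw f {1..Suc n} S"
  shows "bij_betw f {1..n} (S - {f (Suc n)})"
proof -
  have "bij_betw f ({1..Suc n} - {Suc n}) (S - {f (Suc n)})"
  proof (rule bij_betw_DiffI[OF assms])
    have "Suc n \<in> {1..Suc n}" by simp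
    then show "{f (Suc n)} \<subseteq> S" using assms unfolding bij_betw_def by blast
  qed auto
  moreover have "{1..Suc n} - {Suc n} = {1..n}" by auto
  ultimately show ?thesis by (simp only:)
qed

lemma ex1_unique2: "\<exists>!y. P y \<Longrightarrow> P a \<Longrightarrow> P b \<Longrightarrow> a = b"
  by blast

text \<open>The last code determines the rank of the last value in the set of all absolute values and their
negatives; that value is then removed and the argument repeated.\<close>

lemma code_unique:
  assumes "bij_betw (\<lambda>i. \<bar>g (int i)\<bar>) {1..n} S" "bij_betw (\<lambda>i. \<bar>h (int i)\<bar>) {1..n} S"
    "\<And>s. s \<in> S \<Longrightarrow> s > 0" "\<And>j. j \<in> {1..n} \<Longrightarrow> code g j = code h j"
  shows "\<forall>j\<in>{1..n}. g (int j) = h (int j)"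
  using assms
proof (induction n arbitrary: S)
  case (Suc n)
  have fin: "finite S" using Suc.prems(1) bij_betw_finite by blast
  have card: "card S = Suc n" using bij_betw_same_card[OF Suc.prems(1)] by simp
  have mem: "f (int (Suc n)) \<in> S \<union> uminus ` S" if "bij_betw (\<lambda>i. \<bar>f (int i)\<bar>) {1..Suc n} S" for f :: "int \<Rightarrow> int"
  proof -
    have "Suc n \<in> {1..Suc n}" by simp
    then have "\<bar>f (int (Suc n))\<bar> \<in> S" using that unfolding bij_betw_def by blast
    then show ?thesis by (cases "f (int (Suc n)) \<ge> 0") (auto simp: image_iff, metis minus_minus)
  qed
  have eq: "card {u \<in> S \<union> uminus ` S. u > g (int (Suc n))} = card {u \<in> S \<union> uminus ` S. u > h (int (Suc n))}"
    using Suc.prems(4)[of "Suc n"] above_card[OF Suc.prems(1,3)] above_card[OF Suc.prems(2,3)]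
    by (simp add: code_def)
  have "card {u \<in> S \<union> uminus ` S. u > h (int (Suc n))} < card (S \<union> uminus ` S)"
    by (rule psubset_card_mono) (use fin mem[OF Suc.prems(2)] in auto)
  then have ex1: "\<exists>!y. y \<in> S \<union> uminus ` S \<and>
      card {u \<in> S \<union> uminus ` S. u > y} = card {u \<in> S \<union> uminus ` S. u > h (int (Suc n))}"
    using fin by (intro rank_ex1) auto
  have top: "g (int (Suc n)) = h (int (Suc n))"
    by (rule ex1_unique2[OF ex1 conjI[OF mem[OF Suc.prems(1)] eq] conjI[OF mem[OF Suc.prems(2)] refl]])
  have "\<forall>j\<in>{1..n}. g (int j) = h (int j)"
    by (rule Suc.IH[of "S - {\<bar>g (int (Suc n))\<bar>}"])
       (use bij_restrict[OF Suc.prems(1)] bij_restrict[OF Suc.prems(2)] top Suc.prems(3,4) in auto)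
  then show ?case using top by (auto simp: le_Suc_eq)
qed simp

text \<open>The values are chosen from the last one downwards, each with the rank that its code prescribes among
the values that are still free.\<close>

lemma code_exists:
  assumes "finite S" "card S = n" "\<And>s. s \<in> S \<Longrightarrow> s > (0::int)" "\<And>j. j \<in> {1..n} \<Longrightarrow> r j < 2 * j"
  shows "\<exists>g. bij_betw (\<lambda>i. \<bar>g (int i)\<bar>) {1..n} S \<and> (\<forall>j\<in>{1..n}. code g j = r j)"
  using assms
proof (induction n arbitrary: S)
  case 0
  then show ?case by (simp add: bij_betw_def)
next
  case (Suc n)
  have "r (Suc n) < card (S \<union> uminus ` S)" using Suc.prems(2) Suc.prems(4)[of "Suc n"] card_pm[OF Suc.prems(1,3)] by simp
  then obtain y where y: "y \<in> S \<union> uminus ` S" "card {u \<in> S \<union> uminus ` S. u > y} = r (Suc n)"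
    using rank_ex1[of "S \<union> uminus ` S" "r (Suc n)"] Suc.prems(1) by blast
  have ys: "\<bar>y\<bar> \<in> S" using y(1) Suc.prems(3) by auto (metis abs_of_pos, metis abs_minus_cancel abs_of_pos)
  obtain g where g: "bij_betw (\<lambda>i. \<bar>g (int i)\<bar>) {1..n} (S - {\<bar>y\<bar>})" "\<And>j. j \<in> {1..n} \<Longrightarrow> code g j = r j"
    using Suc.IH[of "S - {\<bar>y\<bar>}"] Suc.prems ys by (auto simp: card_Diff_singleton)
  define h where "h = g(int (Suc n) := y)"
  have hg: "h (int i) = g (int i)" if "i \<in> {1..n}" for i using that by (simp add: h_def)
  have hy: "h (int (Suc n)) = y" by (simp add: h_def)
  have "bij_betw (\<lambda>i. \<bar>h (int i)\<bar>) {1..n} (S - {\<bar>y\<bar>})"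
    using g(1) by (rule bij_betw_cong[THEN iffD1, rotated]) (simp add: hg)
  then have "bij_betw (\<lambda>i. \<bar>h (int i)\<bar>) ({1..n} \<union> {Suc n}) ((S - {\<bar>y\<bar>}) \<union> {\<bar>y\<bar>})"
    by (rule bij_betw_combine) (auto simp: h_def)
  moreover have "{1..n} \<union> {Suc n} = {1..Suc n}" "(S - {\<bar>y\<bar>}) \<union> {\<bar>y\<bar>} = S" using ys by auto
  ultimately have b: "bij_betw (\<lambda>i. \<bar>h (int i)\<bar>) {1..Suc n} S" by simp
  have "code h j = r j" if "j \<in> {1..Suc n}" for j
  proof (cases "j = Suc n")
    case True
    then show ?thesis using above_card[OF b Suc.prems(3), of y] hy y(2) by (simp add: code_def)
  next
    case False
    then have j: "j \<in> {1..n}" using that by auto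
    have "above h j x = above g j x" for x by (rule above_cong) (use hg j in auto)
    then show ?thesis using g(2)[OF j] hg[OF j] by (simp add: code_def)
  qed
  with b show ?case by blast
qed

definition codes :: "nat \<Rightarrow> (nat \<Rightarrow> nat) set" where
  "codes n = {r. \<forall>j. if 1 \<le> j \<and> j \<le> n then r j < 2 * j else r j = 0}"

definition code_fun :: "nat \<Rightarrow> (int \<Rightarrow> int) \<Rightarrow> nat \<Rightarrow> nat" where
  "code_fun n g j = (if 1 \<le> j \<and> j \<le> n then code g j else 0)"

lemma hyper_bij:
  assumes g: "g \<in> hyperoctahedral n"
  shows "bij_betw (\<lambda>i. \<bar>g (int i)\<bar>) {1..n} {1..int n}"
proof -
  have inj: "inj_on (\<lambda>i. \<bar>g (int i)\<bar>) {1..n}"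
  proof (rule inj_onI)
    fix i j assume "\<bar>g (int i)\<bar> = \<bar>g (int j)\<bar>"
    from hyperoctahedral_abs_inj[OF g this] show "i = j" by simp
  qed
  moreover have "(\<lambda>i. \<bar>g (int i)\<bar>) ` {1..n} \<subseteq> {1..int n}"
  proof
    fix x assume "x \<in> (\<lambda>i. \<bar>g (int i)\<bar>) ` {1..n}"
    then obtain i where "i \<in> {1..n}" "x = \<bar>g (int i)\<bar>" by blast
    then show "x \<in> {1..int n}"
      using hyperoctahedral_range[OF g, of "int i"] hyperoctahedral_neq0[OF g, of "int i"] by auto
  qed
  ultimately show ?thesis
    unfolding bij_betw_def using card_image[OF inj]
    by (intro conjI card_subset_eq) simp_all
qed

text \<open>Signed permutations are the assignments whose absolute values run through \<open>1, ..., n\<close>.\<close>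

lemma code_bij: "bij_betw (code_fun n) (hyperoctahedral n) (codes n)"
proof (rule bij_betwI')
  fix g h assume g: "g \<in> hyperoctahedral n" and h: "h \<in> hyperoctahedral n"
  show "code_fun n g = code_fun n h \<longleftrightarrow> g = h"
  proof
    assume eq: "code_fun n g = code_fun n h"
    have "\<forall>j\<in>{1..n}. g (int j) = h (int j)"
    proof (rule code_unique[OF hyper_bij[OF g] hyper_bij[OF h]])
      fix j assume "j \<in> {1..n}"
      then show "code g j = code h j" using fun_cong[OF eq, of j] by (simp add: code_fun_def)
    qed auto
    then have p: "g (int j) = h (int j)" if "1 \<le> j" "j \<le> n" for j using that by auto
    show "g = h"
    proof
      fix i
      consider "\<bar>i\<bar> > int n" | "i = 0" | "0 < i" "i \<le> int n" | "i < 0" "- i \<le> int n" by linarith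
      then show "g i = h i"
      proof cases
        case 1
        then show ?thesis using g h by (auto simp: hyperoctahedral_def permutes_def)
      next
        case 2
        then show ?thesis using hyperoctahedral_0 g h by metis
      next
        case 3
        then show ?thesis using p[of "nat i"] by simp
      next
        case 4
        then show ?thesis using p[of "nat (- i)"] hyperoctahedral_odd[OF g, of i] hyperoctahedral_odd[OF h, of i]
          by simp
      qed
    qed
  qed simp
next
  fix g assume g: "g \<in> hyperoctahedral n"
  show "code_fun n g \<in> codes n"
    unfolding codes_def code_fun_def
  proof (intro CollectI allI)
    fix j
    have "code g j < 2 * j" if "1 \<le> j"
      using code_less[of "j - 1" g] that hyper_g[OF g] hyperoctahedral_neq0[OF g] by (cases j) auto
    then show "if 1 \<le> j \<and> j \<le> n then (if 1 \<le> j \<and> j \<le> n then code g j else 0) < 2 * j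
      else (if 1 \<le> j \<and> j \<le> n then code g j else 0) = 0" by simp
  qed
next
  fix r assume r: "r \<in> codes n"
  have "\<exists>g. bij_betw (\<lambda>i. \<bar>g (int i)\<bar>) {1..n} {1..int n} \<and> (\<forall>j\<in>{1..n}. code g j = r j)"
    by (rule code_exists) (use r in \<open>auto simp: codes_def split: if_splits\<close>)
  then obtain g where g: "bij_betw (\<lambda>i. \<bar>g (int i)\<bar>) {1..n} {1..int n}" "\<And>j. j \<in> {1..n} \<Longrightarrow> code g j = r j"
    by blast
  define h where "h = (\<lambda>i. if 0 < i \<and> i \<le> int n then g i else if i < 0 \<and> - i \<le> int n then - g (- i) else i)"
  have hg: "h (int i) = g (int i)" if "i \<in> {1..n}" for i using that by (simp add: h_def)
  have odd: "h (- i) = - h i" for i by (auto simp: h_def)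
  have rng: "\<bar>g i\<bar> \<in> {1..int n}" if "0 < i" "i \<le> int n" for i
  proof -
    have "nat i \<in> {1..n}" using that by auto
    then have "\<bar>g (int (nat i))\<bar> \<in> {1..int n}" using g(1) unfolding bij_betw_def by blast
    then show ?thesis using that by simp
  qed
  have inj: "i = j" if "\<bar>g i\<bar> = \<bar>g j\<bar>" "0 < i" "i \<le> int n" "0 < j" "j \<le> int n" for i j
  proof -
    have "nat i \<in> {1..n}" "nat j \<in> {1..n}" using that by auto
    moreover have "\<bar>g (int (nat i))\<bar> = \<bar>g (int (nat j))\<bar>" using that by simp
    ultimately have "nat i = nat j" using g(1) unfolding bij_betw_def inj_on_def by blast
    then show ?thesis using that by simp
  qed
  define P where "P = {i. i \<noteq> 0 \<and> \<bar>i\<bar> \<le> int n}"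
  have finP: "finite P" by (rule finite_subset[of _ "{- int n..int n}"]) (auto simp: P_def)
  have "inj_on h P"
  proof (rule inj_onI)
    fix i j assume ij: "i \<in> P" "j \<in> P" "h i = h j"
    have "\<bar>h i\<bar> = \<bar>g \<bar>i\<bar>\<bar>" if "i \<in> P" for i using that by (auto simp: P_def h_def)
    from this[OF ij(1)] this[OF ij(2)]
    have "\<bar>h i\<bar> = \<bar>g \<bar>i\<bar>\<bar>" "\<bar>h j\<bar> = \<bar>g \<bar>j\<bar>\<bar>" .
    with ij(3) have "\<bar>i\<bar> = \<bar>j\<bar>" using inj[of "\<bar>i\<bar>" "\<bar>j\<bar>"] ij by (auto simp: P_def)
    moreover have "h i \<noteq> 0" using \<open>\<bar>h i\<bar> = \<bar>g \<bar>i\<bar>\<bar>\<close> rng[of "\<bar>i\<bar>"] ij by (auto simp: P_def)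
    ultimately show "i = j" using ij(3) odd[of j] by (auto simp: abs_eq_iff)
  qed
  moreover have "h ` P \<subseteq> P"
  proof
    fix x assume "x \<in> h ` P"
    then obtain i where i: "i \<in> P" "x = h i" by blast
    then have "\<bar>x\<bar> = \<bar>g \<bar>i\<bar>\<bar>" by (auto simp: P_def h_def)
    then show "x \<in> P" using rng[of "\<bar>i\<bar>"] i by (auto simp: P_def)
  qed
  ultimately have "bij_betw h P P" using finP by (simp add: bij_betw_def endo_inj_surj)
  then have "h permutes P" by (rule bij_imp_permutes) (auto simp: P_def h_def)
  then have hh: "h \<in> hyperoctahedral n" using odd by (simp add: hyperoctahedral_def P_def)
  have "code h j = r j" if j: "j \<in> {1..n}" for j
  proof -
    have "above h j x = above g j x" for x by (rule above_cong) (use hg j in auto)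
    then show ?thesis using g(2)[OF j] hg[OF j] by (simp add: code_def)
  qed
  then have "r = code_fun n h" using r by (auto simp: fun_eq_iff codes_def code_fun_def)
  with hh show "\<exists>g\<in>hyperoctahedral n. r = code_fun n g" by blast
qed

section \<open>Weighted descents in the hyperoctahedral group\<close>

text \<open>The Gaussian binomial coefficient of \<open>b + m\<close> over \<open>m\<close> at \<open>t\<close>.\<close>

fun qbin :: "real \<Rightarrow> nat \<Rightarrow> nat \<Rightarrow> real" where
  "qbin t b 0 = 1"
| "qbin t 0 (Suc m) = 1"
| "qbin t (Suc b) (Suc m) = qbin t (Suc b) m + t ^ Suc m * qbin t b (Suc m)"

lemma qbin_0: "qbin t 0 m = 1"
  by (cases m) auto

lemma qbin_pascal2: "qbin t (Suc b) (Suc m) = t ^ Suc b * qbin t (Suc b) m + qbin t b (Suc m)"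
proof (induction "b + m" arbitrary: b m rule: less_induct)
  case less
  show ?case
  proof (cases b; cases m)
    fix b' m' assume bm: "b = Suc b'" "m = Suc m'"
    have 1: "qbin t (Suc b) m = t ^ Suc b * qbin t (Suc b) m' + qbin t b m"
      using less[of b m'] bm by simp
    have 2: "qbin t b (Suc m) = t ^ b * qbin t b m + qbin t b' (Suc m)"
      using less[of b' m] bm by simp
    have "qbin t (Suc b) (Suc m) = qbin t (Suc b) m + t ^ Suc m * qbin t b (Suc m)" by simp
    also have "\<dots> = t ^ Suc b * (qbin t (Suc b) m' + t ^ m * qbin t b m) + (qbin t b m + t ^ Suc m * qbin t b' (Suc m))"
      unfolding 1 2 by (simp add: algebra_simps)
    also have "qbin t (Suc b) m' + t ^ m * qbin t b m = qbin t (Suc b) m" using bm by simp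
    also have "qbin t b m + t ^ Suc m * qbin t b' (Suc m) = qbin t b (Suc m)" using bm by simp
    finally show ?thesis .
  next
    fix b' assume "b = Suc b'" "m = 0"
    then show ?thesis using less[of b' 0] by (simp add: algebra_simps)
  next
    fix m' assume bm: "b = 0" "m = Suc m'"
    have "qbin t (Suc 0) (Suc m') = t * qbin t (Suc 0) m' + 1"
      using less[of 0 m'] bm by simp
    moreover have q: "qbin t (Suc 0) (Suc (Suc m')) = qbin t (Suc 0) (Suc m') + t * t ^ Suc m'"
      "qbin t (Suc 0) (Suc m') = qbin t (Suc 0) m' + t ^ Suc m'" by simp_all
    moreover from q(2) have "t * qbin t (Suc 0) (Suc m') = t * qbin t (Suc 0) m' + t * t ^ Suc m'"
      by (simp only: distrib_left)
    ultimately show ?thesis unfolding bm by (simp only: qbin_0 power_0 power_one_right mult_1_right) simp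
  qed simp
qed

lemma qbin_pos: "t > 0 \<Longrightarrow> qbin t b m > 0"
  by (induction t b m rule: qbin.induct) (auto intro: add_pos_pos)

text \<open>The codes of the positions \<open>b + 1, ..., b + m\<close> in a run without descents, except possibly before its
first position.\<close>

definition chain :: "nat \<Rightarrow> nat \<Rightarrow> (nat \<Rightarrow> nat) set" where
  "chain b m = {r. (\<forall>j. if b < j \<and> j \<le> b + m then r j < 2 * j else r j = 0) \<and>
     (\<forall>j. b < j \<and> j < b + m \<longrightarrow> red (Suc j) (r (Suc j)) \<le> r j)}"

text \<open>The factor of one code entry in the weight \<open>a ^ neg_B n g * t ^ coxeter_length n g\<close>.\<close>

definition wt :: "real \<Rightarrow> real \<Rightarrow> nat \<Rightarrow> nat \<Rightarrow> real" where
  "wt t a j r = t ^ r * (if r \<ge> j then a else 1)"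

definition block_sum :: "real \<Rightarrow> real \<Rightarrow> nat \<Rightarrow> nat \<Rightarrow> real" where
  "block_sum t a b m = (\<Sum>r\<in>chain b m. \<Prod>j\<in>{b<..b+m}. wt t a j (r j))"

lemma finite_bounded_funs: "finite {r :: nat \<Rightarrow> nat. \<forall>j. if b < j \<and> j \<le> c then r j < f j else r j = 0}"
proof -
  have "{r. \<forall>j. if b < j \<and> j \<le> c then r j < f j else r j = 0} =
    {r. \<forall>j. (j \<in> {b<..c} \<longrightarrow> r j \<in> {..<f j}) \<and> (j \<notin> {b<..c} \<longrightarrow> r j = 0)}" by auto
  also have "finite \<dots>"
  proof (rule finite_subset)
    define B where "B = (\<Union>j\<in>{b<..c}. {..<f j})"
    show "{r. \<forall>j. (j \<in> {b<..c} \<longrightarrow> r j \<in> {..<f j}) \<and> (j \<notin> {b<..c} \<longrightarrow> r j = 0)} \<subseteq>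
       {r. \<forall>j. (j \<in> {b<..c} \<longrightarrow> r j \<in> B) \<and> (j \<notin> {b<..c} \<longrightarrow> r j = 0)}"
      unfolding B_def by blast
    show "finite {r. \<forall>j. (j \<in> {b<..c} \<longrightarrow> r j \<in> B) \<and> (j \<notin> {b<..c} \<longrightarrow> r j = 0)}"
      by (rule finite_set_of_finite_funs) (auto simp: B_def)
  qed
  finally show ?thesis .
qed

lemma finite_chain: "finite (chain b m)"
  by (rule finite_subset[OF _ finite_bounded_funs[of b "b + m" "\<lambda>j. 2 * j"]]) (auto simp: chain_def)

lemma block_sum_0: "block_sum t a b 0 = 1"
proof -
  have "chain b 0 = {\<lambda>_. 0}" by (auto simp: chain_def)
  then show ?thesis by (simp add: block_sum_def)
qed

text \<open>Along a chain \<open>red (Suc j) (r (Suc j)) \<le> r j\<close>, and \<open>red\<close> of a positive number can be \<open>0\<close> only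
for \<open>r (Suc j) = 1\<close> and \<open>j = 0\<close>; so positivity passes from the last entry to all earlier ones.\<close>

lemma chain_ge1:
  assumes "r \<in> chain b (Suc m)" "r (b + Suc m) \<ge> 1" "b < j" "j \<le> b + Suc m"
  shows "r j \<ge> 1"
  using assms(4,3)
proof (induction j rule: inc_induct)
  case (step k)
  then have "red (Suc k) (r (Suc k)) \<le> r k" "1 \<le> r (Suc k)" using assms(1) by (auto simp: chain_def)
  moreover have "k \<ge> 1" using step by simp
  ultimately show ?case by (auto simp: red_def split: if_splits)
qed (use assms in auto)

lemma prod_shift1: "(\<Prod>j\<in>{Suc b<..Suc c}. f j) = (\<Prod>j\<in>{b<..c}. f (Suc j))" for f :: "nat \<Rightarrow> real"
  by (rule prod.reindex_bij_witness[of _ Suc "\<lambda>j. j - 1"]) auto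

lemma wt_Suc: "wt t a (Suc j) (Suc r) = t * wt t a j r"
  by (simp add: wt_def)

lemma block_sum_part0:
  "(\<Sum>r | r \<in> chain b (Suc m) \<and> r (b + Suc m) = 0. \<Prod>j\<in>{b<..b+Suc m}. wt t a j (r j)) = block_sum t a b m"
  unfolding block_sum_def
proof (rule sum.reindex_bij_witness[of _ "\<lambda>r. r" "\<lambda>r. r"])
  fix r assume r: "r \<in> chain b m"
  have "r j = 0" if "j \<ge> b + Suc m" for j using r that unfolding chain_def by (auto split: if_splits)
  moreover have "red (Suc j) (r (Suc j)) \<le> r j" if "b < j" "j < b + Suc m" for j
    using r that \<open>\<And>j. j \<ge> b + Suc m \<Longrightarrow> r j = 0\<close>[of "Suc j"] unfolding chain_def
    by (cases "j < b + m") (auto simp: red_def)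
  ultimately show "r \<in> {r \<in> chain b (Suc m). r (b + Suc m) = 0}"
    using r unfolding chain_def by (auto split: if_splits simp: le_Suc_eq)
next
  fix r assume r: "r \<in> {r \<in> chain b (Suc m). r (b + Suc m) = 0}"
  then show "r \<in> chain b m" unfolding chain_def by (auto split: if_splits simp: le_Suc_eq)
  have "{b<..b+Suc m} = insert (b + Suc m) {b<..b+m}" by auto
  then show "(\<Prod>j\<in>{b<..b+m}. wt t a j (r j)) = (\<Prod>j\<in>{b<..b+Suc m}. wt t a j (r j))"
    using r by (simp add: wt_def)
qed auto

lemma red_pred: "r \<ge> 1 \<Longrightarrow> j \<ge> 1 \<Longrightarrow> red (Suc j) r = Suc (red j (r - 1))"
  by (auto simp: red_def)

text \<open>Lowering every entry by one moves the whole chain one position down and costs a factor \<open>t\<close> for each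
of the \<open>Suc m\<close> entries. This is possible as long as the first entry is not maximal.\<close>

lemma block_sum_part1:
  "(\<Sum>r | r \<in> chain (Suc b) (Suc m) \<and> r (Suc b + Suc m) \<ge> 1 \<and> r (Suc (Suc b)) \<le> 2 * Suc b.
      \<Prod>j\<in>{Suc b<..Suc b+Suc m}. wt t a j (r j)) = t ^ Suc m * block_sum t a b (Suc m)"
proof -
  have "(\<Sum>r | r \<in> chain (Suc b) (Suc m) \<and> r (Suc b + Suc m) \<ge> 1 \<and> r (Suc (Suc b)) \<le> 2 * Suc b.
      \<Prod>j\<in>{Suc b<..Suc b+Suc m}. wt t a j (r j))
     = (\<Sum>r\<in>chain b (Suc m). \<Prod>j\<in>{b<..b+Suc m}. wt t a (Suc j) (Suc (r j)))"
  proof (rule sum.reindex_bij_witness[of _ "\<lambda>r j. if Suc b < j \<and> j \<le> Suc b + Suc m then Suc (r (j - 1)) else 0"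
        "\<lambda>r j. r (Suc j) - 1"])
    fix r assume "r \<in> {r \<in> chain (Suc b) (Suc m). r (Suc b + Suc m) \<ge> 1 \<and> r (Suc (Suc b)) \<le> 2 * Suc b}"
    then have r: "r \<in> chain (Suc b) (Suc m)" "r (Suc b + Suc m) \<ge> 1" "r (Suc (Suc b)) \<le> 2 * Suc b" by auto
    have ge: "r j \<ge> 1" if "Suc b < j" "j \<le> Suc b + Suc m" for j using chain_ge1[OF r(1,2) that] .
    have out: "r j = 0" if "\<not> (Suc b < j \<and> j \<le> Suc b + Suc m)" for j using r(1) that by (auto simp: chain_def)
    have red: "red (Suc j) (r (Suc j)) \<le> r j" if "Suc b < j" "j < Suc b + Suc m" for j
      using r(1) that by (auto simp: chain_def)
    have lt: "r j < 2 * j" if "Suc b < j" "j \<le> Suc b + Suc m" for j using r(1) that unfolding chain_def by auto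
    show "(\<lambda>j. if Suc b < j \<and> j \<le> Suc b + Suc m then Suc (r (Suc (j - 1)) - 1) else 0) = r"
      using ge out by (fastforce simp: fun_eq_iff)
    show "(\<lambda>j. r (Suc j) - 1) \<in> chain b (Suc m)"
      unfolding chain_def
    proof (intro CollectI conjI allI impI)
      fix j
      show "if b < j \<and> j \<le> b + Suc m then r (Suc j) - 1 < 2 * j else r (Suc j) - 1 = 0"
      proof (cases "b < j \<and> j \<le> b + Suc m")
        case True
        have "r (Suc j) \<le> 2 * j"
        proof (cases "j = Suc b")
          case False
          then have "red (Suc j) (r (Suc j)) \<le> r j" "r j < 2 * j" using red[of j] lt[of j] True by auto
          then show ?thesis by (auto simp: red_def split: if_splits)
        qed (use r in simp)
        with True show ?thesis by auto
      qed (use out[of "Suc j"] in auto)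
      assume j: "b < j \<and> j < b + Suc m"
      have "red (Suc (Suc j)) (r (Suc (Suc j))) \<le> r (Suc j)" using red[of "Suc j"] j by auto
      moreover have "red (Suc (Suc j)) (r (Suc (Suc j))) = Suc (red (Suc j) (r (Suc (Suc j)) - 1))"
        by (rule red_pred) (use ge[of "Suc (Suc j)"] j in auto)
      ultimately show "red (Suc j) (r (Suc (Suc j)) - 1) \<le> r (Suc j) - 1" by simp
    qed
    have "(\<Prod>j\<in>{b<..b+Suc m}. wt t a (Suc j) (Suc (r (Suc j) - 1))) = (\<Prod>j\<in>{b<..b+Suc m}. wt t a (Suc j) (r (Suc j)))"
    proof (rule prod.cong)
      fix j assume "j \<in> {b<..b+Suc m}"
      then show "wt t a (Suc j) (Suc (r (Suc j) - 1)) = wt t a (Suc j) (r (Suc j))" using ge[of "Suc j"] by simp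
    qed simp
    then show "(\<Prod>j\<in>{b<..b+Suc m}. wt t a (Suc j) (Suc (r (Suc j) - 1))) = (\<Prod>j\<in>{Suc b<..Suc b+Suc m}. wt t a j (r j))"
      using prod_shift1[of "\<lambda>j. wt t a j (r j)" b "b + Suc m"] by simp
  next
    fix r assume r: "r \<in> chain b (Suc m)"
    have out: "r j = 0" if "\<not> (b < j \<and> j \<le> b + Suc m)" for j using r that by (auto simp: chain_def)
    then show "(\<lambda>j. (if Suc b < Suc j \<and> Suc j \<le> Suc b + Suc m then Suc (r (Suc j - 1)) else 0) - 1) = r"
      by (fastforce simp: fun_eq_iff)
    have lt: "r j < 2 * j" if "b < j" "j \<le> b + Suc m" for j using r that unfolding chain_def by auto
    have red: "red (Suc j) (r (Suc j)) \<le> r j" if "b < j" "j < b + Suc m" for j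
      using r that by (auto simp: chain_def)
    let ?q = "\<lambda>j. if Suc b < j \<and> j \<le> Suc b + Suc m then Suc (r (j - 1)) else 0"
    have "?q \<in> chain (Suc b) (Suc m)"
      unfolding chain_def
    proof (intro CollectI conjI allI impI)
      fix j
      show "if Suc b < j \<and> j \<le> Suc b + Suc m then ?q j < 2 * j else ?q j = 0"
        using lt[of "j - 1"] by (cases j) auto
      assume j: "Suc b < j \<and> j < Suc b + Suc m"
      then have "red j (r j) \<le> r (j - 1)" using red[of "j - 1"] by auto
      moreover have "red (Suc j) (Suc (r j)) = Suc (red j (r j))" using red_pred[of "Suc (r j)" j] j by simp
      ultimately show "red (Suc j) (?q (Suc j)) \<le> ?q j" using j by auto
    qed
    then show "?q \<in> {r \<in> chain (Suc b) (Suc m). r (Suc b + Suc m) \<ge> 1 \<and> r (Suc (Suc b)) \<le> 2 * Suc b}"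
      using lt[of "Suc b"] by auto
  qed
  also have "\<dots> = (\<Sum>r\<in>chain b (Suc m). t ^ Suc m * (\<Prod>j\<in>{b<..b+Suc m}. wt t a j (r j)))"
    by (simp add: wt_Suc prod.distrib)
  finally show ?thesis by (simp add: block_sum_def sum_distrib_left)
qed

text \<open>A maximal first entry belongs to a value below all the earlier ones and their negatives. The chain
condition on the next entry then says just that it is not maximal, so that the later entries can be
lowered by one as before.\<close>

lemma block_sum_part2:
  "(\<Sum>r | r \<in> chain b (Suc m) \<and> r (b + Suc m) \<ge> 1 \<and> r (Suc b) = Suc (2 * b).
      \<Prod>j\<in>{b<..b+Suc m}. wt t a j (r j)) = a * t ^ (m + Suc (2 * b)) * block_sum t a b m"
proof -
  have "(\<Sum>r | r \<in> chain b (Suc m) \<and> r (b + Suc m) \<ge> 1 \<and> r (Suc b) = Suc (2 * b).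
      \<Prod>j\<in>{b<..b+Suc m}. wt t a j (r j))
     = (\<Sum>r\<in>chain b m. a * t ^ Suc (2 * b) * (\<Prod>j\<in>{b<..b+m}. wt t a (Suc j) (Suc (r j))))"
  proof (rule sum.reindex_bij_witness[of _ "\<lambda>r j. if j = Suc b then Suc (2 * b) else if Suc b < j \<and> j \<le> b + Suc m then Suc (r (j - 1)) else 0"
        "\<lambda>r j. if j = b then 0 else r (Suc j) - 1"])
    fix r assume "r \<in> {r \<in> chain b (Suc m). r (b + Suc m) \<ge> 1 \<and> r (Suc b) = Suc (2 * b)}"
    then have r: "r \<in> chain b (Suc m)" "r (b + Suc m) \<ge> 1" "r (Suc b) = Suc (2 * b)" by auto
    have ge: "r j \<ge> 1" if "b < j" "j \<le> b + Suc m" for j using chain_ge1[OF r(1,2) that] .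
    have out: "r j = 0" if "\<not> (b < j \<and> j \<le> b + Suc m)" for j using r(1) that by (auto simp: chain_def)
    have red: "red (Suc j) (r (Suc j)) \<le> r j" if "b < j" "j < b + Suc m" for j
      using r(1) that by (auto simp: chain_def)
    have lt: "r j < 2 * j" if "b < j" "j \<le> b + Suc m" for j using r(1) that unfolding chain_def by auto
    show "(\<lambda>j. if j = Suc b then Suc (2 * b) else if Suc b < j \<and> j \<le> b + Suc m then Suc (if j - 1 = b then 0 else r (Suc (j - 1)) - 1) else 0) = r"
    proof
      fix j
      show "(if j = Suc b then Suc (2 * b) else if Suc b < j \<and> j \<le> b + Suc m then Suc (if j - 1 = b then 0 else r (Suc (j - 1)) - 1) else 0) = r j"
        using ge[of j] out[of j] r(3) by auto
    qed
    show "(\<lambda>j. if j = b then 0 else r (Suc j) - 1) \<in> chain b m"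
      unfolding chain_def
    proof (intro CollectI conjI allI impI)
      fix j
      show "if b < j \<and> j \<le> b + m then (if j = b then 0 else r (Suc j) - 1) < 2 * j else (if j = b then 0 else r (Suc j) - 1) = 0"
      proof (cases "b < j \<and> j \<le> b + m")
        case True
        then have "red (Suc j) (r (Suc j)) \<le> r j" "r j < 2 * j" using red[of j] lt[of j] by auto
        then have "r (Suc j) \<le> 2 * j" by (auto simp: red_def split: if_splits)
        with True show ?thesis by auto
      qed (use out[of "Suc j"] in auto)
      assume j: "b < j \<and> j < b + m"
      have "red (Suc (Suc j)) (r (Suc (Suc j))) \<le> r (Suc j)" using red[of "Suc j"] j by auto
      moreover have "red (Suc (Suc j)) (r (Suc (Suc j))) = Suc (red (Suc j) (r (Suc (Suc j)) - 1))"
        by (rule red_pred) (use ge[of "Suc (Suc j)"] j in auto)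
      ultimately show "red (Suc j) (if Suc j = b then 0 else r (Suc (Suc j)) - 1) \<le> (if j = b then 0 else r (Suc j) - 1)"
        using j by simp
    qed
    have "{b<..b+Suc m} = insert (Suc b) {Suc b<..Suc (b+m)}" by auto
    then have "(\<Prod>j\<in>{b<..b+Suc m}. wt t a j (r j)) = wt t a (Suc b) (r (Suc b)) * (\<Prod>j\<in>{b<..b+m}. wt t a (Suc j) (r (Suc j)))"
      by (simp add: prod_shift1)
    also have "wt t a (Suc b) (r (Suc b)) = a * t ^ Suc (2 * b)" using r(3) by (simp add: wt_def)
    also have "(\<Prod>j\<in>{b<..b+m}. wt t a (Suc j) (r (Suc j))) = (\<Prod>j\<in>{b<..b+m}. wt t a (Suc j) (Suc (if j = b then 0 else r (Suc j) - 1)))"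
    proof (rule prod.cong)
      fix j assume "j \<in> {b<..b+m}"
      then show "wt t a (Suc j) (r (Suc j)) = wt t a (Suc j) (Suc (if j = b then 0 else r (Suc j) - 1))"
        using ge[of "Suc j"] by simp
    qed simp
    finally show "a * t ^ Suc (2 * b) * (\<Prod>j\<in>{b<..b+m}. wt t a (Suc j) (Suc (if j = b then 0 else r (Suc j) - 1))) = (\<Prod>j\<in>{b<..b+Suc m}. wt t a j (r j))"
      by simp
  next
    fix r assume r: "r \<in> chain b m"
    have out: "r j = 0" if "\<not> (b < j \<and> j \<le> b + m)" for j using r that by (auto simp: chain_def)
    have lt: "r j < 2 * j" if "b < j" "j \<le> b + m" for j using r that unfolding chain_def by auto
    have red: "red (Suc j) (r (Suc j)) \<le> r j" if "b < j" "j < b + m" for j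
      using r that by (auto simp: chain_def)
    let ?q = "\<lambda>j. if j = Suc b then Suc (2 * b) else if Suc b < j \<and> j \<le> b + Suc m then Suc (r (j - 1)) else 0"
    show "(\<lambda>j. if j = b then 0 else ?q (Suc j) - 1) = r"
    proof
      fix j show "(if j = b then 0 else ?q (Suc j) - 1) = r j" using out[of j] by auto
    qed
    have "?q \<in> chain b (Suc m)"
      unfolding chain_def
    proof (intro CollectI conjI allI impI)
      fix j
      show "if b < j \<and> j \<le> b + Suc m then ?q j < 2 * j else ?q j = 0"
        using lt[of "j - 1"] by (cases j) auto
      assume j: "b < j \<and> j < b + Suc m"
      show "red (Suc j) (?q (Suc j)) \<le> ?q j"
      proof (cases "j = Suc b")
        case True
        then have "r j < 2 * j" using lt[of j] j by simp
        then show ?thesis using True by (auto simp: red_def)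
      next
        case False
        then have "red j (r j) \<le> r (j - 1)" using red[of "j - 1"] j by auto
        moreover have "red (Suc j) (Suc (r j)) = Suc (red j (r j))" using red_pred[of "Suc (r j)" j] j by simp
        ultimately show ?thesis using j False by auto
      qed
    qed
    moreover have "?q (b + Suc m) \<ge> 1" by auto
    ultimately show "?q \<in> {r \<in> chain b (Suc m). r (b + Suc m) \<ge> 1 \<and> r (Suc b) = Suc (2 * b)}"
      by auto
  qed
  also have "\<dots> = (\<Sum>r\<in>chain b m. a * t ^ Suc (2 * b) * (t ^ m * (\<Prod>j\<in>{b<..b+m}. wt t a j (r j))))"
    by (simp add: wt_Suc prod.distrib)
  finally show ?thesis by (simp add: block_sum_def sum_distrib_left power_add mult_ac)
qed

text \<open>A chain either ends in \<open>0\<close>, or has only positive entries with the first one maximal, or has only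
positive entries with the first one not maximal.\<close>

lemma block_sum_rec:
  "block_sum t a b (Suc m) = (1 + a * t ^ (m + Suc (2 * b))) * block_sum t a b m +
     (if b = 0 then 0 else t ^ Suc m * block_sum t a (b - 1) (Suc m))"
proof -
  let ?w = "\<lambda>r. \<Prod>j\<in>{b<..b+Suc m}. wt t a j (r j)"
  define A where "A = {r \<in> chain b (Suc m). r (b + Suc m) = 0}"
  define B where "B = {r \<in> chain b (Suc m). r (b + Suc m) \<ge> 1 \<and> r (Suc b) \<le> 2 * b}"
  define C where "C = {r \<in> chain b (Suc m). r (b + Suc m) \<ge> 1 \<and> r (Suc b) = Suc (2 * b)}"
  have le: "r (Suc b) \<le> Suc (2 * b)" if "r \<in> chain b (Suc m)" for r
  proof -
    have "r (Suc b) < 2 * Suc b" using that unfolding chain_def by (auto dest!: spec[of _ "Suc b"])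
    then show ?thesis by simp
  qed
  have ABC: "chain b (Suc m) = A \<union> (B \<union> C)" using le unfolding A_def B_def C_def by force
  have fin: "finite A" "finite B" "finite C" using finite_chain[of b "Suc m"] by (auto simp: A_def B_def C_def)
  have "block_sum t a b (Suc m) = sum ?w A + sum ?w (B \<union> C)"
    unfolding block_sum_def ABC by (rule sum.union_disjoint) (use fin in \<open>auto simp: A_def B_def C_def\<close>)
  also have "sum ?w (B \<union> C) = sum ?w B + sum ?w C"
    by (rule sum.union_disjoint) (use fin in \<open>auto simp: A_def B_def C_def\<close>)
  also have "sum ?w A = block_sum t a b m" unfolding A_def by (rule block_sum_part0)
  also have "sum ?w C = a * t ^ (m + Suc (2 * b)) * block_sum t a b m" unfolding C_def by (rule block_sum_part2)
  also have "sum ?w B = (if b = 0 then 0 else t ^ Suc m * block_sum t a (b - 1) (Suc m))"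
  proof (cases b)
    case 0
    have "B = {}"
    proof (rule ccontr)
      assume "B \<noteq> {}"
      then obtain r where r: "r \<in> chain b (Suc m)" "r (b + Suc m) \<ge> 1" "r (Suc b) \<le> 2 * b" by (auto simp: B_def)
      from chain_ge1[OF r(1,2), of "Suc b"] r(3) 0 show False by simp
    qed
    with 0 show ?thesis by simp
  next
    case (Suc b')
    then show ?thesis unfolding B_def using block_sum_part1[where b = b' and m = m and t = t and a = a] by simp
  qed
  finally show ?thesis by (simp add: algebra_simps)
qed

text \<open>Both sides satisfy the recursion \<open>block_sum_rec\<close>: on the right it combines the two Pascal rules for
\<open>qbin\<close>.\<close>

lemma block_sum_closed:
  "block_sum t a b m = qbin t b m * (\<Prod>i\<in>{b<..b+m}. 1 + a * t ^ i)"
proof (induction m arbitrary: b)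
  case (Suc m)
  note IHm = Suc.IH
  show ?case
  proof (induction b)
    case 0
    have "{0<..Suc m} = insert (Suc m) {0<..m}" by auto
    then show ?case using block_sum_rec[of t a 0 m] by (simp add: IHm qbin_0)
  next
    case (Suc b)
    define P where "P = (\<Prod>i\<in>{Suc b<..Suc b+m}. 1 + a * t ^ i)"
    have e1: "{Suc b<..Suc b+Suc m} = insert (Suc (Suc (b+m))) {Suc b<..Suc b+m}" by auto
    have e2: "{b<..b+Suc m} = insert (Suc b) {Suc b<..Suc b+m}" by auto
    have p1: "(\<Prod>i\<in>{Suc b<..Suc b+Suc m}. 1 + a * t ^ i) = (1 + a * t ^ Suc (Suc (b+m))) * P"
      unfolding e1 P_def by (subst prod.insert) auto
    have p2: "(\<Prod>i\<in>{b<..b+Suc m}. 1 + a * t ^ i) = (1 + a * t ^ Suc b) * P"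
      unfolding e2 P_def by (subst prod.insert) auto
    define Q where "Q = qbin t (Suc b) m" define R where "R = qbin t b (Suc m)"
    have q1: "qbin t (Suc b) (Suc m) = Q + t ^ Suc m * R" by (simp add: Q_def R_def)
    have q2: "qbin t (Suc b) (Suc m) = t ^ Suc b * Q + R" unfolding Q_def R_def by (rule qbin_pascal2)
    have "block_sum t a (Suc b) (Suc m) = (1 + a * t ^ (m + Suc (2 * Suc b))) * (Q * P) + t ^ Suc m * (R * ((1 + a * t ^ Suc b) * P))"
      using block_sum_rec[of t a "Suc b" m] IHm[of "Suc b"] Suc.IH by (simp only: p2 P_def Q_def R_def) simp
    also have "\<dots> = ((Q + t ^ Suc m * R) + a * t ^ Suc (Suc (b+m)) * (t ^ Suc b * Q + R)) * P"
    proof -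
      have "m + Suc (2 * Suc b) = Suc (Suc (b+m)) + Suc b" "Suc (Suc (b+m)) = Suc m + Suc b" by simp_all
      then have "t ^ (m + Suc (2 * Suc b)) = t ^ Suc (Suc (b+m)) * t ^ Suc b"
        "t ^ Suc m * t ^ Suc b = t ^ Suc (Suc (b+m))"
        using power_add by metis+
      moreover note this
      ultimately show ?thesis by (simp only: distrib_left distrib_right mult_1_left mult_1_right) (simp add: mult_ac)
    qed
    also have "\<dots> = qbin t (Suc b) (Suc m) * ((1 + a * t ^ Suc (Suc (b+m))) * P)"
      using q1 q2 by (simp only:) (simp add: algebra_simps)
    finally show ?case by (simp only: p1)
  qed
qed (simp add: block_sum_0)

text \<open>The descent set read off the code: position \<open>0\<close> by the sign of \<open>g 1\<close>, the other positions by
\<open>descent_iff\<close>.\<close>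

definition code_des :: "nat \<Rightarrow> (nat \<Rightarrow> nat) \<Rightarrow> nat set" where
  "code_des n r = {i. i < n \<and> (if i = 0 then r 1 = 1 else \<not> red (Suc i) (r (Suc i)) \<le> r i)}"

lemma Des_B_code:
  assumes "g \<in> hyperoctahedral n"
  shows "Des_B n g = code_des n (code_fun n g)"
proof -
  have "i \<in> Des_B n g \<longleftrightarrow> i \<in> code_des n (code_fun n g)" for i
    using descent_0_iff[OF assms] descent_iff[OF assms, of i]
    by (cases "i = 0") (auto simp: Des_B_def code_des_def code_fun_def)
  then show ?thesis by blast
qed

lemma weight_code:
  assumes g: "g \<in> hyperoctahedral n"
  shows "a ^ neg_B n g * t ^ coxeter_length n g = (\<Prod>j\<in>{1..n}. wt t a j (code_fun n g j))"
proof -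
  have "neg_B n g = card {j\<in>{1..n}. j \<le> code_fun n g j}"
  proof -
    have "g (int j) < 0 \<longleftrightarrow> j \<le> code_fun n g j" if j: "j \<in> {1..n}" for j
      using code_neg_iff[of "j - 1" g] hyper_g[OF g, of _ "j - 1"] hyperoctahedral_neq0[OF g, of "int j"] j
      by (cases j) (auto simp: code_fun_def)
    then have "{j\<in>{1..n}. g (int j) < 0} = {j\<in>{1..n}. j \<le> code_fun n g j}" by blast
    then show ?thesis by (simp add: neg_B_def)
  qed
  moreover have "coxeter_length n g = (\<Sum>j\<in>{1..n}. code_fun n g j)"
    using coxeter_length_code_sum[OF g] by (simp add: code_sum_def code_fun_def)
  moreover have "(\<Prod>j\<in>{1..n}. wt t a j (code_fun n g j)) = t ^ (\<Sum>j\<in>{1..n}. code_fun n g j) * a ^ card {j\<in>{1..n}. j \<le> code_fun n g j}"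
  proof -
    have "(\<Prod>j\<in>{1..n}. (if j \<le> code_fun n g j then a else 1)) = (\<Prod>j\<in>{1..n} \<inter> {j. j \<le> code_fun n g j}. a)"
      by (simp add: prod.If_cases)
    then show ?thesis by (simp add: wt_def prod.distrib power_sum Int_def)
  qed
  ultimately show ?thesis by (simp add: mult.commute)
qed

text \<open>Descents are prescribed only as an upper bound \<open>I\<close>, because a code with descents in \<open>I\<close> then splits
at the elements of \<open>I\<close> into independent chains.\<close>

definition des_sum :: "real \<Rightarrow> real \<Rightarrow> nat \<Rightarrow> nat set \<Rightarrow> real" where
  "des_sum t a n I = (\<Sum>r | r \<in> codes n \<and> code_des n r \<subseteq> I. \<Prod>j\<in>{1..n}. wt t a j (r j))"

lemma finite_codes: "finite (codes n)"
  by (rule finite_subset[OF _ finite_bounded_funs[of 0 n "\<lambda>j. 2 * j"]]) (auto simp: codes_def Suc_le_eq)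

text \<open>Only the identity, whose code vanishes, has no descents.\<close>

lemma des_sum_empty: "des_sum t a n {} = 1"
proof -
  have "{r. r \<in> codes n \<and> code_des n r \<subseteq> {}} = {\<lambda>_. 0}"
  proof (intro equalityI subsetI)
    fix r assume "r \<in> {r. r \<in> codes n \<and> code_des n r \<subseteq> {}}"
    then have r: "r \<in> codes n" "code_des n r = {}" by auto
    have "r j = 0" for j
    proof (induction j)
      case 0
      then show ?case using r(1) by (auto simp: codes_def)
    next
      case (Suc j)
      show ?case
      proof (cases "Suc j \<le> n")
        case True
        then have "j \<notin> code_des n r" "r (Suc j) < 2 * Suc j"
          using r unfolding codes_def by (auto dest!: spec[of _ "Suc j"])
        then show ?thesis using True Suc by (cases "j = 0") (auto simp: code_des_def red_def split: if_splits)
      qed (use r(1) in \<open>auto simp: codes_def\<close>)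
    qed
    then show "r \<in> {\<lambda>_. 0}" by auto
  qed (auto simp: codes_def code_des_def red_def)
  then show ?thesis by (simp add: des_sum_def wt_def)
qed

text \<open>A permitted descent at \<open>b\<close> removes the only condition linking the entries up to \<open>b\<close> with the later
ones.\<close>

lemma des_sum_peel:
  assumes "b < n" "I \<subseteq> {..<b}"
  shows "des_sum t a n (insert b I) = des_sum t a b I * block_sum t a b (n - b)"
proof -
  have "des_sum t a n (insert b I) = (\<Sum>(r, s)\<in>{r. r \<in> codes b \<and> code_des b r \<subseteq> I} \<times> chain b (n - b).
      (\<Prod>j\<in>{1..b}. wt t a j (r j)) * (\<Prod>j\<in>{b<..b+(n-b)}. wt t a j (s j)))"
    unfolding des_sum_def
  proof (rule sum.reindex_bij_witness[of _ "\<lambda>(r, s) j. if j \<le> b then r j else s j"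
        "\<lambda>r. (\<lambda>j. if j \<le> b then r j else 0, \<lambda>j. if j \<le> b then 0 else r j)"])
    fix r assume "r \<in> {r. r \<in> codes n \<and> code_des n r \<subseteq> insert b I}"
    then have r: "r \<in> codes n" "code_des n r \<subseteq> insert b I" by auto
    show "(case (\<lambda>j. if j \<le> b then r j else 0, \<lambda>j. if j \<le> b then 0 else r j) of (r, s) \<Rightarrow> \<lambda>j. if j \<le> b then r j else s j) = r"
      by auto
    have "(\<lambda>j. if j \<le> b then r j else 0) \<in> codes b" using r(1) assms unfolding codes_def by auto
    moreover have "code_des b (\<lambda>j. if j \<le> b then r j else 0) \<subseteq> I"
    proof
      fix i assume i: "i \<in> code_des b (\<lambda>j. if j \<le> b then r j else 0)"
      then have "i < b" by (auto simp: code_des_def)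
      moreover have "i \<in> code_des n r" using i assms by (auto simp: code_des_def split: if_splits)
      ultimately show "i \<in> I" using r(2) by auto
    qed
    moreover have "(\<lambda>j. if j \<le> b then 0 else r j) \<in> chain b (n - b)"
      unfolding chain_def
    proof (intro CollectI conjI allI impI)
      fix j
      show "if b < j \<and> j \<le> b + (n - b) then (if j \<le> b then 0 else r j) < 2 * j else (if j \<le> b then 0 else r j) = 0"
        using r(1) assms unfolding codes_def by (auto dest!: spec[of _ j] split: if_splits)
      assume j: "b < j \<and> j < b + (n - b)"
      then have "j \<notin> code_des n r" using r(2) assms(2) by auto
      then show "red (Suc j) (if Suc j \<le> b then 0 else r (Suc j)) \<le> (if j \<le> b then 0 else r j)"
        using j by (auto simp: code_des_def)
    qed
    ultimately show "(\<lambda>j. if j \<le> b then r j else 0, \<lambda>j. if j \<le> b then 0 else r j)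
       \<in> {r. r \<in> codes b \<and> code_des b r \<subseteq> I} \<times> chain b (n - b)" by blast
    have "{1..n} = {1..b} \<union> {b<..b+(n-b)}" using assms by auto
    then have "(\<Prod>j\<in>{1..n}. wt t a j (r j)) = (\<Prod>j\<in>{1..b}. wt t a j (r j)) * (\<Prod>j\<in>{b<..b+(n-b)}. wt t a j (r j))"
      by (simp only:) (rule prod.union_disjoint, auto)
    then show "(case (\<lambda>j. if j \<le> b then r j else 0, \<lambda>j. if j \<le> b then 0 else r j) of (r, s) \<Rightarrow>
       (\<Prod>j\<in>{1..b}. wt t a j (r j)) * (\<Prod>j\<in>{b<..b+(n-b)}. wt t a j (s j))) = (\<Prod>j\<in>{1..n}. wt t a j (r j))"
      by (auto intro!: arg_cong2[where f = "(*)"] prod.cong)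
  next
    fix x assume "x \<in> {r. r \<in> codes b \<and> code_des b r \<subseteq> I} \<times> chain b (n - b)"
    then obtain r s where x: "x = (r, s)" and r: "r \<in> codes b" "code_des b r \<subseteq> I" and s: "s \<in> chain b (n - b)"
      by auto
    have r0: "r j = 0" if "j > b" for j using r(1) that by (auto simp: codes_def)
    have s0: "s j = 0" if "j \<le> b" for j using s that by (auto simp: chain_def)
    show "(\<lambda>j. if j \<le> b then (case x of (r, s) \<Rightarrow> \<lambda>j. if j \<le> b then r j else s j) j else 0,
       \<lambda>j. if j \<le> b then 0 else (case x of (r, s) \<Rightarrow> \<lambda>j. if j \<le> b then r j else s j) j) = x"
      using r0 s0 by (auto simp: x fun_eq_iff)
    have "(\<lambda>j. if j \<le> b then r j else s j) \<in> codes n"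
      using r(1) s assms unfolding codes_def chain_def by (auto split: if_splits)
    moreover have "code_des n (\<lambda>j. if j \<le> b then r j else s j) \<subseteq> insert b I"
    proof
      fix i assume i: "i \<in> code_des n (\<lambda>j. if j \<le> b then r j else s j)"
      consider "i < b" | "i = b" | "i > b" by linarith
      then show "i \<in> insert b I"
      proof cases
        case 1
        then have "i \<in> code_des b r" using i by (auto simp: code_des_def split: if_splits)
        then show ?thesis using r(2) by auto
      next
        case 3
        then show ?thesis using i s by (auto simp: code_des_def chain_def split: if_splits)
      qed simp
    qed
    ultimately show "(case x of (r, s) \<Rightarrow> \<lambda>j. if j \<le> b then r j else s j) \<in> {r. r \<in> codes n \<and> code_des n r \<subseteq> insert b I}"
      by (simp add: x)
  qed
  also have "\<dots> = des_sum t a b I * block_sum t a b (n - b)"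
    by (simp add: des_sum_def block_sum_def sum_product sum.cartesian_product)
  finally show ?thesis .
qed

lemma sum_Pow_max:
  fixes f :: "nat set \<Rightarrow> real"
  shows "(\<Sum>I\<in>Pow {..<n}. f I) = f {} + (\<Sum>b<n. \<Sum>I\<in>Pow {..<b}. f (insert b I))"
proof (induction n)
  case (Suc n)
  have "Pow {..<Suc n} = Pow {..<n} \<union> insert n ` Pow {..<n}" by (simp add: lessThan_Suc Pow_insert)
  moreover have "inj_on (insert n) (Pow {..<n})" by (auto simp: inj_on_def)
  ultimately have "(\<Sum>I\<in>Pow {..<Suc n}. f I) = (\<Sum>I\<in>Pow {..<n}. f I) + (\<Sum>I\<in>Pow {..<n}. f (insert n I))"
    by (simp add: sum.union_disjoint sum.reindex disjoint_iff) (subst sum.union_disjoint, auto simp: sum.reindex)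
  then show ?case using Suc by simp
qed simp

text \<open>The generating function over descent sets, after inclusion-exclusion over supersets: this is where
the factors \<open>x i / (1 - x i)\<close> come from.\<close>

definition desc_series :: "real \<Rightarrow> real \<Rightarrow> (nat \<Rightarrow> real) \<Rightarrow> nat \<Rightarrow> real" where
  "desc_series t a x n = (\<Sum>I\<in>Pow {..<n}. des_sum t a n I * (\<Prod>i\<in>I. x i / (1 - x i)))"

text \<open>The sets \<open>I\<close> are grouped by their maximum \<open>b\<close>, at which \<open>des_sum_peel\<close> applies.\<close>

lemma desc_series_rec:
  "desc_series t a x n = 1 + (\<Sum>b<n. x b / (1 - x b) * block_sum t a b (n - b) * desc_series t a x b)"
proof -
  have "desc_series t a x n = 1 + (\<Sum>b<n. \<Sum>I\<in>Pow {..<b}. des_sum t a n (insert b I) * (\<Prod>i\<in>insert b I. x i / (1 - x i)))"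
    unfolding desc_series_def by (subst sum_Pow_max) (simp add: des_sum_empty)
  also have "(\<Sum>b<n. \<Sum>I\<in>Pow {..<b}. des_sum t a n (insert b I) * (\<Prod>i\<in>insert b I. x i / (1 - x i)))
     = (\<Sum>b<n. x b / (1 - x b) * block_sum t a b (n - b) * desc_series t a x b)"
  proof (rule sum.cong)
    fix b assume b: "b \<in> {..<n}"
    have "(\<Sum>I\<in>Pow {..<b}. des_sum t a n (insert b I) * (\<Prod>i\<in>insert b I. x i / (1 - x i)))
       = (\<Sum>I\<in>Pow {..<b}. x b / (1 - x b) * block_sum t a b (n - b) * (des_sum t a b I * (\<Prod>i\<in>I. x i / (1 - x i))))"
    proof (rule sum.cong)
      fix I assume I: "I \<in> Pow {..<b}"
      then have "finite I" "b \<notin> I" using finite_subset by auto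
      then show "des_sum t a n (insert b I) * (\<Prod>i\<in>insert b I. x i / (1 - x i))
        = x b / (1 - x b) * block_sum t a b (n - b) * (des_sum t a b I * (\<Prod>i\<in>I. x i / (1 - x i)))"
        using des_sum_peel[of b n I t a] b I by simp
    qed simp
    then show "(\<Sum>I\<in>Pow {..<b}. des_sum t a n (insert b I) * (\<Prod>i\<in>insert b I. x i / (1 - x i)))
       = x b / (1 - x b) * block_sum t a b (n - b) * desc_series t a x b"
      by (simp add: desc_series_def sum_distrib_left)
  qed simp
  finally show ?thesis .
qed

text \<open>With \<open>z i = x i / (1 - x i)\<close> this says that the sum over all \<open>I\<close> containing the descent set,
multiplied by the product of all \<open>1 - x i\<close>, leaves exactly \<open>x i\<close> for each descent \<open>i\<close>.\<close>

lemma sum_supersets: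
  fixes z :: "nat \<Rightarrow> real"
  assumes "finite A" "D \<subseteq> A"
  shows "(\<Sum>I | D \<subseteq> I \<and> I \<subseteq> A. \<Prod>i\<in>I. z i) = (\<Prod>i\<in>D. z i) * (\<Prod>i\<in>A - D. 1 + z i)"
proof -
  have fin: "finite D" "finite (A - D)" using assms finite_subset by auto
  have "(\<Prod>i\<in>A - D. z i + 1) = (\<Sum>J\<in>Pow (A - D). (\<Prod>i\<in>J. z i) * (\<Prod>i\<in>A - D - J. 1))"
    by (rule prod_add) (rule fin)
  then have "(\<Prod>i\<in>D. z i) * (\<Prod>i\<in>A - D. 1 + z i) = (\<Sum>J\<in>Pow (A - D). (\<Prod>i\<in>D. z i) * (\<Prod>i\<in>J. z i))"
    by (simp add: add.commute sum_distrib_left)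
  also have "\<dots> = (\<Sum>I | D \<subseteq> I \<and> I \<subseteq> A. \<Prod>i\<in>I. z i)"
  proof (rule sum.reindex_bij_witness[of _ "\<lambda>I. I - D" "\<lambda>J. D \<union> J"])
    fix J assume J: "J \<in> Pow (A - D)"
    then show "(\<Prod>i\<in>D \<union> J. z i) = (\<Prod>i\<in>D. z i) * (\<Prod>i\<in>J. z i)"
      using fin finite_subset by (intro prod.union_disjoint) auto
  qed (use assms in auto)
  finally show ?thesis by simp
qed

lemma hyperoctahedral_sum:
  assumes "\<And>i. i < n \<Longrightarrow> x i \<noteq> 1"
  shows "(\<Sum>g\<in>hyperoctahedral n. a ^ neg_B n g * t ^ coxeter_length n g * (\<Prod>i\<in>Des_B n g. x i))
    = desc_series t a x n * (\<Prod>i<n. 1 - x i)"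
proof -
  define w where "w = (\<lambda>r. \<Prod>j\<in>{1..n}. wt t a j (r j))"
  define z where "z = (\<lambda>i. x i / (1 - x i))"
  have des: "code_des n r \<subseteq> {..<n}" for r by (auto simp: code_des_def)
  have "(\<Sum>g\<in>hyperoctahedral n. a ^ neg_B n g * t ^ coxeter_length n g * (\<Prod>i\<in>Des_B n g. x i))
     = (\<Sum>g\<in>hyperoctahedral n. (\<lambda>r. w r * (\<Prod>i\<in>code_des n r. x i)) (code_fun n g))"
    by (rule sum.cong) (simp_all add: weight_code Des_B_code w_def)
  also have "\<dots> = (\<Sum>r\<in>codes n. w r * (\<Prod>i\<in>code_des n r. x i))"
    by (rule sum.reindex_bij_betw[OF code_bij])
  also have "\<dots> = (\<Sum>r\<in>codes n. w r * (\<Sum>I | code_des n r \<subseteq> I \<and> I \<subseteq> {..<n}. \<Prod>i\<in>I. z i)) * (\<Prod>i<n. 1 - x i)"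
    unfolding sum_distrib_right
  proof (rule sum.cong)
    fix r
    let ?D = "code_des n r"
    have "(\<Prod>i<n. 1 - x i) = (\<Prod>i\<in>?D. 1 - x i) * (\<Prod>i\<in>{..<n} - ?D. 1 - x i)"
      using des[of r] by (subst prod.subset_diff[of ?D]) (auto simp: mult.commute)
    then have "(\<Sum>I | ?D \<subseteq> I \<and> I \<subseteq> {..<n}. \<Prod>i\<in>I. z i) * (\<Prod>i<n. 1 - x i)
       = ((\<Prod>i\<in>?D. z i) * (\<Prod>i\<in>?D. 1 - x i)) * ((\<Prod>i\<in>{..<n} - ?D. 1 + z i) * (\<Prod>i\<in>{..<n} - ?D. 1 - x i))"
      using sum_supersets[of "{..<n}" ?D z] des[of r] by (simp add: mult_ac)
    also have "(\<Prod>i\<in>?D. z i) * (\<Prod>i\<in>?D. 1 - x i) = (\<Prod>i\<in>?D. x i)"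
      unfolding prod.distrib[symmetric] z_def
      by (rule prod.cong) (use assms des[of r] in \<open>auto simp: field_simps\<close>)
    also have "(\<Prod>i\<in>{..<n} - ?D. 1 + z i) * (\<Prod>i\<in>{..<n} - ?D. 1 - x i) = (\<Prod>i\<in>{..<n} - ?D. 1)"
      unfolding prod.distrib[symmetric] z_def
      by (rule prod.cong) (use assms in \<open>auto simp: field_simps\<close>)
    finally show "w r * (\<Prod>i\<in>?D. x i) = w r * (\<Sum>I | ?D \<subseteq> I \<and> I \<subseteq> {..<n}. \<Prod>i\<in>I. z i) * (\<Prod>i<n. 1 - x i)"
      by (simp add: mult.assoc)
  qed simp
  also have "(\<Sum>r\<in>codes n. w r * (\<Sum>I | code_des n r \<subseteq> I \<and> I \<subseteq> {..<n}. \<Prod>i\<in>I. z i))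
     = (\<Sum>r\<in>codes n. \<Sum>I\<in>Pow {..<n}. if code_des n r \<subseteq> I then w r * (\<Prod>i\<in>I. z i) else 0)"
  proof (rule sum.cong)
    fix r
    have "{I. code_des n r \<subseteq> I \<and> I \<subseteq> {..<n}} = {I\<in>Pow {..<n}. code_des n r \<subseteq> I}" by auto
    moreover have "(\<Sum>I\<in>{I\<in>Pow {..<n}. code_des n r \<subseteq> I}. w r * (\<Prod>i\<in>I. z i))
       = (\<Sum>I\<in>Pow {..<n}. if code_des n r \<subseteq> I then w r * (\<Prod>i\<in>I. z i) else 0)"
      by (rule sum.inter_filter) simp
    ultimately show "w r * (\<Sum>I | code_des n r \<subseteq> I \<and> I \<subseteq> {..<n}. \<Prod>i\<in>I. z i)
       = (\<Sum>I\<in>Pow {..<n}. if code_des n r \<subseteq> I then w r * (\<Prod>i\<in>I. z i) else 0)"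
      by (simp only: sum_distrib_left)
  qed simp
  also have "\<dots> = (\<Sum>I\<in>Pow {..<n}. \<Sum>r\<in>codes n. if code_des n r \<subseteq> I then w r * (\<Prod>i\<in>I. z i) else 0)"
    by (rule sum.swap)
  also have "\<dots> = desc_series t a x n"
    unfolding desc_series_def des_sum_def w_def[symmetric] z_def[symmetric] sum_distrib_right
    by (rule sum.cong) (simp_all add: sum.inter_filter[OF finite_codes])
  finally show ?thesis .
qed

section \<open>Dirichlet sums over Hermite normal forms\<close>

text \<open>The average over independent uniform columns with indices in the list, the other columns of \<open>M\<close>
being kept.\<close>

fun avgL :: "nat set \<Rightarrow> nat \<Rightarrow> nat list \<Rightarrow> ((nat \<Rightarrow> nat \<Rightarrow> int) \<Rightarrow> real) \<Rightarrow> (nat \<Rightarrow> nat \<Rightarrow> int) \<Rightarrow> real" where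
  "avgL I q [] Q M = Q M"
| "avgL I q (j # js) Q M = avg I q (\<lambda>v. avgL I q js Q (M(j := v)))"

lemma avgL_append: "avgL I q (is @ js) Q M = avgL I q is (avgL I q js Q) M"
  by (induction "is" arbitrary: M) simp_all

lemma avgL_rotate:
  "j \<notin> set is \<Longrightarrow> avgL I q (is @ [j]) Q M = avg I q (\<lambda>v. avgL I q is Q (M(j := v)))"
proof (induction "is" arbitrary: M)
  case (Cons i "is")
  have "avgL I q ((i # is) @ [j]) Q M = avg I q (\<lambda>w. avg I q (\<lambda>v. avgL I q is Q ((M(i := w))(j := v))))"
    using Cons by (simp del: fun_upd_apply)
  also have "\<dots> = avg I q (\<lambda>v. avg I q (\<lambda>w. avgL I q is Q ((M(i := w))(j := v))))" by (rule avg_swap)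
  also have "\<dots> = avg I q (\<lambda>v. avgL I q (i # is) Q (M(j := v)))"
    using Cons.prems by (simp add: fun_upd_twist)
  finally show ?case .
qed simp

lemma avg_Un:
  assumes "finite I" "finite J" "I \<inter> J = {}"
  shows "avg (I \<union> J) q F = avg I q (\<lambda>u. avg J q (\<lambda>z. F (\<lambda>i. u i + z i)))"
  using assms(1,3)
proof (induction I arbitrary: F rule: finite_induct)
  case empty
  then show ?case by (simp add: avg_empty)
next
  case (insert x I)
  have "avg (insert x I \<union> J) q F = (\<Sum>a<q. avg (I \<union> J) q (\<lambda>v. F (v(x := int a)))) / real q"
    using insert assms by (simp add: avg_insert)
  also have "\<dots> = (\<Sum>a<q. avg I q (\<lambda>u. avg J q (\<lambda>z. F ((\<lambda>i. u i + z i)(x := int a))))) / real q"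
    using insert by simp
  also have "(\<Sum>a<q. avg I q (\<lambda>u. avg J q (\<lambda>z. F ((\<lambda>i. u i + z i)(x := int a)))))
     = (\<Sum>a<q. avg I q (\<lambda>u. avg J q (\<lambda>z. F (\<lambda>i. (u(x := int a)) i + z i))))"
  proof (intro sum.cong refl avg_cong)
    fix a u z assume "z \<in> cube J q"
    then have "z x = 0" using insert by (auto simp: cube_def)
    then have "(\<lambda>i. u i + z i)(x := int a) = (\<lambda>i. (u(x := int a)) i + z i)" by auto
    then show "F ((\<lambda>i. u i + z i)(x := int a)) = F (\<lambda>i. (u(x := int a)) i + z i)" by (simp only:)
  qed
  finally show ?case using insert by (simp add: avg_insert)
qed

lemma avg_sum: "avg I q (\<lambda>v. \<Sum>x\<in>A. F x v) = (\<Sum>x\<in>A. avg I q (F x))"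
  by (simp add: avg_def sum.swap[of _ A] sum_divide_distrib)

text \<open>Moebius inversion on the divisors of \<open>k\<close>, by induction from \<open>k\<close> downwards.\<close>

lemma divisor_weights_eq:
  fixes w1 w2 :: "nat \<Rightarrow> real"
  assumes "k > 0" "\<And>g. g dvd k \<Longrightarrow> (\<Sum>g' | g' dvd k \<and> g dvd g'. w1 g') = (\<Sum>g' | g' dvd k \<and> g dvd g'. w2 g')"
  shows "g dvd k \<Longrightarrow> w1 g = w2 g"
proof (induction "k - g" arbitrary: g rule: less_induct)
  case less
  define D where "D = {g'. g' dvd k \<and> g dvd g'} - {g}"
  have fin: "finite {g'. g' dvd k \<and> g dvd g'}"
    by (rule finite_subset[of _ "{..k}"]) (use \<open>k > 0\<close> dvd_imp_le in auto)
  have "w1 g + sum w1 D = w2 g + sum w2 D"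
    using assms(2)[OF less.prems] less.prems
      sum.remove[OF fin, of g w1] sum.remove[OF fin, of g w2] unfolding D_def by simp
  moreover have "sum w1 D = sum w2 D"
  proof (rule sum.cong)
    fix g' assume g': "g' \<in> D"
    then have "g' \<le> k" "g \<le> g'" "g \<noteq> g'" using \<open>k > 0\<close> dvd_imp_le dvd_pos_nat unfolding D_def by auto
    then show "w1 g' = w2 g'" using less.hyps[of g'] g' by (auto simp: D_def)
  qed simp
  ultimately show ?case by simp
qed

lemma has_sum_bijI:
  assumes "(h has_sum s) T" "\<And>a. a \<in> S \<Longrightarrow> i (j a) = a" "\<And>a. a \<in> S \<Longrightarrow> j a \<in> T"
    "\<And>b. b \<in> T \<Longrightarrow> j (i b) = b" "\<And>b. b \<in> T \<Longrightarrow> i b \<in> S" "\<And>a. a \<in> S \<Longrightarrow> h (j a) = g a"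
  shows "(g has_sum s) S"
  using assms has_sum_reindex_bij_witness[of S i j T h g s s] by simp

lemma has_sum_finite_sum:
  fixes f :: "'a \<Rightarrow> 'b \<Rightarrow> real"
  assumes "finite A" "\<And>x. x \<in> A \<Longrightarrow> (f x has_sum S x) B"
  shows "((\<lambda>y. \<Sum>x\<in>A. f x y) has_sum (\<Sum>x\<in>A. S x)) B"
  using assms by (induction A rule: finite_induct) (auto intro!: has_sum_add)

text \<open>The real power in \<open>riemann_zeta\<close> is an ordinary power at a natural number.\<close>

lemma zeta_has_sum:
  assumes "s \<ge> 2"
  shows "((\<lambda>d. 1 / real d ^ s) has_sum riemann_zeta (real s)) {1..}"
proof -
  have "summable (\<lambda>k. 1 / real (Suc k) ^ s)"
  proof -
    have "summable (\<lambda>k. real (Suc k) powr (- real s))"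
      using summable_real_powr_iff[of "- real s"] assms by (subst summable_Suc_iff) auto
    then show ?thesis by (simp add: powr_minus powr_realpow divide_inverse)
  qed
  then have "(\<lambda>k. 1 / real (Suc k) ^ s) sums riemann_zeta (real s)"
    unfolding riemann_zeta_def by (simp add: powr_minus powr_realpow divide_inverse summable_sums)
  then have "((\<lambda>k. 1 / real (Suc k) ^ s) has_sum riemann_zeta (real s)) UNIV"
    by (intro sums_nonneg_imp_has_sum) auto
  then show ?thesis
    by (rule has_sum_bijI[where i = Suc and j = "\<lambda>d. d - 1"]) auto
qed

lemma zeta_pos: "s \<ge> 2 \<Longrightarrow> riemann_zeta (real s) > 0"
proof -
  assume s: "s \<ge> 2"
  have "(\<Sum>d\<in>{1}. 1 / real d ^ s) \<le> riemann_zeta (real s)"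
    by (rule finite_sum_le_has_sum[OF zeta_has_sum[OF s]]) auto
  then show ?thesis by simp
qed

text \<open>Both sides are sums of \<open>H g\<close> over the divisors \<open>g\<close> of \<open>k\<close>, with weights that agree by
\<open>divisor_weights_eq\<close>: divisibility by \<open>g\<close> has weight \<open>zeta / g ^ card J\<close> for a random vector as for
the sum over multiples of \<open>g\<close>.\<close>

lemma gcd_distribution:
  fixes H :: "nat \<Rightarrow> real"
  assumes J: "finite J" "card J \<ge> 2" and k: "k > 0" and H: "\<And>g. H g \<ge> 0"
  shows "((\<lambda>d. H (gcd k d) / real d ^ card J) has_sum
    (riemann_zeta (real (card J)) * avg J k (\<lambda>z. H (nat (gcd (int k) (Gcd (z ` J))))))) {1..}"
proof -
  define s where "s = card J"
  define Z where "Z = riemann_zeta (real s)"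
  have Z: "((\<lambda>d. 1 / real d ^ s) has_sum Z) {1..}" unfolding Z_def by (rule zeta_has_sum) (use J s_def in simp)
  define \<gamma> where "\<gamma> = (\<lambda>z :: nat \<Rightarrow> int. nat (gcd (int k) (Gcd (z ` J))))"
  have \<gamma>k: "\<gamma> z dvd k" for z unfolding \<gamma>_def by (metis gcd_dvd1 gcd_ge_0_int int_dvd_int_iff nat_0_le)
  have \<gamma>g: "g dvd \<gamma> z \<longleftrightarrow> g dvd k \<and> (\<forall>i\<in>J. int g dvd z i)" for g z
  proof -
    have "g dvd \<gamma> z \<longleftrightarrow> int g dvd gcd (int k) (Gcd (z ` J))"
      unfolding \<gamma>_def by (metis gcd_ge_0_int int_dvd_int_iff nat_0_le)
    then show ?thesis by (auto simp: dvd_Gcd_iff)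
  qed
  define D where "D = {g. g dvd k}"
  have finD: "finite D" unfolding D_def using k by (intro finite_divisors_nat) auto
  define w1 where "w1 = (\<lambda>g. Z * avg J k (\<lambda>z. of_bool (\<gamma> z = g)))"
  define w2 where "w2 = (\<lambda>g. infsum (\<lambda>d. of_bool (gcd k d = g) / real d ^ s) {1..})"
  have sm: "(\<lambda>d. of_bool (P d) / real d ^ s) summable_on {1..}" for P
    by (rule summable_on_comparison_test[OF has_sum_imp_summable[OF Z]]) auto
  have w2: "((\<lambda>d. of_bool (gcd k d = g) / real d ^ s) has_sum w2 g) {1..}" for g
    unfolding w2_def using sm by (intro has_sum_infsum)
  have tail1: "(\<Sum>g'\<in>{g'. g' dvd k \<and> g dvd g'}. w1 g') = Z / real g ^ s" if g: "g dvd k" for g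
  proof -
    have g0: "g > 0" using g k by (auto intro: Nat.gr0I)
    obtain m where m: "k = g * m" using g by blast
    have fin: "finite {g'. g' dvd k \<and> g dvd g'}" by (rule finite_subset[OF _ finD]) (auto simp: D_def)
    have "(\<Sum>g'\<in>{g'. g' dvd k \<and> g dvd g'}. w1 g') = Z * avg J k (\<lambda>z. \<Sum>g'\<in>{g'. g' dvd k \<and> g dvd g'}. of_bool (\<gamma> z = g'))"
      unfolding w1_def avg_sum sum_distrib_left ..
    also have "avg J k (\<lambda>z. \<Sum>g'\<in>{g'. g' dvd k \<and> g dvd g'}. of_bool (\<gamma> z = g')) = avg J k (\<lambda>z. of_bool (\<forall>i\<in>J. int g dvd z i))"
    proof (rule avg_cong)
      fix z
      have "(\<Sum>g'\<in>{g'. g' dvd k \<and> g dvd g'}. of_bool (\<gamma> z = g')) = (of_bool (\<gamma> z \<in> {g'. g' dvd k \<and> g dvd g'}) :: real)"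
        using fin by (simp add: of_bool_def sum.delta)
      also have "\<dots> = of_bool (\<forall>i\<in>J. int g dvd z i)" using \<gamma>k[of z] \<gamma>g[of g z] g by (auto simp: of_bool_def)
      finally show "(\<Sum>g'\<in>{g'. g' dvd k \<and> g dvd g'}. of_bool (\<gamma> z = g')) = (of_bool (\<forall>i\<in>J. int g dvd z i) :: real)" .
    qed
    also have "\<dots> = 1 / real g ^ s"
    proof -
      have "(\<Sum>z\<in>cube J k. of_bool (\<forall>i\<in>J. int g dvd z i)) = (\<Sum>z | z \<in> cube J (g * m) \<and> (\<forall>i\<in>J. int g dvd z i). 1::real)"
        using finite_cube[OF J(1)] by (simp add: of_bool_def sum.inter_filter[symmetric] m)
      also have "\<dots> = (\<Sum>w\<in>cube J m. 1)" by (rule sum_cube_multiples[OF g0])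
      also have "\<dots> = real m ^ s" using card_cube[OF J(1)] by (simp add: s_def)
      finally show ?thesis using k m by (simp add: avg_def s_def[symmetric] power_mult_distrib)
    qed
    finally show ?thesis by simp
  qed
  have tail2: "(\<Sum>g'\<in>{g'. g' dvd k \<and> g dvd g'}. w2 g') = Z / real g ^ s" if g: "g dvd k" for g
  proof -
    have g0: "g > 0" using g k by (auto intro: Nat.gr0I)
    have fin: "finite {g'. g' dvd k \<and> g dvd g'}" by (rule finite_subset[OF _ finD]) (auto simp: D_def)
    have "((\<lambda>d. \<Sum>g'\<in>{g'. g' dvd k \<and> g dvd g'}. of_bool (gcd k d = g') / real d ^ s) has_sum (\<Sum>g'\<in>{g'. g' dvd k \<and> g dvd g'}. w2 g')) {1..}"
      by (rule has_sum_finite_sum[OF fin w2])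
    moreover have "(\<Sum>g'\<in>{g'. g' dvd k \<and> g dvd g'}. of_bool (gcd k d = g') / real d ^ s) = of_bool (g dvd d) / real d ^ s" for d
    proof -
      have "(\<Sum>g'\<in>{g'. g' dvd k \<and> g dvd g'}. of_bool (gcd k d = g') / real d ^ s) = (\<Sum>g'\<in>{g'. g' dvd k \<and> g dvd g'}. of_bool (gcd k d = g')) / real d ^ s"
        by (simp add: sum_divide_distrib)
      also have "(\<Sum>g'\<in>{g'. g' dvd k \<and> g dvd g'}. of_bool (gcd k d = g')) = (of_bool (gcd k d \<in> {g'. g' dvd k \<and> g dvd g'}) :: real)"
        using fin by (simp add: of_bool_def sum.delta)
      also have "gcd k d \<in> {g'. g' dvd k \<and> g dvd g'} \<longleftrightarrow> g dvd d" using g by auto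
      finally show ?thesis .
    qed
    ultimately have 1: "((\<lambda>d. of_bool (g dvd d) / real d ^ s) has_sum (\<Sum>g'\<in>{g'. g' dvd k \<and> g dvd g'}. w2 g')) {1..}" by simp
    have "((\<lambda>d. 1 / real g ^ s * (1 / real d ^ s)) has_sum (1 / real g ^ s * Z)) {1..}"
      by (rule has_sum_cmult_right[OF Z])
    then have "((\<lambda>d. 1 / real d ^ s) has_sum (1 / real g ^ s * Z)) {d. d \<ge> 1 \<and> g dvd d}"
      by (rule has_sum_bijI[where i = "\<lambda>d. g * d" and j = "\<lambda>d. d div g"])
         (use g0 in \<open>auto simp: power_mult_distrib\<close>)
    then have "((\<lambda>d. of_bool (g dvd d) / real d ^ s) has_sum (1 / real g ^ s * Z)) {1..}"
      by (rule has_sum_cong_neutral[THEN iffD1, rotated -1]) auto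
    with 1 show ?thesis using has_sum_unique by fastforce
  qed
  have weq: "w1 g = w2 g" if "g dvd k" for g
    by (rule divisor_weights_eq[OF k]) (use tail1 tail2 that in auto)
  have "((\<lambda>d. \<Sum>g\<in>D. H g * (of_bool (gcd k d = g) / real d ^ s)) has_sum (\<Sum>g\<in>D. H g * w2 g)) {1..}"
    by (rule has_sum_finite_sum[OF finD has_sum_cmult_right[OF w2]])
  moreover have "(\<Sum>g\<in>D. H g * (of_bool (gcd k d = g) / real d ^ s)) = H (gcd k d) / real d ^ s" for d
  proof -
    have "(\<Sum>g\<in>D. H g * (of_bool (gcd k d = g) / real d ^ s)) = (\<Sum>g\<in>D. if g = gcd k d then H g / real d ^ s else 0)"
      by (rule sum.cong) auto
    then show ?thesis using finD by (simp add: sum.delta D_def)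
  qed
  moreover have "(\<Sum>g\<in>D. H g * w2 g) = Z * avg J k (\<lambda>z. H (\<gamma> z))"
  proof -
    have "(\<Sum>g\<in>D. H g * w2 g) = (\<Sum>g\<in>D. H g * w1 g)" by (rule sum.cong) (auto simp: D_def weq)
    also have "\<dots> = Z * avg J k (\<lambda>z. \<Sum>g\<in>D. H g * of_bool (\<gamma> z = g))"
      unfolding w1_def avg_sum avg_cmult sum_distrib_left by (simp add: mult_ac)
    also have "(\<lambda>z. \<Sum>g\<in>D. H g * of_bool (\<gamma> z = g)) = (\<lambda>z. H (\<gamma> z))"
    proof
      fix z
      have "(\<Sum>g\<in>D. H g * of_bool (\<gamma> z = g)) = (\<Sum>g\<in>D. if g = \<gamma> z then H g else 0)"
        by (rule sum.cong) auto
      then show "(\<Sum>g\<in>D. H g * of_bool (\<gamma> z = g)) = H (\<gamma> z)" using finD \<gamma>k by (simp add: sum.delta D_def)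
    qed
    finally show ?thesis .
  qed
  ultimately show ?thesis by (simp add: s_def Z_def \<gamma>_def)
qed

text \<open>A possible column \<open>j\<close> of a Hermite normal form: zero below a positive diagonal entry, and reduced
modulo it above.\<close>

definition hcol :: "nat \<Rightarrow> (nat \<Rightarrow> int) set" where
  "hcol j = {v. v j > 0 \<and> (\<forall>i<j. 0 \<le> v i \<and> v i < v j) \<and> (\<forall>i>j. v i = 0)}"

text \<open>Matrices are stored by columns, \<open>M j i\<close> being the entry in row \<open>i\<close> and column \<open>j\<close>, because all the
averages are taken one column after the other.\<close>

definition hnf :: "nat \<Rightarrow> (nat \<Rightarrow> nat \<Rightarrow> int) set" where
  "hnf r = PiE {..<r} hcol"

lemma hcol_eq: "hcol j = (\<lambda>(d, u). u(j := int d)) ` (SIGMA d:{1..}. cube {..<j} d)"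
proof (intro equalityI subsetI)
  fix v assume v: "v \<in> hcol j"
  have "v = (\<lambda>(d, u). u(j := int d)) (nat (v j), v(j := 0))" using v by (auto simp: hcol_def)
  moreover have "(nat (v j), v(j := 0)) \<in> (SIGMA d:{1..}. cube {..<j} d)"
    using v by (auto simp: hcol_def cube_def)
  ultimately show "v \<in> (\<lambda>(d, u). u(j := int d)) ` (SIGMA d:{1..}. cube {..<j} d)" by blast
next
  fix v assume "v \<in> (\<lambda>(d, u). u(j := int d)) ` (SIGMA d:{1..}. cube {..<j} d)"
  then obtain d u where "v = u(j := int d)" "d \<ge> 1" and u: "u \<in> cube {..<j} d" by auto
  moreover have "u i = 0" if "i > j" for i using u that unfolding cube_def by (auto dest!: spec[of _ i])
  moreover have "0 \<le> u i \<and> u i < int d" if "i < j" for i using u that unfolding cube_def by auto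
  ultimately show "v \<in> hcol j" by (auto simp: hcol_def)
qed

lemma hcol_inj: "inj_on (\<lambda>(d, u). u(j := int d)) (SIGMA d:{1..}. cube {..<j} d)"
proof (rule inj_onI, clarify)
  fix d u d' u'
  assume u: "u \<in> cube {..<j} d" "u' \<in> cube {..<j} d'" and eq: "u(j := int d) = u'(j := int d')"
  have "d = d'" using fun_cong[OF eq, of j] by simp
  moreover have "u i = u' i" for i
    using fun_cong[OF eq, of i] u by (cases "i = j") (auto simp: cube_def)
  ultimately show "d = d' \<and> u = u'" by auto
qed

lemma has_sum_hcol:
  assumes F: "\<And>v. v \<in> hcol j \<Longrightarrow> F v \<ge> (0::real)"
    and s: "((\<lambda>d. \<Sum>u\<in>cube {..<j} d. F (u(j := int d))) has_sum S) {1..}"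
  shows "(F has_sum S) (hcol j)"
proof -
  have f: "((\<lambda>u. F (u(j := int d))) has_sum (\<Sum>u\<in>cube {..<j} d. F (u(j := int d)))) (cube {..<j} d)" for d
    by (rule has_sum_finite) (simp add: finite_cube)
  have "(\<lambda>(d, u). F (u(j := int d))) summable_on (SIGMA d:{1..}. cube {..<j} d)"
  proof (rule summable_on_SigmaI)
    show "((\<lambda>u. case (d, u) of (d, u) \<Rightarrow> F (u(j := int d))) has_sum (\<Sum>u\<in>cube {..<j} d. F (u(j := int d)))) (cube {..<j} d)" for d
      using f[of d] by simp
    show "(\<lambda>d. \<Sum>u\<in>cube {..<j} d. F (u(j := int d))) summable_on {1..}" by (rule has_sum_imp_summable[OF s])
    fix d u assume "d \<in> {1::nat..}" "u \<in> cube {..<j} d"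
    then have "u(j := int d) \<in> hcol j" unfolding hcol_eq by (intro image_eqI[of _ _ "(d, u)"]) auto
    then show "(case (d, u) of (d, u) \<Rightarrow> F (u(j := int d))) \<ge> 0" using F by simp
  qed
  then have "((\<lambda>(d, u). F (u(j := int d))) has_sum S) (SIGMA d:{1..}. cube {..<j} d)"
    by (rule has_sum_SigmaI[OF _ s, rotated]) (use f in simp)
  then show ?thesis
    unfolding hcol_eq by (subst has_sum_reindex[OF hcol_inj]) (simp add: o_def case_prod_unfold)
qed

lemma hnf_Suc_bij: "bij_betw (\<lambda>(T, v). T(r := v)) (hnf r \<times> hcol r) (hnf (Suc r))"
proof (rule bij_betwI[where g = "\<lambda>M. (M(r := undefined), M r)"])
  show "(\<lambda>(T, v). T(r := v)) \<in> hnf r \<times> hcol r \<rightarrow> hnf (Suc r)"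
  proof
    fix x assume "x \<in> hnf r \<times> hcol r"
    then obtain T v where x: "x = (T, v)" "T \<in> PiE {..<r} hcol" "v \<in> hcol r" unfolding hnf_def by blast
    then show "(\<lambda>(T, v). T(r := v)) x \<in> hnf (Suc r)"
      unfolding hnf_def lessThan_Suc using PiE_fun_upd[OF x(3,2)] by (simp del: fun_upd_apply)
  qed
  show "(\<lambda>M. (M(r := undefined), M r)) \<in> hnf (Suc r) \<rightarrow> hnf r \<times> hcol r"
  proof
    fix M assume "M \<in> hnf (Suc r)"
    then have M: "M \<in> PiE (insert r {..<r}) hcol" unfolding hnf_def lessThan_Suc .
    have "M(r := undefined) \<in> PiE {..<r} hcol" by (rule fun_upd_in_PiE[OF _ M]) simp
    moreover have "M r \<in> hcol r" using M by (rule PiE_mem) simp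
    ultimately show "(M(r := undefined), M r) \<in> hnf r \<times> hcol r" by (simp add: hnf_def)
  qed
  show "(\<lambda>M. (M(r := undefined), M r)) ((\<lambda>(T, v). T(r := v)) x) = x" if xin: "x \<in> hnf r \<times> hcol r" for x
  proof -
    obtain T v where x: "x = (T, v)" "T \<in> PiE {..<r} hcol" using xin unfolding hnf_def by (cases x) auto
    have "T r = undefined" using PiE_arb[OF x(2)] by simp
    then have "T(r := undefined) = T" by (metis fun_upd_triv)
    then show ?thesis using x by simp
  qed
qed auto

lemma has_sum_hnf_Suc:
  assumes F: "\<And>M. M \<in> hnf (Suc r) \<Longrightarrow> F M \<ge> (0::real)"
    and G: "\<And>T. T \<in> hnf r \<Longrightarrow> ((\<lambda>v. F (T(r := v))) has_sum G T) (hcol r)"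
    and S: "(G has_sum S) (hnf r)"
  shows "(F has_sum S) (hnf (Suc r))"
proof -
  have "(\<lambda>(T, v). F (T(r := v))) summable_on (SIGMA T:hnf r. hcol r)"
  proof (rule summable_on_SigmaI)
    show "((\<lambda>v. case (T, v) of (T, v) \<Rightarrow> F (T(r := v))) has_sum G T) (hcol r)" if "T \<in> hnf r" for T
      using G[OF that] by simp
    show "G summable_on hnf r" by (rule has_sum_imp_summable[OF S])
    fix T v assume "T \<in> hnf r" "v \<in> hcol r"
    then have "T(r := v) \<in> hnf (Suc r)" using hnf_Suc_bij[of r] unfolding bij_betw_def by force
    then show "(case (T, v) of (T, v) \<Rightarrow> F (T(r := v))) \<ge> 0" using F by simp
  qed
  then have "((\<lambda>(T, v). F (T(r := v))) has_sum S) (hnf r \<times> hcol r)"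
    by (rule has_sum_SigmaI[OF _ S, rotated]) (use G in simp)
  then show ?thesis
    using has_sum_reindex_bij_betw[OF hnf_Suc_bij[of r], where f = F and S = S] by (simp add: case_prod_unfold)
qed

text \<open>Functions of the first \<open>R\<close> columns modulo \<open>k\<close> that are invariant under simultaneous row operations.
This is all that is used of isotropy when a column is replaced by a uniform one.\<close>

definition colinv :: "nat set \<Rightarrow> nat \<Rightarrow> nat \<Rightarrow> ((nat \<Rightarrow> nat \<Rightarrow> int) \<Rightarrow> real) \<Rightarrow> bool" where
  "colinv I k R Q \<longleftrightarrow>
     (\<forall>M M'. (\<forall>j<R. \<forall>i. [M j i = M' j i] (mod int k)) \<longrightarrow> Q M = Q M') \<and>
     (\<forall>M i i' c. i \<in> I \<longrightarrow> i' \<in> I \<longrightarrow> i \<noteq> i' \<longrightarrow> Q (\<lambda>j. rowop i i' c (M j)) = Q M)"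

lemma colinvD1: "colinv I k R Q \<Longrightarrow> (\<And>j i. j < R \<Longrightarrow> [M j i = M' j i] (mod int k)) \<Longrightarrow> Q M = Q M'"
  unfolding colinv_def by blast

lemma colinvD2: "colinv I k R Q \<Longrightarrow> i \<in> I \<Longrightarrow> i' \<in> I \<Longrightarrow> i \<noteq> i' \<Longrightarrow> Q (\<lambda>j. rowop i i' c (M j)) = Q M"
  unfolding colinv_def by blast

lemma colinv_periodic:
  assumes "colinv I k R Q" shows "periodic k (\<lambda>v. Q (M(r := v)))"
  unfolding periodic_def
proof (intro allI impI)
  fix v w :: "nat \<Rightarrow> int" assume "\<forall>i. [v i = w i] (mod int k)"
  then show "Q (M(r := v)) = Q (M(r := w))" by (intro colinvD1[OF assms]) auto
qed

text \<open>Averaging over a column that undergoes the same row operation restores the invariance in the others.\<close>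

lemma colinv_avg:
  assumes Q: "colinv I k (Suc r) Q" and k: "k > 0"
  shows "colinv I k r (\<lambda>M. avg I k (\<lambda>v. Q (M(r := v))))"
  unfolding colinv_def
proof (intro conjI allI impI)
  fix M M' :: "nat \<Rightarrow> nat \<Rightarrow> int"
  assume "\<forall>j<r. \<forall>i. [M j i = M' j i] (mod int k)"
  then show "avg I k (\<lambda>v. Q (M(r := v))) = avg I k (\<lambda>v. Q (M'(r := v)))"
    by (intro avg_cong colinvD1[OF Q]) (auto simp: less_Suc_eq)
next
  fix M :: "nat \<Rightarrow> nat \<Rightarrow> int" and i i' c assume i: "i \<in> I" "i' \<in> I" "i \<noteq> i'"
  define E where "E = (\<lambda>j. rowop i i' c (M j))"
  have "avg I k (\<lambda>v. Q (E(r := v))) = avg I k (\<lambda>v. Q (E(r := rowop i i' c v)))"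
    by (rule avg_rowop[symmetric]) (use i k colinv_periodic[OF Q] in auto)
  also have "(\<lambda>v. Q (E(r := rowop i i' c v))) = (\<lambda>v. Q (M(r := v)))"
  proof
    fix v
    have "E(r := rowop i i' c v) = (\<lambda>j. rowop i i' c ((M(r := v)) j))" by (auto simp: E_def)
    then show "Q (E(r := rowop i i' c v)) = Q (M(r := v))" using colinvD2[OF Q i] by (simp only:)
  qed
  finally show "avg I k (\<lambda>v. Q ((\<lambda>j. rowop i i' c (M j))(r := v))) = avg I k (\<lambda>v. Q (M(r := v)))"
    by (simp only: E_def)
qed

text \<open>For diagonal entry \<open>d\<close>, adding multiples of row \<open>r\<close> to the rows above shows that \<open>F\<close> has period \<open>d\<close>
as well as \<open>k\<close> in the entries above the diagonal; so their sum is \<open>d ^ r\<close> times a mean modulo \<open>k\<close>, a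
function of \<open>gcd k d\<close> only. By Euclid, a uniform vector on the \<open>N - r\<close> places from \<open>r\<close> on also
depends on its gcd with \<open>k\<close> only, and \<open>gcd_distribution\<close> identifies the two.\<close>

lemma column_sum:
  fixes F :: "(nat \<Rightarrow> int) \<Rightarrow> real"
  assumes k: "k > 0" and r: "r + 2 \<le> N" and periodic: "periodic k F" and F0: "\<And>v. F v \<ge> 0"
    and row: "\<And>v i i' c. i < N \<Longrightarrow> r \<le> i' \<Longrightarrow> i' < N \<Longrightarrow> i \<noteq> i' \<Longrightarrow> F (rowop i i' c v) = F v"
  shows "((\<lambda>v. F v / real_of_int (v r) ^ N) has_sum (riemann_zeta (real (N - r)) * avg {..<N} k F)) (hcol r)"
proof (rule has_sum_hcol)
  define G where "G = (\<lambda>d::nat. avg {..<r} k (\<lambda>u. F (u(r := int d))))"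
  define J where "J = {r..<N}"
  have J: "finite J" "card J \<ge> 2" "r \<in> J" "Suc r \<in> J" using r by (auto simp: J_def)
  have eu: "F v = F (\<lambda>i. if i \<in> J then if i = r then gcd (int k) (Gcd (v ` J)) else 0 else v i)" for v
    by (rule euclid_mod[where s = "Suc r"]) (use J periodic in \<open>auto simp: J_def intro!: row\<close>)
  have box: "(\<Sum>u\<in>cube {..<r} d. F (u(r := int d))) = real d ^ r * G d" if d: "d \<ge> 1" for d
  proof -
    define F' where "F' = (\<lambda>u. F (\<lambda>i. if i < r then u i else if i = r then int d else 0))"
    have F'u: "F' u = F (u(r := int d))" if "u \<in> cube {..<r} q" for u q
    proof -
      have "(\<lambda>i. if i < r then u i else if i = r then int d else 0) = u(r := int d)"
        using that by (auto simp: cube_def fun_eq_iff)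
      then show ?thesis by (simp add: F'_def)
    qed
    have perk: "periodic k F'" unfolding periodic_def F'_def
      by (auto intro!: periodic_D[OF periodic])
    have perd: "periodic d F'" unfolding periodic_def
    proof (intro allI impI)
      fix v w :: "nat \<Rightarrow> int" assume vw: "\<forall>i. [v i = w i] (mod int d)"
      have "F' (\<lambda>i. if i < m then w i else v i) = F' v" for m
      proof (induction m)
        case (Suc m)
        define u where "u = (\<lambda>i. if i < m then w i else v i)"
        have "F' (\<lambda>i. if i < Suc m then w i else v i) = F' (u(m := w m))"
          by (rule arg_cong[of _ _ F']) (auto simp: u_def less_Suc_eq)
        also have "\<dots> = F' u"
        proof (cases "m < r")
          case True
          obtain c where c: "w m = v m + int d * c"
            using vw by (metis cong_iff_lin)
          have "(\<lambda>i. if i < r then (u(m := w m)) i else if i = r then int d else 0)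
            = rowop m r c (\<lambda>i. if i < r then u i else if i = r then int d else 0)"
            using True c by (auto simp: rowop_def u_def mult.commute)
          then show ?thesis unfolding F'_def using row[of m r] True r by simp
        next
          case False
          then show ?thesis unfolding F'_def by (intro arg_cong[of _ _ F]) auto
        qed
        finally show ?case using Suc by (simp add: u_def)
      qed simp
      from this[of r] have "F' v = F' (\<lambda>i. if i < r then w i else v i)" ..
      also have "\<dots> = F' w" unfolding F'_def by (intro arg_cong[of _ _ F]) auto
      finally show "F' v = F' w" .
    qed
    have "(\<Sum>u\<in>cube {..<r} d. F (u(r := int d))) = (\<Sum>u\<in>cube {..<r} d. F' u)"
      by (rule sum.cong) (auto simp: F'u)
    also have "\<dots> = real d ^ r * avg {..<r} d F'" using d by (simp add: avg_def)
    also have "avg {..<r} d F' = avg {..<r} k F'" by (rule avg_period2) (use perd perk d k in auto)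
    also have "\<dots> = G d" unfolding G_def by (rule avg_cong) (simp add: F'u)
    finally show ?thesis .
  qed
  have Gg: "G d = G (gcd k d)" for d
    unfolding G_def
  proof (rule avg_cong)
    fix u assume u: "u \<in> cube {..<r} k"
    have "Gcd ((u(r := int d)) ` J) = int d"
    proof (rule Gcd_eqI)
      fix b assume "b \<in> (u(r := int d)) ` J"
      then show "int d dvd b" using u by (auto simp: cube_def J_def)
    next
      fix c assume "\<And>b. b \<in> (u(r := int d)) ` J \<Longrightarrow> c dvd b"
      from this[of "(u(r := int d)) r"] show "c dvd int d" using J by auto
    qed auto
    then have "F (u(r := int d)) = F (\<lambda>i. if i \<in> J then if i = r then gcd (int k) (int d) else 0 else (u(r := int d)) i)"
      using eu[of "u(r := int d)"] by (simp only:)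
    also have "(\<lambda>i. if i \<in> J then if i = r then gcd (int k) (int d) else 0 else (u(r := int d)) i) = u(r := int (gcd k d))"
      using u J r by (auto simp: cube_def J_def fun_eq_iff)
    finally show "F (u(r := int d)) = F (u(r := int (gcd k d)))" .
  qed
  have "((\<lambda>d. G (gcd k d) / real d ^ card J) has_sum
    (riemann_zeta (real (card J)) * avg J k (\<lambda>z. G (nat (gcd (int k) (Gcd (z ` J))))))) {1..}"
    by (rule gcd_distribution) (use J k F0 in \<open>auto simp: G_def intro: avg_nonneg\<close>)
  also have "avg J k (\<lambda>z. G (nat (gcd (int k) (Gcd (z ` J))))) = avg {..<N} k F"
  proof -
    have "avg {..<N} k F = avg ({..<r} \<union> J) k F" using r by (intro arg_cong[of _ _ "\<lambda>I. avg I k F"]) (auto simp: J_def)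
    also have "\<dots> = avg {..<r} k (\<lambda>u. avg J k (\<lambda>z. F (\<lambda>i. u i + z i)))"
      by (rule avg_Un) (use J in \<open>auto simp: J_def\<close>)
    also have "\<dots> = avg J k (\<lambda>z. avg {..<r} k (\<lambda>u. F (\<lambda>i. u i + z i)))" by (rule avg_swap)
    also have "\<dots> = avg J k (\<lambda>z. G (nat (gcd (int k) (Gcd (z ` J)))))"
      unfolding G_def
    proof (intro avg_cong)
      fix z u assume z: "z \<in> cube J k" and u: "u \<in> cube {..<r} k"
      have "F (\<lambda>i. u i + z i) = F (\<lambda>i. if i \<in> J then if i = r then gcd (int k) (Gcd ((\<lambda>i. u i + z i) ` J)) else 0 else u i + z i)"
        by (rule eu)
      also have "(\<lambda>i. u i + z i) ` J = z ` J" using u by (intro image_cong) (auto simp: cube_def J_def)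
      also have "(\<lambda>i. if i \<in> J then if i = r then gcd (int k) (Gcd (z ` J)) else 0 else u i + z i) = u(r := int (nat (gcd (int k) (Gcd (z ` J)))))"
        using u z J r by (auto simp: cube_def J_def fun_eq_iff)
      finally show "F (\<lambda>i. u i + z i) = F (u(r := int (nat (gcd (int k) (Gcd (z ` J))))))" .
    qed
    finally show ?thesis by simp
  qed
  finally have main: "((\<lambda>d. G (gcd k d) / real d ^ card J) has_sum (riemann_zeta (real (N - r)) * avg {..<N} k F)) {1..}"
    by (simp add: J_def)
  show "((\<lambda>d. \<Sum>u\<in>cube {..<r} d. F (u(r := int d)) / real_of_int ((u(r := int d)) r) ^ N) has_sum
     (riemann_zeta (real (N - r)) * avg {..<N} k F)) {1..}"
  proof (rule has_sum_cong[THEN iffD1, OF _ main])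
    fix d :: nat assume "d \<in> {1..}"
    then have d: "d \<ge> 1" by simp
    have "N = r + card J" using r by (simp add: J_def)
    then have "real d ^ N = real d ^ r * real d ^ card J" by (metis power_add)
    then show "G (gcd k d) / real d ^ card J = (\<Sum>u\<in>cube {..<r} d. F (u(r := int d)) / real_of_int ((u(r := int d)) r) ^ N)"
      using box[OF d] Gg[of d] d by (simp add: sum_divide_distrib[symmetric])
  qed
next
  fix v :: "nat \<Rightarrow> int" assume "v \<in> hcol r"
  then have "v r > 0" by (simp add: hcol_def)
  then show "F v / real_of_int (v r) ^ N \<ge> 0" using F0 by simp
qed

lemma hnf_0: "hnf 0 = {\<lambda>_. undefined}"
  by (simp add: hnf_def)

text \<open>The last column is summed first by \<open>column_sum\<close>, and \<open>colinv_avg\<close> keeps the result within the class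
of invariant functions.\<close>

lemma hnf_sum:
  fixes Q :: "(nat \<Rightarrow> nat \<Rightarrow> int) \<Rightarrow> real"
  assumes k: "k > 0" and r: "r + 1 \<le> N" and Q: "colinv {..<N} k r Q" and Q0: "\<And>M. Q M \<ge> 0"
  shows "((\<lambda>T. Q T / (\<Prod>j<r. real_of_int (T j j)) ^ N) has_sum
    ((\<Prod>j<r. riemann_zeta (real (N - j))) * avgL {..<N} k [0..<r] Q (\<lambda>_. undefined))) (hnf r)"
  using r Q Q0
proof (induction r arbitrary: Q)
  case 0
  then show ?case by (simp add: hnf_0 has_sum_finite_iff)
next
  case (Suc r)
  define Q' where "Q' = (\<lambda>M. avg {..<N} k (\<lambda>v. Q (M(r := v))))"
  have IH: "((\<lambda>T. Q' T / (\<Prod>j<r. real_of_int (T j j)) ^ N) has_sum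
    ((\<Prod>j<r. riemann_zeta (real (N - j))) * avgL {..<N} k [0..<r] Q' (\<lambda>_. undefined))) (hnf r)"
    by (rule Suc.IH) (use Suc.prems k in \<open>auto simp: Q'_def intro!: colinv_avg avg_nonneg\<close>)
  show ?case
  proof (rule has_sum_hnf_Suc)
    have "((\<lambda>T. riemann_zeta (real (N - r)) * (Q' T / (\<Prod>j<r. real_of_int (T j j)) ^ N)) has_sum
      (riemann_zeta (real (N - r)) * ((\<Prod>j<r. riemann_zeta (real (N - j))) * avgL {..<N} k [0..<r] Q' (\<lambda>_. undefined)))) (hnf r)"
      by (rule has_sum_cmult_right[OF IH])
    also have "riemann_zeta (real (N - r)) * ((\<Prod>j<r. riemann_zeta (real (N - j))) * avgL {..<N} k [0..<r] Q' (\<lambda>_. undefined))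
      = (\<Prod>j<Suc r. riemann_zeta (real (N - j))) * avgL {..<N} k [0..<Suc r] Q (\<lambda>_. undefined)"
    proof -
      have "avgL {..<N} k [r] Q = Q'" by (rule ext) (simp add: Q'_def)
      then show ?thesis by (simp add: avgL_append)
    qed
    finally show "((\<lambda>T. riemann_zeta (real (N - r)) * (Q' T / (\<Prod>j<r. real_of_int (T j j)) ^ N)) has_sum
      ((\<Prod>j<Suc r. riemann_zeta (real (N - j))) * avgL {..<N} k [0..<Suc r] Q (\<lambda>_. undefined))) (hnf r)" .
  next
    fix T assume T: "T \<in> hnf r"
    define F where "F = (\<lambda>v. Q (T(r := v)))"
    have Tz: "T j i = 0" if "j < r" "i > j" for i j using T that by (auto simp: hnf_def hcol_def PiE_iff)
    have "((\<lambda>v. F v / real_of_int (v r) ^ N) has_sum (riemann_zeta (real (N - r)) * avg {..<N} k F)) (hcol r)"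
    proof (rule column_sum)
      show "periodic k F" unfolding F_def by (rule colinv_periodic) (rule Suc.prems)
      fix v i i' c assume i: "i < N" "r \<le> i'" "i' < N" "i \<noteq> i'"
      have "F (rowop i i' c v) = Q (\<lambda>j. rowop i i' c ((T(r := v)) j))"
        unfolding F_def
      proof (rule colinvD1[OF Suc.prems(2)])
        fix j l assume "j < Suc r"
        then show "[(T(r := rowop i i' c v)) j l = rowop i i' c ((T(r := v)) j) l] (mod int k)"
          using Tz[of j i'] i by (cases "j = r") (auto simp: rowop_def)
      qed
      also have "\<dots> = F v" unfolding F_def by (rule colinvD2[OF Suc.prems(2)]) (use i in auto)
      finally show "F (rowop i i' c v) = F v" .
    qed (use k Suc.prems in \<open>auto simp: F_def\<close>)
    then have "((\<lambda>v. F v / real_of_int (v r) ^ N * (1 / (\<Prod>j<r. real_of_int (T j j)) ^ N)) has_sum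
       (riemann_zeta (real (N - r)) * avg {..<N} k F * (1 / (\<Prod>j<r. real_of_int (T j j)) ^ N))) (hcol r)"
      by (rule has_sum_cmult_left)
    then show "((\<lambda>v. Q (T(r := v)) / (\<Prod>j<Suc r. real_of_int ((T(r := v)) j j)) ^ N) has_sum
       (riemann_zeta (real (N - r)) * (Q' T / (\<Prod>j<r. real_of_int (T j j)) ^ N))) (hcol r)"
      by (simp add: F_def Q'_def power_mult_distrib mult_ac divide_inverse)
  next
    fix M :: "nat \<Rightarrow> nat \<Rightarrow> int" assume M: "M \<in> hnf (Suc r)"
    have "real_of_int (M j j) \<ge> 0" if "j < Suc r" for j using M that by (auto simp: hnf_def hcol_def PiE_iff less_imp_le)
    then show "Q M / (\<Prod>j<Suc r. real_of_int (M j j)) ^ N \<ge> 0"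
      using Suc.prems by (intro divide_nonneg_nonneg zero_le_power prod_nonneg) auto
  qed
qed

section \<open>Hermite normal forms and lattices\<close>

text \<open>The combination with coefficients \<open>e\<close> of the first \<open>r\<close> rows of \<open>M\<close>, truncated to \<open>N\<close> coordinates.\<close>

definition comb :: "nat \<Rightarrow> nat \<Rightarrow> (nat \<Rightarrow> nat \<Rightarrow> int) \<Rightarrow> (nat \<Rightarrow> int) \<Rightarrow> nat \<Rightarrow> int" where
  "comb N r M e = (\<lambda>j. if j < N then \<Sum>i<r. e i * M j i else 0)"

abbreviation "lat N M \<equiv> range (comb N N M)"

definition is_lat :: "nat \<Rightarrow> (nat \<Rightarrow> int) set \<Rightarrow> bool" where
  "is_lat N L \<longleftrightarrow> L \<subseteq> int_vecs N \<and> (\<lambda>_. 0) \<in> L \<and> (\<forall>x\<in>L. \<forall>y\<in>L. (\<lambda>i. x i - y i) \<in> L) \<and>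
     (\<forall>i<N. \<exists>m>0. (\<lambda>j. if j = i then m else 0) \<in> L)"

text \<open>The least positive element divides all the others, by division with remainder.\<close>

lemma int_subgroup_generator:
  fixes L :: "int set"
  assumes d: "\<And>x y. x \<in> L \<Longrightarrow> y \<in> L \<Longrightarrow> x - y \<in> L" and m: "m \<in> L" "m > 0"
  shows "\<exists>d>0. \<forall>z. z \<in> L \<longleftrightarrow> d dvd z"
proof -
  have zero: "0 \<in> L" using d[OF m(1) m(1)] by simp
  have neg: "- x \<in> L" if "x \<in> L" for x using d[OF zero that] by simp
  have add: "x + y \<in> L" if "x \<in> L" "y \<in> L" for x y using d[OF that(1) neg[OF that(2)]] by simp
  have mulnat: "int c * x \<in> L" if "x \<in> L" for c x
  proof (induction c)
    case (Suc c)
    have "int (Suc c) * x = x + int c * x" by (simp add: algebra_simps)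
    then show ?case using add[OF that Suc] by (simp only:)
  qed (use zero in simp)
  have mul: "c * x \<in> L" if "x \<in> L" for c x
  proof (cases "c \<ge> 0")
    case True
    then show ?thesis using mulnat[OF that, of "nat c"] by simp
  next
    case False
    then show ?thesis using neg[OF mulnat[OF that, of "nat (- c)"]] by simp
  qed
  define P where "P = (\<lambda>n. n > 0 \<and> int n \<in> L)"
  have "P (nat m)" using m by (simp add: P_def)
  then have P: "P (LEAST n. P n)" by (rule LeastI)
  define dn where "dn = (LEAST n. P n)"
  have "P dn" using P by (simp only: dn_def)
  then have dn: "dn > 0" "int dn \<in> L" by (simp_all add: P_def)
  have "int dn dvd z" if z: "z \<in> L" for z
  proof -
    have "z mod int dn \<in> L"
      using d[OF z mul[OF dn(2), of "z div int dn"]] by (simp add: minus_div_mult_eq_mod)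
    moreover have r: "0 \<le> z mod int dn" "z mod int dn < int dn" using dn by auto
    moreover have "\<not> P (nat (z mod int dn))"
      by (rule not_less_Least) (use r in \<open>simp add: dn_def[symmetric] nat_less_iff\<close>)
    ultimately have "\<not> z mod int dn > 0" by (simp add: P_def)
    then show ?thesis using r(1) by auto
  qed
  moreover have "z \<in> L" if "int dn dvd z" for z
    using mul[OF dn(2), of "z div int dn"] that by simp
  ultimately have "\<forall>z. z \<in> L \<longleftrightarrow> int dn dvd z" by blast
  then show ?thesis using dn(1) by (intro exI[of _ "int dn"] conjI) simp_all
qed

context
  fixes L :: "(nat \<Rightarrow> int) set"
  assumes zero: "(\<lambda>_. 0) \<in> L" and diff: "\<And>x y. x \<in> L \<Longrightarrow> y \<in> L \<Longrightarrow> (\<lambda>i. x i - y i) \<in> L"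
begin

lemma lat_neg: "x \<in> L \<Longrightarrow> (\<lambda>i. - x i) \<in> L"
  using diff[OF zero, of x] by simp

lemma lat_add: "x \<in> L \<Longrightarrow> y \<in> L \<Longrightarrow> (\<lambda>i. x i + y i) \<in> L"
  using diff[OF _ lat_neg, of x y] by simp

lemma lat_mult: "x \<in> L \<Longrightarrow> (\<lambda>i. c * x i) \<in> L"
proof -
  assume x: "x \<in> L"
  have nat: "(\<lambda>i. int n * x i) \<in> L" for n
  proof (induction n)
    case (Suc n)
    then show ?case using lat_add[OF x Suc] by (simp add: algebra_simps)
  qed (use zero in simp)
  show ?thesis
  proof (cases "c \<ge> 0")
    case True
    then show ?thesis using nat[of "nat c"] by simp
  next
    case False
    then show ?thesis using lat_neg[OF nat[of "nat (- c)"]] by simp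
  qed
qed

lemma lat_sum: "(\<And>i. i < (n::nat) \<Longrightarrow> w i \<in> L) \<Longrightarrow> (\<lambda>j. \<Sum>i<n. e i * w i j) \<in> L"
proof (induction n)
  case (Suc n)
  then show ?case using lat_add[OF Suc.IH lat_mult[of "w n" "e n"]] by simp
qed (use zero in simp)

end

lemma hnf_zero: "M \<in> hnf N \<Longrightarrow> j < N \<Longrightarrow> i > j \<Longrightarrow> M j i = 0"
  by (auto simp: hnf_def hcol_def PiE_iff)

lemma hnf_diag: "M \<in> hnf N \<Longrightarrow> j < N \<Longrightarrow> M j j > 0"
  by (auto simp: hnf_def hcol_def PiE_iff)

lemma hnf_restrict: "M \<in> hnf (Suc N) \<Longrightarrow> M(N := undefined) \<in> hnf N"
  unfolding hnf_def lessThan_Suc by (rule fun_upd_in_PiE) auto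

lemma comb_int_vecs: "comb N r M e \<in> int_vecs N"
  by (simp add: comb_def int_vecs_def)

lemma comb_unit:
  assumes "i < N"
  shows "comb N N M (\<lambda>l. of_bool (l = i)) = (\<lambda>j. if j < N then M j i else 0)"
proof -
  have *: "(\<Sum>l<N. of_bool (l = i) * M j l) = M j i" for j
  proof -
    have "(\<Sum>l<N. of_bool (l = i) * M j l) = (\<Sum>l<N. if l = i then M j l else 0)"
      by (rule sum.cong) auto
    then show ?thesis using assms by (simp add: sum.delta)
  qed
  show ?thesis unfolding comb_def * ..
qed

lemma comb_Suc:
  assumes "M \<in> hnf (Suc N)"
  shows "comb (Suc N) (Suc N) M e = (comb N N (M(N := undefined)) e)(N := (\<Sum>i<N. e i * M N i) + e N * M N N)"
  using hnf_zero[OF assms, of _ N] by (auto simp: comb_def fun_eq_iff less_Suc_eq)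

text \<open>The coefficients vanish successively from \<open>0\<close> on, since in a triangular matrix coordinate \<open>j\<close>
involves only the coefficients up to \<open>j\<close> and the earlier ones are known to vanish.\<close>

lemma comb_small:
  assumes M: "M \<in> hnf N" and small: "\<And>j. j < N \<Longrightarrow> \<bar>comb N N M e j\<bar> < M j j"
  shows "i < N \<Longrightarrow> e i = 0"
proof (induction i rule: less_induct)
  case (less j)
  have "comb N N M e j = (\<Sum>i<N. e i * M j i)" using less.prems by (simp add: comb_def)
  also have "\<dots> = (\<Sum>i\<in>{j}. e i * M j i)"
  proof (rule sum.mono_neutral_right)
    show "\<forall>i\<in>{..<N} - {j}. e i * M j i = 0"
    proof
      fix i assume i: "i \<in> {..<N} - {j}"
      show "e i * M j i = 0"
        using less.IH[of i] hnf_zero[OF M less.prems, of i] i less.prems by (cases "i < j") auto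
    qed
  qed (use less.prems in auto)
  finally have "comb N N M e j = e j * M j j" by simp
  then have "\<bar>e j * M j j\<bar> < M j j" using small[OF less.prems] by simp
  then have "\<bar>e j\<bar> * M j j < 1 * M j j" using hnf_diag[OF M less.prems] by (simp add: abs_mult)
  then show ?case using hnf_diag[OF M less.prems] by (simp add: mult_less_cancel_right)
qed

lemma comb_add: "comb N r M (\<lambda>i. e i + f i) = (\<lambda>j. comb N r M e j + comb N r M f j)"
  by (auto simp: comb_def fun_eq_iff distrib_right sum.distrib)

lemma comb_diff: "comb N r M (\<lambda>i. e i - f i) = (\<lambda>j. comb N r M e j - comb N r M f j)"
  by (auto simp: comb_def fun_eq_iff left_diff_distrib sum_subtractf)

lemma comb_inj:
  assumes M: "M \<in> hnf N" and eq: "comb N N M e = comb N N M f" and i: "i < N"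
  shows "e i = f i"
proof -
  have z: "comb N N M (\<lambda>i. e i - f i) j = 0" for j using fun_cong[OF eq, of j] by (simp add: comb_diff)
  have small: "\<bar>comb N N M (\<lambda>i. e i - f i) j\<bar> < M j j" if "j < N" for j
    unfolding z using hnf_diag[OF M that] by simp
  have "e i - f i = 0" by (rule comb_small[OF M small i])
  then show ?thesis by simp
qed

text \<open>By induction on the dimension: the elements of \<open>L\<close> with vanishing earlier coordinates have the last
diagonal entry as generator, the projection forgetting the last coordinate has a Hermite normal
form, and lifts of its rows are reduced modulo that generator.\<close>

lemma hnf_exists: "is_lat N L \<Longrightarrow> \<exists>M\<in>hnf N. L = lat N M"
proof (induction N arbitrary: L)
  case 0
  then have "L = {\<lambda>_. 0}" by (auto simp: is_lat_def int_vecs_def)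
  moreover have "lat 0 M = {\<lambda>_. 0}" for M by (auto simp: comb_def)
  ultimately show ?case by (auto simp: hnf_0)
next
  case (Suc N)
  have zero: "(\<lambda>_. 0) \<in> L" and diff: "\<And>x y. x \<in> L \<Longrightarrow> y \<in> L \<Longrightarrow> (\<lambda>i. x i - y i) \<in> L"
    and sub: "L \<subseteq> int_vecs (Suc N)"
    and fin: "\<And>i. i < Suc N \<Longrightarrow> \<exists>m>0. (\<lambda>j. if j = i then m else 0) \<in> L"
    using Suc.prems unfolding is_lat_def by auto
  define L' where "L' = (\<lambda>x. x(N := 0)) ` L"
  have "is_lat N L'"
    unfolding is_lat_def
  proof (intro conjI ballI allI impI)
    show "L' \<subseteq> int_vecs N" using sub by (auto simp: L'_def int_vecs_def Suc_le_eq)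
    show "(\<lambda>_. 0) \<in> L'" unfolding L'_def by (rule image_eqI[OF _ zero]) auto
    fix x y assume "x \<in> L'" "y \<in> L'"
    then obtain x' y' where "x' \<in> L" "y' \<in> L" "x = x'(N := 0)" "y = y'(N := 0)" by (auto simp: L'_def)
    then show "(\<lambda>i. x i - y i) \<in> L'" unfolding L'_def
      by (intro image_eqI[of _ _ "\<lambda>i. x' i - y' i"] diff) auto
  next
    fix i assume "i < N"
    then obtain m where "m > 0" "(\<lambda>j. if j = i then m else 0) \<in> L" using fin[of i] by auto
    then show "\<exists>m>0. (\<lambda>j. if j = i then m else 0) \<in> L'"
      unfolding L'_def using \<open>i < N\<close> by (intro exI[of _ m] conjI image_eqI[of _ _ "\<lambda>j. if j = i then m else 0"]) auto
  qed
  from Suc.IH[OF this] obtain T where T: "T \<in> hnf N" "L' = lat N T" by blast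
  define Z where "Z = {z. (\<lambda>j. if j = N then z else 0) \<in> L}"
  obtain m where m: "m > 0" "m \<in> Z" using fin[of N] by (auto simp: Z_def)
  have "\<exists>d>0. \<forall>z. z \<in> Z \<longleftrightarrow> d dvd z"
  proof (rule int_subgroup_generator)
    fix x y assume "x \<in> Z" "y \<in> Z"
    then have "(\<lambda>i. (if i = N then x else 0) - (if i = N then y else 0)) \<in> L" unfolding Z_def by (auto intro: diff)
    moreover have "(\<lambda>i. (if i = N then x else 0) - (if i = N then y else 0)) = (\<lambda>j. if j = N then x - y else 0)" by auto
    ultimately show "x - y \<in> Z" by (simp add: Z_def)
  qed (use m in auto)
  then obtain d where d: "d > 0" "\<And>z. (\<lambda>j. if j = N then z else 0) \<in> L \<longleftrightarrow> d dvd z"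
    unfolding Z_def by auto
  define row where "row = (\<lambda>i. comb N N T (\<lambda>l. of_bool (l = i)))"
  have "\<exists>u. 0 \<le> u \<and> u < d \<and> (row i)(N := u) \<in> L" for i
  proof -
    have "row i \<in> L'" unfolding T(2) row_def by blast
    then obtain x where x: "x \<in> L" "row i = x(N := 0)" by (auto simp: L'_def)
    have "(\<lambda>j. if j = N then d * (x N div d) else 0) \<in> L" by (subst d(2)) simp
    from diff[OF x(1) this] have "(\<lambda>j. x j - (if j = N then d * (x N div d) else 0)) \<in> L" .
    moreover have "(\<lambda>j. x j - (if j = N then d * (x N div d) else 0)) = (row i)(N := x N mod d)"
      using x(2) by (auto simp: fun_eq_iff minus_mult_div_eq_mod)
    ultimately show ?thesis using d(1) by (intro exI[of _ "x N mod d"]) auto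
  qed
  then obtain u where u: "\<And>i. 0 \<le> u i" "\<And>i. u i < d" "\<And>i. (row i)(N := u i) \<in> L" by metis
  define v where "v = (\<lambda>i. if i < N then u i else if i = N then d else 0)"
  define M where "M = T(N := v)"
  have "v \<in> hcol N" using u d by (auto simp: hcol_def v_def)
  then have M: "M \<in> hnf (Suc N)"
    unfolding M_def hnf_def lessThan_Suc by (rule PiE_fun_upd) (use T in \<open>simp add: hnf_def\<close>)
  have TM: "M(N := undefined) = T"
  proof -
    have "T N = undefined" using T(1) unfolding hnf_def by (intro PiE_arb) auto
    then have "T(N := undefined) = T" by (rule fun_upd_idem)
    then show ?thesis by (simp add: M_def)
  qed
  have comb: "comb (Suc N) (Suc N) M e = (comb N N T e)(N := (\<Sum>i<N. e i * u i) + e N * d)" for e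
    unfolding comb_Suc[OF M] TM by (auto simp: M_def v_def intro!: arg_cong2[where f = "(+)"] sum.cong)
  have rowsum: "(\<lambda>j. \<Sum>i<N. e i * ((row i)(N := u i)) j) = (comb N N T e)(N := \<Sum>i<N. e i * u i)" for e
  proof
    fix j
    have "(\<Sum>i<N. e i * row i j) = comb N N T e j"
      by (cases "j < N") (simp_all add: row_def comb_unit comb_def)
    then show "(\<Sum>i<N. e i * ((row i)(N := u i)) j) = ((comb N N T e)(N := \<Sum>i<N. e i * u i)) j"
      by (cases "j = N") simp_all
  qed
  have "L = lat (Suc N) M"
  proof (intro equalityI subsetI)
    fix x assume x: "x \<in> L"
    then have "x(N := 0) \<in> lat N T" unfolding T(2)[symmetric] L'_def by blast
    then obtain e where e: "x(N := 0) = comb N N T e" by blast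
    have s: "(comb N N T e)(N := \<Sum>i<N. e i * u i) \<in> L"
      unfolding rowsum[symmetric] by (rule lat_sum[OF zero diff u(3)])
    have "(\<lambda>j. x j - ((comb N N T e)(N := \<Sum>i<N. e i * u i)) j) \<in> L" by (rule diff[OF x s])
    moreover have "(\<lambda>j. x j - ((comb N N T e)(N := \<Sum>i<N. e i * u i)) j) = (\<lambda>j. if j = N then x N - (\<Sum>i<N. e i * u i) else 0)"
      using e by (auto simp: fun_eq_iff split: if_splits)
    ultimately have "d dvd x N - (\<Sum>i<N. e i * u i)" using d(2) by simp
    then obtain c where c: "x N = (\<Sum>i<N. e i * u i) + c * d" by (auto simp: dvd_def algebra_simps)
    have ce: "comb N N T (e(N := c)) = comb N N T e" by (auto simp: comb_def)
    have "comb (Suc N) (Suc N) M (e(N := c)) = x"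
      unfolding comb ce using e c by (auto simp: fun_eq_iff split: if_splits)
    then show "x \<in> lat (Suc N) M" by (metis rangeI)
  next
    fix x assume "x \<in> lat (Suc N) M"
    then obtain e where x: "x = comb (Suc N) (Suc N) M e" by blast
    have l1: "(comb N N T e)(N := \<Sum>i<N. e i * u i) \<in> L"
      unfolding rowsum[symmetric] by (rule lat_sum[OF zero diff u(3)])
    have l2: "(\<lambda>j. if j = N then e N * d else 0) \<in> L" by (subst d(2)) simp
    have "(\<lambda>j. ((comb N N T e)(N := \<Sum>i<N. e i * u i)) j + (if j = N then e N * d else 0)) \<in> L"
      using lat_add[OF zero diff l1 l2] .
    moreover have "(\<lambda>j. ((comb N N T e)(N := \<Sum>i<N. e i * u i)) j + (if j = N then e N * d else 0)) = x"
      unfolding x comb by (auto simp: fun_eq_iff comb_def)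
    ultimately show "x \<in> L" by simp
  qed
  with M show ?case by blast
qed

text \<open>By induction the matrices agree outside the last column. Its diagonal entry generates the lattice
vectors supported on the last coordinate, and its other entries are reduced modulo that generator.\<close>

lemma hnf_unique: "M \<in> hnf N \<Longrightarrow> M' \<in> hnf N \<Longrightarrow> lat N M = lat N M' \<Longrightarrow> M = M'"
proof (induction N arbitrary: M M')
  case 0
  then show ?case by (simp add: hnf_0)
next
  case (Suc N)
  define T T' where "T = M(N := undefined)" and "T' = M'(N := undefined)"
  have T: "T \<in> hnf N" "T' \<in> hnf N" unfolding T_def T'_def using Suc.prems hnf_restrict by auto
  have sub: "lat N (A(N := undefined)) \<subseteq> lat N (B(N := undefined))"
    if "A \<in> hnf (Suc N)" "B \<in> hnf (Suc N)" "lat (Suc N) A = lat (Suc N) B" for A B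
  proof
    fix x assume "x \<in> lat N (A(N := undefined))"
    then obtain e where x: "x = comb N N (A(N := undefined)) e" by blast
    have "comb (Suc N) (Suc N) A e \<in> lat (Suc N) B" using that(3) by blast
    then obtain f where f: "comb (Suc N) (Suc N) A e = comb (Suc N) (Suc N) B f" by blast
    have "comb N N (A(N := undefined)) e = comb N N (B(N := undefined)) f"
    proof
      fix j
      show "comb N N (A(N := undefined)) e j = comb N N (B(N := undefined)) f j"
        using fun_cong[OF f, of j] unfolding comb_Suc[OF that(1)] comb_Suc[OF that(2)]
        by (cases "j = N") (simp_all add: comb_def)
    qed
    then show "x \<in> lat N (B(N := undefined))" using x by blast
  qed
  have "lat N T = lat N T'" unfolding T_def T'_def using sub Suc.prems by blast
  then have TT: "T = T'" using Suc.IH T by blast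
  have key: "M N N dvd z" if Mz: "M \<in> hnf (Suc N)" "(\<lambda>j. if j = N then z else 0) \<in> lat (Suc N) M" for M z
  proof -
    obtain e where e: "(\<lambda>j. if j = N then z else 0) = comb (Suc N) (Suc N) M e" using Mz(2) by blast
    have cz: "comb N N (M(N := undefined)) e = (\<lambda>_. 0)"
    proof
      fix j
      show "comb N N (M(N := undefined)) e j = 0"
        using fun_cong[OF e, of j] unfolding comb_Suc[OF Mz(1)] by (cases "j = N") (auto simp: comb_def)
    qed
    have "e i = 0" if "i < N" for i
    proof (rule comb_small[OF hnf_restrict[OF Mz(1)] _ that])
      fix j assume "j < N"
      then show "\<bar>comb N N (M(N := undefined)) e j\<bar> < (M(N := undefined)) j j"
        unfolding cz using hnf_diag[OF hnf_restrict[OF Mz(1)]] by simp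
    qed
    then have "z = e N * M N N" using fun_cong[OF e, of N] unfolding comb_Suc[OF Mz(1)] by simp
    then show ?thesis by simp
  qed
  have diag: "(\<lambda>j. if j = N then M N N else 0) \<in> lat (Suc N) M" if "M \<in> hnf (Suc N)" for M
  proof -
    have "comb (Suc N) (Suc N) M (\<lambda>i. of_bool (i = N)) = (\<lambda>j. if j = N then M N N else 0)"
      unfolding comb_Suc[OF that] by (auto simp: comb_def fun_eq_iff)
    then show ?thesis by (metis rangeI)
  qed
  have pos: "M N N > 0" "M' N N > 0" using hnf_diag Suc.prems by auto
  have "M N N dvd M' N N" "M' N N dvd M N N"
    using key[OF Suc.prems(1)] key[OF Suc.prems(2)] diag[OF Suc.prems(1)] diag[OF Suc.prems(2)] Suc.prems(3) by auto
  then have NN: "M N N = M' N N" using pos by (simp add: zdvd_antisym_nonneg)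
  have Ni: "M N i = M' N i" for i
  proof (cases "i < N")
    case True
    define f where "f = (\<lambda>l. of_bool (l = i) :: int)"
    have *: "comb (Suc N) (Suc N) A f = (comb N N (A(N := undefined)) f)(N := A N i)" if "A \<in> hnf (Suc N)" for A
    proof -
      have "(\<Sum>l<N. f l * A N l) = (\<Sum>l<N. if l = i then A N l else 0)"
        by (rule sum.cong) (auto simp: f_def)
      also have "\<dots> = A N i" using True by (simp add: sum.delta)
      finally show ?thesis unfolding comb_Suc[OF that] using True by (simp add: f_def)
    qed
    obtain g where g: "comb (Suc N) (Suc N) M' f = comb (Suc N) (Suc N) M g" using Suc.prems(3) by blast
    have "(\<lambda>j. comb (Suc N) (Suc N) M f j - comb (Suc N) (Suc N) M' f j) \<in> lat (Suc N) M"
      unfolding g comb_diff[symmetric] by blast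
    moreover have "(\<lambda>j. comb (Suc N) (Suc N) M f j - comb (Suc N) (Suc N) M' f j) = (\<lambda>j. if j = N then M N i - M' N i else 0)"
      unfolding *[OF Suc.prems(1)] *[OF Suc.prems(2)] using TT by (auto simp: T_def T'_def)
    ultimately have "M N N dvd M N i - M' N i" using key[OF Suc.prems(1)] by simp
    moreover have "0 \<le> M N i" "M N i < M N N" "0 \<le> M' N i" "M' N i < M N N"
    proof -
      have "M N \<in> hcol N" "M' N \<in> hcol N" using Suc.prems unfolding hnf_def by (auto intro: PiE_mem)
      then show "0 \<le> M N i" "M N i < M N N" "0 \<le> M' N i" "M' N i < M N N"
        using True by (simp_all add: hcol_def NN)
    qed
    ultimately show ?thesis
      by (metis mod_eq_dvd_iff mod_pos_pos_trivial)
  next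
    case False
    then show ?thesis using NN hnf_zero[OF Suc.prems(1), of N i] hnf_zero[OF Suc.prems(2), of N i] by (cases "i = N") auto
  qed
  have "M N = M' N" using Ni by auto
  then show ?case using TT unfolding T_def T'_def by (metis fun_upd_triv fun_upd_upd)
qed

text \<open>Representatives of the integer vectors modulo the lattice of \<open>M\<close>.\<close>

definition hbox :: "nat \<Rightarrow> (nat \<Rightarrow> nat \<Rightarrow> int) \<Rightarrow> (nat \<Rightarrow> int) set" where
  "hbox N M = {y. (\<forall>j<N. 0 \<le> y j \<and> y j < M j j) \<and> (\<forall>j\<ge>N. y j = 0)}"

lemma box_reduce:
  "M \<in> hnf N \<Longrightarrow> x \<in> int_vecs N \<Longrightarrow> \<exists>y\<in>hbox N M. \<exists>e. x = (\<lambda>j. comb N N M e j + y j)"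
proof (induction N arbitrary: M x)
  case 0
  then show ?case by (auto simp: int_vecs_def hbox_def comb_def fun_eq_iff)
next
  case (Suc N)
  define T where "T = M(N := undefined)"
  have T: "T \<in> hnf N" using Suc.prems hnf_restrict by (simp add: T_def)
  have "x(N := 0) \<in> int_vecs N" using Suc.prems by (auto simp: int_vecs_def Suc_le_eq)
  from Suc.IH[OF T this] obtain y e where y: "y \<in> hbox N T" "x(N := 0) = (\<lambda>j. comb N N T e j + y j)" by blast
  define c where "c = x N - (\<Sum>i<N. e i * M N i)"
  have d: "M N N > 0" using hnf_diag[OF Suc.prems(1)] by simp
  define y' where "y' = y(N := c mod M N N)"
  define e' where "e' = e(N := c div M N N)"
  have "y' \<in> hbox (Suc N) M" using y(1) d by (auto simp: hbox_def y'_def T_def less_Suc_eq)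
  moreover have "x = (\<lambda>j. comb (Suc N) (Suc N) M e' j + y' j)"
  proof
    fix j
    have "comb N N T e' = comb N N T e" by (auto simp: comb_def e'_def)
    moreover have "(\<Sum>i<N. e' i * M N i) = (\<Sum>i<N. e i * M N i)" by (simp add: e'_def)
    moreover have "c div M N N * M N N + c mod M N N = c" by simp
    ultimately show "x j = comb (Suc N) (Suc N) M e' j + y' j"
      unfolding comb_Suc[OF Suc.prems(1)] T_def[symmetric]
      using fun_cong[OF y(2), of j] by (cases "j = N") (simp_all add: y'_def e'_def c_def)
  qed
  ultimately show ?case by blast
qed

lemma box_unique:
  assumes M: "M \<in> hnf N" and y: "y \<in> hbox N M" "y' \<in> hbox N M" and e: "(\<lambda>j. y j - y' j) = comb N N M e"
  shows "y = y'"
proof -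
  have "\<bar>comb N N M e j\<bar> < M j j" if "j < N" for j
  proof -
    have "0 \<le> y j" "y j < M j j" "0 \<le> y' j" "y' j < M j j" using that y by (auto simp: hbox_def)
    then show ?thesis unfolding e[symmetric] by (simp add: abs_less_iff)
  qed
  then have "e i = 0" if "i < N" for i using comb_small[OF M] that by blast
  then have "comb N N M e = (\<lambda>_. 0)" by (auto simp: comb_def)
  then show ?thesis using e by (auto simp: fun_eq_iff)
qed

lemma card_box:
  assumes "\<And>j. j < N \<Longrightarrow> M j j > 0"
  shows "finite (hbox N M) \<and> int (card (hbox N M)) = (\<Prod>j<N. M j j)"
  using assms
proof (induction N)
  case 0
  have "hbox 0 M = {\<lambda>_. 0}" by (auto simp: hbox_def)
  then show ?case by simp
next
  case (Suc N)
  have bij: "bij_betw (\<lambda>(y, c). y(N := c)) (hbox N M \<times> {0..<M N N}) (hbox (Suc N) M)"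
    by (rule bij_betw_byWitness[where f' = "\<lambda>y. (y(N := 0), y N)"])
       (auto simp: hbox_def less_Suc_eq fun_eq_iff Suc_le_eq)
  have "finite (hbox N M)" "int (card (hbox N M)) = (\<Prod>j<N. M j j)" using Suc by auto
  moreover have "card (hbox (Suc N) M) = card (hbox N M) * nat (M N N)"
    using bij_betw_same_card[OF bij] by (simp add: card_cartesian_product)
  ultimately show ?case using bij_betw_finite[OF bij] Suc.prems[of N] by simp
qed

section \<open>Finite-index subgroups of the Heisenberg group\<close>

text \<open>Coordinates \<open>x\<close> of length \<open>2 * n\<close>, the second half being stored in reverse order. The symplectic
form then pairs the columns \<open>l\<close> and \<open>2 * n - 1 - l\<close>, which suits the order in which columns of a
Hermite normal form are filled.\<close>

definition heis_elt :: "nat \<Rightarrow> (nat \<Rightarrow> int) \<Rightarrow> int \<Rightarrow> (nat \<Rightarrow> int) \<times> (nat \<Rightarrow> int) \<times> int" where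
  "heis_elt n x c = (\<lambda>i. if i < n then x i else 0, \<lambda>i. if i < n then x (2 * n - 1 - i) else 0, c)"

definition heis_form :: "nat \<Rightarrow> (nat \<Rightarrow> int) \<Rightarrow> (nat \<Rightarrow> int) \<Rightarrow> int" where
  "heis_form n x y = (\<Sum>i<n. x i * y (2 * n - 1 - i))"

lemma heis_elt_mult: "heis_elt n x c \<otimes>\<^bsub>heisenberg n\<^esub> heis_elt n y d = heis_elt n (\<lambda>i. x i + y i) (c + d + heis_form n x y)"
  by (auto simp: heisenberg_def heis_elt_def heis_form_def fun_eq_iff)

lemma heis_elt_carrier: "heis_elt n x c \<in> carrier (heisenberg n)"
  by (auto simp: heisenberg_def heis_elt_def int_vecs_def)

lemma heis_elt_one: "heis_elt n (\<lambda>_. 0) 0 = \<one>\<^bsub>heisenberg n\<^esub>"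
  by (auto simp: heisenberg_def heis_elt_def)

lemma heis_elt_surj:
  assumes "g \<in> carrier (heisenberg n)"
  shows "\<exists>x\<in>int_vecs (2 * n). \<exists>c. g = heis_elt n x c"
proof -
  obtain a b c where g: "g = (a, b, c)" "a \<in> int_vecs n" "b \<in> int_vecs n"
    using assms by (auto simp: heisenberg_def)
  define x where "x = (\<lambda>i. if i < n then a i else if i < 2 * n then b (2 * n - 1 - i) else 0)"
  have "x \<in> int_vecs (2 * n)" by (auto simp: x_def int_vecs_def)
  moreover have "g = heis_elt n x c" using g by (auto simp: heis_elt_def x_def int_vecs_def fun_eq_iff)
  ultimately show ?thesis by blast
qed

lemma heis_elt_inject:
  assumes "x \<in> int_vecs (2 * n)" "y \<in> int_vecs (2 * n)"
  shows "heis_elt n x c = heis_elt n y d \<longleftrightarrow> x = y \<and> c = d"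
proof
  assume eq: "heis_elt n x c = heis_elt n y d"
  have "x i = y i" for i
  proof -
    consider "i < n" | "n \<le> i" "i < 2 * n" | "i \<ge> 2 * n" by linarith
    then show ?thesis
    proof cases
      case 1
      then show ?thesis using eq by (auto simp: heis_elt_def dest!: fun_cong[of _ _ i])
    next
      case 2
      have "fst (snd (heis_elt n x c)) (2 * n - 1 - i) = fst (snd (heis_elt n y d)) (2 * n - 1 - i)"
        using eq by (simp only:)
      moreover have "2 * n - 1 - i < n" "2 * n - 1 - (2 * n - 1 - i) = i" using 2 by auto
      ultimately show ?thesis unfolding heis_elt_def fst_conv snd_conv by (simp only: if_True)
    qed (use assms in \<open>auto simp: int_vecs_def\<close>)
  qed
  then show "x = y \<and> c = d" using eq by (auto simp: heis_elt_def)
qed simp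

lemma heis_form_add_left: "heis_form n (\<lambda>i. x i + y i) z = heis_form n x z + heis_form n y z"
  by (simp add: heis_form_def distrib_right sum.distrib)

lemma heis_form_add_right: "heis_form n x (\<lambda>i. y i + z i) = heis_form n x y + heis_form n x z"
  by (simp add: heis_form_def distrib_left sum.distrib)

lemma heis_form_mult_left: "heis_form n (\<lambda>i. a * x i) y = a * heis_form n x y"
  by (simp add: heis_form_def sum_distrib_left mult_ac)

lemma heis_form_mult_right: "heis_form n x (\<lambda>i. a * y i) = a * heis_form n x y"
  by (simp add: heis_form_def sum_distrib_left mult_ac)

lemma heis_form_minus_left: "heis_form n (\<lambda>i. - x i) y = - heis_form n x y"
  using heis_form_mult_left[of n "-1" x y] by simp

lemma heis_form_minus_right: "heis_form n x (\<lambda>i. - y i) = - heis_form n x y"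
  using heis_form_mult_right[of n x "-1" y] by simp

lemma heis_form_zero: "heis_form n (\<lambda>_. 0) y = 0" "heis_form n x (\<lambda>_. 0) = 0"
  by (simp_all add: heis_form_def)

lemma heis_elt_inv: "inv\<^bsub>heisenberg n\<^esub> heis_elt n x c = heis_elt n (\<lambda>i. - x i) (- c + heis_form n x x)"
  by (rule group.inv_equality[OF group_heisenberg])
     (simp_all add: heis_elt_mult heis_elt_carrier heis_form_minus_left heis_elt_one)

text \<open>Elements of the group over the rows of \<open>M\<close> commute pairwise up to \<open>k\<close>-th powers in the centre.
Written through columns, the condition is a sum of \<open>n\<close> wedges of columns \<open>l\<close> and \<open>2 * n - 1 - l\<close>.\<close>

definition isotropic :: "nat \<Rightarrow> nat \<Rightarrow> (nat \<Rightarrow> nat \<Rightarrow> int) \<Rightarrow> bool" where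
  "isotropic n k M \<longleftrightarrow> (\<forall>i j. int k dvd (\<Sum>l<n. M l i * M (2 * n - 1 - l) j - M l j * M (2 * n - 1 - l) i))"

definition mat_row :: "(nat \<Rightarrow> nat \<Rightarrow> int) \<Rightarrow> nat \<Rightarrow> nat \<Rightarrow> int" where
  "mat_row M i = (\<lambda>j. M j i)"

lemma isotropic_heis_form: "isotropic n k M \<longleftrightarrow> (\<forall>i j. [heis_form n (mat_row M i) (mat_row M j) = heis_form n (mat_row M j) (mat_row M i)] (mod int k))"
  by (simp add: isotropic_def heis_form_def mat_row_def cong_iff_dvd_diff sum_subtractf)

lemma heis_form_cong: "(\<And>i. i < 2 * n \<Longrightarrow> x i = x' i) \<Longrightarrow> (\<And>i. i < 2 * n \<Longrightarrow> y i = y' i) \<Longrightarrow> heis_form n x y = heis_form n x' y'"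
  unfolding heis_form_def by (rule sum.cong) auto

lemma comb_0: "comb N 0 M e = (\<lambda>_. 0)"
  by (auto simp: comb_def)

lemma heis_form_comb_Suc:
  "heis_form n (comb (2 * n) (Suc r) M e) y = heis_form n (comb (2 * n) r M e) y + e r * heis_form n (mat_row M r) y"
  "heis_form n y (comb (2 * n) (Suc r) M e) = heis_form n y (comb (2 * n) r M e) + e r * heis_form n y (mat_row M r)"
proof -
  have "heis_form n (comb (2 * n) (Suc r) M e) y = heis_form n (\<lambda>j. comb (2 * n) r M e j + e r * mat_row M r j) y"
    "heis_form n y (comb (2 * n) (Suc r) M e) = heis_form n y (\<lambda>j. comb (2 * n) r M e j + e r * mat_row M r j)"
    by (rule heis_form_cong; simp add: comb_def mat_row_def)+
  then show "heis_form n (comb (2 * n) (Suc r) M e) y = heis_form n (comb (2 * n) r M e) y + e r * heis_form n (mat_row M r) y"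
    "heis_form n y (comb (2 * n) (Suc r) M e) = heis_form n y (comb (2 * n) r M e) + e r * heis_form n y (mat_row M r)"
    by (simp_all add: heis_form_add_left heis_form_add_right heis_form_mult_left heis_form_mult_right)
qed

definition triangle :: "int \<Rightarrow> int" where "triangle z = z * (z - 1) div 2"

lemma tri2: "2 * triangle z = z * (z - 1)"
proof -
  have "even (z * (z - 1))" by auto
  then show ?thesis by (simp add: triangle_def)
qed

lemma triangle_add: "triangle (x + y) = triangle x + triangle y + x * y"
proof -
  have "2 * triangle (x + y) = 2 * (triangle x + triangle y + x * y)"
    using tri2[of "x + y"] tri2[of x] tri2[of y] by (simp add: algebra_simps)
  then show ?thesis by simp
qed

text \<open>The central coordinate of the ordered product of powers, with exponents \<open>e\<close>, of the elements
\<open>heis_elt n (mat_row M i) (t i)\<close> for \<open>i < r\<close>. The binomial coefficient comes from a power of a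
single element.\<close>

fun psi :: "nat \<Rightarrow> (nat \<Rightarrow> nat \<Rightarrow> int) \<Rightarrow> (nat \<Rightarrow> int) \<Rightarrow> nat \<Rightarrow> (nat \<Rightarrow> int) \<Rightarrow> int" where
  "psi n M t 0 e = 0"
| "psi n M t (Suc r) e = psi n M t r e + e r * t r + e r * heis_form n (comb (2 * n) r M e) (mat_row M r) + triangle (e r) * heis_form n (mat_row M r) (mat_row M r)"

lemma comb_ext: "(\<And>i. i < r \<Longrightarrow> e i = f i) \<Longrightarrow> comb N r M e = comb N r M f"
  by (auto simp: comb_def fun_eq_iff intro!: sum.cong)

lemma psi_ext: "(\<And>i. i < r \<Longrightarrow> e i = f i) \<Longrightarrow> psi n M t r e = psi n M t r f"
proof (induction r)
  case (Suc r)
  then show ?case using comb_ext[of r e f "2 * n" M] by simp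
qed simp

lemma psi_zero: "(\<And>i. i < r \<Longrightarrow> e i = 0) \<Longrightarrow> psi n M t r e = 0"
  by (induction r) (simp_all add: triangle_def)

lemma heis_form_comb_sym:
  assumes "isotropic n k M"
  shows "[heis_form n (comb (2 * n) r M e) (mat_row M i) = heis_form n (mat_row M i) (comb (2 * n) r M e)] (mod int k)"
proof (induction r)
  case (Suc r)
  show ?case unfolding heis_form_comb_Suc
    by (intro cong_add cong_mult cong_refl Suc) (use assms in \<open>simp add: isotropic_heis_form\<close>)
qed (simp add: comb_0 heis_form_zero)

text \<open>Collecting the product of two such elements commutes generators past each other, which is harmless
modulo \<open>k\<close> exactly by isotropy.\<close>

lemma psi_add:
  assumes iso: "isotropic n k M"
  shows "[psi n M t r (\<lambda>i. e i + f i) = psi n M t r e + psi n M t r f + heis_form n (comb (2 * n) r M e) (comb (2 * n) r M f)] (mod int k)"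
proof (induction r)
  case (Suc r)
  let ?X = "comb (2 * n) r M e" let ?Y = "comb (2 * n) r M f" let ?R = "mat_row M r"
  define D where "D = psi n M t r (\<lambda>i. e i + f i) - (psi n M t r e + psi n M t r f + heis_form n ?X ?Y)"
  have D: "int k dvd D" using Suc by (simp add: D_def cong_iff_dvd_diff)
  have S: "int k dvd heis_form n ?Y ?R - heis_form n ?R ?Y" using heis_form_comb_sym[OF iso, of r f r] by (simp add: cong_iff_dvd_diff)
  have "psi n M t (Suc r) (\<lambda>i. e i + f i) - (psi n M t (Suc r) e + psi n M t (Suc r) f + heis_form n (comb (2 * n) (Suc r) M e) (comb (2 * n) (Suc r) M f))
    = D + e r * (heis_form n ?Y ?R - heis_form n ?R ?Y)"
    unfolding D_def psi.simps heis_form_comb_Suc comb_add heis_form_add_left triangle_add by (simp add: algebra_simps)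
  then show ?case using D S by (simp add: cong_iff_dvd_diff)
qed (simp add: comb_0 heis_form_zero)

text \<open>The subgroup generated by lifts of the rows of \<open>M\<close> with central coordinates \<open>t\<close> and by the \<open>k\<close>-th
powers in the centre.\<close>

definition data_subgroup :: "nat \<Rightarrow> nat \<Rightarrow> (nat \<Rightarrow> nat \<Rightarrow> int) \<Rightarrow> (nat \<Rightarrow> int) \<Rightarrow> ((nat \<Rightarrow> int) \<times> (nat \<Rightarrow> int) \<times> int) set" where
  "data_subgroup n k M t = {heis_elt n (comb (2 * n) (2 * n) M e) c | e c. [c = psi n M t (2 * n) e] (mod int k)}"

lemma heis_elt_in_data_subgroup:
  assumes "M \<in> hnf (2 * n)"
  shows "heis_elt n (comb (2 * n) (2 * n) M e) c \<in> data_subgroup n k M t \<longleftrightarrow> [c = psi n M t (2 * n) e] (mod int k)"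
proof
  assume "heis_elt n (comb (2 * n) (2 * n) M e) c \<in> data_subgroup n k M t"
  then obtain f d where fd: "heis_elt n (comb (2 * n) (2 * n) M e) c = heis_elt n (comb (2 * n) (2 * n) M f) d" "[d = psi n M t (2 * n) f] (mod int k)"
    by (auto simp: data_subgroup_def)
  then have eq: "comb (2 * n) (2 * n) M e = comb (2 * n) (2 * n) M f" "c = d" using heis_elt_inject comb_int_vecs by blast+
  then have "psi n M t (2 * n) e = psi n M t (2 * n) f" by (intro psi_ext comb_inj[OF assms eq(1)])
  then show "[c = psi n M t (2 * n) e] (mod int k)" using fd(2) eq(2) by simp
qed (auto simp: data_subgroup_def)

lemma data_subgroup_int_vecs:
  assumes "heis_elt n x c \<in> data_subgroup n k M t" "x \<in> int_vecs (2 * n)"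
  shows "x \<in> lat (2 * n) M"
proof -
  obtain e d where "heis_elt n x c = heis_elt n (comb (2 * n) (2 * n) M e) d" using assms(1) by (auto simp: data_subgroup_def)
  then have "x = comb (2 * n) (2 * n) M e" using heis_elt_inject[OF assms(2) comb_int_vecs] by blast
  then show ?thesis by blast
qed

lemma data_subgroup_subgroup:
  assumes M: "M \<in> hnf (2 * n)" and iso: "isotropic n k M"
  shows "subgroup (data_subgroup n k M t) (heisenberg n)"
proof (rule group.subgroupI[OF group_heisenberg])
  let ?c = "comb (2 * n) (2 * n) M" let ?p = "psi n M t (2 * n)"
  show "data_subgroup n k M t \<subseteq> carrier (heisenberg n)" by (auto simp: data_subgroup_def heis_elt_carrier)
  show "data_subgroup n k M t \<noteq> {}" unfolding data_subgroup_def using cong_refl by blast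
  fix a assume "a \<in> data_subgroup n k M t"
  then obtain e c where a: "a = heis_elt n (?c e) c" "[c = ?p e] (mod int k)" by (auto simp: data_subgroup_def)
  have "[?p (\<lambda>i. e i + - e i) = ?p e + ?p (\<lambda>i. - e i) + heis_form n (?c e) (?c (\<lambda>i. - e i))] (mod int k)"
    by (rule psi_add[OF iso])
  moreover have neg: "?c (\<lambda>i. - e i) = (\<lambda>j. - ?c e j)" by (auto simp: comb_def sum_negf)
  ultimately have "[0 = ?p e + ?p (\<lambda>i. - e i) - heis_form n (?c e) (?c e)] (mod int k)"
    using psi_zero[of "2 * n" "\<lambda>i. 0"] by (simp add: heis_form_minus_right)
  then have "[- c + heis_form n (?c e) (?c e) = ?p (\<lambda>i. - e i)] (mod int k)"
    using dvd_diff[of "int k" "0 - (?p e + ?p (\<lambda>i. - e i) - heis_form n (?c e) (?c e))" "c - ?p e"] a(2)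
    by (simp add: cong_iff_dvd_diff algebra_simps)
  then show "inv\<^bsub>heisenberg n\<^esub> a \<in> data_subgroup n k M t"
    unfolding a heis_elt_inv data_subgroup_def neg[symmetric] by blast
  fix b assume "b \<in> data_subgroup n k M t"
  then obtain f d where b: "b = heis_elt n (?c f) d" "[d = ?p f] (mod int k)" by (auto simp: data_subgroup_def)
  have "[c + d + heis_form n (?c e) (?c f) = ?p e + ?p f + heis_form n (?c e) (?c f)] (mod int k)"
    by (intro cong_add a b cong_refl)
  also have "[?p e + ?p f + heis_form n (?c e) (?c f) = ?p (\<lambda>i. e i + f i)] (mod int k)"
    by (rule cong_sym[OF psi_add[OF iso]])
  finally show "a \<otimes>\<^bsub>heisenberg n\<^esub> b \<in> data_subgroup n k M t"
    unfolding a b heis_elt_mult data_subgroup_def comb_add[symmetric] by blast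
qed

text \<open>Indices are computed by exhibiting exactly one element of every coset.\<close>

lemma rcosets_transversal:
  assumes G: "group G" and H: "subgroup H G" and T: "T \<subseteq> carrier G"
    and ex: "\<And>g. g \<in> carrier G \<Longrightarrow> \<exists>h\<in>H. \<exists>t\<in>T. g = h \<otimes>\<^bsub>G\<^esub> t"
    and un: "\<And>h t t'. h \<in> H \<Longrightarrow> t \<in> T \<Longrightarrow> t' \<in> T \<Longrightarrow> t = h \<otimes>\<^bsub>G\<^esub> t' \<Longrightarrow> t = t'"
  shows "bij_betw (\<lambda>t. H #>\<^bsub>G\<^esub> t) T (rcosets\<^bsub>G\<^esub> H)"
proof -
  interpret group G by (rule G)
  show ?thesis
    unfolding bij_betw_def
  proof
    show "inj_on (\<lambda>t. H #>\<^bsub>G\<^esub> t) T"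
    proof (rule inj_onI)
      fix t t' assume t: "t \<in> T" "t' \<in> T" "H #>\<^bsub>G\<^esub> t = H #>\<^bsub>G\<^esub> t'"
      have "t \<in> H #>\<^bsub>G\<^esub> t" by (rule rcos_self) (use t T H in auto)
      then obtain h where "h \<in> H" "t = h \<otimes>\<^bsub>G\<^esub> t'" using t(3) by (auto simp: r_coset_def)
      then show "t = t'" using un t by blast
    qed
    show "(\<lambda>t. H #>\<^bsub>G\<^esub> t) ` T = rcosets\<^bsub>G\<^esub> H"
    proof (intro equalityI subsetI)
      fix A assume "A \<in> rcosets\<^bsub>G\<^esub> H"
      then obtain g where g: "g \<in> carrier G" "A = H #>\<^bsub>G\<^esub> g" by (auto simp: RCOSETS_def)
      obtain h t where ht: "h \<in> H" "t \<in> T" "g = h \<otimes>\<^bsub>G\<^esub> t" using ex[OF g(1)] by blast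
      then have "g \<in> H #>\<^bsub>G\<^esub> t" by (auto simp: r_coset_def)
      then have "H #>\<^bsub>G\<^esub> t = H #>\<^bsub>G\<^esub> g" by (rule repr_independence) (use ht T H in auto)
      then show "A \<in> (\<lambda>t. H #>\<^bsub>G\<^esub> t) ` T" using g ht by blast
    qed (use T in \<open>auto simp: RCOSETS_def\<close>)
  qed
qed

text \<open>The elements with projection in \<open>hbox\<close> and central coordinate in \<open>0, ..., k - 1\<close> form a transversal.\<close>

lemma data_subgroup_index:
  assumes M: "M \<in> hnf (2 * n)" and iso: "isotropic n k M" and k: "k > 0"
  shows "finite (rcosets\<^bsub>heisenberg n\<^esub> data_subgroup n k M t) \<and>
    int (card (rcosets\<^bsub>heisenberg n\<^esub> data_subgroup n k M t)) = int k * (\<Prod>j<2 * n. M j j)"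
proof -
  let ?N = "2 * n" let ?G = "heisenberg n"
  define X where "X = hbox ?N M \<times> {0..<int k}"
  define T where "T = (\<lambda>(y, c). heis_elt n y c) ` X"
  have box_iv: "hbox ?N M \<subseteq> int_vecs ?N" by (auto simp: hbox_def int_vecs_def)
  have "bij_betw (\<lambda>t. data_subgroup n k M t' #>\<^bsub>?G\<^esub> t) T (rcosets\<^bsub>?G\<^esub> data_subgroup n k M t')" for t'
  proof (rule rcosets_transversal[OF group_heisenberg data_subgroup_subgroup[OF M iso]])
    show "T \<subseteq> carrier ?G" by (auto simp: T_def heis_elt_carrier)
  next
    fix g assume "g \<in> carrier ?G"
    then obtain x c where g: "g = heis_elt n x c" "x \<in> int_vecs ?N" using heis_elt_surj by blast
    obtain y e where y: "y \<in> hbox ?N M" "x = (\<lambda>j. comb ?N ?N M e j + y j)" using box_reduce[OF M g(2)] by blast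
    define c' where "c' = (c - psi n M t' ?N e - heis_form n (comb ?N ?N M e) y) mod int k"
    define s where "s = c - c' - heis_form n (comb ?N ?N M e) y"
    have "[s = psi n M t' ?N e] (mod int k)"
    proof -
      have "s - psi n M t' ?N e = (c - psi n M t' ?N e - heis_form n (comb ?N ?N M e) y) - c'" by (simp add: s_def)
      then show ?thesis unfolding cong_iff_dvd_diff c'_def by (simp add: minus_mod_eq_mult_div)
    qed
    then have "heis_elt n (comb ?N ?N M e) s \<in> data_subgroup n k M t'" by (simp add: heis_elt_in_data_subgroup[OF M])
    moreover have "heis_elt n y c' \<in> T" unfolding T_def X_def using y k by (intro image_eqI[of _ _ "(y, c')"]) (auto simp: c'_def)
    moreover have "g = heis_elt n (comb ?N ?N M e) s \<otimes>\<^bsub>?G\<^esub> heis_elt n y c'"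
      unfolding heis_elt_mult g y(2) s_def by simp
    ultimately show "\<exists>h\<in>data_subgroup n k M t'. \<exists>t\<in>T. g = h \<otimes>\<^bsub>?G\<^esub> t" by blast
  next
    fix h u u' assume h: "h \<in> data_subgroup n k M t'" and u: "u \<in> T" "u' \<in> T" and eq: "u = h \<otimes>\<^bsub>?G\<^esub> u'"
    obtain y c where y: "y \<in> hbox ?N M" "0 \<le> c" "c < int k" "u = heis_elt n y c" using u(1) by (auto simp: T_def X_def)
    obtain y' c' where y': "y' \<in> hbox ?N M" "0 \<le> c'" "c' < int k" "u' = heis_elt n y' c'" using u(2) by (auto simp: T_def X_def)
    obtain e s where e: "h = heis_elt n (comb ?N ?N M e) s" "[s = psi n M t' ?N e] (mod int k)" using h by (auto simp: data_subgroup_def)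
    have iv: "(\<lambda>j. comb ?N ?N M e j + y' j) \<in> int_vecs ?N"
      using y'(1) by (auto simp: comb_def int_vecs_def hbox_def)
    have "heis_elt n y c = heis_elt n (\<lambda>j. comb ?N ?N M e j + y' j) (s + c' + heis_form n (comb ?N ?N M e) y')"
      using eq unfolding y y' e heis_elt_mult .
    then have e1: "y = (\<lambda>j. comb ?N ?N M e j + y' j)" "c = s + c' + heis_form n (comb ?N ?N M e) y'"
      using heis_elt_inject[OF subsetD[OF box_iv y(1)] iv] by auto
    have yy: "y = y'" by (rule box_unique[OF M y(1) y'(1), of e]) (simp add: e1(1))
    then have c0: "comb ?N ?N M e = (\<lambda>_. 0)" using e1(1) by (auto simp: fun_eq_iff)
    have "e i = 0" if "i < ?N" for i using comb_small[OF M _ that, of e] hnf_diag[OF M] by (simp add: c0)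
    then have "psi n M t' ?N e = 0" by (rule psi_zero)
    then have "[c = c'] (mod int k)" using e1(2) e(2) by (simp add: c0 heis_form_zero cong_iff_dvd_diff)
    then have "c = c'" using y y' by (simp add: cong_def)
    with yy show "u = u'" by (simp add: y y')
  qed
  then have b: "bij_betw (\<lambda>u. data_subgroup n k M t #>\<^bsub>?G\<^esub> u) T (rcosets\<^bsub>?G\<^esub> data_subgroup n k M t)" .
  have inj: "inj_on (\<lambda>(y, c). heis_elt n y c) X"
    by (rule inj_onI) (use box_iv heis_elt_inject in \<open>auto simp: X_def subset_iff\<close>)
  have cb: "finite (hbox ?N M)" "int (card (hbox ?N M)) = (\<Prod>j<?N. M j j)"
    using card_box[of ?N M] hnf_diag[OF M] by auto
  have "finite T" using cb by (simp add: T_def X_def)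
  moreover have "card T = card X" unfolding T_def by (rule card_image[OF inj])
  moreover have "card X = card (hbox ?N M) * k" unfolding X_def by (simp add: card_cartesian_product)
  ultimately show ?thesis
    using bij_betw_finite[OF b] bij_betw_same_card[OF b] cb by (simp add: mult.commute)
qed

text \<open>The parameters of the subgroups of index \<open>m\<close>.\<close>

definition subgroup_data :: "nat \<Rightarrow> nat \<Rightarrow> (nat \<times> (nat \<Rightarrow> nat \<Rightarrow> int) \<times> (nat \<Rightarrow> int)) set" where
  "subgroup_data n m = {(k, M, t). k \<ge> 1 \<and> M \<in> hnf (2 * n) \<and> isotropic n k M \<and> t \<in> cube {..<2 * n} k \<and>
     int k * (\<Prod>j<2 * n. M j j) = int m}"

text \<open>The parameters \<open>t\<close> are read off as the central coordinates over the rows of \<open>M\<close>.\<close>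

lemma psi_unit:
  assumes "i < r"
  shows "psi n M t r (\<lambda>l. of_bool (l = i)) = t i"
  using assms
proof (induction r)
  case (Suc r)
  show ?case
  proof (cases "i = r")
    case True
    have "psi n M t r (\<lambda>l. of_bool (l = i)) = 0" by (rule psi_zero) (use True in auto)
    moreover have "comb (2 * n) r M (\<lambda>l. of_bool (l = i)) = (\<lambda>_. 0)" using True by (auto simp: comb_def)
    ultimately show ?thesis using True by (simp add: triangle_def heis_form_zero)
  next
    case False
    then show ?thesis using Suc by (simp add: triangle_def)
  qed
qed simp

text \<open>The subgroup determines \<open>k\<close> by its intersection with the centre, \<open>M\<close> by its projection through
\<open>hnf_unique\<close>, and then \<open>t\<close> modulo \<open>k\<close> by \<open>psi_unit\<close>.\<close>

lemma data_subgroup_inj: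
  assumes A: "k \<ge> 1" "M \<in> hnf (2 * n)" "isotropic n k M" "t \<in> cube {..<2 * n} k"
    and B: "k' \<ge> 1" "M' \<in> hnf (2 * n)" "isotropic n k' M'" "t' \<in> cube {..<2 * n} k'"
    and eq: "data_subgroup n k M t = data_subgroup n k' M' t'"
  shows "k = k' \<and> M = M' \<and> t = t'"
proof -
  have center: "heis_elt n (\<lambda>_. 0) c \<in> data_subgroup n k M t \<longleftrightarrow> int k dvd c" if "M \<in> hnf (2 * n)" for k M t c
  proof -
    have "comb (2 * n) (2 * n) M (\<lambda>_. 0) = (\<lambda>_. 0)" by (auto simp: comb_def)
    then have "heis_elt n (\<lambda>_. 0) c \<in> data_subgroup n k M t \<longleftrightarrow> [c = psi n M t (2 * n) (\<lambda>_. 0)] (mod int k)"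
      using heis_elt_in_data_subgroup[OF that, of "\<lambda>_. 0" c k t] by simp
    then show ?thesis by (simp add: psi_zero cong_0_iff)
  qed
  have "int k dvd c \<longleftrightarrow> int k' dvd c" for c using center[OF A(2), of c k t] center[OF B(2), of c k' t'] eq by simp
  then have "k dvd k'" "k' dvd k" by (meson dvd_refl int_dvd_int_iff)+
  then have k: "k = k'" by (simp add: dvd_antisym)
  have sub: "lat (2 * n) M \<subseteq> lat (2 * n) M'" if "M \<in> hnf (2 * n)" "data_subgroup n k M t = data_subgroup n k' M' t'" for k M t k' M' t'
  proof
    fix x assume "x \<in> lat (2 * n) M"
    then obtain e where x: "x = comb (2 * n) (2 * n) M e" by blast
    have "heis_elt n x (psi n M t (2 * n) e) \<in> data_subgroup n k' M' t'"
      unfolding that(2)[symmetric] x by (simp add: heis_elt_in_data_subgroup[OF that(1)])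
    then show "x \<in> lat (2 * n) M'" by (rule data_subgroup_int_vecs) (simp add: x comb_int_vecs)
  qed
  have M: "M = M'" by (rule hnf_unique[OF A(2) B(2)]) (use sub[OF A(2) eq] sub[OF B(2) eq[symmetric]] in blast)
  have "t i = t' i" for i
  proof (cases "i < 2 * n")
    case True
    have "heis_elt n (comb (2 * n) (2 * n) M (\<lambda>l. of_bool (l = i))) (t i) \<in> data_subgroup n k M t"
      by (simp add: heis_elt_in_data_subgroup[OF A(2)] psi_unit[OF True])
    then have "heis_elt n (comb (2 * n) (2 * n) M (\<lambda>l. of_bool (l = i))) (t i) \<in> data_subgroup n k M t'" using eq k M by simp
    then have "[t i = t' i] (mod int k)" by (simp add: heis_elt_in_data_subgroup[OF A(2)] psi_unit[OF True])
    then show ?thesis using True A(4) B(4) k by (auto simp: cube_def cong_def)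
  qed (use A(4) B(4) in \<open>auto simp: cube_def\<close>)
  then show ?thesis using k M by auto
qed

context
  fixes n :: nat and H :: "((nat \<Rightarrow> int) \<times> (nat \<Rightarrow> int) \<times> int) set"
  assumes H: "subgroup H (heisenberg n)" and fin: "finite (rcosets\<^bsub>heisenberg n\<^esub> H)"
begin

lemma H_mult: "heis_elt n x c \<in> H \<Longrightarrow> heis_elt n y d \<in> H \<Longrightarrow> heis_elt n (\<lambda>i. x i + y i) (c + d + heis_form n x y) \<in> H"
  using subgroup.m_closed[OF H, of "heis_elt n x c" "heis_elt n y d"] by (simp add: heis_elt_mult)

lemma H_inv: "heis_elt n x c \<in> H \<Longrightarrow> heis_elt n (\<lambda>i. - x i) (- c + heis_form n x x) \<in> H"
  using subgroup.m_inv_closed[OF H, of "heis_elt n x c"] by (simp add: heis_elt_inv)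

lemma H_one: "heis_elt n (\<lambda>_. 0) 0 \<in> H"
  using subgroup.one_closed[OF H] by (simp add: heis_elt_one)

lemma H_diff: "heis_elt n x c \<in> H \<Longrightarrow> heis_elt n x d \<in> H \<Longrightarrow> heis_elt n (\<lambda>_. 0) (c - d) \<in> H"
  using H_mult[OF _ H_inv, of x c x d] by (simp add: heis_form_minus_right)

lemma H_center: "heis_elt n x c \<in> H \<Longrightarrow> heis_elt n (\<lambda>_. 0) d \<in> H \<Longrightarrow> heis_elt n x (c + d) \<in> H"
  using H_mult[of x c "\<lambda>_. 0" d] by (simp add: heis_form_zero)

text \<open>Two powers of an element lie in the same coset of a subgroup of finite index.\<close>

lemma H_power: "\<exists>m>0. \<exists>d. heis_elt n (\<lambda>i. int m * x i) d \<in> H \<and> (x = (\<lambda>_. 0) \<longrightarrow> d = int m * c)"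
proof -
  interpret group "heisenberg n" by (rule group_heisenberg)
  let ?g = "heis_elt n x c"
  have g: "?g \<in> carrier (heisenberg n)" by (rule heis_elt_carrier)
  have pow: "\<exists>d. ?g [^]\<^bsub>heisenberg n\<^esub> (m::nat) = heis_elt n (\<lambda>i. int m * x i) d \<and> (x = (\<lambda>_. 0) \<longrightarrow> d = int m * c)" for m
  proof (induction m)
    case 0
    have "heis_elt n (\<lambda>i. int 0 * x i) 0 = \<one>\<^bsub>heisenberg n\<^esub>" by (simp add: heis_elt_one)
    then show ?case by (intro exI[of _ 0]) simp
  next
    case (Suc m)
    then obtain d where d: "?g [^]\<^bsub>heisenberg n\<^esub> m = heis_elt n (\<lambda>i. int m * x i) d" "x = (\<lambda>_. 0) \<longrightarrow> d = int m * c" by blast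
    have "?g [^]\<^bsub>heisenberg n\<^esub> Suc m = heis_elt n (\<lambda>i. int (Suc m) * x i) (d + c + heis_form n (\<lambda>i. int m * x i) x)"
      using d by (simp add: heis_elt_mult algebra_simps)
    then show ?case using d(2) by (intro exI[of _ "d + c + heis_form n (\<lambda>i. int m * x i) x"]) (auto simp: heis_form_zero algebra_simps)
  qed
  have "\<not> inj (\<lambda>m::nat. H #>\<^bsub>heisenberg n\<^esub> (?g [^]\<^bsub>heisenberg n\<^esub> m))"
  proof
    assume "inj (\<lambda>m::nat. H #>\<^bsub>heisenberg n\<^esub> (?g [^]\<^bsub>heisenberg n\<^esub> m))"
    moreover have "range (\<lambda>m::nat. H #>\<^bsub>heisenberg n\<^esub> (?g [^]\<^bsub>heisenberg n\<^esub> m)) \<subseteq> rcosets\<^bsub>heisenberg n\<^esub> H"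
      using g by (auto simp: RCOSETS_def)
    ultimately show False using fin finite_imageD finite_subset infinite_UNIV_nat by blast
  qed
  then obtain a b :: nat where ab: "a < b" "H #>\<^bsub>heisenberg n\<^esub> (?g [^]\<^bsub>heisenberg n\<^esub> a) = H #>\<^bsub>heisenberg n\<^esub> (?g [^]\<^bsub>heisenberg n\<^esub> b)"
    unfolding inj_def by (metis linorder_neqE_nat)
  have "?g [^]\<^bsub>heisenberg n\<^esub> b \<in> H #>\<^bsub>heisenberg n\<^esub> (?g [^]\<^bsub>heisenberg n\<^esub> b)" by (rule rcos_self) (use g H in auto)
  then have "?g [^]\<^bsub>heisenberg n\<^esub> b \<in> H #>\<^bsub>heisenberg n\<^esub> (?g [^]\<^bsub>heisenberg n\<^esub> a)" using ab by simp
  then obtain h where h: "h \<in> H" "?g [^]\<^bsub>heisenberg n\<^esub> b = h \<otimes>\<^bsub>heisenberg n\<^esub> (?g [^]\<^bsub>heisenberg n\<^esub> a)"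
    by (auto simp: r_coset_def)
  have "?g [^]\<^bsub>heisenberg n\<^esub> b = ?g [^]\<^bsub>heisenberg n\<^esub> (b - a) \<otimes>\<^bsub>heisenberg n\<^esub> ?g [^]\<^bsub>heisenberg n\<^esub> a"
    using ab(1) g by (simp add: nat_pow_mult)
  then have "h = ?g [^]\<^bsub>heisenberg n\<^esub> (b - a)"
    using h g subgroup.mem_carrier[OF H h(1)] right_cancel[of "?g [^]\<^bsub>heisenberg n\<^esub> a" h "?g [^]\<^bsub>heisenberg n\<^esub> (b - a)"]
    by (simp add: nat_pow_closed)
  then show ?thesis using h(1) pow[of "b - a"] ab(1) by (intro exI[of _ "b - a"]) auto
qed

text \<open>The intersection with the centre gives \<open>k\<close>, the Hermite normal form of the projection gives \<open>M\<close>, and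
central coordinates over the rows, reduced modulo \<open>k\<close>, give \<open>t\<close>. Commutators in \<open>H\<close> are central,
which makes \<open>M\<close> isotropic; the ordered products of powers of the chosen lifts then exhaust \<open>H\<close> up to
\<open>k\<close>-th powers in the centre.\<close>

lemma data_subgroup_surj: "\<exists>k\<ge>1. \<exists>M\<in>hnf (2 * n). \<exists>t\<in>cube {..<2 * n} k. isotropic n k M \<and> H = data_subgroup n k M t"
proof -
  let ?N = "2 * n"
  define Z where "Z = {c. heis_elt n (\<lambda>_. 0) c \<in> H}"
  obtain m where m: "m > 0" "heis_elt n (\<lambda>_. 0) (int m * 1) \<in> H" using H_power[of "\<lambda>_. 0" 1] by auto
  have "\<exists>d>0. \<forall>z. z \<in> Z \<longleftrightarrow> d dvd z"
    by (rule int_subgroup_generator[of _ "int m"]) (use m H_diff in \<open>auto simp: Z_def\<close>)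
  then obtain d where d: "d > 0" "\<And>z. heis_elt n (\<lambda>_. 0) z \<in> H \<longleftrightarrow> d dvd z" by (auto simp: Z_def)
  define k where "k = nat d"
  have k: "k \<ge> 1" "d = int k" using d(1) by (auto simp: k_def)
  have cong: "heis_elt n x c' \<in> H" if "heis_elt n x c \<in> H" "[c = c'] (mod int k)" for x c c'
  proof -
    have "heis_elt n (\<lambda>_. 0) (c' - c) \<in> H" using that(2) d(2) k by (simp add: cong_iff_dvd_diff dvd_diff_commute)
    from H_center[OF that(1) this] show ?thesis by simp
  qed
  define L where "L = {x \<in> int_vecs ?N. \<exists>c. heis_elt n x c \<in> H}"
  have "is_lat ?N L"
    unfolding is_lat_def
  proof (intro conjI ballI allI impI)
    show "(\<lambda>_. 0) \<in> L" using H_one by (auto simp: L_def int_vecs_def)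
    fix x y assume "x \<in> L" "y \<in> L"
    then obtain c c' where "x \<in> int_vecs ?N" "y \<in> int_vecs ?N" "heis_elt n x c \<in> H" "heis_elt n y c' \<in> H" by (auto simp: L_def)
    moreover from H_mult[OF this(3) H_inv[OF this(4)]]
    have "heis_elt n (\<lambda>i. x i - y i) (c + (- c' + heis_form n y y) + heis_form n x (\<lambda>i. - y i)) \<in> H" by simp
    ultimately show "(\<lambda>i. x i - y i) \<in> L" by (auto simp: L_def int_vecs_def)
  next
    fix i assume i: "i < ?N"
    obtain m d where m: "m > 0" "heis_elt n (\<lambda>j. int m * (if j = i then 1 else 0)) d \<in> H"
      using H_power[of "\<lambda>j. if j = i then 1 else 0" 0] by blast
    have "(\<lambda>j. int m * (if j = i then 1 else 0)) = (\<lambda>j. if j = i then int m else 0)" by auto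
    then show "\<exists>m>0. (\<lambda>j. if j = i then m else 0) \<in> L"
      using m i by (intro exI[of _ "int m"]) (auto simp: L_def int_vecs_def)
  qed (auto simp: L_def)
  then obtain M where M: "M \<in> hnf ?N" "L = lat ?N M" using hnf_exists by blast
  define row where "row = (\<lambda>i. comb ?N ?N M (\<lambda>l. of_bool (l = i)))"
  have "\<exists>c. heis_elt n (row i) c \<in> H" for i
  proof -
    have "row i \<in> L" unfolding M(2) row_def by blast
    then show ?thesis by (simp add: L_def)
  qed
  then obtain c where c: "\<And>i. heis_elt n (row i) (c i) \<in> H" by metis
  define t where "t = (\<lambda>i. if i < ?N then c i mod int k else 0)"
  have t: "t \<in> cube {..<?N} k" using k by (auto simp: t_def cube_def)
  have rt: "heis_elt n (row i) (t i) \<in> H" if "i < ?N" for i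
    using c[of i] by (rule cong) (use that in \<open>simp add: t_def cong_def\<close>)
  have heis_form_row: "heis_form n (row i) y = heis_form n (mat_row M i) y" "heis_form n y (row i) = heis_form n y (mat_row M i)" if "i < ?N" for i y
    unfolding row_def comb_unit[OF that] mat_row_def by (rule heis_form_cong; simp)+
  have comm: "int k dvd heis_form n x y - heis_form n y x" if "heis_elt n x a \<in> H" "heis_elt n y b \<in> H" for x y a b
  proof -
    have "heis_elt n (\<lambda>i. x i + y i) (a + b + heis_form n x y) \<in> H" "heis_elt n (\<lambda>i. x i + y i) (a + b + heis_form n y x) \<in> H"
      using H_mult[OF that] H_mult[OF that(2,1)] by (simp_all add: add.commute)
    from H_diff[OF this] show ?thesis using d(2) k by simp
  qed
  have iso: "isotropic n k M"
    unfolding isotropic_heis_form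
  proof (intro allI)
    fix i j
    have rw0: "heis_form n (mat_row M i) y = 0" "heis_form n y (mat_row M i) = 0" if "\<not> i < ?N" for i y
      using that hnf_zero[OF M(1), of _ i] unfolding heis_form_def mat_row_def by (auto intro!: sum.neutral)
    show "[heis_form n (mat_row M i) (mat_row M j) = heis_form n (mat_row M j) (mat_row M i)] (mod int k)"
    proof (cases "i < ?N \<and> j < ?N")
      case True
      then have "int k dvd heis_form n (row i) (row j) - heis_form n (row j) (row i)" using comm[OF rt rt] by blast
      then show ?thesis using True heis_form_row by (simp add: cong_iff_dvd_diff)
    qed (use rw0 in auto)
  qed
  have mul: "heis_elt n (\<lambda>j. a * row i j) (a * t i + triangle a * heis_form n (row i) (row i)) \<in> H" if i: "i < ?N" for a i
  proof -
    have nat: "heis_elt n (\<lambda>j. int a * row i j) (int a * t i + triangle (int a) * heis_form n (row i) (row i)) \<in> H" for a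
    proof (induction a)
      case 0
      then show ?case using H_one by (simp add: triangle_def)
    next
      case (Suc a)
      have "triangle (int (Suc a)) = triangle (int a) + int a" using triangle_add[of "int a" 1] by (simp add: triangle_def add.commute)
      then show ?case using H_mult[OF Suc rt[OF i]] by (simp add: heis_form_mult_left algebra_simps)
    qed
    show ?thesis
    proof (cases "a \<ge> 0")
      case True
      then show ?thesis using nat[of "nat a"] by simp
    next
      case False
      define b where "b = int (nat (- a))"
      have a: "a = - b" using False by (simp add: b_def)
      have tb: "triangle a = - triangle b + b * b" using triangle_add[of b "- b"] a by (simp add: triangle_def)
      have "heis_elt n (\<lambda>j. - (b * row i j)) (- (b * t i + triangle b * heis_form n (row i) (row i)) + heis_form n (\<lambda>j. b * row i j) (\<lambda>j. b * row i j)) \<in> H"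
        by (rule H_inv) (use nat[of "nat (- a)"] in \<open>simp add: b_def\<close>)
      then show ?thesis unfolding heis_form_mult_left heis_form_mult_right tb unfolding a by (simp add: algebra_simps)
    qed
  qed
  have mem: "r \<le> ?N \<Longrightarrow> heis_elt n (comb ?N r M e) (psi n M t r e) \<in> H" for r e
  proof (induction r)
    case 0
    then show ?case using H_one by (simp add: comb_0)
  next
    case (Suc r)
    have r: "r < ?N" using Suc by simp
    have "heis_elt n (\<lambda>j. comb ?N r M e j + e r * row r j) (psi n M t r e + (e r * t r + triangle (e r) * heis_form n (row r) (row r)) + heis_form n (comb ?N r M e) (\<lambda>j. e r * row r j)) \<in> H"
      by (rule H_mult[OF _ mul[OF r]]) (use Suc in simp)
    moreover have "(\<lambda>j. comb ?N r M e j + e r * row r j) = comb ?N (Suc r) M e"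
      unfolding row_def comb_unit[OF r] by (auto simp: comb_def fun_eq_iff)
    ultimately show ?case unfolding heis_form_mult_right using heis_form_row[OF r] by (simp add: algebra_simps)
  qed
  have "H = data_subgroup n k M t"
  proof (intro equalityI subsetI)
    fix g assume g: "g \<in> H"
    then obtain x b where x: "g = heis_elt n x b" "x \<in> int_vecs ?N" using heis_elt_surj subgroup.mem_carrier[OF H] by blast
    then have "x \<in> L" using g by (auto simp: L_def)
    then obtain e where e: "x = comb ?N ?N M e" using M(2) by blast
    have "heis_elt n (\<lambda>_. 0) (b - psi n M t ?N e) \<in> H" by (rule H_diff[of x]) (use g x e mem in auto)
    then have "[b = psi n M t ?N e] (mod int k)" using d(2) k by (simp add: cong_iff_dvd_diff)
    then show "g \<in> data_subgroup n k M t" unfolding x e by (simp add: heis_elt_in_data_subgroup[OF M(1)])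
  next
    fix g assume "g \<in> data_subgroup n k M t"
    then obtain e b where g: "g = heis_elt n (comb ?N ?N M e) b" "[b = psi n M t ?N e] (mod int k)" by (auto simp: data_subgroup_def)
    show "g \<in> H" unfolding g(1) by (rule cong[OF mem[of ?N e] cong_sym[OF g(2)]]) simp
  qed
  then show ?thesis using k(1) M(1) t iso by blast
qed

end

lemma num_subgroups_subgroup_data: "num_subgroups_of_index (heisenberg n) m = card (subgroup_data n m)"
proof -
  have "bij_betw (\<lambda>(k, M, t). data_subgroup n k M t) (subgroup_data n m)
     {H. subgroup H (heisenberg n) \<and> finite (rcosets\<^bsub>heisenberg n\<^esub> H) \<and> card (rcosets\<^bsub>heisenberg n\<^esub> H) = m}"
    unfolding bij_betw_def
  proof
    show "inj_on (\<lambda>(k, M, t). data_subgroup n k M t) (subgroup_data n m)"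
      by (rule inj_onI) (use data_subgroup_inj in \<open>auto simp: subgroup_data_def\<close>)
    show "(\<lambda>(k, M, t). data_subgroup n k M t) ` subgroup_data n m = {H. subgroup H (heisenberg n) \<and> finite (rcosets\<^bsub>heisenberg n\<^esub> H) \<and> card (rcosets\<^bsub>heisenberg n\<^esub> H) = m}"
    proof (intro equalityI subsetI)
      fix H assume "H \<in> (\<lambda>(k, M, t). data_subgroup n k M t) ` subgroup_data n m"
      then obtain k M t where kMt: "(k, M, t) \<in> subgroup_data n m" "H = data_subgroup n k M t" by auto
      then show "H \<in> {H. subgroup H (heisenberg n) \<and> finite (rcosets\<^bsub>heisenberg n\<^esub> H) \<and> card (rcosets\<^bsub>heisenberg n\<^esub> H) = m}"
        using data_subgroup_subgroup[of M n k t] data_subgroup_index[of M n k t] by (auto simp: subgroup_data_def)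
    next
      fix H assume H: "H \<in> {H. subgroup H (heisenberg n) \<and> finite (rcosets\<^bsub>heisenberg n\<^esub> H) \<and> card (rcosets\<^bsub>heisenberg n\<^esub> H) = m}"
      then obtain k M t where kMt: "k \<ge> 1" "M \<in> hnf (2 * n)" "t \<in> cube {..<2 * n} k" "isotropic n k M" "H = data_subgroup n k M t"
        using data_subgroup_surj[of H n] by blast
      then have "(k, M, t) \<in> subgroup_data n m" using H data_subgroup_index[of M n k t] by (auto simp: subgroup_data_def)
      then show "H \<in> (\<lambda>(k, M, t). data_subgroup n k M t) ` subgroup_data n m" using kMt(5) by force
    qed
  qed
  then show ?thesis unfolding num_subgroups_of_index_def by (simp add: bij_betw_same_card)
qed

section \<open>Random alternating forms modulo an integer\<close>

definition wedge :: "nat \<Rightarrow> (nat \<Rightarrow> int) \<Rightarrow> (nat \<Rightarrow> int) \<Rightarrow> nat \<Rightarrow> nat \<Rightarrow> int" where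
  "wedge s a u i j = int s * (a i * u j - a j * u i)"

text \<open>The probability that \<open>B\<close> plus a sum of random wedges vanishes modulo \<open>q\<close>, with one wedge of two
uniform vectors for each list element \<open>s\<close>, scaled by \<open>s\<close>. The scaling is what makes the recursion
over powers of a prime close up.\<close>

fun van_prob :: "nat \<Rightarrow> nat set \<Rightarrow> nat list \<Rightarrow> (nat \<Rightarrow> nat \<Rightarrow> int) \<Rightarrow> real" where
  "van_prob q I [] B = of_bool (\<forall>i\<in>I. \<forall>j\<in>I. int q dvd B i j)"
| "van_prob q I (s # cs) B = avg I q (\<lambda>a. avg I q (\<lambda>u. van_prob q I cs (\<lambda>i j. B i j + wedge s a u i j)))"

lemma van_prob_cong:
  "(\<And>i j. i \<in> I \<Longrightarrow> j \<in> I \<Longrightarrow> [B i j = B' i j] (mod int q)) \<Longrightarrow> van_prob q I cs B = van_prob q I cs B'"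
proof (induction cs arbitrary: B B')
  case Nil
  then have "int q dvd B i j \<longleftrightarrow> int q dvd B' i j" if "i \<in> I" "j \<in> I" for i j
    using that cong_dvd_iff by blast
  then show ?case by auto
next
  case (Cons s cs)
  show ?case unfolding van_prob.simps
    by (intro avg_cong Cons.IH) (auto intro!: cong_add Cons.prems)
qed

lemma van_prob_nonneg: "van_prob q I cs B \<ge> 0"
  by (induction cs arbitrary: B) (auto intro: avg_nonneg)

lemma van_prob_1: "finite I \<Longrightarrow> van_prob 1 I cs B = 1"
  by (induction cs arbitrary: B) (auto simp: avg_const)

lemma cong_wedge:
  "(\<And>i. [a i = a' i] (mod m)) \<Longrightarrow> (\<And>i. [u i = u' i] (mod m)) \<Longrightarrow> [wedge s a u i j = wedge s a' u' i j] (mod m)"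
  unfolding wedge_def by (intro cong_mult cong_diff cong_refl) auto

lemma periodic_van_prob_u: "periodic q (\<lambda>u. van_prob q I cs (\<lambda>i j. B i j + wedge s a u i j))"
  unfolding periodic_def by (auto intro!: van_prob_cong cong_add cong_wedge)

lemma periodic_van_prob_a: "periodic q (\<lambda>a. avg I q (\<lambda>u. van_prob q I cs (\<lambda>i j. B i j + wedge s a u i j)))"
  unfolding periodic_def by (auto intro!: avg_cong van_prob_cong cong_add cong_wedge)

lemma avg_swap2:
  "avg I q (\<lambda>a. avg I q (\<lambda>b. avg J r (\<lambda>c. avg J r (\<lambda>d. F a b c d))))
   = avg J r (\<lambda>c. avg J r (\<lambda>d. avg I q (\<lambda>a. avg I q (\<lambda>b. F a b c d))))"
proof -
  have "avg I q (\<lambda>a. avg I q (\<lambda>b. avg J r (\<lambda>c. avg J r (\<lambda>d. F a b c d))))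
     = avg I q (\<lambda>a. avg J r (\<lambda>c. avg I q (\<lambda>b. avg J r (\<lambda>d. F a b c d))))"
    by (subst avg_swap) simp
  also have "\<dots> = avg I q (\<lambda>a. avg J r (\<lambda>c. avg J r (\<lambda>d. avg I q (\<lambda>b. F a b c d))))"
    by (subst (3) avg_swap) simp
  also have "\<dots> = avg J r (\<lambda>c. avg I q (\<lambda>a. avg J r (\<lambda>d. avg I q (\<lambda>b. F a b c d))))"
    by (subst avg_swap) simp
  also have "\<dots> = avg J r (\<lambda>c. avg J r (\<lambda>d. avg I q (\<lambda>a. avg I q (\<lambda>b. F a b c d))))"
    by (rule avg_cong) (rule avg_swap)
  finally show ?thesis .
qed

lemma van_prob_swap: "van_prob q I (s # t # cs) B = van_prob q I (t # s # cs) B"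
  unfolding van_prob.simps by (subst avg_swap2) (simp add: add_ac)

text \<open>The random wedges are independent, so their order is immaterial.\<close>

lemma van_prob_rotate: "van_prob q I (cs @ [s]) B = van_prob q I (s # cs) B"
proof (induction cs arbitrary: B)
  case (Cons c cs)
  have "van_prob q I ((c # cs) @ [s]) B = van_prob q I (c # s # cs) B"
    unfolding append_Cons van_prob.simps(2)[of q I c] using Cons.IH by (simp only:)
  then show ?case by (simp only: van_prob_swap)
qed simp

text \<open>The effect of a row operation on a bilinear form: the same operation on both indices.\<close>

definition act :: "nat \<Rightarrow> nat \<Rightarrow> int \<Rightarrow> (nat \<Rightarrow> nat \<Rightarrow> int) \<Rightarrow> nat \<Rightarrow> nat \<Rightarrow> int" where
  "act i i' c B a b = rowop i i' c (\<lambda>b. rowop i i' c (\<lambda>a. B a b) a) b"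

lemma act_wedge: "act i i' c (wedge s x y) a b = wedge s (rowop i i' c x) (rowop i i' c y) a b"
  by (cases "a = i"; cases "b = i") (simp_all add: act_def rowop_def wedge_def algebra_simps)

lemma act_add: "act i i' c (\<lambda>a b. B a b + B' a b) x y = act i i' c B x y + act i i' c B' x y"
  by (cases "x = i"; cases "y = i") (simp_all add: act_def rowop_def algebra_simps)

lemma act_dvd:
  assumes "i \<in> I" "i' \<in> I" "\<And>a b. a \<in> I \<Longrightarrow> b \<in> I \<Longrightarrow> m dvd B a b" "a \<in> I" "b \<in> I"
  shows "m dvd act i i' c B a b"
  using assms by (auto simp: act_def rowop_def)

lemma act_inverse: "i \<noteq> i' \<Longrightarrow> act i i' (- c) (act i i' c B) a b = B a b"
  by (cases "a = i"; cases "b = i") (simp_all add: act_def rowop_def algebra_simps)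

text \<open>Row operations permute the uniform vectors, and they do not affect whether a form vanishes.\<close>

lemma van_prob_act:
  assumes i: "i \<in> I" "i' \<in> I" "i \<noteq> i'" and q: "q > 0"
  shows "van_prob q I cs (act i i' c B) = van_prob q I cs B"
proof (induction cs arbitrary: B)
  case Nil
  have "(\<forall>a\<in>I. \<forall>b\<in>I. int q dvd act i i' c B a b) \<longleftrightarrow> (\<forall>a\<in>I. \<forall>b\<in>I. int q dvd B a b)"
  proof
    assume *: "\<forall>a\<in>I. \<forall>b\<in>I. int q dvd act i i' c B a b"
    have "int q dvd act i i' (- c) (act i i' c B) a b" if "a \<in> I" "b \<in> I" for a b
      by (rule act_dvd[OF i(1,2)]) (use * that in auto)
    then show "\<forall>a\<in>I. \<forall>b\<in>I. int q dvd B a b" by (simp only: act_inverse[OF i(3)]) blast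
  qed (use act_dvd[OF i(1,2)] in blast)
  then show ?case by simp
next
  case (Cons s cs)
  have "van_prob q I (s # cs) (act i i' c B) = avg I q (\<lambda>a. avg I q (\<lambda>u. van_prob q I cs (\<lambda>x y. act i i' c B x y + wedge s (rowop i i' c a) u x y)))"
    unfolding van_prob.simps
    by (rule avg_rowop[OF periodic_van_prob_a q i(1,2,3), symmetric])
  also have "\<dots> = avg I q (\<lambda>a. avg I q (\<lambda>u. van_prob q I cs (\<lambda>x y. act i i' c B x y + wedge s (rowop i i' c a) (rowop i i' c u) x y)))"
    by (intro avg_cong avg_rowop[OF periodic_van_prob_u q i(1,2,3), symmetric])
  also have "\<dots> = avg I q (\<lambda>a. avg I q (\<lambda>u. van_prob q I cs (act i i' c (\<lambda>x y. B x y + wedge s a u x y))))"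
    by (intro avg_cong arg_cong[of _ _ "van_prob q I cs"] ext) (simp add: act_add act_wedge)
  also have "\<dots> = van_prob q I (s # cs) B" by (simp only: Cons.IH van_prob.simps)
  finally show ?case .
qed

text \<open>A form that is a multiple of \<open>p\<close> vanishes modulo \<open>q * p\<close> if and only if its quotient vanishes modulo
\<open>q\<close>.\<close>

lemma van_prob_scale:
  assumes "finite I" "p > 0" "q > 0"
  shows "van_prob (q * p) I (map ((*) p) cs) (\<lambda>i j. int p * B i j) = van_prob q I cs B"
proof (induction cs arbitrary: B)
  case Nil
  then show ?case using assms by (simp add: mult.commute[of "int q"])
next
  case (Cons s cs)
  have "van_prob (q * p) I (map ((*) p) (s # cs)) (\<lambda>i j. int p * B i j)
     = avg I (q * p) (\<lambda>a. avg I (q * p) (\<lambda>u. van_prob (q * p) I (map ((*) p) cs) (\<lambda>i j. int p * (B i j + wedge s a u i j))))"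
    by (simp add: wedge_def algebra_simps)
  also have "\<dots> = avg I (q * p) (\<lambda>a. avg I (q * p) (\<lambda>u. van_prob q I cs (\<lambda>i j. B i j + wedge s a u i j)))"
    by (simp only: Cons.IH)
  also have "\<dots> = avg I (q * p) (\<lambda>a. avg I q (\<lambda>u. van_prob q I cs (\<lambda>i j. B i j + wedge s a u i j)))"
    by (intro avg_cong avg_period[OF assms(1) periodic_van_prob_u]) (use assms in auto)
  also have "\<dots> = avg I q (\<lambda>a. avg I q (\<lambda>u. van_prob q I cs (\<lambda>i j. B i j + wedge s a u i j)))"
    by (intro avg_period[OF assms(1) periodic_van_prob_a]) (use assms in auto)
  finally show ?case by simp
qed

text \<open>The congruences determine every entry of \<open>u\<close> modulo \<open>q\<close>.\<close>

lemma avg_single: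
  assumes "finite J" "q > 0"
  shows "avg J q (\<lambda>u. of_bool (\<forall>j\<in>J. int q dvd b j + u j)) = 1 / real q ^ card J"
proof -
  define w where "w = (\<lambda>j. if j \<in> J then (- b j) mod int q else 0)"
  have "{u \<in> cube J q. \<forall>j\<in>J. int q dvd b j + u j} = {w}"
  proof (intro equalityI subsetI)
    fix u assume u: "u \<in> {u \<in> cube J q. \<forall>j\<in>J. int q dvd b j + u j}"
    have "u j = w j" for j
    proof (cases "j \<in> J")
      case True
      then have "0 \<le> u j" "u j < int q" "int q dvd b j + u j" using u by (auto simp: cube_def)
      then have "[u j = - b j] (mod int q)" "u j mod int q = u j"
        by (simp_all add: cong_iff_dvd_diff add.commute)
      then show ?thesis using True by (simp add: w_def cong_def)
    qed (use u in \<open>auto simp: w_def cube_def\<close>)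
    then show "u \<in> {w}" by auto
  next
    fix u assume "u \<in> {w}"
    moreover have "int q dvd b j + (- b j) mod int q" for j
      by (metis add.commute diff_minus_eq_add dvd_minus_mod dvd_diff_commute minus_diff_eq mod_eq_dvd_iff mod_mod_trivial)
    ultimately show "u \<in> {u \<in> cube J q. \<forall>j\<in>J. int q dvd b j + u j}" using assms by (auto simp: w_def cube_def)
  qed
  then have "(\<Sum>u\<in>cube J q. of_bool (\<forall>j\<in>J. int q dvd b j + u j)) = (1::real)"
    using finite_cube[OF assms(1), of q] by (simp add: of_bool_def sum.inter_filter[symmetric])
  then show ?thesis by (simp add: avg_def)
qed

lemma avg_indep:
  assumes "finite I" "r \<in> I" "\<And>v a. F (v(r := a)) = F v" "q > 0"
  shows "avg I q F = avg (I - {r}) q F"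
proof -
  have "avg (insert r (I - {r})) q F = (\<Sum>a<q. avg (I - {r}) q (\<lambda>v. F (v(r := int a)))) / real q"
    by (rule avg_insert) (use assms in auto)
  then show ?thesis using assms by (simp add: insert_absorb)
qed

definition alternating :: "(nat \<Rightarrow> nat \<Rightarrow> int) \<Rightarrow> bool" where
  "alternating B \<longleftrightarrow> (\<forall>i j. B i j = - B j i)"

text \<open>Wedging with a unit vector in direction \<open>r\<close> adds a free uniform value to each entry of row \<open>r\<close>.
These \<open>card I - 1\<close> values must cancel what is there, and the rows other than \<open>r\<close> are left untouched.\<close>

lemma van_prob_pivot:
  assumes I: "finite I" "r \<in> I" and q: "q > 0" and B: "alternating B"
  shows "avg I q (\<lambda>u. van_prob q I cs (\<lambda>i j. B i j + wedge 1 (\<lambda>i. of_bool (i = r)) u i j))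
    = van_prob q (I - {r}) cs B / real q ^ (card I - 1)"
  using B
proof (induction cs arbitrary: B)
  case Nil
  define P where "P \<longleftrightarrow> (\<forall>i\<in>I - {r}. \<forall>j\<in>I - {r}. int q dvd B i j)"
  have Bs: "B i j = - B j i" for i j using Nil unfolding alternating_def by blast
  have Brr: "B r r = 0" using Bs[of r r] by simp
  have "(\<forall>i\<in>I. \<forall>j\<in>I. int q dvd B i j + wedge 1 (\<lambda>i. of_bool (i = r)) u i j)
      \<longleftrightarrow> P \<and> (\<forall>j\<in>I - {r}. int q dvd B r j + u j)" (is "?L \<longleftrightarrow> ?R") for u
  proof
    assume L: ?L
    have "int q dvd B i j" if "i \<in> I - {r}" "j \<in> I - {r}" for i j
    proof -
      have "int q dvd B i j + wedge 1 (\<lambda>i. of_bool (i = r)) u i j" using L that by blast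
      then show ?thesis using that by (simp add: wedge_def)
    qed
    moreover have "int q dvd B r j + u j" if "j \<in> I - {r}" for j
    proof -
      have "int q dvd B r j + wedge 1 (\<lambda>i. of_bool (i = r)) u r j" using L that I by blast
      then show ?thesis using that by (simp add: wedge_def)
    qed
    ultimately show ?R unfolding P_def by blast
  next
    assume R: ?R
    show ?L
    proof (intro ballI)
      fix i j assume ij: "i \<in> I" "j \<in> I"
      show "int q dvd B i j + wedge 1 (\<lambda>i. of_bool (i = r)) u i j"
      proof (cases "i = r"; cases "j = r")
        assume "i \<noteq> r" "j = r"
        then have "B i j + wedge 1 (\<lambda>i. of_bool (i = r)) u i j = - (B r i + u i)"
          using Bs[of i r] by (simp add: wedge_def)
        then show ?thesis using R ij \<open>i \<noteq> r\<close> by (metis DiffI dvd_minus_iff singletonD)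
      qed (use R ij Brr in \<open>auto simp: P_def wedge_def\<close>)
    qed
  qed
  then have "avg I q (\<lambda>u. van_prob q I [] (\<lambda>i j. B i j + wedge 1 (\<lambda>i. of_bool (i = r)) u i j))
     = of_bool P * avg I q (\<lambda>u. of_bool (\<forall>j\<in>I - {r}. int q dvd B r j + u j))"
    unfolding avg_cmult[symmetric] by (simp add: of_bool_conj)
  also have "avg I q (\<lambda>u. of_bool (\<forall>j\<in>I - {r}. int q dvd B r j + u j)) = avg (I - {r}) q (\<lambda>u. of_bool (\<forall>j\<in>I - {r}. int q dvd B r j + u j))"
    by (rule avg_indep) (use I q in auto)
  also have "\<dots> = 1 / real q ^ card (I - {r})" by (rule avg_single) (use I q in auto)
  finally show ?case using I by (simp add: P_def)
next
  case (Cons s cs)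
  have alt: "alternating (\<lambda>i j. B i j + wedge s a u i j)" for a u
    unfolding alternating_def
  proof (intro allI)
    fix i j
    have "B i j = - B j i" using Cons.prems unfolding alternating_def by blast
    then show "B i j + wedge s a u i j = - (B j i + wedge s a u j i)" by (simp add: wedge_def algebra_simps)
  qed
  let ?e = "\<lambda>i. of_bool (i = r) :: int"
  have "avg I q (\<lambda>u. van_prob q I (s # cs) (\<lambda>i j. B i j + wedge 1 ?e u i j))
     = avg I q (\<lambda>a. avg I q (\<lambda>u'. avg I q (\<lambda>u. van_prob q I cs (\<lambda>i j. (B i j + wedge s a u' i j) + wedge 1 ?e u i j))))"
  proof -
    have "avg I q (\<lambda>u. van_prob q I (s # cs) (\<lambda>i j. B i j + wedge 1 ?e u i j))
      = avg I q (\<lambda>u. avg I q (\<lambda>a. avg I q (\<lambda>u'. van_prob q I cs (\<lambda>i j. (B i j + wedge s a u' i j) + wedge 1 ?e u i j))))"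
      by (simp add: add_ac)
    also have "\<dots> = avg I q (\<lambda>a. avg I q (\<lambda>u. avg I q (\<lambda>u'. van_prob q I cs (\<lambda>i j. (B i j + wedge s a u' i j) + wedge 1 ?e u i j))))"
      by (rule avg_swap)
    also have "\<dots> = avg I q (\<lambda>a. avg I q (\<lambda>u'. avg I q (\<lambda>u. van_prob q I cs (\<lambda>i j. (B i j + wedge s a u' i j) + wedge 1 ?e u i j))))"
      by (rule avg_cong) (rule avg_swap)
    finally show ?thesis .
  qed
  also have "\<dots> = avg I q (\<lambda>a. avg I q (\<lambda>u'. van_prob q (I - {r}) cs (\<lambda>i j. B i j + wedge s a u' i j))) / real q ^ (card I - 1)"
    by (simp only: Cons.IH[OF alt]) (simp add: avg_def sum_divide_distrib[symmetric])
  also have "avg I q (\<lambda>a. avg I q (\<lambda>u'. van_prob q (I - {r}) cs (\<lambda>i j. B i j + wedge s a u' i j)))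
     = avg I q (\<lambda>a. avg (I - {r}) q (\<lambda>u'. van_prob q (I - {r}) cs (\<lambda>i j. B i j + wedge s a u' i j)))"
    by (intro avg_cong avg_indep I q van_prob_cong) (simp add: wedge_def)
  also have "\<dots> = avg (I - {r}) q (\<lambda>a. avg (I - {r}) q (\<lambda>u'. van_prob q (I - {r}) cs (\<lambda>i j. B i j + wedge s a u' i j)))"
    by (intro avg_indep I q avg_cong van_prob_cong) (simp add: wedge_def)
  finally show ?case by simp
qed

text \<open>A uniform vector modulo a power of \<open>p\<close> is divisible by \<open>p\<close> with probability \<open>1 / p ^ card I\<close>, and is
then \<open>p\<close> times a uniform vector. Otherwise it has a unit entry, row operations take it to a unit
vector, and \<open>van_prob_pivot\<close> applies.\<close>

lemma van_prob_free_column: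
  assumes I: "finite I" "r \<in> I" "card I \<ge> 2" and p: "prime p"
  shows "van_prob (p ^ Suc k) I (1 # cs) (\<lambda>_ _. 0) = van_prob (p ^ Suc k) I (p # cs) (\<lambda>_ _. 0) / real p ^ card I
     + (1 - 1 / real p ^ card I) * (van_prob (p ^ Suc k) (I - {r}) cs (\<lambda>_ _. 0) / real (p ^ Suc k) ^ (card I - 1))"
proof -
  define q where "q = p ^ Suc k"
  define m where "m = p ^ k"
  have qm: "q = p * m" by (simp add: q_def m_def)
  have p0: "p > 0" using p prime_gt_0_nat by blast
  have q0: "q > 0" "m > 0" using p0 by (simp_all add: q_def m_def)
  define F where "F = (\<lambda>a. avg I q (\<lambda>u. van_prob q I cs (\<lambda>i j. wedge 1 a u i j)))"
  have perF: "periodic q F" using periodic_van_prob_a[of q I cs "\<lambda>_ _. 0" 1] by (simp add: F_def)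
  have rowF: "F (rowop i i' c a) = F a" if i: "i \<in> I" "i' \<in> I" "i \<noteq> i'" for i i' c a
  proof -
    have "F (rowop i i' c a) = avg I q (\<lambda>u. van_prob q I cs (\<lambda>x y. wedge 1 (rowop i i' c a) (rowop i i' c u) x y))"
      unfolding F_def using avg_rowop[OF periodic_van_prob_u[of q I cs "\<lambda>_ _. 0" 1 "rowop i i' c a"] q0(1) i(1,2,3), of c] by simp
    also have "\<dots> = avg I q (\<lambda>u. van_prob q I cs (act i i' c (wedge 1 a u)))"
      by (intro avg_cong arg_cong[of _ _ "van_prob q I cs"] ext) (simp add: act_wedge)
    also have "\<dots> = F a" unfolding F_def by (simp add: van_prob_act[OF i q0(1)])
    finally show ?thesis .
  qed
  obtain s where s: "s \<in> I" "r \<noteq> s"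
  proof -
    have "card (I - {r}) \<ge> 1" using I by simp
    then have "I - {r} \<noteq> {}" by (metis card.empty not_one_le_zero)
    then show ?thesis using that by blast
  qed
  have unimod: "F a = F (\<lambda>i. of_bool (i = r))" if a: "a \<in> cube I q" "\<not> (\<forall>i\<in>I. int p dvd a i)" for a
  proof -
    have "F a = F (\<lambda>i. if i \<in> I then if i = r then gcd (int q) (Gcd (a ` I)) else 0 else a i)"
      by (rule euclid_mod[OF rowF I(1,2) s perF])
    also have "gcd (int q) (Gcd (a ` I)) = 1"
    proof -
      have "\<not> int p dvd Gcd (a ` I)" using a(2) by (auto simp: dvd_Gcd_iff)
      then have "coprime (int p) (Gcd (a ` I))" using p by (intro prime_imp_coprime) auto
      then show ?thesis by (simp add: q_def coprime_iff_gcd_eq_1[symmetric])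
    qed
    also have "(\<lambda>i. if i \<in> I then if i = r then 1 else 0 else a i) = (\<lambda>i. of_bool (i = r))"
      using a(1) I by (auto simp: cube_def fun_eq_iff split: if_splits)
    finally show ?thesis .
  qed
  define D where "D = {a \<in> cube I q. \<forall>i\<in>I. int p dvd a i}"
  have finC: "finite (cube I q)" by (rule finite_cube[OF I(1)])
  have D: "D \<subseteq> cube I q" by (auto simp: D_def)
  have sumD: "sum F D = (\<Sum>w\<in>cube I m. F (\<lambda>i. int p * w i))"
    unfolding D_def qm by (rule sum_cube_multiples[OF p0])
  have cardD: "card D = m ^ card I"
    using sum_cube_multiples[OF p0, where I = I and m = m and F = "\<lambda>_. 1 :: nat"] card_cube[OF I(1), of m] by (simp add: D_def qm)
  have wp: "wedge 1 (\<lambda>i. int p * w i) u = wedge p w u" for w u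
    by (auto simp: wedge_def fun_eq_iff algebra_simps)
  have "periodic m (\<lambda>w. F (\<lambda>i. int p * w i))"
    unfolding periodic_def
  proof (intro allI impI)
    fix v w :: "nat \<Rightarrow> int" assume "\<forall>i. [v i = w i] (mod int m)"
    then have "[int p * v i = int p * w i] (mod int q)" for i
      by (simp add: qm cong_iff_dvd_diff right_diff_distrib[symmetric])
    then show "F (\<lambda>i. int p * v i) = F (\<lambda>i. int p * w i)" by (rule periodic_D[OF perF])
  qed
  then have "avg I q (\<lambda>w. F (\<lambda>i. int p * w i)) = avg I m (\<lambda>w. F (\<lambda>i. int p * w i))"
    using avg_period[where I = I and d = m and F = "\<lambda>w. F (\<lambda>i. int p * w i)" and m = p] I p0 q0 by (simp add: qm mult.commute)
  moreover have "avg I q (\<lambda>w. F (\<lambda>i. int p * w i)) = van_prob q I (p # cs) (\<lambda>_ _. 0)"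
    unfolding F_def wp by simp
  ultimately have "avg I m (\<lambda>w. F (\<lambda>i. int p * w i)) = van_prob q I (p # cs) (\<lambda>_ _. 0)" by (simp only:)
  moreover have "sum F D = real m ^ card I * avg I m (\<lambda>w. F (\<lambda>i. int p * w i))"
    using q0 by (simp add: sumD avg_def)
  ultimately have "sum F D = real m ^ card I * van_prob q I (p # cs) (\<lambda>_ _. 0)" by (simp only:)
  moreover have "sum F (cube I q - D) = real (q ^ card I - m ^ card I) * F (\<lambda>i. of_bool (i = r))"
  proof -
    have "sum F (cube I q - D) = (\<Sum>a\<in>cube I q - D. F (\<lambda>i. of_bool (i = r)))"
      by (rule sum.cong) (auto simp: D_def intro: unimod)
    then show ?thesis using card_Diff_subset[OF finite_subset[OF D finC] D] card_cube[OF I(1), of q] cardD by simp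
  qed
  moreover have "F (\<lambda>i. of_bool (i = r)) = van_prob q (I - {r}) cs (\<lambda>_ _. 0) / real q ^ (card I - 1)"
    using van_prob_pivot[OF I(1,2) q0(1), of "\<lambda>_ _. 0" cs] by (simp add: F_def alternating_def)
  moreover have "sum F (cube I q) = sum F D + sum F (cube I q - D)"
    using sum.subset_diff[OF D finC] by (simp add: add.commute)
  ultimately have "avg I q F = (real m ^ card I * van_prob q I (p # cs) (\<lambda>_ _. 0)
      + real (q ^ card I - m ^ card I) * (van_prob q (I - {r}) cs (\<lambda>_ _. 0) / real q ^ (card I - 1))) / real q ^ card I"
    by (simp add: avg_def)
  also have "real (q ^ card I - m ^ card I) = real q ^ card I - real m ^ card I"
  proof -
    have "m ^ card I \<le> q ^ card I" using p0 by (intro power_mono) (auto simp: qm)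
    then show ?thesis by (simp add: of_nat_diff)
  qed
  also have "real m ^ card I = real q ^ card I / real p ^ card I"
    using p0 by (simp add: qm power_mult_distrib)
  also have "(real q ^ card I / real p ^ card I * van_prob q I (p # cs) (\<lambda>_ _. 0)
      + (real q ^ card I - real q ^ card I / real p ^ card I) * (van_prob q (I - {r}) cs (\<lambda>_ _. 0) / real q ^ (card I - 1))) / real q ^ card I
    = van_prob q I (p # cs) (\<lambda>_ _. 0) / real p ^ card I + (1 - 1 / real p ^ card I) * (van_prob q (I - {r}) cs (\<lambda>_ _. 0) / real q ^ (card I - 1))"
  proof -
    have "(Q / P * x + (Q - Q / P) * y) / Q = x / P + (1 - 1 / P) * y" if "Q \<noteq> 0" for Q P x y :: real
      using that by (simp add: field_simps)
    note cancel = this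
    show ?thesis by (rule cancel) (use q0 in simp)
  qed
  finally show ?thesis by (simp add: F_def q_def)
qed

lemma sum_crt:
  fixes f g :: "int \<Rightarrow> real"
  assumes co: "coprime m n" and "m > 0" "n > 0" and f: "\<And>x. f (x mod int m) = f x" and g: "\<And>x. g (x mod int n) = g x"
  shows "(\<Sum>a<m * n. f (int a) * g (int a)) = (\<Sum>a<m. f (int a)) * (\<Sum>b<n. g (int b))"
proof -
  define h where "h = (\<lambda>a::nat. (a mod m, a mod n))"
  have inj: "inj_on h {..<m * n}"
  proof (rule inj_onI)
    fix a b assume ab: "a \<in> {..<m * n}" "b \<in> {..<m * n}" "h a = h b"
    then have "[a = b] (mod m)" "[a = b] (mod n)" by (auto simp: h_def cong_def)
    then have "[a = b] (mod m * n)" using co by (rule coprime_cong_mult_nat)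
    then show "a = b" using ab by (simp add: cong_def)
  qed
  have "h ` {..<m * n} = {..<m} \<times> {..<n}"
  proof (rule card_subset_eq)
    show "h ` {..<m * n} \<subseteq> {..<m} \<times> {..<n}" using assms by (auto simp: h_def)
  qed (use card_image[OF inj] in auto)
  with inj have b: "bij_betw h {..<m * n} ({..<m} \<times> {..<n})" by (simp add: bij_betw_def)
  have "(\<Sum>a<m * n. f (int a) * g (int a)) = (\<Sum>a<m * n. (\<lambda>(x, y). f (int x) * g (int y)) (h a))"
  proof (rule sum.cong)
    fix a
    show "f (int a) * g (int a) = (\<lambda>(x, y). f (int x) * g (int y)) (h a)"
      using f[of "int a"] g[of "int a"] by (simp add: h_def of_nat_mod)
  qed simp
  also have "\<dots> = (\<Sum>(x, y)\<in>{..<m} \<times> {..<n}. f (int x) * g (int y))"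
    by (rule sum.reindex_bij_betw[OF b])
  finally show ?thesis by (simp add: sum_product sum.cartesian_product)
qed

lemma avg_crt:
  assumes "finite I" and co: "coprime m n" "m > 0" "n > 0" and "periodic m F" "periodic n G"
  shows "avg I (m * n) (\<lambda>v. F v * G v) = avg I m F * avg I n G"
  using assms(1,5,6)
proof (induction I arbitrary: F G rule: finite_induct)
  case (insert x I)
  have "(\<Sum>a<m * n. avg I (m * n) (\<lambda>v. F (v(x := int a)) * G (v(x := int a))))
     = (\<Sum>a<m * n. avg I m (\<lambda>v. F (v(x := int a))) * avg I n (\<lambda>v. G (v(x := int a))))"
    by (intro sum.cong refl insert.IH periodic_upd) (rule insert)+
  also have "\<dots> = (\<Sum>a<m. avg I m (\<lambda>v. F (v(x := int a)))) * (\<Sum>b<n. avg I n (\<lambda>v. G (v(x := int b))))"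
  proof (rule sum_crt[OF co, of "\<lambda>z. avg I m (\<lambda>v. F (v(x := z)))" "\<lambda>z. avg I n (\<lambda>v. G (v(x := z)))"])
    show "avg I m (\<lambda>v. F (v(x := z mod int m))) = avg I m (\<lambda>v. F (v(x := z)))" for z
      by (intro avg_cong periodic_D[OF insert.prems(1)]) auto
    show "avg I n (\<lambda>v. G (v(x := z mod int n))) = avg I n (\<lambda>v. G (v(x := z)))" for z
      by (intro avg_cong periodic_D[OF insert.prems(2)]) auto
  qed
  finally show ?case using insert by (simp add: avg_insert)
qed (simp add: avg_empty)

text \<open>Uniform residues modulo \<open>m * n\<close> are independent pairs of uniform residues, and divisibility by
\<open>m * n\<close> is the conjunction of the two divisibilities.\<close>

lemma van_prob_crt:
  assumes "finite I" "coprime m n" "m > 0" "n > 0"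
  shows "van_prob (m * n) I cs B = van_prob m I cs B * van_prob n I cs B"
proof (induction cs arbitrary: B)
  case Nil
  have "int (m * n) dvd B i j \<longleftrightarrow> int m dvd B i j \<and> int n dvd B i j" for i j
    using assms(2) by (metis coprime_int_iff divides_mult dvd_mult_left dvd_mult_right of_nat_mult)
  then show ?case by (auto simp: of_bool_def)
next
  case (Cons s cs)
  have "van_prob (m * n) I (s # cs) B = avg I (m * n) (\<lambda>a. avg I (m * n) (\<lambda>u. van_prob m I cs (\<lambda>i j. B i j + wedge s a u i j) * van_prob n I cs (\<lambda>i j. B i j + wedge s a u i j)))"
    by (simp only: van_prob.simps Cons.IH)
  also have "\<dots> = avg I (m * n) (\<lambda>a. avg I m (\<lambda>u. van_prob m I cs (\<lambda>i j. B i j + wedge s a u i j)) * avg I n (\<lambda>u. van_prob n I cs (\<lambda>i j. B i j + wedge s a u i j)))"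
    by (intro avg_cong avg_crt assms periodic_van_prob_u)
  also have "\<dots> = van_prob m I (s # cs) B * van_prob n I (s # cs) B"
    unfolding van_prob.simps by (intro avg_crt assms periodic_van_prob_a)
  finally show ?case .
qed

text \<open>With \<open>t = 1 / p\<close>, this is the probability that exactly \<open>m\<close> of \<open>l\<close> successive free columns contain a
unit, each of them consuming a row of the \<open>N\<close> available ones, times the probability
\<open>t ^ (Suc k * (rows - 1))\<close> of cancelling each pivot row.\<close>

definition lev :: "real \<Rightarrow> nat \<Rightarrow> nat \<Rightarrow> nat \<Rightarrow> nat \<Rightarrow> real" where
  "lev t k N l m = qbin t (l - m) m * (\<Prod>i<m. (1 - t ^ (N - i)) * t ^ (Suc k * (N - 1 - i))) * t ^ ((N - m) * (l - m))"

lemma lev_0: "lev t k N l 0 = t ^ (N * l)"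
  by (simp add: lev_def)

lemma prod_lessThan_shift: "(\<Prod>i<Suc m. f i) = f 0 * (\<Prod>i<m. f (Suc i))" for f :: "nat \<Rightarrow> real"
  by (rule prod.lessThan_Suc_shift)

text \<open>Either the first of the columns has no unit, with probability \<open>t ^ N\<close>, or it is a pivot and takes
one row away.\<close>

lemma lev_Suc:
  assumes "m \<le> l" "l < N"
  shows "lev t k N (Suc l) (Suc m) = (if m < l then t ^ N * lev t k N l (Suc m) else 0)
    + (1 - t ^ N) * t ^ (Suc k * (N - 1)) * lev t k (N - 1) l m"
proof -
  define P where "P = (\<Prod>i<Suc m. (1 - t ^ (N - i)) * t ^ (Suc k * (N - 1 - i)))"
  have P: "P = (1 - t ^ N) * t ^ (Suc k * (N - 1)) * (\<Prod>i<m. (1 - t ^ (N - 1 - i)) * t ^ (Suc k * (N - 1 - 1 - i)))"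
    unfolding P_def prod_lessThan_shift by (simp add: diff_diff_add)
  have L1: "lev t k N (Suc l) (Suc m) = qbin t (l - m) (Suc m) * P * t ^ ((N - Suc m) * (l - m))"
    by (simp add: lev_def P_def)
  have L2: "(1 - t ^ N) * t ^ (Suc k * (N - 1)) * lev t k (N - 1) l m = qbin t (l - m) m * P * t ^ ((N - Suc m) * (l - m))"
    unfolding lev_def P by simp
  show ?thesis
  proof (cases "m < l")
    case False
    then have "m = l" using assms by simp
    then show ?thesis unfolding L1 L2 by (simp add: qbin_0)
  next
    case True
    then obtain b where b: "l - m = Suc b" "l - Suc m = b" by (metis Suc_diff_Suc)
    have "t ^ N * t ^ ((N - Suc m) * b) = t ^ Suc m * t ^ ((N - Suc m) * Suc b)"
    proof -
      have "N + (N - Suc m) * b = Suc m + (N - Suc m) * Suc b" using assms by simp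
      then show ?thesis by (metis power_add)
    qed
    then have "t ^ N * lev t k N l (Suc m) = t ^ Suc m * qbin t b (Suc m) * P * t ^ ((N - Suc m) * (l - m))"
      unfolding lev_def P_def b by (simp add: mult_ac)
    then show ?thesis using True unfolding L1 L2 b(1) by (simp add: algebra_simps)
  qed
qed

text \<open>The probability modulo \<open>p ^ k\<close> that a sum of \<open>j\<close> random wedges in dimension \<open>n + j\<close> vanishes. Of the
\<open>j\<close> columns, \<open>m\<close> have a pivot and the remaining \<open>j - m\<close> are divisible by \<open>p\<close>, which lowers the
exponent.\<close>

fun sol :: "real \<Rightarrow> nat \<Rightarrow> nat \<Rightarrow> nat \<Rightarrow> real" where
  "sol t n 0 j = 1"
| "sol t n (Suc k) j = (\<Sum>m\<le>j. lev t k (n + j) j m * sol t n k (j - m))"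

text \<open>Columns are treated one after the other by \<open>van_prob_free_column\<close>, those found to be divisible by
\<open>p\<close> being moved to the end of the list. Once all are divisible, \<open>van_prob_scale\<close> divides the modulus
by \<open>p\<close>.\<close>

lemma van_prob_level:
  assumes p: "prime p" and n: "n \<ge> 1"
    and sol: "\<And>I b. finite I \<Longrightarrow> card I = n + b \<Longrightarrow> van_prob (p ^ k) I (replicate b 1) (\<lambda>_ _. 0) = sol (1 / real p) n k b"
  shows "finite I \<Longrightarrow> card I = n + j + l \<Longrightarrow>
    van_prob (p ^ Suc k) I (replicate l 1 @ replicate j p) (\<lambda>_ _. 0)
      = (\<Sum>m\<le>l. lev (1 / real p) k (card I) l m * sol (1 / real p) n k (j + l - m))"
proof (induction l arbitrary: I j)
  case 0
  have p0: "p > 0" using p prime_gt_0_nat by blast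
  have "van_prob (p ^ k * p) I (map ((*) p) (replicate j 1)) (\<lambda>i j. int p * 0) = van_prob (p ^ k) I (replicate j 1) (\<lambda>_ _. 0)"
    by (rule van_prob_scale) (use 0 p0 in auto)
  then show ?case using sol[of I j] 0 by (simp add: lev_0 mult.commute)
next
  case (Suc l)
  define t where "t = 1 / real p"
  define N where "N = card I"
  have N: "N = n + j + Suc l" using Suc by (simp add: N_def)
  then have "card I \<noteq> 0" by (simp add: N_def)
  then obtain r where r: "r \<in> I" by (metis card.empty ex_in_conv)
  define S where "S = (\<lambda>m. sol t n k m)"
  have tp: "1 / real p ^ e = t ^ e" for e by (simp add: t_def power_one_over)
  have "van_prob (p ^ Suc k) I (replicate (Suc l) 1 @ replicate j p) (\<lambda>_ _. 0)
     = van_prob (p ^ Suc k) I (p # (replicate l 1 @ replicate j p)) (\<lambda>_ _. 0) / real p ^ card I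
     + (1 - 1 / real p ^ card I) * (van_prob (p ^ Suc k) (I - {r}) (replicate l 1 @ replicate j p) (\<lambda>_ _. 0) / real (p ^ Suc k) ^ (card I - 1))"
    using van_prob_free_column[OF Suc.prems(1) r _ p, of k "replicate l 1 @ replicate j p"] Suc.prems n by simp
  also have "van_prob (p ^ Suc k) I (p # (replicate l 1 @ replicate j p)) (\<lambda>_ _. 0) = van_prob (p ^ Suc k) I (replicate l 1 @ replicate (Suc j) p) (\<lambda>_ _. 0)"
    unfolding van_prob_rotate[symmetric] by (simp add: replicate_append_same)
  also have "\<dots> = (\<Sum>m\<le>l. lev t k N l m * S (Suc j + l - m))"
    unfolding t_def S_def N_def by (rule Suc.IH) (use Suc.prems in auto)
  also have "van_prob (p ^ Suc k) (I - {r}) (replicate l 1 @ replicate j p) (\<lambda>_ _. 0) = (\<Sum>m\<le>l. lev t k (card (I - {r})) l m * S (j + l - m))"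
    unfolding t_def S_def by (rule Suc.IH) (use Suc.prems r in auto)
  also have "card (I - {r}) = N - 1" using Suc.prems r by (simp add: N_def)
  also have "1 / real p ^ card I = t ^ N" by (simp add: tp N_def)
  also have "(\<Sum>m\<le>l. lev t k N l m * S (Suc j + l - m)) / real p ^ card I = t ^ N * (\<Sum>m\<le>l. lev t k N l m * S (Suc j + l - m))"
    by (simp add: N_def flip: tp)
  also have "(\<Sum>m\<le>l. lev t k (N - 1) l m * S (j + l - m)) / real (p ^ Suc k) ^ (card I - 1) = t ^ (Suc k * (N - 1)) * (\<Sum>m\<le>l. lev t k (N - 1) l m * S (j + l - m))"
    by (simp add: N_def t_def power_one_over power_mult[symmetric] del: power_Suc)
  also have "t ^ N * (\<Sum>m\<le>l. lev t k N l m * S (Suc j + l - m)) + (1 - t ^ N) * (t ^ (Suc k * (N - 1)) * (\<Sum>m\<le>l. lev t k (N - 1) l m * S (j + l - m)))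
     = (\<Sum>m\<le>Suc l. lev t k N (Suc l) m * S (j + Suc l - m))"
  proof -
    have lN: "l < N" using N by simp
    have "(\<Sum>m\<le>Suc l. lev t k N (Suc l) m * S (j + Suc l - m))
      = lev t k N (Suc l) 0 * S (j + Suc l) + (\<Sum>m\<le>l. lev t k N (Suc l) (Suc m) * S (j + l - m))"
      by (subst sum.atMost_Suc_shift) simp
    also have "(\<Sum>m\<le>l. lev t k N (Suc l) (Suc m) * S (j + l - m))
      = (\<Sum>m\<le>l. (if m < l then t ^ N * lev t k N l (Suc m) else 0) * S (j + l - m)) + (1 - t ^ N) * t ^ (Suc k * (N - 1)) * (\<Sum>m\<le>l. lev t k (N - 1) l m * S (j + l - m))"
      unfolding sum_distrib_left sum.distrib[symmetric]
      by (rule sum.cong) (use lN in \<open>auto simp: lev_Suc algebra_simps\<close>)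
    also have "(\<Sum>m\<le>l. (if m < l then t ^ N * lev t k N l (Suc m) else 0) * S (j + l - m)) = (\<Sum>m<l. t ^ N * lev t k N l (Suc m) * S (j + l - m))"
      by (rule sum.mono_neutral_cong_right) auto
    also have "lev t k N (Suc l) 0 = t ^ N * lev t k N l 0" by (simp add: lev_0 power_add)
    also have "t ^ N * lev t k N l 0 * S (j + Suc l) + ((\<Sum>m<l. t ^ N * lev t k N l (Suc m) * S (j + l - m)) + (1 - t ^ N) * t ^ (Suc k * (N - 1)) * (\<Sum>m\<le>l. lev t k (N - 1) l m * S (j + l - m)))
       = t ^ N * (lev t k N l 0 * S (Suc j + l) + (\<Sum>m<l. lev t k N l (Suc m) * S (j + l - m))) + (1 - t ^ N) * t ^ (Suc k * (N - 1)) * (\<Sum>m\<le>l. lev t k (N - 1) l m * S (j + l - m))"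
      by (simp add: sum_distrib_left algebra_simps)
    also have "lev t k N l 0 * S (Suc j + l) + (\<Sum>m<l. lev t k N l (Suc m) * S (j + l - m)) = (\<Sum>m\<le>l. lev t k N l m * S (Suc j + l - m))"
      by (simp add: sum.atMost_shift)
    finally show ?thesis by simp
  qed
  finally show ?case by (simp add: S_def t_def N_def)
qed

lemma van_prob_prime_power:
  assumes p: "prime p" and n: "n \<ge> 1"
  shows "finite I \<Longrightarrow> card I = n + b \<Longrightarrow> van_prob (p ^ k) I (replicate b 1) (\<lambda>_ _. 0) = sol (1 / real p) n k b"
proof (induction k arbitrary: I b)
  case 0
  then show ?case using van_prob_1 by simp
next
  case (Suc k)
  show ?case using van_prob_level[OF p n Suc.IH Suc.prems(1), of 0 b] Suc.prems by simp
qed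

definition uexp :: "nat \<Rightarrow> nat \<Rightarrow> nat" where "uexp n j = (\<Sum>i<n + j. i)"

lemma lev_prod:
  assumes "b \<le> j"
  shows "lev t k (n + j) j (j - b) = qbin t b (j - b) * (\<Prod>i\<in>{b<..j}. 1 - t ^ (n + i)) * t ^ (Suc k * (uexp n j - uexp n b)) * t ^ ((n + b) * b)"
proof -
  have "(\<Prod>i<j - b. (1 - t ^ (n + j - i)) * t ^ (Suc k * (n + j - 1 - i)))
     = (\<Prod>i\<in>{b<..j}. 1 - t ^ (n + i)) * t ^ (Suc k * (uexp n j - uexp n b))"
  proof -
    have "(\<Prod>i<j - b. 1 - t ^ (n + j - i)) = (\<Prod>i\<in>{b<..j}. 1 - t ^ (n + i))"
      by (rule prod.reindex_bij_witness[of _ "\<lambda>i. j - i" "\<lambda>i. j - i"]) (use assms in auto)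
    moreover have "(\<Prod>i<j - b. t ^ (Suc k * (n + j - 1 - i))) = t ^ (Suc k * (uexp n j - uexp n b))"
    proof -
      have "(\<Sum>i<j - b. n + j - 1 - i) = (\<Sum>i\<in>{n + b..<n + j}. i)"
        by (rule sum.reindex_bij_witness[of _ "\<lambda>i. n + j - 1 - i" "\<lambda>i. n + j - 1 - i"]) (use assms in auto)
      moreover have "uexp n j = uexp n b + (\<Sum>i\<in>{n + b..<n + j}. i)"
        unfolding uexp_def using assms by (simp add: lessThan_atLeast0 sum.atLeastLessThan_concat)
      ultimately show ?thesis by (simp add: power_sum[symmetric] sum_distrib_left[symmetric] del: mult_Suc)
    qed
    ultimately show ?thesis by (simp add: prod.distrib)
  qed
  then show ?thesis using assms by (simp add: lev_def mult_ac)
qed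

lemma uexp_mono: "b \<le> j \<Longrightarrow> uexp n b \<le> uexp n j"
  unfolding uexp_def by (intro sum_mono2) auto

definition xval :: "real \<Rightarrow> nat \<Rightarrow> nat \<Rightarrow> real" where
  "xval t n b = t ^ (uexp n n - uexp n b + (n + b) * b)"

text \<open>Rescaling by a power of \<open>t\<close> removes the dependence of the coefficients in \<open>sol\<close> on \<open>k\<close>.\<close>

definition wsol :: "real \<Rightarrow> nat \<Rightarrow> nat \<Rightarrow> nat \<Rightarrow> real" where
  "wsol t n k j = t ^ (k * (uexp n n - uexp n j)) * sol t n k j"

lemma wsol_0: "wsol t n 0 j = 1"
  by (simp add: wsol_def)

text \<open>With the closed form \<open>block_sum_closed\<close> at \<open>a = - (t ^ n)\<close>, the products over the pivots in \<open>lev\<close>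
are the block sums of the hyperoctahedral group.\<close>

lemma wsol_Suc:
  assumes "j \<le> n"
  shows "wsol t n (Suc k) j = (\<Sum>b\<le>j. xval t n b * block_sum t (- (t ^ n)) b (j - b) * wsol t n k b)"
proof -
  have "sol t n (Suc k) j = (\<Sum>b\<le>j. lev t k (n + j) j (j - b) * sol t n k b)"
    unfolding sol.simps by (rule sum.reindex_bij_witness[of _ "\<lambda>b. j - b" "\<lambda>m. j - m"]) auto
  then have "wsol t n (Suc k) j = (\<Sum>b\<le>j. t ^ (Suc k * (uexp n n - uexp n j)) * (lev t k (n + j) j (j - b) * sol t n k b))"
    by (simp add: wsol_def sum_distrib_left del: mult_Suc)
  also have "\<dots> = (\<Sum>b\<le>j. xval t n b * block_sum t (- (t ^ n)) b (j - b) * wsol t n k b)"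
  proof (rule sum.cong)
    fix b assume "b \<in> {..j}"
    then have b: "b \<le> j" by simp
    have e: "Suc k * (uexp n n - uexp n j) + Suc k * (uexp n j - uexp n b) = (uexp n n - uexp n b) + k * (uexp n n - uexp n b)"
    proof -
      have "(uexp n n - uexp n j) + (uexp n j - uexp n b) = uexp n n - uexp n b"
        using uexp_mono[of b j n] uexp_mono[of j n n] b assms by simp
      then show ?thesis by (metis add_mult_distrib2 mult_Suc)
    qed
    have bs: "block_sum t (- (t ^ n)) b (j - b) = qbin t b (j - b) * (\<Prod>i\<in>{b<..j}. 1 - t ^ (n + i))"
      using b by (simp add: block_sum_closed power_add)
    have "t ^ (Suc k * (uexp n n - uexp n j)) * (lev t k (n + j) j (j - b) * sol t n k b)
      = (t ^ (Suc k * (uexp n n - uexp n j)) * t ^ (Suc k * (uexp n j - uexp n b))) * (t ^ ((n + b) * b) * block_sum t (- (t ^ n)) b (j - b) * sol t n k b)"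
      unfolding lev_prod[OF b] bs by (simp only: mult_ac)
    also have "t ^ (Suc k * (uexp n n - uexp n j)) * t ^ (Suc k * (uexp n j - uexp n b)) = t ^ (uexp n n - uexp n b) * t ^ (k * (uexp n n - uexp n b))"
      by (simp only: e flip: power_add)
    finally show "t ^ (Suc k * (uexp n n - uexp n j)) * (lev t k (n + j) j (j - b) * sol t n k b)
      = xval t n b * block_sum t (- (t ^ n)) b (j - b) * wsol t n k b"
      by (simp only: xval_def wsol_def power_add mult_ac)
  qed simp
  finally show ?thesis .
qed

section \<open>The isotropy probability and the average over Hermite normal forms\<close>

lemma avgL_cong:
  "(\<And>M'. (\<And>j. j \<in> set js \<Longrightarrow> M' j \<in> cube I k) \<Longrightarrow> (\<And>j. j \<notin> set js \<Longrightarrow> M' j = M j) \<Longrightarrow> Q M' = Q' M') \<Longrightarrow>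
    avgL I k js Q M = avgL I k js Q' M"
proof (induction js arbitrary: M)
  case (Cons j js)
  show ?case unfolding avgL.simps
  proof (intro avg_cong Cons.IH)
    fix v M' assume v: "v \<in> cube I k" and M': "\<And>l. l \<in> set js \<Longrightarrow> M' l \<in> cube I k" "\<And>l. l \<notin> set js \<Longrightarrow> M' l = (M(j := v)) l"
    show "Q M' = Q' M'"
    proof (rule Cons.prems)
      show "M' l \<in> cube I k" if "l \<in> set (j # js)" for l
        using M'(1)[of l] M'(2)[of l] v that by (cases "l \<in> set js") auto
      show "M' l = M l" if "l \<notin> set (j # js)" for l using M'(2)[of l] that by auto
    qed
  qed
qed simp

text \<open>The isotropy condition involves the columns \<open>l\<close> and \<open>2 * n - 1 - l\<close> in pairs, and these are peeled
off from the outside.\<close>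

lemma avgL_van_prob:
  "m \<le> n \<Longrightarrow> avgL I k [m..<2 * n - m] (\<lambda>M. of_bool (\<forall>i\<in>I. \<forall>j\<in>I. int k dvd (\<Sum>l<n. wedge 1 (M l) (M (2 * n - 1 - l)) i j))) M
    = van_prob k I (replicate (n - m) 1) (\<lambda>i j. \<Sum>l<m. wedge 1 (M l) (M (2 * n - 1 - l)) i j)"
proof (induction "n - m" arbitrary: m M)
  case 0
  then have "m = n" by simp
  then show ?case by simp
next
  case (Suc d)
  let ?Q = "\<lambda>M. of_bool (\<forall>i\<in>I. \<forall>j\<in>I. int k dvd (\<Sum>l<n. wedge 1 (M l) (M (2 * n - 1 - l)) i j)) :: real"
  have m: "m < n" "Suc m \<le> n" "d = n - Suc m" using Suc by auto
  define r where "r = 2 * n - 1 - m"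
  define mid where "mid = [Suc m..<2 * n - Suc m]"
  have "[m..<2 * n - m] = m # [Suc m..<2 * n - m]" by (rule upt_conv_Cons) (use m in simp)
  moreover have "[Suc m..<2 * n - m] = mid @ [r]"
  proof -
    have "2 * n - m = Suc r" "r = 2 * n - Suc m" using m by (auto simp: r_def)
    then show ?thesis using m by (simp add: mid_def r_def)
  qed
  ultimately have l: "[m..<2 * n - m] = m # mid @ [r]" by simp
  have rm: "r \<notin> set mid" by (auto simp: mid_def r_def)
  have "avgL I k [m..<2 * n - m] ?Q M = avg I k (\<lambda>v. avg I k (\<lambda>w. avgL I k mid ?Q ((M(m := v))(r := w))))"
    unfolding l avgL.simps using avgL_rotate[OF rm] by (simp only:)
  also have "\<dots> = avg I k (\<lambda>v. avg I k (\<lambda>w. van_prob k I (replicate (n - Suc m) 1) (\<lambda>i j. (\<Sum>l<m. wedge 1 (M l) (M (2 * n - 1 - l)) i j) + wedge 1 v w i j)))"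
  proof (intro avg_cong)
    fix v w
    define M' where "M' = (M(m := v))(r := w)"
    have "avgL I k mid ?Q M' = van_prob k I (replicate (n - Suc m) 1) (\<lambda>i j. \<Sum>l<Suc m. wedge 1 (M' l) (M' (2 * n - 1 - l)) i j)"
      unfolding mid_def by (rule Suc.hyps(1)[OF m(3,2)])
    also have "(\<lambda>i j. \<Sum>l<Suc m. wedge 1 (M' l) (M' (2 * n - 1 - l)) i j) = (\<lambda>i j. (\<Sum>l<m. wedge 1 (M l) (M (2 * n - 1 - l)) i j) + wedge 1 v w i j)"
    proof (intro ext)
      fix i j
      have "(\<Sum>l<m. wedge 1 (M' l) (M' (2 * n - 1 - l)) i j) = (\<Sum>l<m. wedge 1 (M l) (M (2 * n - 1 - l)) i j)"
      proof (rule sum.cong)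
        fix l assume "l \<in> {..<m}"
        then have "l \<noteq> m" "l \<noteq> r" "2 * n - 1 - l \<noteq> m" "2 * n - 1 - l \<noteq> r" using m by (auto simp: r_def)
        then show "wedge 1 (M' l) (M' (2 * n - 1 - l)) i j = wedge 1 (M l) (M (2 * n - 1 - l)) i j" by (simp add: M'_def)
      qed simp
      moreover have "M' m = v" "M' (2 * n - 1 - m) = w" using m by (auto simp: M'_def r_def)
      ultimately show "(\<Sum>l<Suc m. wedge 1 (M' l) (M' (2 * n - 1 - l)) i j) = (\<Sum>l<m. wedge 1 (M l) (M (2 * n - 1 - l)) i j) + wedge 1 v w i j"
        by simp
    qed
    finally show "avgL I k mid ?Q ((M(m := v))(r := w)) = van_prob k I (replicate (n - Suc m) 1) (\<lambda>i j. (\<Sum>l<m. wedge 1 (M l) (M (2 * n - 1 - l)) i j) + wedge 1 v w i j)"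
      by (simp only: M'_def)
  qed
  also have "\<dots> = van_prob k I (replicate (n - m) 1) (\<lambda>i j. \<Sum>l<m. wedge 1 (M l) (M (2 * n - 1 - l)) i j)"
  proof -
    have "n - m = Suc (n - Suc m)" using m by simp
    then show ?thesis by (simp only: replicate_Suc van_prob.simps)
  qed
  finally show ?case .
qed

text \<open>The probability that a uniform square matrix of size \<open>2 * n\<close> modulo \<open>k\<close> is isotropic.\<close>

definition iso_prob :: "nat \<Rightarrow> nat \<Rightarrow> real" where
  "iso_prob n k = van_prob k {..<2 * n} (replicate n 1) (\<lambda>_ _. 0)"

lemma isotropic_wedge: "isotropic n k M \<longleftrightarrow> (\<forall>i j. int k dvd (\<Sum>l<n. wedge 1 (M l) (M (2 * n - 1 - l)) i j))"
  by (simp add: isotropic_def wedge_def)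

lemma avgL_isotropic: "avgL {..<2 * n} k [0..<2 * n] (\<lambda>M. of_bool (isotropic n k M)) M0 = iso_prob n k"
proof -
  let ?I = "{..<2 * n}"
  have "avgL ?I k [0..<2 * n] (\<lambda>M. of_bool (isotropic n k M)) M0
     = avgL ?I k [0..<2 * n] (\<lambda>M. of_bool (\<forall>i\<in>?I. \<forall>j\<in>?I. int k dvd (\<Sum>l<n. wedge 1 (M l) (M (2 * n - 1 - l)) i j))) M0"
  proof (rule avgL_cong)
    fix M' assume M': "\<And>j. j \<in> set [0..<2 * n] \<Longrightarrow> M' j \<in> cube ?I k"
    have "M' l i = 0" if "l < 2 * n" "\<not> i < 2 * n" for l i using M'[of l] that by (auto simp: cube_def)
    then have z: "(\<Sum>l<n. wedge 1 (M' l) (M' (2 * n - 1 - l)) i j) = 0" if "\<not> (i < 2 * n \<and> j < 2 * n)" for i j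
      using that by (intro sum.neutral) (auto simp: wedge_def)
    have "int k dvd (\<Sum>l<n. wedge 1 (M' l) (M' (2 * n - 1 - l)) i j)"
      if "\<forall>i\<in>?I. \<forall>j\<in>?I. int k dvd (\<Sum>l<n. wedge 1 (M' l) (M' (2 * n - 1 - l)) i j)" for i j
      using that z[of i j] by (cases "i < 2 * n \<and> j < 2 * n") simp_all
    then have "isotropic n k M' \<longleftrightarrow> (\<forall>i\<in>?I. \<forall>j\<in>?I. int k dvd (\<Sum>l<n. wedge 1 (M' l) (M' (2 * n - 1 - l)) i j))"
      unfolding isotropic_wedge by blast
    then show "of_bool (isotropic n k M') = (of_bool (\<forall>i\<in>?I. \<forall>j\<in>?I. int k dvd (\<Sum>l<n. wedge 1 (M' l) (M' (2 * n - 1 - l)) i j)) :: real)"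
      by (rule arg_cong)
  qed
  also have "\<dots> = iso_prob n k" using avgL_van_prob[of 0 n ?I k M0] by (simp add: iso_prob_def)
  finally show ?thesis .
qed

lemma isotropic_congr:
  assumes "\<And>j i. j < 2 * n \<Longrightarrow> [M j i = M' j i] (mod int k)"
  shows "isotropic n k M = isotropic n k M'"
proof -
  have "[(\<Sum>l<n. M l i * M (2 * n - 1 - l) j - M l j * M (2 * n - 1 - l) i) = (\<Sum>l<n. M' l i * M' (2 * n - 1 - l) j - M' l j * M' (2 * n - 1 - l) i)] (mod int k)" for i j
    by (intro cong_sum cong_diff cong_mult assms) auto
  then show ?thesis unfolding isotropic_def using cong_dvd_iff by blast
qed

lemma act_sum: "act i i' c (\<lambda>a b. \<Sum>l<(n::nat). B l a b) x y = (\<Sum>l<n. act i i' c (B l) x y)"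
proof (induction n)
  case 0
  show ?case by (simp add: act_def rowop_def)
next
  case (Suc n)
  show ?case using act_add[of i i' c "\<lambda>a b. \<Sum>l<n. B l a b" "B n" x y] Suc by simp
qed

text \<open>Row operations act on the form by simultaneous operations on its two indices, which are invertible.\<close>

lemma isotropic_colinv: "colinv {..<2 * n} k (2 * n) (\<lambda>M. of_bool (isotropic n k M))"
  unfolding colinv_def
proof (intro conjI allI impI)
  fix M M' :: "nat \<Rightarrow> nat \<Rightarrow> int" assume "\<forall>j<2 * n. \<forall>i. [M j i = M' j i] (mod int k)"
  then show "of_bool (isotropic n k M) = (of_bool (isotropic n k M') :: real)"
    by (intro arg_cong[of _ _ of_bool] isotropic_congr) auto
next
  fix M :: "nat \<Rightarrow> nat \<Rightarrow> int" and i i' c assume i: "i \<in> {..<2 * n}" "i' \<in> {..<2 * n}" "i \<noteq> i'"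
  define B where "B = (\<lambda>M a b. \<Sum>l<n. wedge 1 (M l) (M (2 * n - 1 - l)) a b)"
  have B: "B (\<lambda>j. rowop i i' c (M j)) a b = act i i' c (B M) a b" for M c a b
    unfolding B_def act_sum act_wedge ..
  have iso: "isotropic n k M \<longleftrightarrow> (\<forall>a b. int k dvd B M a b)" for M by (simp add: isotropic_wedge B_def)
  have "isotropic n k (\<lambda>j. rowop i i' c (M j))" if "isotropic n k M" for M c
    unfolding iso B using act_dvd[of i UNIV i' "int k" "B M"] that unfolding iso by blast
  moreover have "(\<lambda>j. rowop i i' (- c) (rowop i i' c (M j))) = M" using i by (auto simp: rowop_def fun_eq_iff)
  ultimately have "isotropic n k (\<lambda>j. rowop i i' c (M j)) \<longleftrightarrow> isotropic n k M" by metis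
  then show "of_bool (isotropic n k (\<lambda>j. rowop i i' c (M j))) = (of_bool (isotropic n k M) :: real)" by simp
qed

text \<open>Given the columns of \<open>T\<close>, the proportion of last columns modulo \<open>k\<close> that make the matrix isotropic.\<close>

definition last_prob :: "nat \<Rightarrow> nat \<Rightarrow> (nat \<Rightarrow> nat \<Rightarrow> int) \<Rightarrow> real" where
  "last_prob n k T = avg {..<2 * n} k (\<lambda>v. of_bool (isotropic n k (T(2 * n - 1 := v))))"

text \<open>Averaging over the last column leaves an invariant function of the first \<open>2 * n - 1\<close> columns, to
which \<open>hnf_sum\<close> applies; the average over all columns is the isotropy probability.\<close>

lemma last_prob_has_sum:
  assumes n: "n \<ge> 1" and k: "k > 0"
  shows "((\<lambda>T. last_prob n k T / (\<Prod>j<2 * n - 1. real_of_int (T j j)) ^ (2 * n)) has_sum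
    ((\<Prod>j<2 * n - 1. riemann_zeta (real (2 * n - j))) * iso_prob n k)) (hnf (2 * n - 1))"
proof -
  have S: "2 * n = Suc (2 * n - 1)" using n by simp
  have "colinv {..<2 * n} k (Suc (2 * n - 1)) (\<lambda>M. of_bool (isotropic n k M))" using isotropic_colinv[of n k] S by simp
  from colinv_avg[OF this k] have c: "colinv {..<2 * n} k (2 * n - 1) (last_prob n k)" unfolding last_prob_def .
  have "avgL {..<2 * n} k [2 * n - 1] (\<lambda>M. of_bool (isotropic n k M)) = last_prob n k" by (rule ext) (simp add: last_prob_def)
  moreover have "[0..<2 * n] = [0..<2 * n - 1] @ [2 * n - 1]" using S by (metis upt_Suc_append zero_le)
  ultimately have "avgL {..<2 * n} k [0..<2 * n - 1] (last_prob n k) (\<lambda>_. undefined) = iso_prob n k"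
    using avgL_isotropic[of n k "\<lambda>_. undefined"] avgL_append[of "{..<2 * n}" k "[0..<2 * n - 1]" "[2 * n - 1]" "\<lambda>M. of_bool (isotropic n k M)" "\<lambda>_. undefined"]
    by simp
  then show ?thesis
    using hnf_sum[OF k _ c] n unfolding last_prob_def[symmetric] by (simp add: avg_nonneg last_prob_def)
qed

lemma iso_prob_1: "iso_prob n 1 = 1"
  unfolding iso_prob_def by (rule van_prob_1) simp

lemma iso_prob_nonneg: "iso_prob n k \<ge> 0"
  by (simp add: iso_prob_def van_prob_nonneg)

lemma iso_prob_mult: "coprime a b \<Longrightarrow> a > 0 \<Longrightarrow> b > 0 \<Longrightarrow> iso_prob n (a * b) = iso_prob n a * iso_prob n b"
  unfolding iso_prob_def by (rule van_prob_crt) auto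

lemma iso_prob_prime_power:
  assumes "prime p" "n \<ge> 1"
  shows "iso_prob n (p ^ k) = wsol (1 / real p) n k n"
  using van_prob_prime_power[OF assms, of "{..<2 * n}" n k] by (simp add: iso_prob_def wsol_def)

section \<open>Local factors and the Euler product\<close>

text \<open>Summing the recursion over \<open>k\<close> gives a linear equation for the sum. The nonnegative partial sums are
bounded by its solution, which is what guarantees convergence.\<close>

lemma affine_rec_sums:
  fixes w c :: "nat \<Rightarrow> real"
  assumes w: "\<And>k. w (Suc k) = x * w k + c k" "w 0 \<ge> 0" and x: "0 \<le> x" "x < 1" and c: "\<And>k. c k \<ge> 0" "c sums C"
  shows "w sums ((w 0 + C) / (1 - x))"
proof -
  have w0: "w k \<ge> 0" for k by (induction k) (use w x c in auto)
  have rec: "(\<Sum>k<Suc m. w k) = w 0 + x * (\<Sum>k<m. w k) + (\<Sum>k<m. c k)" for m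
    unfolding sum.lessThan_Suc_shift by (simp add: w(1) sum.distrib sum_distrib_left)
  have "summable w"
  proof (rule summableI_nonneg_bounded[OF w0])
    fix m
    have "(\<Sum>k<m. w k) \<le> (\<Sum>k<Suc m. w k)" using w0 by simp
    then have "(\<Sum>k<m. w k) \<le> w 0 + x * (\<Sum>k<m. w k) + (\<Sum>k<m. c k)" unfolding rec .
    moreover have "(\<Sum>k<m. c k) \<le> C" using sum_le_suminf[of c "{..<m}"] c by (simp add: sums_iff)
    ultimately have "(\<Sum>k<m. w k) * (1 - x) \<le> w 0 + C" by (simp add: algebra_simps)
    then show "(\<Sum>k<m. w k) \<le> (w 0 + C) / (1 - x)" using x by (simp add: pos_le_divide_eq)
  qed
  then have s: "w sums suminf w" by (rule summable_sums)
  then have "(\<lambda>k. w (Suc k)) sums (suminf w - w 0)" by (subst sums_Suc_iff) simp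
  moreover have "(\<lambda>k. w (Suc k)) sums (x * suminf w + C)" unfolding w(1) by (intro sums_add sums_mult s c)
  ultimately have "suminf w - w 0 = x * suminf w + C" by (rule sums_unique2)
  then have "suminf w * (1 - x) = w 0 + C" by (simp add: algebra_simps)
  then have "suminf w = (w 0 + C) / (1 - x)" using x by (simp add: eq_divide_eq)
  then show ?thesis using s by simp
qed

lemma uexp_closed: "2 * int (uexp n j) = (int n + int j) * (int n + int j - 1)"
proof -
  have "2 * int (\<Sum>i<m. i) = int m * (int m - 1)" for m by (induction m) (simp_all add: algebra_simps)
  from this[of "n + j"] show ?thesis by (simp add: uexp_def)
qed

text \<open>In closed form \<open>(3 * n ^ 2 - n + b ^ 2 + b) / 2\<close>, which is at the same time the argument of a zeta
function in \<open>R_const\<close> and the exponent that \<open>c_coeff\<close> produces at \<open>Y = p powi (- 2 * n)\<close>.\<close>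

definition xexp :: "nat \<Rightarrow> nat \<Rightarrow> nat" where "xexp n b = uexp n n - uexp n b + (n + b) * b"

lemma xexp_closed:
  assumes "b \<le> n"
  shows "2 * int (xexp n b) = 3 * int n ^ 2 - int n + int b ^ 2 + int b"
proof -
  have "uexp n b \<le> uexp n n" unfolding uexp_def by (rule sum_mono2) (use assms in auto)
  then have "2 * int (xexp n b) = 2 * int (uexp n n) - 2 * int (uexp n b) + 2 * (int n + int b) * int b"
    by (simp add: xexp_def of_nat_diff algebra_simps)
  also have "\<dots> = 3 * int n ^ 2 - int n + int b ^ 2 + int b"
    unfolding uexp_closed by (simp add: algebra_simps power2_eq_square)
  finally show ?thesis .
qed

lemma xexp_ge_2:
  assumes "n \<ge> 2" "b \<le> n"
  shows "xexp n b \<ge> 2"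
proof -
  have "int n * int n \<ge> 2 * int n" using assms by (intro mult_right_mono) auto
  then have "2 * int (xexp n b) \<ge> 5 * int n" unfolding xexp_closed[OF assms(2)] power2_eq_square
    by (smt (verit) of_nat_0_le_iff mult_nonneg_nonneg)
  then show ?thesis using assms by linarith
qed

lemma xexp_pos: "n \<ge> 1 \<Longrightarrow> b \<le> n \<Longrightarrow> xexp n b > 0"
proof (rule ccontr)
  assume n: "n \<ge> 1" "b \<le> n" and "\<not> xexp n b > 0"
  then have "3 * int n ^ 2 - int n + int b ^ 2 + int b = 0" using xexp_closed[OF n(2)] by simp
  moreover have "int n ^ 2 \<ge> int n" using n by (simp add: power2_eq_square)
  moreover have "int b ^ 2 \<ge> 0" by simp
  ultimately show False using n by linarith
qed

lemma xexp_zeta_arg: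
  assumes "b \<le> n"
  shows "2 * real n ^ 2 - real ((n + 1) choose 2) + real ((b + 1) choose 2) = real (xexp n b)"
proof -
  have c: "2 * real ((m + 1) choose 2) = real m ^ 2 + real m" for m
  proof -
    have "2 * ((m + 1) choose 2) = (m + 1) * m" by (simp add: choose_two)
    then have "real (2 * ((m + 1) choose 2)) = real ((m + 1) * m)" by simp
    then show ?thesis by (simp add: power2_eq_square algebra_simps)
  qed
  have "real_of_int (2 * int (xexp n b)) = real_of_int (3 * int n ^ 2 - int n + int b ^ 2 + int b)"
    by (simp only: xexp_closed[OF assms])
  then show ?thesis using c[of n] c[of b] by simp
qed

lemma xexp_c_coeff:
  assumes "b \<le> n"
  shows "int (xexp n b) = 2 * int n * (int n + 1) - c_coeff n b"
proof -
  have "even (int n * (int n + 5) - int b * (int b + 1))" by (cases "even n"; cases "even b") simp_all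
  then have "2 * c_coeff n b = int n * (int n + 5) - int b * (int b + 1)" unfolding c_coeff_def by simp
  then show ?thesis using xexp_closed[OF assms] by (simp add: algebra_simps power2_eq_square)
qed

lemma xval_xexp: "xval t n b = t ^ xexp n b"
  by (simp add: xval_def xexp_def)

lemma xval_less_1:
  assumes "0 < t" "t < 1" "n \<ge> 1" "b \<le> n"
  shows "0 < xval t n b" "xval t n b < 1"
  using assms xexp_pos[OF assms(3,4)] by (auto simp: xval_xexp power_less_one_iff)

text \<open>Summing \<open>wsol_Suc\<close> over the exponent gives \<open>(1 - x j) * s j = 1 + ...\<close>, which is the recursion
\<open>desc_series_rec\<close> for the numbers \<open>(1 - x j) * s j\<close>.\<close>

lemma wsol_sums:
  assumes t: "0 < t" "t < 1" and n: "n \<ge> 1"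
  shows "j \<le> n \<Longrightarrow> (\<lambda>k. wsol t n k j) sums (desc_series t (- (t ^ n)) (xval t n) j / (1 - xval t n j))"
proof (induction j rule: less_induct)
  case (less j)
  define B where "B = (\<lambda>b. block_sum t (- (t ^ n)) b (j - b))"
  have B: "B b \<ge> 0" for b
  proof -
    have "1 + - (t ^ n) * t ^ i \<ge> 0" for i
    proof -
      have "t ^ n * t ^ i \<le> 1 * 1" using t by (intro mult_mono power_le_one) auto
      then show ?thesis by simp
    qed
    then show ?thesis unfolding B_def block_sum_closed using qbin_pos[of t b "j - b"] t
      by (intro mult_nonneg_nonneg prod_nonneg) auto
  qed
  have x: "0 < xval t n b" "xval t n b < 1" if "b \<le> j" for b using xval_less_1[OF t n, of b] less.prems that by auto
  define c where "c = (\<lambda>k. \<Sum>b<j. xval t n b * B b * wsol t n k b)"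
  have pos: "wsol t n k b \<ge> 0" if "b \<le> n" for k b using that
  proof (induction k arbitrary: b)
    case (Suc k)
    have "block_sum t (- (t ^ n)) i m \<ge> 0" for i m
    proof -
      have "1 + - (t ^ n) * t ^ i \<ge> 0" for i
      proof -
        have "t ^ n * t ^ i \<le> 1 * 1" using t by (intro mult_mono power_le_one) auto
        then show ?thesis by simp
      qed
      then show ?thesis unfolding block_sum_closed using qbin_pos[of t i m] t
        by (intro mult_nonneg_nonneg prod_nonneg) auto
    qed
    then show ?case unfolding wsol_Suc[OF Suc.prems] using Suc t
      by (intro sum_nonneg mult_nonneg_nonneg) (auto simp: xval_def)
  qed (simp add: wsol_0)
  have "(\<lambda>k. wsol t n k j) sums ((wsol t n 0 j + (\<Sum>b<j. xval t n b * B b * (desc_series t (- (t ^ n)) (xval t n) b / (1 - xval t n b)))) / (1 - xval t n j))"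
  proof (rule affine_rec_sums)
    fix k
    have "block_sum t (- (t ^ n)) j (j - j) = 1" using block_sum_0 by simp
    then show "wsol t n (Suc k) j = xval t n j * wsol t n k j + c k"
      unfolding wsol_Suc[OF less.prems] lessThan_Suc_atMost[symmetric] c_def B_def by simp
    show "c k \<ge> 0" unfolding c_def using less.prems x(1) by (intro sum_nonneg mult_nonneg_nonneg B pos less_imp_le[OF x(1)]) auto
  next
    show "c sums (\<Sum>b<j. xval t n b * B b * (desc_series t (- (t ^ n)) (xval t n) b / (1 - xval t n b)))"
      unfolding c_def by (intro sums_sum sums_mult less.IH) (use less.prems in auto)
  qed (use x[of j] in \<open>auto simp: wsol_0\<close>)
  also have "wsol t n 0 j + (\<Sum>b<j. xval t n b * B b * (desc_series t (- (t ^ n)) (xval t n) b / (1 - xval t n b))) = desc_series t (- (t ^ n)) (xval t n) j"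
    unfolding wsol_0 by (subst desc_series_rec[of _ _ _ j]) (simp add: B_def)
  finally show ?case .
qed

text \<open>At this argument every sign contributes \<open>- (t ^ n)\<close>, every unit of length contributes \<open>t\<close>, and a
descent at \<open>i\<close> contributes \<open>t ^ xexp n i\<close>.\<close>

lemma N_poly_eval:
  assumes p: "p > 1" and n: "n \<ge> 1"
  defines "t \<equiv> 1 / real p"
  shows "N_poly n (real p) (real p powi (- 2 * int n)) = desc_series t (- (t ^ n)) (xval t n) n * (\<Prod>i<n. 1 - xval t n i)"
proof -
  have t: "0 < t" "t < 1" using p by (auto simp: t_def)
  have p0: "real p \<noteq> 0" using p by simp
  have tp: "t ^ m = real p powi (- int m)" for m
    by (simp add: t_def power_int_minus divide_inverse power_inverse)
  have "N_poly n (real p) (real p powi (- 2 * int n)) = (\<Sum>g\<in>hyperoctahedral n. (- (t ^ n)) ^ neg_B n g * t ^ coxeter_length n g * (\<Prod>i\<in>Des_B n g. xval t n i))"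
    unfolding N_poly_def
  proof (rule sum.cong)
    fix g assume "g \<in> hyperoctahedral n"
    have fin: "finite (Des_B n g)" by (rule finite_subset[of _ "{..<n}"]) (auto simp: Des_B_def)
    have "(\<Prod>i\<in>Des_B n g. xval t n i) = t ^ (\<Sum>i\<in>Des_B n g. xexp n i)" by (simp add: xval_xexp power_sum)
    then have "(- (t ^ n)) ^ neg_B n g * t ^ coxeter_length n g * (\<Prod>i\<in>Des_B n g. xval t n i)
      = (- 1) ^ neg_B n g * t ^ (n * neg_B n g + coxeter_length n g + (\<Sum>i\<in>Des_B n g. xexp n i))"
      by (subst power_minus) (simp add: power_add power_mult)
    also have "t ^ (n * neg_B n g + coxeter_length n g + (\<Sum>i\<in>Des_B n g. xexp n i)) = real p powi (C_stat n g + (- 2 * int n) * int (D_stat n g))"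
      unfolding tp
    proof (rule arg_cong[of _ _ "\<lambda>e. real p powi e"])
      have "int (\<Sum>i\<in>Des_B n g. xexp n i) = (\<Sum>i\<in>Des_B n g. 2 * int n * (int n + 1) - c_coeff n i)"
        unfolding of_nat_sum by (rule sum.cong) (auto simp: Des_B_def intro!: xexp_c_coeff)
      also have "\<dots> = int (card (Des_B n g)) * (2 * int n * (int n + 1)) - (\<Sum>i\<in>Des_B n g. c_coeff n i)"
        by (simp only: sum_subtractf sum_constant)
      finally show "- int (n * neg_B n g + coxeter_length n g + (\<Sum>i\<in>Des_B n g. xexp n i)) = C_stat n g + (- 2 * int n) * int (D_stat n g)"
        by (simp add: C_stat_def D_stat_def des_B_def algebra_simps del: of_nat_sum)
    qed
    also have "\<dots> = real p powi C_stat n g * (real p powi (- 2 * int n)) ^ D_stat n g"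
      using p0 by (simp only: power_int_add power_int_mult power_int_of_nat simp_thms)
    finally show "(- 1) ^ neg_B n g * real p powi C_stat n g * (real p powi (- 2 * int n)) ^ D_stat n g
      = (- (t ^ n)) ^ neg_B n g * t ^ coxeter_length n g * (\<Prod>i\<in>Des_B n g. xval t n i)" by (simp only: mult.assoc)
  qed simp
  also have "\<dots> = desc_series t (- (t ^ n)) (xval t n) n * (\<Prod>i<n. 1 - xval t n i)"
    by (rule hyperoctahedral_sum) (use xval_less_1[OF t n] in \<open>simp add: less_imp_neq\<close>)
  finally show ?thesis .
qed

text \<open>At \<open>j = n\<close> the sum from \<open>wsol_sums\<close> has the denominator \<open>1 - xval t n n\<close>, and the product over the
smaller indices comes from \<open>N_poly_eval\<close>.\<close>

lemma iso_prob_local_sums: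
  assumes p: "prime p" and n: "n \<ge> 1"
  shows "(\<lambda>k. iso_prob n (p ^ k)) sums
    (N_poly n (real p) (real p powi (- 2 * int n)) / (\<Prod>i\<le>n. 1 - (1 / real p) ^ xexp n i))"
proof -
  define t where "t = 1 / real p"
  have p1: "p > 1" using p by (rule prime_gt_1_nat)
  have t: "0 < t" "t < 1" using p1 by (auto simp: t_def)
  have ne: "1 - xval t n i \<noteq> 0" if "i \<le> n" for i using xval_less_1[OF t n that] by simp
  have van_prob: "(\<Prod>i<n. 1 - xval t n i) \<noteq> 0" using ne by simp
  have "(\<lambda>k. wsol t n k n) sums (desc_series t (- (t ^ n)) (xval t n) n / (1 - xval t n n))"
    by (rule wsol_sums[OF t n]) simp
  also have "desc_series t (- (t ^ n)) (xval t n) n / (1 - xval t n n)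
    = N_poly n (real p) (real p powi (- 2 * int n)) / (\<Prod>i\<le>n. 1 - xval t n i)"
  proof -
    have "N_poly n (real p) (real p powi (- 2 * int n)) = desc_series t (- (t ^ n)) (xval t n) n * (\<Prod>i<n. 1 - xval t n i)"
      unfolding t_def by (rule N_poly_eval[OF p1 n])
    moreover have "(\<Prod>i\<le>n. 1 - xval t n i) = (\<Prod>i<n. 1 - xval t n i) * (1 - xval t n n)"
      by (simp only: lessThan_Suc_atMost[symmetric] prod.lessThan_Suc)
    ultimately show ?thesis using van_prob by (simp only: mult_divide_mult_cancel_left mult.commute[of "desc_series t (- (t ^ n)) (xval t n) n"] not_False_eq_True)
  qed
  finally show ?thesis unfolding iso_prob_prime_power[OF p n] t_def[symmetric] xval_xexp .
qed

text \<open>A number with prime factors in \<open>insert p Q\<close> is uniquely a power of \<open>p\<close> times a number with prime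
factors in \<open>Q\<close>.\<close>

lemma smooth_has_sum:
  fixes f :: "nat \<Rightarrow> real"
  assumes f: "f 1 = 1" "\<And>m. f m \<ge> 0" "\<And>a b. coprime a b \<Longrightarrow> a > 0 \<Longrightarrow> b > 0 \<Longrightarrow> f (a * b) = f a * f b"
    and E: "\<And>p. prime p \<Longrightarrow> (\<lambda>k. f (p ^ k)) sums E p"
    and Q: "finite Q" "\<And>p. p \<in> Q \<Longrightarrow> prime p"
  shows "(f has_sum (\<Prod>p\<in>Q. E p)) {m. m > 0 \<and> prime_factors m \<subseteq> Q}"
  using Q
proof (induction Q rule: finite_induct)
  case empty
  have "{m::nat. m > 0 \<and> prime_factors m \<subseteq> {}} = {1}" by (auto simp: prime_factorization_empty_iff)
  then show ?case using f(1) by (simp add: has_sum_finite_iff)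
next
  case (insert p Q)
  define S where "S = {m::nat. m > 0 \<and> prime_factors m \<subseteq> Q}"
  have p: "prime p" using insert.prems by simp
  have S: "(f has_sum (\<Prod>q\<in>Q. E q)) S" unfolding S_def using insert by simp
  have cop: "coprime (p ^ k) m" if "m \<in> S" for k m
  proof -
    have "\<not> p dvd m" using that p insert.hyps(2) unfolding S_def
      by (auto simp: prime_factors_dvd)
    then show ?thesis using p by (simp add: prime_imp_coprime)
  qed
  have fm: "f (p ^ k * m) = f (p ^ k) * f m" if "m \<in> S" for k m
    by (rule f(3)[OF cop[OF that]]) (use that p in \<open>auto simp: S_def prime_gt_0_nat\<close>)
  have pk: "((\<lambda>k. f (p ^ k)) has_sum E p) UNIV" by (rule sums_nonneg_imp_has_sum[OF E[OF p] f(2)])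
  define h where "h = (\<lambda>(k, m). f (p ^ k) * f m)"
  have in1: "((\<lambda>m. h (k, m)) has_sum (f (p ^ k) * (\<Prod>q\<in>Q. E q))) S" for k
    unfolding h_def prod.case by (rule has_sum_cmult_right[OF S])
  have out: "((\<lambda>k. f (p ^ k) * (\<Prod>q\<in>Q. E q)) has_sum (E p * (\<Prod>q\<in>Q. E q))) UNIV"
    by (rule has_sum_cmult_left[OF pk])
  have "h summable_on (UNIV \<times> S)"
    by (rule summable_on_SigmaI[OF in1 has_sum_imp_summable[OF out]]) (simp add: h_def f(2))
  then have H: "(h has_sum (E p * (\<Prod>q\<in>Q. E q))) (UNIV \<times> S)"
    by (rule has_sum_SigmaI[OF in1 out])
  have "(f has_sum (E p * (\<Prod>q\<in>Q. E q))) {m. m > 0 \<and> prime_factors m \<subseteq> insert p Q}"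
  proof (rule has_sum_bijI[OF H, where i = "\<lambda>(k, m). p ^ k * m" and j = "\<lambda>m. (multiplicity p m, m div p ^ multiplicity p m)"])
    fix m assume m: "m \<in> {m. m > 0 \<and> prime_factors m \<subseteq> insert p Q}"
    define k where "k = multiplicity p m"
    define m' where "m' = m div p ^ k"
    have mm: "m = p ^ k * m'" by (simp add: m'_def k_def multiplicity_dvd)
    have m0: "m > 0" using m by simp
    have nd: "\<not> p dvd m'"
      unfolding m'_def k_def using multiplicity_decompose[of m p] m0 prime_gt_1_nat[OF p] by simp
    have m'0: "m' > 0" using m0 mm by (cases "m' = 0") auto
    have "prime_factors m' \<subseteq> prime_factors m" using m0 mm by (intro dvd_prime_factors) auto
    moreover have "p \<notin> prime_factors m'" using nd by (auto dest: in_prime_factors_imp_dvd)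
    ultimately have m'S: "m' \<in> S" using m m'0 by (auto simp: S_def)
    show "(case (multiplicity p m, m div p ^ multiplicity p m) of (k, m) \<Rightarrow> p ^ k * m) = m"
      unfolding k_def[symmetric] m'_def[symmetric] prod.case by (rule mm[symmetric])
    show "(multiplicity p m, m div p ^ multiplicity p m) \<in> UNIV \<times> S"
      using m'S by (simp add: m'_def k_def)
    show "h (multiplicity p m, m div p ^ multiplicity p m) = f m"
      unfolding k_def[symmetric] m'_def[symmetric] h_def prod.case fm[OF m'S, symmetric] mm[symmetric] ..
  next
    fix b :: "nat \<times> nat" assume b: "b \<in> UNIV \<times> S"
    obtain k m where km: "b = (k, m)" "m \<in> S" using b by auto
    have m: "m > 0" "prime_factors m \<subseteq> Q" using km by (auto simp: S_def)
    have nd: "\<not> p dvd m" using m p insert.hyps(2) by (auto simp: prime_factors_dvd)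
    have mu: "multiplicity p (p ^ k * m) = k"
      by (rule multiplicity_eqI) (use nd p in \<open>auto simp: prime_gt_0_nat\<close>)
    show "(multiplicity p (case b of (k, m) \<Rightarrow> p ^ k * m), (case b of (k, m) \<Rightarrow> p ^ k * m) div p ^ multiplicity p (case b of (k, m) \<Rightarrow> p ^ k * m)) = b"
      using mu p by (simp add: km(1) prime_gt_0_nat)
    have "prime_factors (p ^ k * m) \<subseteq> insert p Q"
    proof
      fix q assume "q \<in> prime_factors (p ^ k * m)"
      then have q: "prime q" "q dvd p ^ k * m" by (auto simp: prime_factors_dvd)
      then have "q dvd p \<or> q dvd m" using prime_dvd_multD prime_dvd_power by blast
      then show "q \<in> insert p Q" using q(1) p m by (auto simp: prime_factors_dvd primes_dvd_imp_eq)
    qed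
    then show "(case b of (k, m) \<Rightarrow> p ^ k * m) \<in> {m. m > 0 \<and> prime_factors m \<subseteq> insert p Q}"
      using m p by (simp add: km(1) prime_gt_0_nat)
  qed
  then show ?case using insert.hyps by simp
qed

text \<open>The product over primes up to \<open>x\<close> is the sum over the numbers with no larger prime factor, which
lies between the sum over \<open>1, ..., x\<close> and the full sum.\<close>

lemma euler_product_nonneg:
  fixes f :: "nat \<Rightarrow> real"
  assumes f: "f 1 = 1" "\<And>m. f m \<ge> 0" "\<And>a b. coprime a b \<Longrightarrow> a > 0 \<Longrightarrow> b > 0 \<Longrightarrow> f (a * b) = f a * f b"
    and E: "\<And>p. prime p \<Longrightarrow> (\<lambda>k. f (p ^ k)) sums E p"
    and s: "summable (\<lambda>k. f (Suc k))"
  shows "(\<lambda>p. if prime p then E p else 1) has_prod (\<Sum>k. f (Suc k))"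
proof -
  define Z where "Z = (\<Sum>k. f (Suc k))"
  define P where "P = (\<lambda>x. {p. prime p \<and> p \<le> (x::nat)})"
  have fin: "finite (P x)" for x unfolding P_def by (rule finite_subset[of _ "{..x}"]) auto
  have "((f \<circ> Suc) has_sum Z) UNIV"
    unfolding Z_def comp_def by (rule sums_nonneg_imp_has_sum[OF summable_sums[OF s]]) (rule f(2))
  then have Z: "(f has_sum Z) (range Suc)" by (subst has_sum_reindex) auto
  have sm: "(f has_sum (\<Prod>p\<in>P x. E p)) {m. m > 0 \<and> prime_factors m \<subseteq> P x}" for x
    by (rule smooth_has_sum[OF f E fin]) (auto simp: P_def)
  have eq: "(\<Prod>p\<le>x. if prime p then E p else 1) = (\<Prod>p\<in>P x. E p)" for x
  proof -
    have "P x = {p\<in>{..x}. prime p}" by (auto simp: P_def)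
    then show ?thesis by (simp only: prod.inter_filter finite_atMost)
  qed
  have up: "(\<Prod>p\<in>P x. E p) \<le> Z" for x
  proof (rule has_sum_mono2[OF sm Z])
    show "{m. m > 0 \<and> prime_factors m \<subseteq> P x} \<subseteq> range Suc" by (auto intro: Suc_pred[symmetric])
  qed (rule f(2))
  have lo: "(\<Sum>k<x. f (Suc k)) \<le> (\<Prod>p\<in>P x. E p)" for x
  proof -
    have "(\<Sum>k<x. f (Suc k)) = (\<Sum>m\<in>{1..x}. f m)"
      by (rule sum.reindex_bij_witness[of _ "\<lambda>k. k - 1" Suc]) auto
    also have "\<dots> \<le> (\<Prod>p\<in>P x. E p)"
    proof (rule finite_sum_le_has_sum[OF sm])
      show "{1..x} \<subseteq> {m. m > 0 \<and> prime_factors m \<subseteq> P x}"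
        unfolding P_def by (auto simp: prime_factors_dvd intro: order.trans[OF dvd_imp_le])
    qed (use f(2) in auto)
    finally show ?thesis .
  qed
  have lim: "(\<lambda>x. \<Prod>p\<le>x. if prime p then E p else 1) \<longlonglongrightarrow> Z"
    unfolding eq
  proof (rule tendsto_sandwich[OF always_eventually always_eventually])
    show "\<forall>x. (\<Sum>k<x. f (Suc k)) \<le> (\<Prod>p\<in>P x. E p)" using lo by blast
    show "\<forall>x. (\<Prod>p\<in>P x. E p) \<le> Z" using up by blast
    show "(\<lambda>x. \<Sum>k<x. f (Suc k)) \<longlonglongrightarrow> Z" unfolding Z_def using summable_sums[OF s] by (simp add: sums_def)
  qed simp
  have "f (Suc 0) \<le> Z" using lo[of 1] up[of 1] by simp
  then have "Z \<noteq> 0" using f(1) by simp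
  with lim show ?thesis unfolding Z_def by (simp add: has_prod_def raw_has_prod_def cong: if_cong)
qed

lemma zeta_euler_product:
  assumes e: "e \<ge> 2"
  shows "(\<lambda>p. if prime p then 1 - (1 / real p) ^ e else 1) has_prod (1 / riemann_zeta (real e))"
proof -
  define f where "f = (\<lambda>m::nat. 1 / real m ^ e)"
  have z: "(\<Sum>k. f (Suc k)) = riemann_zeta (real e)" "summable (\<lambda>k. f (Suc k))"
  proof -
    have f: "f (Suc k) = real (Suc k) powr (- real e)" for k
      by (simp add: f_def powr_minus_divide powr_realpow del: of_nat_Suc)
    show "(\<Sum>k. f (Suc k)) = riemann_zeta (real e)" by (simp only: f riemann_zeta_def)
    show "summable (\<lambda>k. f (Suc k))" unfolding f by (rule summable_powr_Suc) (use e in simp)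
  qed
  have "(\<lambda>p. if prime p then 1 / (1 - (1 / real p) ^ e) else 1) has_prod (\<Sum>k. f (Suc k))"
  proof (rule euler_product_nonneg[OF _ _ _ _ z(2)])
    fix p :: nat assume p: "prime p"
    have "norm ((1 / real p) ^ e) < 1"
      using prime_gt_1_nat[OF p] e by (simp add: power_less_one_iff power_one_over)
    then have "(\<lambda>k. ((1 / real p) ^ e) ^ k) sums (1 / (1 - (1 / real p) ^ e))" by (rule geometric_sums)
    moreover have "((1 / real p) ^ e) ^ k = f (p ^ k)" for k
      by (simp add: f_def power_one_over power_mult[symmetric] mult.commute)
    ultimately show "(\<lambda>k. f (p ^ k)) sums (1 / (1 - (1 / real p) ^ e))" by simp
  qed (auto simp: f_def power_mult_distrib)
  then have "(\<lambda>p. inverse (if prime p then 1 / (1 - (1 / real p) ^ e) else 1)) has_prod inverse (\<Sum>k. f (Suc k))"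
    by (rule has_prod_inverse)
  moreover have "inverse (if prime p then 1 / (1 - (1 / real p) ^ e) else 1) = (if prime p then 1 - (1 / real p) ^ e else 1)" for p :: nat
    by simp
  ultimately show ?thesis by (simp only: z(1) inverse_eq_divide)
qed

lemma has_prod_finite_prod:
  fixes f :: "'a \<Rightarrow> nat \<Rightarrow> real"
  assumes "finite A" "\<And>i. i \<in> A \<Longrightarrow> f i has_prod c i"
  shows "(\<lambda>p. \<Prod>i\<in>A. f i p) has_prod (\<Prod>i\<in>A. c i)"
  using assms
proof (induction A rule: finite_induct)
  case (insert i A)
  have "(\<lambda>p. f i p * (\<Prod>j\<in>A. f j p)) has_prod (c i * (\<Prod>j\<in>A. c j))"
    by (rule has_prod_mult) (use insert in auto)
  then show ?case using insert.hyps by simp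
qed simp

text \<open>The second family of zeta values in \<open>R_const\<close> cancels the Euler factors by which the local sums
differ from \<open>N_poly\<close>.\<close>

lemma R_const_eq:
  assumes n: "n \<ge> 2" and s: "summable (\<lambda>k. iso_prob n (Suc k))"
  shows "R_const n = (\<Prod>j<2 * n - 1. riemann_zeta (real (2 * n - j))) * (\<Sum>k. iso_prob n (Suc k))"
proof -
  have n1: "n \<ge> 1" using n by simp
  define \<zeta> where "\<zeta> = (\<lambda>i. riemann_zeta (real (xexp n i)))"
  have \<zeta>: "\<zeta> i \<noteq> 0" if "i \<le> n" for i using zeta_pos[OF xexp_ge_2[OF n that]] by (simp add: \<zeta>_def)
  define E where "E = (\<lambda>p. N_poly n (real p) (real p powi (- 2 * int n)) / (\<Prod>i\<le>n. 1 - (1 / real p) ^ xexp n i))"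
  have 1: "(\<lambda>p. if prime p then E p else 1) has_prod (\<Sum>k. iso_prob n (Suc k))"
    by (rule euler_product_nonneg[OF _ _ _ _ s])
      (simp_all only: iso_prob_1 iso_prob_nonneg iso_prob_mult E_def iso_prob_local_sums[OF _ n1])
  have 2: "(\<lambda>p. \<Prod>i\<le>n. if prime p then 1 - (1 / real p) ^ xexp n i else 1) has_prod (\<Prod>i\<le>n. 1 / \<zeta> i)"
    unfolding \<zeta>_def by (intro has_prod_finite_prod zeta_euler_product xexp_ge_2 n) auto
  have "(\<lambda>p. (if prime p then E p else 1) * (\<Prod>i\<le>n. if prime p then 1 - (1 / real p) ^ xexp n i else 1)) has_prod
     ((\<Sum>k. iso_prob n (Suc k)) * (\<Prod>i\<le>n. 1 / \<zeta> i))" by (rule has_prod_mult[OF 1 2])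
  moreover have "(if prime p then E p else 1) * (\<Prod>i\<le>n. if prime p then 1 - (1 / real p) ^ xexp n i else 1)
     = (if prime p then N_poly n (real p) (real p powi (- 2 * int n)) else 1)" for p :: nat
  proof (cases "prime p")
    case True
    have "(\<Prod>i\<le>n. 1 - (1 / real p) ^ xexp n i) \<noteq> 0"
    proof -
      have "(1 / real p) ^ xexp n i < 1" if "i \<le> n" for i
        using prime_gt_1_nat[OF True] xexp_pos[OF n1 that] by (simp add: power_less_one_iff)
      then show ?thesis by (auto simp: less_imp_neq)
    qed
    then show ?thesis using True by (simp add: E_def)
  qed simp
  ultimately have "(\<lambda>p. if prime p then N_poly n (real p) (real p powi (- 2 * int n)) else 1) has_prod
     ((\<Sum>k. iso_prob n (Suc k)) * (\<Prod>i\<le>n. 1 / \<zeta> i))" by simp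
  then have P: "(\<Prod>p. if prime p then N_poly n (real p) (real p powi (- 2 * int n)) else 1) = (\<Sum>k. iso_prob n (Suc k)) * (\<Prod>i\<le>n. 1 / \<zeta> i)"
    by (rule has_prod_unique[symmetric])
  have Q: "(\<Prod>i=0..n. riemann_zeta (2 * real n ^ 2 - real ((n + 1) choose 2) + real ((i + 1) choose 2))) = (\<Prod>i\<le>n. \<zeta> i)"
    unfolding \<zeta>_def atLeast0AtMost by (intro prod.cong refl arg_cong[of _ _ riemann_zeta] xexp_zeta_arg) auto
  have R: "(\<Prod>i=0..2*n-2. riemann_zeta (2 * real n - real i)) = (\<Prod>j<2 * n - 1. riemann_zeta (real (2 * n - j)))"
  proof (rule prod.cong)
    show "{0..2 * n - 2} = {..<2 * n - 1}" using n by auto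
  qed (use n in \<open>auto simp: of_nat_diff\<close>)
  have "(\<Prod>i\<le>n. 1 / \<zeta> i) * (\<Prod>i\<le>n. \<zeta> i) = 1"
    unfolding prod.distrib[symmetric] by (rule prod.neutral) (use \<zeta> in auto)
  then show ?thesis unfolding R_const_def P Q R by (simp add: mult_ac)
qed

section \<open>Counting last columns\<close>

text \<open>Both bounds follow by induction from the factorisation of \<open>(y + 1) ^ Suc e - y ^ Suc e\<close>.\<close>

lemma power_sum_bounds:
  "real y ^ Suc e / real (Suc e) \<le> (\<Sum>d=1..y. real d ^ e) \<and> (\<Sum>d=1..y. real d ^ e) \<le> real y ^ Suc e / real (Suc e) + real y ^ e"
proof (induction y)
  case 0
  then show ?case by simp
next
  case (Suc y)
  have tel: "real (Suc y) ^ Suc e - real y ^ Suc e = (\<Sum>i<Suc e. real y ^ (Suc e - Suc i) * real (Suc y) ^ i)"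
    using power_diff_sumr2[of "real (Suc y)" "Suc e" "real y"] by simp
  have "(\<Sum>i<Suc e. real y ^ (Suc e - Suc i) * real (Suc y) ^ i) \<le> (\<Sum>i<Suc e. real (Suc y) ^ e)"
  proof (rule sum_mono)
    fix i assume "i \<in> {..<Suc e}"
    then have "e = (Suc e - Suc i) + i" by auto
    moreover have "real y ^ (Suc e - Suc i) * real (Suc y) ^ i \<le> real (Suc y) ^ (Suc e - Suc i) * real (Suc y) ^ i"
      by (intro mult_right_mono power_mono) auto
    ultimately show "real y ^ (Suc e - Suc i) * real (Suc y) ^ i \<le> real (Suc y) ^ e" by (metis power_add)
  qed
  then have up: "real (Suc y) ^ Suc e - real y ^ Suc e \<le> real (Suc e) * real (Suc y) ^ e" using tel by simp
  have "(\<Sum>i<Suc e. real y ^ e) \<le> (\<Sum>i<Suc e. real y ^ (Suc e - Suc i) * real (Suc y) ^ i)"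
  proof (rule sum_mono)
    fix i assume "i \<in> {..<Suc e}"
    then have "e = (Suc e - Suc i) + i" by auto
    moreover have "real y ^ (Suc e - Suc i) * real y ^ i \<le> real y ^ (Suc e - Suc i) * real (Suc y) ^ i"
      by (intro mult_left_mono power_mono) auto
    ultimately show "real y ^ e \<le> real y ^ (Suc e - Suc i) * real (Suc y) ^ i" by (metis power_add)
  qed
  then have lo: "real (Suc e) * real y ^ e \<le> real (Suc y) ^ Suc e - real y ^ Suc e" using tel by simp
  have u: "real (Suc y) ^ Suc e / real (Suc e) \<le> real y ^ Suc e / real (Suc e) + real (Suc y) ^ e"
    using up by (simp add: field_simps del: power_Suc of_nat_Suc)
  have l: "real y ^ Suc e / real (Suc e) + real y ^ e \<le> real (Suc y) ^ Suc e / real (Suc e)"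
  proof -
    have "real (Suc e) * real y ^ e / real (Suc e) \<le> (real (Suc y) ^ Suc e - real y ^ Suc e) / real (Suc e)"
      using lo by (rule divide_right_mono) simp
    then show ?thesis by (simp add: diff_divide_distrib del: power_Suc of_nat_Suc)
  qed
  have "(\<Sum>d=1..Suc y. real d ^ e) = (\<Sum>d=1..y. real d ^ e) + real (Suc y) ^ e" by simp
  then show ?case using Suc u l by linarith
qed

text \<open>After subtracting its mean, \<open>f\<close> has bounded partial sums, and Abel summation transfers this to the
weights \<open>d ^ e\<close>.\<close>

lemma weighted_periodic_sum:
  fixes f :: "int \<Rightarrow> real"
  assumes p: "\<And>x. f (x + int k) = f x" and b: "\<And>x. 0 \<le> f x" "\<And>x. f x \<le> 1" and k: "k > 0" and e: "e \<ge> 1"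
  shows "\<bar>(\<Sum>d=1..y. real d ^ e * f (int d)) - (\<Sum>a<k. f (int a)) / real k * (real y ^ Suc e / real (Suc e))\<bar>
    \<le> (4 * 2 ^ e + 1) * real k * real y ^ e"
proof (cases "y = 0")
  case True
  then show ?thesis using e by simp
next
  case False
  define \<mu> where "\<mu> = (\<Sum>a<k. f (int a)) / real k"
  define h where "h = (\<lambda>d. f (int d) - \<mu>)"
  have \<mu>: "0 \<le> \<mu>" "\<mu> \<le> 1"
  proof -
    have "(\<Sum>a<k. f (int a)) \<le> (\<Sum>a<k. 1)" by (intro sum_mono b)
    then show "\<mu> \<le> 1" using k by (simp add: \<mu>_def)
  qed (auto simp: \<mu>_def intro!: divide_nonneg_nonneg sum_nonneg b)
  have H: "\<bar>\<Sum>j=1..d. h j\<bar> \<le> 2 * real k" for d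
  proof -
    have "(\<Sum>a<Suc d. f (int a)) = f 0 + (\<Sum>j=1..d. f (int j))"
      by (induction d) simp_all
    then have "(\<Sum>j=1..d. h j) = ((\<Sum>a<Suc d. f (int a)) - real (Suc d) * \<mu>) + (\<mu> - f 0)"
      by (simp add: h_def sum_subtractf algebra_simps)
    moreover have "\<bar>(\<Sum>a<Suc d. f (int a)) - real (Suc d) * \<mu>\<bar> \<le> real k"
      unfolding \<mu>_def by (rule sum_periodic_approx) (use p b k in auto)
    moreover have "\<bar>\<mu> - f 0\<bar> \<le> 1" using \<mu> b[of 0] by linarith
    moreover have "real k \<ge> 1" using k by simp
    ultimately show ?thesis by linarith
  qed
  have "(\<Sum>d=1..y. h d * real d ^ e) = (\<Sum>j=1..y. h j) * real (Suc y) ^ e + (\<Sum>m=1..y. (\<Sum>j=1..m. h j) * (real m ^ e - real (Suc m) ^ e))"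
    by (rule abel_summation)
  then have "\<bar>\<Sum>d=1..y. h d * real d ^ e\<bar> \<le> \<bar>\<Sum>j=1..y. h j\<bar> * real (Suc y) ^ e + \<bar>\<Sum>m=1..y. (\<Sum>j=1..m. h j) * (real m ^ e - real (Suc m) ^ e)\<bar>"
    by (simp only:) (rule order_trans[OF abs_triangle_ineq], simp add: abs_mult)
  also have "\<bar>\<Sum>j=1..y. h j\<bar> * real (Suc y) ^ e \<le> 2 * real k * real (Suc y) ^ e"
    by (intro mult_right_mono H) simp
  also have "\<bar>\<Sum>m=1..y. (\<Sum>j=1..m. h j) * (real m ^ e - real (Suc m) ^ e)\<bar> \<le> (\<Sum>m=1..y. 2 * real k * (real (Suc m) ^ e - real m ^ e))"
  proof (rule order_trans[OF sum_abs], rule sum_mono)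
    fix m
    have "real m ^ e \<le> real (Suc m) ^ e" by (intro power_mono) auto
    then have "\<bar>(\<Sum>j=1..m. h j) * (real m ^ e - real (Suc m) ^ e)\<bar> = \<bar>\<Sum>j=1..m. h j\<bar> * (real (Suc m) ^ e - real m ^ e)"
      by (simp add: abs_mult)
    also have "\<dots> \<le> 2 * real k * (real (Suc m) ^ e - real m ^ e)"
      by (intro mult_right_mono H) (use \<open>real m ^ e \<le> real (Suc m) ^ e\<close> in simp)
    finally show "\<bar>(\<Sum>j=1..m. h j) * (real m ^ e - real (Suc m) ^ e)\<bar> \<le> 2 * real k * (real (Suc m) ^ e - real m ^ e)" .
  qed
  also have "(\<Sum>m=1..y. 2 * real k * (real (Suc m) ^ e - real m ^ e)) = 2 * real k * (real (Suc y) ^ e - 1)"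
  proof -
    have "(\<Sum>m=1..y. real (Suc m) ^ e - real m ^ e) = real (Suc y) ^ e - 1"
      by (induction y) simp_all
    then show ?thesis by (simp add: sum_distrib_left[symmetric] del: of_nat_Suc)
  qed
  also have "2 * real k * real (Suc y) ^ e + 2 * real k * (real (Suc y) ^ e - 1) \<le> 4 * real k * real (Suc y) ^ e"
    by (simp add: algebra_simps)
  also have "real (Suc y) ^ e \<le> 2 ^ e * real y ^ e"
  proof -
    have "real (Suc y) \<le> 2 * real y" using False by simp
    then have "real (Suc y) ^ e \<le> (2 * real y) ^ e" by (rule power_mono) simp
    then show ?thesis by (simp only: power_mult_distrib)
  qed
  finally have 1: "\<bar>\<Sum>d=1..y. h d * real d ^ e\<bar> \<le> 4 * real k * (2 ^ e * real y ^ e)"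
    by (simp add: mult_left_mono)
  have "\<mu> * (real y ^ Suc e / real (Suc e)) \<le> \<mu> * (\<Sum>d=1..y. real d ^ e)"
    "\<mu> * (\<Sum>d=1..y. real d ^ e) \<le> \<mu> * (real y ^ Suc e / real (Suc e) + real y ^ e)"
    by (rule mult_left_mono[OF conjunct1[OF power_sum_bounds] \<mu>(1)], rule mult_left_mono[OF conjunct2[OF power_sum_bounds] \<mu>(1)])
  moreover have "\<mu> * real y ^ e \<le> 1 * real y ^ e" using \<mu> by (intro mult_right_mono) auto
  moreover have "1 * real y ^ e \<le> real k * real y ^ e" using k by (intro mult_right_mono) auto
  ultimately have 2: "\<bar>\<mu> * (\<Sum>d=1..y. real d ^ e) - \<mu> * (real y ^ Suc e / real (Suc e))\<bar> \<le> real k * real y ^ e"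
    by (simp add: distrib_left del: power_Suc of_nat_Suc)
  have "(\<Sum>d=1..y. real d ^ e * f (int d)) = (\<Sum>d=1..y. h d * real d ^ e) + \<mu> * (\<Sum>d=1..y. real d ^ e)"
    by (simp add: h_def sum_distrib_left sum.distrib[symmetric] algebra_simps)
  with 1 2 show ?thesis unfolding \<mu>_def[symmetric] by (simp add: algebra_simps del: power_Suc of_nat_Suc)
qed

text \<open>The number of last columns with diagonal entry at most \<open>y\<close> that complete \<open>T\<close> to an isotropic matrix.\<close>

definition last_cols :: "nat \<Rightarrow> nat \<Rightarrow> (nat \<Rightarrow> nat \<Rightarrow> int) \<Rightarrow> nat \<Rightarrow> real" where
  "last_cols n k T y = (\<Sum>d=1..y. \<Sum>u\<in>cube {..<2 * n - 1} d. of_bool (isotropic n k (T(2 * n - 1 := u(2 * n - 1 := int d)))))"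

lemma periodic_isotropic: "periodic k (\<lambda>v. of_bool (isotropic n k (T(r := v))) :: real)"
  unfolding periodic_def
proof (intro allI impI)
  fix v w :: "nat \<Rightarrow> int" assume "\<forall>i. [v i = w i] (mod int k)"
  then have "isotropic n k (T(r := v)) = isotropic n k (T(r := w))" by (intro isotropic_congr) auto
  then show "of_bool (isotropic n k (T(r := v))) = (of_bool (isotropic n k (T(r := w))) :: real)" by simp
qed

text \<open>For diagonal entry \<open>d\<close> the other entries fill a cube of side \<open>d\<close>, on which \<open>cube_approx\<close> gives the
proportion modulo \<open>k\<close>; this proportion is periodic in \<open>d\<close>, so that \<open>weighted_periodic_sum\<close> applies.\<close>

lemma last_cols_approx:
  assumes n: "n \<ge> 1" and k: "k > 0"
  shows "\<bar>last_cols n k T y - last_prob n k T * (real y ^ (2 * n) / real (2 * n))\<bar>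
    \<le> (real (2 * n) + 4 * 2 ^ (2 * n) + 1) * real k * real y ^ (2 * n - 1)"
proof -
  define e where "e = 2 * n - 1"
  have N: "2 * n = Suc e" and e: "e \<ge> 1" using n by (auto simp: e_def)
  define \<Phi> where "\<Phi> = (\<lambda>v. of_bool (isotropic n k (T(e := v))) :: real)"
  have periodic: "periodic k \<Phi>" unfolding \<Phi>_def by (rule periodic_isotropic)
  define A where "A = (\<lambda>d. avg {..<e} k (\<lambda>u. \<Phi> (u(e := d))))"
  have A: "A (x + int k) = A x" "0 \<le> A x" "A x \<le> 1" for x
    unfolding A_def
    by (simp only: periodic_real[OF periodic]) (auto intro!: avg_nonneg avg_le_1 k simp: \<Phi>_def)
  have col: "\<bar>(\<Sum>u\<in>cube {..<e} d. \<Phi> (u(e := int d))) - real d ^ e * A (int d)\<bar> \<le> real e * real k * real y ^ (e - 1)"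
    if d: "1 \<le> d" "d \<le> y" for d
  proof -
    have "real d * \<bar>(\<Sum>u\<in>cube {..<e} d. \<Phi> (u(e := int d))) - real d ^ card {..<e} * A (int d)\<bar> \<le> real (card {..<e}) * real k * real d ^ card {..<e}"
      unfolding A_def by (rule cube_approx) (use periodic k d in \<open>auto simp: \<Phi>_def intro!: periodic_isotropic periodic_upd[OF periodic, unfolded \<Phi>_def]\<close>)
    moreover have "real d ^ e = real d * real d ^ (e - 1)" using e by (cases e) auto
    ultimately have "real d * \<bar>(\<Sum>u\<in>cube {..<e} d. \<Phi> (u(e := int d))) - real d ^ e * A (int d)\<bar> \<le> real d * (real e * real k * real d ^ (e - 1))"
      by (simp add: mult_ac)
    then have "\<bar>(\<Sum>u\<in>cube {..<e} d. \<Phi> (u(e := int d))) - real d ^ e * A (int d)\<bar> \<le> real e * real k * real d ^ (e - 1)"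
      using d by (simp add: mult_le_cancel_left)
    also have "\<dots> \<le> real e * real k * real y ^ (e - 1)" using d by (intro mult_left_mono power_mono) auto
    finally show ?thesis .
  qed
  have "\<bar>last_cols n k T y - (\<Sum>d=1..y. real d ^ e * A (int d))\<bar> \<le> (\<Sum>d=1..y. real e * real k * real y ^ (e - 1))"
  proof -
    have "last_cols n k T y - (\<Sum>d=1..y. real d ^ e * A (int d)) = (\<Sum>d=1..y. (\<Sum>u\<in>cube {..<e} d. \<Phi> (u(e := int d))) - real d ^ e * A (int d))"
      unfolding last_cols_def e_def[symmetric] \<Phi>_def by (simp only: sum_subtractf)
    then show ?thesis by (simp only:) (rule order_trans[OF sum_abs], rule sum_mono, rule col, auto)
  qed
  also have "\<dots> = real e * real k * real y ^ e"
    using e by (cases e) simp_all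
  finally have 1: "\<bar>last_cols n k T y - (\<Sum>d=1..y. real d ^ e * A (int d))\<bar> \<le> real e * real k * real y ^ e" .
  have 2: "\<bar>(\<Sum>d=1..y. real d ^ e * A (int d)) - (\<Sum>a<k. A (int a)) / real k * (real y ^ Suc e / real (Suc e))\<bar>
    \<le> (4 * 2 ^ e + 1) * real k * real y ^ e"
    by (rule weighted_periodic_sum) (use A k e in auto)
  have p: "last_prob n k T = (\<Sum>a<k. A (int a)) / real k"
    unfolding last_prob_def e_def[symmetric] N lessThan_Suc by (subst avg_insert) (auto simp: A_def \<Phi>_def)
  have "\<bar>last_cols n k T y - last_prob n k T * (real y ^ Suc e / real (Suc e))\<bar> \<le> real e * real k * real y ^ e + (4 * 2 ^ e + 1) * real k * real y ^ e"
    using 1 2 unfolding p by linarith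
  also have "\<dots> = (real e + 4 * 2 ^ e + 1) * real k * real y ^ e" by (simp add: algebra_simps)
  also have "\<dots> \<le> (real (Suc e) + 4 * 2 ^ Suc e + 1) * real k * real y ^ e"
  proof -
    have "(2::real) ^ e \<le> 2 ^ Suc e" by (rule power_increasing) auto
    then have "real e + 4 * 2 ^ e + 1 \<le> real (Suc e) + 4 * 2 ^ Suc e + 1" unfolding of_nat_Suc by linarith
    then show ?thesis by (intro mult_right_mono) auto
  qed
  finally show ?thesis unfolding N by simp
qed

section \<open>Bounds uniform in the central index\<close>

text \<open>A column with diagonal entry \<open>d\<close> can be filled in \<open>d ^ j\<close> ways above the diagonal.\<close>

lemma hnf_prod_has_sum:
  assumes "\<And>j d. j < r \<Longrightarrow> f j d \<ge> (0::real)" "\<And>j. j < r \<Longrightarrow> ((\<lambda>d. real d ^ j * f j d) has_sum S j) {1..}"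
  shows "((\<lambda>T. \<Prod>j<r. f j (nat (T j j))) has_sum (\<Prod>j<r. S j)) (hnf r)"
  using assms
proof (induction r)
  case 0
  then show ?case by (simp add: hnf_0 has_sum_finite_iff)
next
  case (Suc r)
  show ?case
  proof (rule has_sum_hnf_Suc[where G = "\<lambda>T. (\<Prod>j<r. f j (nat (T j j))) * S r"])
    show "(\<Prod>j<Suc r. f j (nat (M j j))) \<ge> 0" for M using Suc.prems(1) by (intro prod_nonneg) auto
    have "((\<lambda>T. \<Prod>j<r. f j (nat (T j j))) has_sum (\<Prod>j<r. S j)) (hnf r)" by (rule Suc.IH) (use Suc.prems in auto)
    from has_sum_cmult_left[OF this, of "S r"]
    show "((\<lambda>T. (\<Prod>j<r. f j (nat (T j j))) * S r) has_sum (\<Prod>j<Suc r. S j)) (hnf r)" by simp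
  next
    fix T assume "T \<in> hnf r"
    have "((\<lambda>v. f r (nat (v r))) has_sum S r) (hcol r)"
    proof (rule has_sum_hcol)
      show "((\<lambda>d. \<Sum>u\<in>cube {..<r} d. f r (nat ((u(r := int d)) r))) has_sum S r) {1..}"
        using Suc.prems(2)[of r] by (simp add: card_cube)
    qed (use Suc.prems(1)[of r] in auto)
    from has_sum_cmult_right[OF this, of "\<Prod>j<r. f j (nat (T j j))"]
    show "((\<lambda>v. \<Prod>j<Suc r. f j (nat ((T(r := v)) j j))) has_sum ((\<Prod>j<r. f j (nat (T j j))) * S r)) (hcol r)"
      by simp
  qed
qed

lemma powr_summable_on: "e < -1 \<Longrightarrow> (\<lambda>d. real d powr e) summable_on {1::nat..}"
proof -
  assume e: "e < -1"
  have "(\<lambda>m. real m powr e) sums (\<Sum>m. real m powr e)"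
    using e by (intro summable_sums) (simp add: summable_real_powr_iff)
  then have "(\<lambda>m. real m powr e) summable_on UNIV"
    by (intro has_sum_imp_summable[OF sums_nonneg_imp_has_sum]) auto
  then show ?thesis by (rule summable_on_subset_banach) simp
qed

definition hnf_det :: "nat \<Rightarrow> (nat \<Rightarrow> nat \<Rightarrow> int) \<Rightarrow> nat" where
  "hnf_det r T = (\<Prod>j<r. nat (T j j))"

lemma hnf_det_pos: "T \<in> hnf r \<Longrightarrow> hnf_det r T > 0"
  unfolding hnf_det_def by (intro prod_pos) (auto dest: hnf_diag)

lemma hnf_det_real: "T \<in> hnf r \<Longrightarrow> real (hnf_det r T) = (\<Prod>j<r. real_of_int (T j j))"
  unfolding hnf_det_def of_nat_prod by (rule prod.cong) (auto dest!: hnf_diag)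

lemma hnf_det_int: "T \<in> hnf r \<Longrightarrow> int (hnf_det r T) = (\<Prod>j<r. T j j)"
  unfolding hnf_det_def of_nat_prod by (rule prod.cong) (auto dest!: hnf_diag)

lemma hnf_det_powr_summable:
  assumes "\<And>j. j < r \<Longrightarrow> ex j + real j < -1"
  shows "(\<lambda>T. \<Prod>j<r. real (nat (T j j)) powr ex j) summable_on hnf r"
proof -
  have "((\<lambda>T. \<Prod>j<r. (\<lambda>d. real d powr ex j) (nat (T j j))) has_sum (\<Prod>j<r. infsum (\<lambda>d. real d ^ j * real d powr ex j) {1..})) (hnf r)"
  proof (rule hnf_prod_has_sum)
    fix j assume j: "j < r"
    have "(\<lambda>d. real d powr (ex j + real j)) summable_on {1::nat..}" by (rule powr_summable_on) (rule assms[OF j])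
    then have "(\<lambda>d. real d ^ j * real d powr ex j) summable_on {1..}"
      by (rule summable_on_cong[THEN iffD1, rotated]) (simp add: powr_add powr_realpow)
    then show "((\<lambda>d. real d ^ j * real d powr ex j) has_sum infsum (\<lambda>d. real d ^ j * real d powr ex j) {1..}) {1..}"
      by (rule has_sum_infsum)
  qed simp
  then show ?thesis by (rule has_sum_imp_summable)
qed

lemma hnf_det_powr_prod: "T \<in> hnf r \<Longrightarrow> (\<Prod>j<r. real (nat (T j j)) powr e) = real (hnf_det r T) powr e"
  unfolding hnf_det_def of_nat_prod by (subst prod_powr_distrib) auto

text \<open>The entry of the form at the first and the last row is the product of the first and the last
diagonal entry, as all other columns vanish in the last row.\<close>

lemma isotropic_outer:
  assumes n: "n \<ge> 1" and T: "T \<in> hnf (2 * n - 1)" and u: "u \<in> cube {..<2 * n - 1} d"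
    and iso: "isotropic n k (T(2 * n - 1 := u(2 * n - 1 := int d)))"
  shows "int k dvd T 0 0 * int d"
proof -
  define r where "r = 2 * n - 1"
  define M where "M = T(r := u(r := int d))"
  have iso': "int k dvd (\<Sum>l<n. M l 0 * M (2 * n - 1 - l) r - M l r * M (2 * n - 1 - l) 0)"
    using iso unfolding isotropic_def M_def r_def by blast
  have "(\<Sum>l<n. M l 0 * M (2 * n - 1 - l) r - M l r * M (2 * n - 1 - l) 0) = (\<Sum>l\<in>{0}. M l 0 * M (2 * n - 1 - l) r - M l r * M (2 * n - 1 - l) 0)"
  proof (rule sum.mono_neutral_right)
    show "\<forall>l\<in>{..<n} - {0}. M l 0 * M (2 * n - 1 - l) r - M l r * M (2 * n - 1 - l) 0 = 0"
    proof
      fix l assume l: "l \<in> {..<n} - {0}"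
      have "M l r = 0" "M (2 * n - 1 - l) r = 0"
        using hnf_zero[OF T, of l r] hnf_zero[OF T, of "2 * n - 1 - l" r] l by (auto simp: M_def r_def)
      then show "M l 0 * M (2 * n - 1 - l) r - M l r * M (2 * n - 1 - l) 0 = 0" by simp
    qed
  qed (use n in auto)
  moreover have "M 0 r = 0" "M 0 0 = T 0 0" "M (2 * n - 1 - 0) r = int d"
    using hnf_zero[OF T, of 0 r] n by (auto simp: M_def r_def)
  ultimately show ?thesis using iso' by simp
qed

text \<open>The entry of the form at the rows \<open>n - 1\<close> and \<open>n\<close> comes from the two middle columns only: the
earlier ones vanish in these rows. For \<open>n \<ge> 2\<close> the last column is not among them.\<close>

lemma isotropic_middle:
  assumes n: "n \<ge> 2" and T: "T \<in> hnf (2 * n - 1)" and iso: "isotropic n k (T(2 * n - 1 := v))"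
  shows "int k dvd T (n - 1) (n - 1) * T n n"
proof -
  define r where "r = 2 * n - 1"
  define M where "M = T(r := v)"
  have MT: "M j = T j" if "j < r" for j using that by (simp add: M_def)
  have iso': "int k dvd (\<Sum>l<n. M l (n - 1) * M (2 * n - 1 - l) n - M l n * M (2 * n - 1 - l) (n - 1))"
    using iso unfolding isotropic_def M_def r_def by blast
  have "(\<Sum>l<n. M l (n - 1) * M (2 * n - 1 - l) n - M l n * M (2 * n - 1 - l) (n - 1)) = (\<Sum>l\<in>{n - 1}. M l (n - 1) * M (2 * n - 1 - l) n - M l n * M (2 * n - 1 - l) (n - 1))"
  proof (rule sum.mono_neutral_right)
    show "\<forall>l\<in>{..<n} - {n - 1}. M l (n - 1) * M (2 * n - 1 - l) n - M l n * M (2 * n - 1 - l) (n - 1) = 0"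
    proof
      fix l assume l: "l \<in> {..<n} - {n - 1}"
      then have "l < n - 1" by auto
      then have "M l (n - 1) = 0" "M l n = 0"
        using hnf_zero[OF T, of l "n - 1"] hnf_zero[OF T, of l n] MT[of l] n by (auto simp: r_def)
      then show "M l (n - 1) * M (2 * n - 1 - l) n - M l n * M (2 * n - 1 - l) (n - 1) = 0" by simp
    qed
  qed (use n in auto)
  moreover have "M (n - 1) n = 0" using hnf_zero[OF T, of "n - 1" n] MT[of "n - 1"] n by (auto simp: r_def)
  moreover have "2 * n - 1 - (n - 1) = n" using n by simp
  moreover have "M (n - 1) (n - 1) = T (n - 1) (n - 1)" "M n n = T n n" using MT n by (auto simp: r_def)
  ultimately show ?thesis using iso' by simp
qed

text \<open>The quotients \<open>a * d div k\<close> are different positive integers not exceeding \<open>a * y / k\<close>.\<close>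

lemma card_dvd_mult_le:
  assumes "k > 0"
  shows "real k * real (card {d\<in>{1..y}. k dvd a * d}) \<le> real a * real y \<or> a = 0"
proof (cases "a = 0")
  case False
  have "card {d\<in>{1..y}. k dvd a * d} \<le> card {1..a * y div k}"
  proof (rule card_inj_on_le[of "\<lambda>d. a * d div k"])
    show "inj_on (\<lambda>d. a * d div k) {d\<in>{1..y}. k dvd a * d}"
    proof (rule inj_onI)
      fix d d' assume d: "d \<in> {d\<in>{1..y}. k dvd a * d}" "d' \<in> {d\<in>{1..y}. k dvd a * d}" "a * d div k = a * d' div k"
      have "a * d = a * d div k * k" using d(1) by simp
      also have "\<dots> = a * d' div k * k" by (simp only: d(3))
      also have "\<dots> = a * d'" using d(2) by simp
      finally have "a * d = a * d'" .
      then show "d = d'" using False by simp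
    qed
    show "(\<lambda>d. a * d div k) ` {d\<in>{1..y}. k dvd a * d} \<subseteq> {1..a * y div k}"
    proof
      fix x assume "x \<in> (\<lambda>d. a * d div k) ` {d\<in>{1..y}. k dvd a * d}"
      then obtain d where d: "1 \<le> d" "d \<le> y" "k dvd a * d" "x = a * d div k" by auto
      have "x * k = a * d" using d by simp
      moreover have "a * d > 0" using False d by simp
      ultimately have "x > 0" by (metis gr0I mult_0 less_irrefl)
      moreover have "x \<le> a * y div k" unfolding d(4) using d by (intro div_le_mono mult_le_mono) auto
      ultimately show "x \<in> {1..a * y div k}" by simp
    qed
  qed simp
  then have "k * card {d\<in>{1..y}. k dvd a * d} \<le> k * (a * y div k)" by simp
  also have "\<dots> \<le> a * y" by simp
  finally show ?thesis by (metis of_nat_le_iff of_nat_mult)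
qed simp

text \<open>The part of the bound in \<open>last_cols_bound\<close> that depends on \<open>T\<close>.\<close>

definition wbound :: "nat \<Rightarrow> real \<Rightarrow> real \<Rightarrow> (nat \<Rightarrow> nat \<Rightarrow> int) \<Rightarrow> real" where
  "wbound n \<theta> \<phi> T = real_of_int (T 0 0) powr \<theta> * (if n \<ge> 2 then real_of_int (T (n - 1) (n - 1) * T n n) powr \<phi> else 1)"

lemma last_cols_nonneg: "last_cols n k T y \<ge> 0"
  unfolding last_cols_def by (intro sum_nonneg) auto

text \<open>By \<open>isotropic_outer\<close> the last diagonal entry satisfies a divisibility that holds with frequency at
most \<open>T 0 0 / k\<close>, and any power of this ratio between \<open>0\<close> and \<open>1\<close> is a valid bound. By
\<open>isotropic_middle\<close>, \<open>k\<close> does not exceed the product of the middle diagonal entries.\<close>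

lemma last_cols_bound:
  assumes n: "n \<ge> 1" and k: "k > 0" and T: "T \<in> hnf (2 * n - 1)" and \<theta>: "0 \<le> \<theta>" "\<theta> \<le> 1"
    and \<phi>: "\<phi> \<ge> 0" "n = 1 \<longrightarrow> \<phi> = 0"
  shows "last_cols n k T y \<le> real y ^ (2 * n) * (wbound n \<theta> \<phi> T * real k powr (- \<theta> - \<phi>))"
proof -
  define e where "e = 2 * n - 1"
  define C where "C \<longleftrightarrow> (n \<ge> 2 \<longrightarrow> int k dvd T (n - 1) (n - 1) * T n n)"
  define a where "a = nat (T 0 0)"
  have T00: "T 0 0 > 0" using hnf_diag[OF T, of 0] n by auto
  then have a: "a > 0" "int a = T 0 0" by (auto simp: a_def)
  have "last_cols n k T y \<le> (\<Sum>d=1..y. \<Sum>u\<in>cube {..<e} d. of_bool (C \<and> k dvd a * d))"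
    unfolding last_cols_def e_def[symmetric]
  proof (intro sum_mono)
    fix d u assume u: "u \<in> cube {..<e} d"
    have "C \<and> k dvd a * d" if iso: "isotropic n k (T(e := u(e := int d)))"
    proof
      show C unfolding C_def using isotropic_middle[of n T k] T iso by (auto simp: e_def)
      have "int k dvd int (a * d)" using isotropic_outer[OF n T] u iso a by (simp add: e_def)
      then show "k dvd a * d" by (simp only: int_dvd_int_iff)
    qed
    then show "of_bool (isotropic n k (T(e := u(e := int d)))) \<le> (of_bool (C \<and> k dvd a * d) :: real)" by auto
  qed
  also have "\<dots> = of_bool C * (\<Sum>d=1..y. real d ^ e * of_bool (k dvd a * d))"
    by (auto simp: card_cube sum_distrib_left of_bool_def intro!: sum.cong)
  also have "(\<Sum>d=1..y. real d ^ e * of_bool (k dvd a * d)) \<le> (\<Sum>d=1..y. real y ^ e * of_bool (k dvd a * d))"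
    by (intro sum_mono mult_right_mono power_mono) auto
  also have "(\<Sum>d=1..y. real y ^ e * of_bool (k dvd a * d)) = real y ^ e * real (card {d\<in>{1..y}. k dvd a * d})"
    by (simp add: sum_distrib_left[symmetric] of_bool_def sum.inter_filter[symmetric])
  also have "real (card {d\<in>{1..y}. k dvd a * d}) \<le> real y * (real a / real k) powr \<theta>"
  proof (cases "real a / real k \<ge> 1")
    case True
    have "card {d\<in>{1..y}. k dvd a * d} \<le> card {1..y}" by (rule card_mono) auto
    then have "real (card {d\<in>{1..y}. k dvd a * d}) \<le> real y * 1" by simp
    also have "\<dots> \<le> real y * (real a / real k) powr \<theta>" using True \<theta> by (intro mult_left_mono ge_one_powr_ge_zero) auto
    finally show ?thesis .
  next
    case False
    have "real (card {d\<in>{1..y}. k dvd a * d}) \<le> real y * (real a / real k)"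
      using card_dvd_mult_le[OF k, of y a] a k by (simp add: field_simps)
    also have "real a / real k = (real a / real k) powr 1" using a k by simp
    also have "(real a / real k) powr 1 \<le> (real a / real k) powr \<theta>"
      using False \<theta> a k by (intro powr_mono') auto
    finally show ?thesis by (simp add: mult_left_mono)
  qed
  finally have 1: "last_cols n k T y \<le> of_bool C * (real y ^ e * (real y * (real a / real k) powr \<theta>))"
    by (simp add: mult_left_mono)
  have 2: "of_bool C \<le> (if n \<ge> 2 then real_of_int (T (n - 1) (n - 1) * T n n) powr \<phi> else 1) * real k powr (- \<phi>)"
  proof (cases "n \<ge> 2 \<and> C")
    case True
    then have dv: "int k dvd T (n - 1) (n - 1) * T n n" by (simp add: C_def)
    moreover have pos: "T (n - 1) (n - 1) * T n n > 0" using True by (intro mult_pos_pos hnf_diag[OF T]) auto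
    ultimately have "int k \<le> T (n - 1) (n - 1) * T n n" by (simp add: zdvd_imp_le)
    then have "real k \<le> real_of_int (T (n - 1) (n - 1) * T n n)" by (metis of_int_le_iff of_int_of_nat_eq)
    then have "real k powr \<phi> \<le> real_of_int (T (n - 1) (n - 1) * T n n) powr \<phi>" using \<phi> by (intro powr_mono2) auto
    then have "real k powr \<phi> * real k powr (- \<phi>) \<le> real_of_int (T (n - 1) (n - 1) * T n n) powr \<phi> * real k powr (- \<phi>)"
      by (intro mult_right_mono) auto
    moreover have "real k powr \<phi> * real k powr (- \<phi>) = 1" using k by (simp flip: powr_add)
    ultimately show ?thesis using True by simp
  next
    case False
    then show ?thesis using \<phi> n k by (cases "n \<ge> 2") auto
  qed
  have "last_cols n k T y \<le> ((if n \<ge> 2 then real_of_int (T (n - 1) (n - 1) * T n n) powr \<phi> else 1) * real k powr (- \<phi>)) * (real y ^ e * (real y * (real a / real k) powr \<theta>))"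
    by (rule order_trans[OF 1], rule mult_right_mono[OF 2]) auto
  also have "(real a / real k) powr \<theta> = real_of_int (T 0 0) powr \<theta> * real k powr (- \<theta>)"
    using a by (simp add: powr_divide powr_minus_divide flip: a(2))
  also have "real y ^ e * (real y * (real_of_int (T 0 0) powr \<theta> * real k powr (- \<theta>))) = real y ^ (2 * n) * (real_of_int (T 0 0) powr \<theta> * real k powr (- \<theta>))"
  proof -
    have "2 * n = Suc e" using n by (simp add: e_def)
    then show ?thesis by simp
  qed
  finally show ?thesis using k by (simp add: wbound_def powr_diff powr_minus divide_inverse mult_ac)
qed

text \<open>The weight of column \<open>j\<close> is a power of its diagonal entry with exponent at most
\<open>\<theta> + j - 2 * n\<close> or \<open>\<phi> + j - 2 * n\<close>, which is less than \<open>- 1\<close> for \<open>j < 2 * n - 1\<close>. The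
three distinguished columns are different for \<open>n \<ge> 2\<close>.\<close>

lemma wbound_summable:
  assumes n: "n \<ge> 1" and \<theta>: "0 \<le> \<theta>" "\<theta> < 1" and \<phi>: "\<phi> = 0 \<or> (n \<ge> 2 \<and> 0 \<le> \<phi> \<and> \<phi> < 1)"
  shows "(\<lambda>T. wbound n \<theta> \<phi> T / real (hnf_det (2 * n - 1) T) ^ (2 * n)) summable_on hnf (2 * n - 1)"
proof -
  define r where "r = 2 * n - 1"
  define \<phi>' where "\<phi>' = (if n \<ge> 2 then \<phi> else 0)"
  define ex where "ex = (\<lambda>j. (if j = 0 then \<theta> else 0) + (if j = n - 1 then \<phi>' else 0) + (if j = n then \<phi>' else 0) - real (2 * n))"
  have "(\<lambda>T. \<Prod>j<r. real (nat (T j j)) powr ex j) summable_on hnf r"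
  proof (rule hnf_det_powr_summable)
    fix j assume "j < r"
    then show "ex j + real j < -1" using n \<theta> \<phi> by (auto simp: ex_def r_def \<phi>'_def)
  qed
  then show ?thesis
    unfolding r_def[symmetric]
  proof (rule summable_on_cong[THEN iffD1, rotated])
    fix T assume T: "T \<in> hnf r"
    have pos: "real (nat (T j j)) > 0" if "j < r" for j using hnf_diag[OF T that] by simp
    have del: "(\<Prod>j<r. real (nat (T j j)) powr (if j = i then c else 0)) = real_of_int (T i i) powr c" if "i < r" for i c
    proof -
      have "(\<Prod>j<r. real (nat (T j j)) powr (if j = i then c else 0)) = (\<Prod>j<r. if j = i then real (nat (T j j)) powr c else 1)"
      proof (rule prod.cong)
        fix j assume "j \<in> {..<r}"
        then show "real (nat (T j j)) powr (if j = i then c else 0) = (if j = i then real (nat (T j j)) powr c else 1)"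
          using pos[of j] by (cases "j = i") auto
      qed simp
      then show ?thesis using that hnf_diag[OF T that] by (simp add: prod.delta)
    qed
    have "(\<Prod>j<r. real (nat (T j j)) powr ex j) = (\<Prod>j<r. real (nat (T j j)) powr (if j = 0 then \<theta> else 0)) *
       ((\<Prod>j<r. real (nat (T j j)) powr (if j = n - 1 then \<phi>' else 0)) * ((\<Prod>j<r. real (nat (T j j)) powr (if j = n then \<phi>' else 0)) * (\<Prod>j<r. real (nat (T j j)) powr (- real (2 * n)))))"
      unfolding prod.distrib[symmetric] ex_def by (rule prod.cong) (simp_all add: algebra_simps flip: powr_add)
    also have "(\<Prod>j<r. real (nat (T j j)) powr (if j = 0 then \<theta> else 0)) = real_of_int (T 0 0) powr \<theta>"
      by (rule del) (use n in \<open>simp add: r_def\<close>)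
    also have "(\<Prod>j<r. real (nat (T j j)) powr (- real (2 * n))) = 1 / real (hnf_det r T) ^ (2 * n)"
      using hnf_det_pos[OF T] by (subst hnf_det_powr_prod[OF T]) (simp only: powr_minus_divide powr_realpow of_nat_0_less_iff)
    also have "(\<Prod>j<r. real (nat (T j j)) powr (if j = n - 1 then \<phi>' else 0)) * ((\<Prod>j<r. real (nat (T j j)) powr (if j = n then \<phi>' else 0)) * (1 / real (hnf_det r T) ^ (2 * n)))
      = (if n \<ge> 2 then real_of_int (T (n - 1) (n - 1) * T n n) powr \<phi> else 1) / real (hnf_det r T) ^ (2 * n)"
    proof (cases "n \<ge> 2")
      case True
      have "T (n - 1) (n - 1) > 0" "T n n > 0" using hnf_diag[OF T, of "n - 1"] hnf_diag[OF T, of n] True by (auto simp: r_def)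
      then show ?thesis using True del[of "n - 1" \<phi>'] del[of n \<phi>'] by (simp add: r_def \<phi>'_def powr_mult)
    next
      case False
      have "(\<Prod>j<r. real (nat (T j j)) powr (if j = i then \<phi>' else 0)) = 1" for i
      proof (rule prod.neutral, rule ballI)
        fix j assume "j \<in> {..<r}"
        then show "real (nat (T j j)) powr (if j = i then \<phi>' else 0) = 1" using pos[of j] False by (cases "j = i") (auto simp: \<phi>'_def)
      qed
      then show ?thesis using False by simp
    qed
    finally show "(\<Prod>j<r. real (nat (T j j)) powr ex j) = wbound n \<theta> \<phi> T / real (hnf_det r T) ^ (2 * n)"
      by (simp add: wbound_def)
  qed
qed

section \<open>Asymptotics for a fixed central index\<close>

text \<open>The number of subgroups of index at most \<open>X\<close> that meet the centre in the \<open>k\<close>-th powers, as a sum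
over all columns but the last one.\<close>

definition central_count :: "nat \<Rightarrow> nat \<Rightarrow> nat \<Rightarrow> real" where
  "central_count n k X = infsum (\<lambda>T. real k ^ (2 * n) * last_cols n k T (X div (k * hnf_det (2 * n - 1) T))) (hnf (2 * n - 1))"

text \<open>The main term of \<open>central_count\<close>, normalised by \<open>X ^ (2 * n) / (2 * n)\<close>.\<close>

definition central_density :: "nat \<Rightarrow> nat \<Rightarrow> real" where
  "central_density n k = infsum (\<lambda>T. last_prob n k T / real (hnf_det (2 * n - 1) T) ^ (2 * n)) (hnf (2 * n - 1))"

lemma last_prob_bounds: "k > 0 \<Longrightarrow> 0 \<le> last_prob n k T" "k > 0 \<Longrightarrow> last_prob n k T \<le> 1"
  by (auto simp: last_prob_def intro!: avg_nonneg avg_le_1)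

lemma central_density_eq:
  assumes "n \<ge> 1" "k > 0"
  shows "central_density n k = (\<Prod>j<2 * n - 1. riemann_zeta (real (2 * n - j))) * iso_prob n k"
    and "(\<lambda>T. last_prob n k T / real (hnf_det (2 * n - 1) T) ^ (2 * n)) summable_on hnf (2 * n - 1)"
proof -
  have h: "((\<lambda>T. last_prob n k T / real (hnf_det (2 * n - 1) T) ^ (2 * n)) has_sum
    ((\<Prod>j<2 * n - 1. riemann_zeta (real (2 * n - j))) * iso_prob n k)) (hnf (2 * n - 1))"
    using last_prob_has_sum[OF assms] by (rule has_sum_cong[THEN iffD1, rotated]) (simp add: hnf_det_real)
  show "central_density n k = (\<Prod>j<2 * n - 1. riemann_zeta (real (2 * n - j))) * iso_prob n k"
    unfolding central_density_def using h by (rule infsumI)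
  show "(\<lambda>T. last_prob n k T / real (hnf_det (2 * n - 1) T) ^ (2 * n)) summable_on hnf (2 * n - 1)"
    using h by (rule has_sum_imp_summable)
qed

lemma nat_div_real:
  assumes "c > 0"
  shows "real (X div c) \<le> real X / real c" "real X / real c < real (X div c) + 1"
proof -
  have "real X = real (X div c) * real c + real (X mod c)" by (simp flip: of_nat_mult of_nat_add)
  moreover have "real (X mod c) < real c" using assms by simp
  moreover have c: "real c > 0" using assms by simp
  ultimately show "real (X div c) \<le> real X / real c" "real X / real c < real (X div c) + 1"
    by (simp_all add: pos_le_divide_eq pos_divide_less_eq distrib_right)
qed

lemma power_diff_le:
  fixes a b :: real
  assumes "0 \<le> a" "a \<le> b" "b \<le> a + 1"
  shows "b ^ N - a ^ N \<le> real N * b ^ (N - 1)"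
proof -
  have "b ^ N - a ^ N = (b - a) * (\<Sum>i<N. a ^ (N - Suc i) * b ^ i)" by (rule power_diff_sumr2)
  also have "\<dots> \<le> 1 * (\<Sum>i<N. b ^ (N - 1))"
  proof (rule mult_mono)
    show "(\<Sum>i<N. a ^ (N - Suc i) * b ^ i) \<le> (\<Sum>i<N. b ^ (N - 1))"
    proof (rule sum_mono)
      fix i assume "i \<in> {..<N}"
      then have e: "N - 1 = (N - Suc i) + i" by auto
      have "a ^ (N - Suc i) * b ^ i \<le> b ^ (N - Suc i) * b ^ i"
        using assms by (intro mult_right_mono power_mono) auto
      then show "a ^ (N - Suc i) * b ^ i \<le> b ^ (N - 1)" by (simp only: e power_add)
    qed
  qed (use assms in \<open>auto intro!: sum_nonneg mult_nonneg_nonneg\<close>)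
  finally show ?thesis by simp
qed

definition K1 :: "nat \<Rightarrow> real" where "K1 n = real (2 * n) + 4 * 2 ^ (2 * n) + 2"

text \<open>Passing from the integer part to \<open>z\<close> costs no more than the main error. Raising the exponent from
\<open>2 * n - 1\<close> to \<open>2 * n - 1 / 2\<close> covers the case \<open>z < 1\<close> and makes the sum of these bounds over \<open>T\<close>
converge.\<close>

lemma last_cols_approx_real:
  assumes n: "n \<ge> 1" and k: "k > 0" and c: "c > 0" and X: "X \<ge> 1"
  defines "z \<equiv> real X / real c"
  shows "\<bar>last_cols n k T (X div c) - last_prob n k T * (z ^ (2 * n) / real (2 * n))\<bar> \<le> K1 n * real k * z powr (real (2 * n) - 1 / 2)"
proof -
  define N where "N = 2 * n"
  define y where "y = X div c"
  define p where "p = last_prob n k T"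
  have p: "0 \<le> p" "p \<le> 1" using last_prob_bounds[OF k] by (auto simp: p_def)
  have z: "z > 0" using X c by (simp add: z_def)
  have yz: "real y \<le> z" "z < real y + 1" using nat_div_real[OF c] by (simp_all add: y_def z_def)
  have N: "N \<ge> 2" using n by (simp add: N_def)
  have kr: "real k \<ge> 1" using k by simp
  have K1: "K1 n \<ge> 1" by (simp add: K1_def)
  show ?thesis
  proof (cases "y = 0")
    case True
    then have z1: "z < 1" using yz by simp
    have "last_cols n k T y = 0" using True by (simp add: last_cols_def)
    moreover have "p * (z ^ N / real N) \<le> 1 * (z ^ N / 1)"
      using p z N by (intro mult_mono divide_left_mono) auto
    moreover have "z ^ N = z powr real N" using z by (simp add: powr_realpow)
    moreover have "z powr real N \<le> z powr (real N - 1 / 2)" using z z1 by (intro powr_mono') auto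
    moreover have "1 * (z powr (real N - 1 / 2)) \<le> K1 n * real k * z powr (real N - 1 / 2)"
      using K1 kr mult_mono[of 1 "K1 n" 1 "real k"] by (intro mult_right_mono) auto
    moreover have "p * (z ^ N / real N) \<ge> 0" using p z by simp
    ultimately show ?thesis by (simp add: N_def y_def p_def)
  next
    case False
    then have z1: "z \<ge> 1" using yz by simp
    have "real y ^ N \<le> z ^ N" using yz by (intro power_mono) auto
    have zp: "z ^ (N - 1) \<le> z powr (real N - 1 / 2)"
    proof -
      have "z ^ (N - 1) = z powr (real N - 1)" using z N by (simp add: powr_realpow[symmetric] of_nat_diff)
      also have "\<dots> \<le> z powr (real N - 1 / 2)" using z1 by (intro powr_mono) auto
      finally show ?thesis .
    qed
    have 1: "\<bar>last_cols n k T y - p * (real y ^ N / real N)\<bar> \<le> (real N + 4 * 2 ^ N + 1) * real k * real y ^ (N - 1)"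
      unfolding N_def p_def by (rule last_cols_approx[OF n k])
    have "real y ^ (N - 1) \<le> z ^ (N - 1)" using yz by (intro power_mono) auto
    then have yp: "real y ^ (N - 1) \<le> z powr (real N - 1 / 2)" using zp by linarith
    have 2: "\<bar>p * (real y ^ N / real N) - p * (z ^ N / real N)\<bar> \<le> real k * z powr (real N - 1 / 2)"
    proof -
      have "\<bar>p * (real y ^ N / real N) - p * (z ^ N / real N)\<bar> = p * ((z ^ N - real y ^ N) / real N)"
      proof -
        have "p * (real y ^ N / real N) - p * (z ^ N / real N) = - (p * ((z ^ N - real y ^ N) / real N))"
          by (simp add: diff_divide_distrib right_diff_distrib)
        moreover have "0 \<le> p * ((z ^ N - real y ^ N) / real N)"
          using \<open>real y ^ N \<le> z ^ N\<close> p by (intro mult_nonneg_nonneg divide_nonneg_nonneg) auto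
        ultimately show ?thesis by (simp only: abs_minus_cancel abs_of_nonneg)
      qed
      also have "\<dots> \<le> 1 * ((z ^ N - real y ^ N) / real N)"
        using p \<open>real y ^ N \<le> z ^ N\<close> by (intro mult_right_mono) auto
      also have "\<dots> \<le> 1 * (real N * z ^ (N - 1) / real N)"
        using power_diff_le[of "real y" z N] yz by (intro mult_left_mono divide_right_mono) auto
      also have "\<dots> = z ^ (N - 1)" using N by simp
      also have "\<dots> \<le> 1 * z powr (real N - 1 / 2)" using zp by simp
      also have "\<dots> \<le> real k * z powr (real N - 1 / 2)" using kr by (intro mult_right_mono) auto
      finally show ?thesis .
    qed
    have "(real N + 4 * 2 ^ N + 1) * real k * real y ^ (N - 1) \<le> (real N + 4 * 2 ^ N + 1) * real k * z powr (real N - 1 / 2)"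
      using yp by (intro mult_left_mono) auto
    with 1 2 have "\<bar>last_cols n k T y - p * (z ^ N / real N)\<bar> \<le> (real N + 4 * 2 ^ N + 1) * real k * z powr (real N - 1 / 2) + real k * z powr (real N - 1 / 2)"
    proof -
      assume a: "\<bar>last_cols n k T y - p * (real y ^ N / real N)\<bar> \<le> (real N + 4 * 2 ^ N + 1) * real k * real y ^ (N - 1)"
        "\<bar>p * (real y ^ N / real N) - p * (z ^ N / real N)\<bar> \<le> real k * z powr (real N - 1 / 2)"
        "(real N + 4 * 2 ^ N + 1) * real k * real y ^ (N - 1) \<le> (real N + 4 * 2 ^ N + 1) * real k * z powr (real N - 1 / 2)"
      have triangle: "\<bar>a - c\<bar> \<le> \<bar>a - b\<bar> + \<bar>b - c\<bar>" for a b c :: real by simp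
      show ?thesis by (rule order_trans[OF triangle add_mono[OF order_trans[OF a(1,3)] a(2)]])
    qed
    then show ?thesis unfolding K1_def N_def[symmetric] y_def[symmetric] p_def[symmetric] by (simp add: algebra_simps)
  qed
qed

text \<open>The bound \<open>last_cols_bound\<close>, summed over \<open>T\<close>.\<close>

lemma central_count_upper:
  assumes n: "n \<ge> 1" and \<theta>: "0 \<le> \<theta>" "\<theta> < 1" and \<phi>: "\<phi> = 0 \<or> (n \<ge> 2 \<and> 0 \<le> \<phi> \<and> \<phi> < 1)"
  shows "\<exists>C\<ge>0. \<forall>k X. k > 0 \<longrightarrow> (\<lambda>T. real k ^ (2 * n) * last_cols n k T (X div (k * hnf_det (2 * n - 1) T))) summable_on hnf (2 * n - 1) \<and>
    central_count n k X \<le> C * real X ^ (2 * n) * real k powr (- \<theta> - \<phi>)"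
proof -
  define r where "r = 2 * n - 1"
  define b where "b = (\<lambda>T. wbound n \<theta> \<phi> T / real (hnf_det r T) ^ (2 * n))"
  have b: "b summable_on hnf r" unfolding b_def r_def by (rule wbound_summable[OF n \<theta> \<phi>])
  have b0: "b T \<ge> 0" for T unfolding b_def wbound_def by (auto intro!: divide_nonneg_nonneg)
  define C where "C = infsum b (hnf r)"
  have "C \<ge> 0" unfolding C_def by (rule infsum_nonneg) (rule b0)
  moreover have "(\<lambda>T. real k ^ (2 * n) * last_cols n k T (X div (k * hnf_det r T))) summable_on hnf r \<and>
    central_count n k X \<le> C * real X ^ (2 * n) * real k powr (- \<theta> - \<phi>)" if k: "k > 0" for k X
  proof -
    have le: "real k ^ (2 * n) * last_cols n k T (X div (k * hnf_det r T)) \<le> real X ^ (2 * n) * real k powr (- \<theta> - \<phi>) * b T" if T: "T \<in> hnf r" for T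
    proof -
      have D: "hnf_det r T > 0" using hnf_det_pos[OF T] .
      have w: "wbound n \<theta> \<phi> T * real k powr (- \<theta> - \<phi>) \<ge> 0" unfolding wbound_def by auto
      have "last_cols n k T (X div (k * hnf_det r T)) \<le> real (X div (k * hnf_det r T)) ^ (2 * n) * (wbound n \<theta> \<phi> T * real k powr (- \<theta> - \<phi>))"
        by (rule last_cols_bound) (use n k T \<theta> \<phi> in \<open>auto simp: r_def\<close>)
      also have "\<dots> \<le> (real X / real (k * hnf_det r T)) ^ (2 * n) * (wbound n \<theta> \<phi> T * real k powr (- \<theta> - \<phi>))"
        using nat_div_real(1)[of "k * hnf_det r T" X] k D w by (intro mult_right_mono power_mono) auto
      finally have "real k ^ (2 * n) * last_cols n k T (X div (k * hnf_det r T)) \<le> real k ^ (2 * n) * ((real X / real (k * hnf_det r T)) ^ (2 * n) * (wbound n \<theta> \<phi> T * real k powr (- \<theta> - \<phi>)))"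
        by (intro mult_left_mono) auto
      also have "\<dots> = real X ^ (2 * n) * real k powr (- \<theta> - \<phi>) * b T"
        using k by (simp add: b_def power_divide power_mult_distrib)
      finally show ?thesis .
    qed
    have s: "(\<lambda>T. real X ^ (2 * n) * real k powr (- \<theta> - \<phi>) * b T) summable_on hnf r"
      by (rule summable_on_cmult_right[OF b])
    have sm: "(\<lambda>T. real k ^ (2 * n) * last_cols n k T (X div (k * hnf_det r T))) summable_on hnf r"
      by (rule summable_on_comparison_test[OF s]) (use le last_cols_nonneg in auto)
    have "central_count n k X \<le> infsum (\<lambda>T. real X ^ (2 * n) * real k powr (- \<theta> - \<phi>) * b T) (hnf r)"
      unfolding central_count_def r_def[symmetric] by (rule infsum_mono[OF sm s le])
    also have "\<dots> = C * real X ^ (2 * n) * real k powr (- \<theta> - \<phi>)"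
      unfolding C_def by (subst infsum_cmult_right) (use b in \<open>auto simp: mult_ac\<close>)
    finally show ?thesis using sm by simp
  qed
  ultimately show ?thesis unfolding r_def by blast
qed

lemma central_count_nonneg: "central_count n k X \<ge> 0"
  unfolding central_count_def by (intro infsum_nonneg mult_nonneg_nonneg last_cols_nonneg) auto

lemma central_density_nonneg: "k > 0 \<Longrightarrow> central_density n k \<ge> 0"
  unfolding central_density_def by (intro infsum_nonneg divide_nonneg_nonneg last_prob_bounds) auto

text \<open>The sum over \<open>T\<close> of the errors in \<open>last_cols_approx_real\<close> converges, because column \<open>j < 2 * n - 1\<close>
contributes diagonal entries to the power \<open>j - 2 * n + 1 / 2\<close>.\<close>

lemma central_count_approx:
  assumes n: "n \<ge> 1"
  shows "\<exists>K\<ge>0. \<forall>k X. k > 0 \<longrightarrow> X \<ge> 1 \<longrightarrow>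
    \<bar>central_count n k X - real X ^ (2 * n) * central_density n k / real (2 * n)\<bar> \<le> K * real k powr (3 / 2) * real X powr (real (2 * n) - 1 / 2)"
proof -
  define r where "r = 2 * n - 1"
  define N where "N = 2 * n"
  define b where "b = (\<lambda>T. real (hnf_det r T) powr (- (real N - 1 / 2)))"
  have b: "b summable_on hnf r"
  proof -
    have "(\<lambda>T. \<Prod>j<r. real (nat (T j j)) powr (- (real N - 1 / 2))) summable_on hnf r"
      by (rule hnf_det_powr_summable) (use n in \<open>auto simp: r_def N_def\<close>)
    then show ?thesis by (rule summable_on_cong[THEN iffD1, rotated]) (simp add: b_def hnf_det_powr_prod)
  qed
  define K where "K = K1 n * infsum b (hnf r)"
  have K1: "K1 n \<ge> 0" by (simp add: K1_def)
  have "K \<ge> 0" unfolding K_def using K1 by (intro mult_nonneg_nonneg infsum_nonneg) (auto simp: b_def)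
  obtain C where C: "\<And>k X. k > 0 \<Longrightarrow> (\<lambda>T. real k ^ N * last_cols n k T (X div (k * hnf_det r T))) summable_on hnf r"
    using central_count_upper[OF n, of 0 0] unfolding r_def N_def by auto
  have "\<bar>central_count n k X - real X ^ N * central_density n k / real N\<bar> \<le> K * real k powr (3 / 2) * real X powr (real N - 1 / 2)"
    if k: "k > 0" and X: "X \<ge> 1" for k X
  proof -
    define f where "f = (\<lambda>T. real k ^ N * last_cols n k T (X div (k * hnf_det r T)))"
    define g where "g = (\<lambda>T. real X ^ N / real N * (last_prob n k T / real (hnf_det r T) ^ N))"
    define h where "h = (\<lambda>T. K1 n * (real k powr (3 / 2) * real X powr (real N - 1 / 2)) * b T)"
    have f: "f summable_on hnf r" unfolding f_def by (rule C[OF k])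
    have lp: "(\<lambda>T. last_prob n k T / real (hnf_det r T) ^ N) summable_on hnf r"
      unfolding r_def N_def by (rule central_density_eq(2)[OF n k])
    have g: "g summable_on hnf r" unfolding g_def by (rule summable_on_cmult_right[OF lp])
    have gi: "infsum g (hnf r) = real X ^ N * central_density n k / real N"
      unfolding g_def by (subst infsum_cmult_right) (use lp in \<open>auto simp: central_density_def r_def N_def\<close>)
    have h: "h summable_on hnf r" unfolding h_def by (rule summable_on_cmult_right[OF b])
    have le: "\<bar>f T - g T\<bar> \<le> h T" if T: "T \<in> hnf r" for T
    proof -
      define c where "c = k * hnf_det r T"
      define z where "z = real X / real c"
      have D: "hnf_det r T > 0" using hnf_det_pos[OF T] .
      have c: "c > 0" using D k by (simp add: c_def)
      have "\<bar>last_cols n k T (X div c) - last_prob n k T * (z ^ N / real N)\<bar> \<le> K1 n * real k * z powr (real N - 1 / 2)"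
        unfolding z_def N_def by (rule last_cols_approx_real[OF n k c X])
      then have "real k ^ N * \<bar>last_cols n k T (X div c) - last_prob n k T * (z ^ N / real N)\<bar> \<le> real k ^ N * (K1 n * real k * z powr (real N - 1 / 2))"
        by (intro mult_left_mono) auto
      moreover have "f T - g T = real k ^ N * (last_cols n k T (X div c) - last_prob n k T * (z ^ N / real N))"
        using k by (simp add: f_def g_def c_def z_def power_divide power_mult_distrib right_diff_distrib mult_ac)
      moreover have "real k ^ N * (K1 n * real k * z powr (real N - 1 / 2)) = h T"
      proof -
        have "z powr (real N - 1 / 2) = real X powr (real N - 1 / 2) * real k powr (- (real N - 1 / 2)) * b T"
          using k D unfolding z_def c_def b_def powr_minus_divide by (simp add: powr_divide powr_mult)
        moreover have "real k ^ N * real k * real k powr (- (real N - 1 / 2)) = real k powr (3 / 2)"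
        proof -
          have "real k ^ N * real k = real k powr (real N + 1)" using k by (simp add: powr_add powr_realpow)
          then have "real k ^ N * real k * real k powr (- (real N - 1 / 2)) = real k powr ((real N + 1) + - (real N - 1 / 2))"
            by (simp only: powr_add)
          then show ?thesis by simp
        qed
        ultimately show ?thesis unfolding h_def by (simp add: mult_ac)
      qed
      ultimately show ?thesis by (simp add: abs_mult)
    qed
    have "central_count n k X - real X ^ N * central_density n k / real N = infsum (\<lambda>T. f T - g T) (hnf r)"
    proof -
      have W: "central_count n k X = infsum f (hnf r)" unfolding central_count_def f_def r_def N_def ..
      have "((\<lambda>T. - g T) has_sum - infsum g (hnf r)) (hnf r)"
        using has_sum_infsum[OF g] by (simp add: has_sum_uminus)
      from infsumI[OF has_sum_add[OF has_sum_infsum[OF f] this]] show ?thesis unfolding W gi[symmetric] by simp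
    qed
    moreover have "norm (infsum (\<lambda>T. f T - g T) (hnf r)) \<le> infsum h (hnf r)"
    proof (rule norm_infsum_le)
      show "((\<lambda>T. f T - g T) has_sum infsum (\<lambda>T. f T - g T) (hnf r)) (hnf r)"
        using summable_on_add[OF f, of "\<lambda>T. - g T"] g by (simp add: summable_on_uminus has_sum_infsum)
    qed (use has_sum_infsum[OF h] le in auto)
    moreover have "infsum h (hnf r) = K * real k powr (3 / 2) * real X powr (real N - 1 / 2)"
      unfolding h_def K_def by (subst infsum_cmult_right) (use b in \<open>auto simp: mult_ac\<close>)
    ultimately show ?thesis by simp
  qed
  with \<open>K \<ge> 0\<close> show ?thesis unfolding N_def by blast
qed

text \<open>The two divisibilities, used with exponent \<open>3 / 4\<close> each, save \<open>k powr (3 / 2)\<close>. Dividing by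
\<open>X ^ (2 * n)\<close> and letting \<open>X\<close> tend to infinity carries the bound over to the density.\<close>

lemma central_density_upper:
  assumes n: "n \<ge> 2"
  shows "\<exists>C\<ge>0. \<forall>k X. k > 0 \<longrightarrow> central_count n k X \<le> C * real X ^ (2 * n) * real k powr (- 3 / 2) \<and> central_density n k \<le> real (2 * n) * C * real k powr (- 3 / 2)"
proof -
  have n1: "n \<ge> 1" using n by simp
  obtain C where C: "C \<ge> 0" "\<And>k X. k > 0 \<Longrightarrow> central_count n k X \<le> C * real X ^ (2 * n) * real k powr (- 3 / 2)"
    \<comment> \<open>Exponents below \<open>1\<close>, as \<open>wbound_summable\<close> requires, whose sum exceeds \<open>1\<close>.\<close>
    using central_count_upper[OF n1, of "3 / 4" "3 / 4"] n by auto
  obtain K where K: "K \<ge> 0" "\<And>k X. k > 0 \<Longrightarrow> X \<ge> 1 \<Longrightarrow>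
    \<bar>central_count n k X - real X ^ (2 * n) * central_density n k / real (2 * n)\<bar> \<le> K * real k powr (3 / 2) * real X powr (real (2 * n) - 1 / 2)"
    using central_count_approx[OF n1] by blast
  have "central_density n k \<le> real (2 * n) * C * real k powr (- 3 / 2)" if k: "k > 0" for k
  proof -
    define c where "c = K * real k powr (3 / 2)"
    have *: "central_density n k / real (2 * n) \<le> C * real k powr (- 3 / 2) + c * real X powr (- 1 / 2)" if X: "X \<ge> 1" for X
    proof -
      have "real X ^ (2 * n) * central_density n k / real (2 * n) \<le> C * real X ^ (2 * n) * real k powr (- 3 / 2) + c * real X powr (real (2 * n) - 1 / 2)"
        using C(2)[OF k, of X] K(2)[OF k X] unfolding c_def by linarith
      also have "real X powr (real (2 * n) - 1 / 2) = real X ^ (2 * n) * real X powr (- 1 / 2)"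
        using X by (simp add: powr_realpow[symmetric] powr_add[symmetric] del: of_nat_mult)
      finally have "real X ^ (2 * n) * (central_density n k / real (2 * n)) \<le> real X ^ (2 * n) * (C * real k powr (- 3 / 2) + c * real X powr (- 1 / 2))"
        by (simp add: algebra_simps)
      then show ?thesis by (rule mult_left_le_imp_le) (use X in simp)
    qed
    have "(\<lambda>X. C * real k powr (- 3 / 2) + c * real X powr (- 1 / 2)) \<longlonglongrightarrow> C * real k powr (- 3 / 2) + c * 0"
      by (intro tendsto_intros tendsto_neg_powr filterlim_real_sequentially) auto
    moreover have "\<forall>\<^sub>F X in sequentially. central_density n k / real (2 * n) \<le> C * real k powr (- 3 / 2) + c * real X powr (- 1 / 2)"
      using eventually_ge_at_top[of 1] by eventually_elim (rule *)
    ultimately have "central_density n k / real (2 * n) \<le> C * real k powr (- 3 / 2) + c * 0"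
      by (rule tendsto_lowerbound) simp
    then show ?thesis using n by (simp add: field_simps)
  qed
  then show ?thesis using C by blast
qed

lemma summable_central_density:
  assumes n: "n \<ge> 2"
  shows "summable (\<lambda>k. central_density n (Suc k))"
proof -
  obtain C where C: "\<And>k. k > 0 \<Longrightarrow> central_density n k \<le> real (2 * n) * C * real k powr (- 3 / 2)"
    using central_density_upper[OF n] by blast
  show ?thesis
  proof (rule summable_comparison_test')
    show "summable (\<lambda>k. real (2 * n) * C * real (Suc k) powr (- 3 / 2))"
      by (intro summable_mult summable_powr_Suc) simp
    show "norm (central_density n (Suc k)) \<le> real (2 * n) * C * real (Suc k) powr (- 3 / 2)" for k
      using C[of "Suc k"] central_density_nonneg[of "Suc k" n] by simp
  qed
qed

lemma central_count_zero: "k > X \<Longrightarrow> central_count n k X = 0"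
proof -
  assume k: "k > X"
  define r where "r = 2 * n - 1"
  have "X div (k * hnf_det r T) = 0" if "T \<in> hnf r" for T
  proof -
    have "k * 1 \<le> k * hnf_det r T" using hnf_det_pos[OF that] by (intro mult_le_mono2) simp
    then have "X < k * hnf_det r T" using k by linarith
    then show ?thesis by simp
  qed
  then have "infsum (\<lambda>T. real k ^ (2 * n) * last_cols n k T (X div (k * hnf_det r T))) (hnf r) = infsum (\<lambda>T. 0) (hnf r)"
    by (intro infsum_cong) (simp add: last_cols_def)
  then show ?thesis unfolding central_count_def r_def[symmetric] by simp
qed

lemma min_powr_interpolate:
  fixes x a b :: real
  assumes "0 \<le> x" "x \<le> a" "x \<le> b" "0 \<le> t" "t \<le> 1"
  shows "x \<le> a powr t * b powr (1 - t)"
proof -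
  have "x = x powr t * x powr (1 - t)" using assms by (cases "x = 0") (simp_all flip: powr_add)
  also have "\<dots> \<le> a powr t * b powr (1 - t)" using assms by (intro mult_mono powr_mono2) auto
  finally show ?thesis .
qed

text \<open>For each \<open>k\<close> the error is bounded both by \<open>central_count_approx\<close>, which is good in \<open>X\<close> but grows
with \<open>k\<close>, and by the sizes of the two terms. A geometric mean of the two bounds is summable over \<open>k\<close>
and keeps a saving in \<open>X\<close>.\<close>

lemma sum_central_count_asymptotics:
  assumes n: "n \<ge> 2"
  shows "\<exists>K. \<forall>X\<ge>1. \<bar>(\<Sum>k=1..X. central_count n k X) - (\<Sum>k. central_density n (Suc k)) / real (2 * n) * real X ^ (2 * n)\<bar> \<le> K * real X powr (real (2 * n) - 1 / 24)"
proof -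
  have n1: "n \<ge> 1" using n by simp
  obtain C where C: "C \<ge> 0" "\<And>k X. k > 0 \<Longrightarrow> central_count n k X \<le> C * real X ^ (2 * n) * real k powr (- 3 / 2)"
      "\<And>k. k > 0 \<Longrightarrow> central_density n k \<le> real (2 * n) * C * real k powr (- 3 / 2)"
    using central_density_upper[OF n] by blast
  obtain K where K: "K \<ge> 0" "\<And>k X. k > 0 \<Longrightarrow> X \<ge> 1 \<Longrightarrow>
    \<bar>central_count n k X - real X ^ (2 * n) * central_density n k / real (2 * n)\<bar> \<le> K * real k powr (3 / 2) * real X powr (real (2 * n) - 1 / 2)"
    using central_count_approx[OF n1] by blast
  define L where "L = K powr (1 / 12) * C powr (11 / 12)"
  define E where "E = (\<lambda>k X. \<bar>central_count n k X - real X ^ (2 * n) * central_density n k / real (2 * n)\<bar>)"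
  have E: "E k X \<le> L * real X powr (real (2 * n) - 1 / 24) * real k powr (- 5 / 4)" if k: "k > 0" and X: "X \<ge> 1" for k X
  proof -
    have gN: "0 \<le> central_density n k / real (2 * n)" "central_density n k / real (2 * n) \<le> C * real k powr (- 3 / 2)"
      using C(3)[OF k] central_density_nonneg[OF k, of n] n by (simp_all add: field_simps)
    have "real X ^ (2 * n) * (central_density n k / real (2 * n)) \<le> real X ^ (2 * n) * (C * real k powr (- 3 / 2))"
      by (intro mult_left_mono gN) auto
    moreover have "real X ^ (2 * n) * (central_density n k / real (2 * n)) \<ge> 0" by (intro mult_nonneg_nonneg gN) auto
    ultimately have "E k X \<le> C * real X ^ (2 * n) * real k powr (- 3 / 2)"
      unfolding E_def using C(2)[OF k, of X] central_count_nonneg[of n k X] by (simp add: mult_ac abs_le_iff)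
    \<comment> \<open>The weights \<open>1 / 12\<close> and \<open>11 / 12\<close> give the exponent \<open>3 / 24 - 33 / 24 = - 5 / 4\<close>
      of \<open>k\<close>, less than \<open>- 1\<close>, and lower the exponent of \<open>X\<close> by \<open>1 / 24\<close>.\<close>
    then have "E k X \<le> (K * real k powr (3 / 2) * real X powr (real (2 * n) - 1 / 2)) powr (1 / 12) * (C * real X ^ (2 * n) * real k powr (- 3 / 2)) powr (1 - 1 / 12)"
      by (intro min_powr_interpolate) (use K(2)[OF k X] in \<open>auto simp: E_def\<close>)
    also have "\<dots> = L * real X powr (real (2 * n) - 1 / 24) * real k powr (- 5 / 4)"
    proof -
      have X0: "real X > 0" and k0: "real k > 0" using X k by auto
      have "real X ^ (2 * n) = real X powr real (2 * n)" using X0 by (simp only: powr_realpow)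
      then have "(K * real k powr (3 / 2) * real X powr (real (2 * n) - 1 / 2)) powr (1 / 12) * (C * real X ^ (2 * n) * real k powr (- 3 / 2)) powr (1 - 1 / 12)
        = L * ((real X powr ((real (2 * n) - 1 / 2) * (1 / 12)) * real X powr (real (2 * n) * (11 / 12))) * (real k powr (3 / 2 * (1 / 12)) * real k powr (- 3 / 2 * (11 / 12))))"
        using K(1) C(1) by (simp add: L_def powr_mult powr_powr mult_ac)
      also have "real X powr ((real (2 * n) - 1 / 2) * (1 / 12)) * real X powr (real (2 * n) * (11 / 12)) = real X powr (real (2 * n) - 1 / 24)"
        unfolding powr_add[symmetric] by (rule arg_cong[of _ _ "\<lambda>e. real X powr e"]) (simp add: field_simps)
      also have "real k powr (3 / 2 * (1 / 12)) * real k powr (- 3 / 2 * (11 / 12)) = real k powr (- 5 / 4)"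
        unfolding powr_add[symmetric] by simp
      finally show ?thesis by simp
    qed
    finally show ?thesis .
  qed
  define M where "M = (\<Sum>k. real (Suc k) powr (- 5 / 4))"
  have Ms: "summable (\<lambda>k. real (Suc k) powr (- 5 / 4))" by (rule summable_powr_Suc) simp
  have "\<bar>(\<Sum>k=1..X. central_count n k X) - (\<Sum>k. central_density n (Suc k)) / real (2 * n) * real X ^ (2 * n)\<bar> \<le> (L * M) * real X powr (real (2 * n) - 1 / 24)"
    if X: "X \<ge> 1" for X
  proof -
    have W: "(\<lambda>k. central_count n (Suc k) X) sums (\<Sum>k=1..X. central_count n k X)"
    proof -
      have "(\<lambda>k. central_count n (Suc k) X) sums (\<Sum>k\<in>{..<X}. central_count n (Suc k) X)"
        by (rule sums_finite) (auto intro: central_count_zero)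
      also have "(\<Sum>k\<in>{..<X}. central_count n (Suc k) X) = (\<Sum>k=1..X. central_count n k X)"
        by (rule sum.reindex_bij_witness[of _ "\<lambda>k. k - 1" Suc]) auto
      finally show ?thesis .
    qed
    have g: "(\<lambda>k. real X ^ (2 * n) * central_density n (Suc k) / real (2 * n)) sums ((\<Sum>k. central_density n (Suc k)) / real (2 * n) * real X ^ (2 * n))"
      using sums_mult[OF summable_sums[OF summable_central_density[OF n]], of "real X ^ (2 * n) / real (2 * n)"] by (simp add: mult_ac)
    have d: "(\<lambda>k. central_count n (Suc k) X - real X ^ (2 * n) * central_density n (Suc k) / real (2 * n)) sums
      ((\<Sum>k=1..X. central_count n k X) - (\<Sum>k. central_density n (Suc k)) / real (2 * n) * real X ^ (2 * n))" by (rule sums_diff[OF W g])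
    have bs: "summable (\<lambda>k. L * real X powr (real (2 * n) - 1 / 24) * real (Suc k) powr (- 5 / 4))"
      by (rule summable_mult[OF Ms])
    have "norm (\<Sum>k. central_count n (Suc k) X - real X ^ (2 * n) * central_density n (Suc k) / real (2 * n)) \<le> (\<Sum>k. L * real X powr (real (2 * n) - 1 / 24) * real (Suc k) powr (- 5 / 4))"
      by (rule norm_suminf_le[OF _ bs]) (use E[OF zero_less_Suc X] in \<open>simp only: E_def real_norm_def\<close>)
    also have "\<dots> = L * real X powr (real (2 * n) - 1 / 24) * M" unfolding M_def by (rule suminf_mult[OF Ms])
    finally show ?thesis using sums_unique[OF d] by (simp add: mult_ac)
  qed
  then show ?thesis by blast
qed

section \<open>The abscissa of convergence\<close>

text \<open>Convergence of an infinite sum of zeros and ones is what proves that the counted sets are finite.\<close>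

lemma has_sum_of_bool_card:
  assumes "((\<lambda>x. of_bool (P x)) has_sum (S :: real)) A"
  shows "finite {x\<in>A. P x}" "S = real (card {x\<in>A. P x})"
proof -
  have h: "((\<lambda>_. 1 :: real) has_sum S) {x\<in>A. P x}"
    using assms by (rule has_sum_cong_neutral[THEN iffD1, rotated 3]) auto
  then have "(\<lambda>_. 1 :: real) summable_on {x\<in>A. P x}" by (rule has_sum_imp_summable)
  then show "finite {x\<in>A. P x}" using infsum_diverge_constant[of "{x\<in>A. P x}" "1 :: real"] by auto
  show "S = real (card {x\<in>A. P x})" using infsumI[OF h] by simp
qed

text \<open>Once the other columns are fixed as \<open>T\<close>, the condition on the index bounds the last diagonal entry
by \<open>X div (k * hnf_det r T)\<close>.\<close>

lemma card_hnf_le: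
  assumes n: "n \<ge> 1" and k: "k > 0"
  shows "finite {M\<in>hnf (2 * n). isotropic n k M \<and> k * hnf_det (2 * n) M \<le> X}"
    and "real k ^ (2 * n) * real (card {M\<in>hnf (2 * n). isotropic n k M \<and> k * hnf_det (2 * n) M \<le> X}) = central_count n k X"
proof -
  define r where "r = 2 * n - 1"
  have N: "2 * n = Suc r" using n by (simp add: r_def)
  define G where "G = (\<lambda>T. last_cols n k T (X div (k * hnf_det r T)))"
  have "(\<lambda>T. real k ^ (2 * n) * G T) summable_on hnf r"
    using central_count_upper[OF n, of 0 0] k unfolding r_def G_def by auto
  then have "(\<lambda>T. 1 / real k ^ (2 * n) * (real k ^ (2 * n) * G T)) summable_on hnf r" by (rule summable_on_cmult_right)
  then have G: "(G has_sum infsum G (hnf r)) (hnf r)" using k by (simp add: has_sum_infsum)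
  have W: "central_count n k X = real k ^ (2 * n) * infsum G (hnf r)"
  proof -
    have "infsum (\<lambda>T. real k ^ (2 * n) * G T) (hnf r) = real k ^ (2 * n) * infsum G (hnf r)"
      by (rule infsum_cmult_right) (use G has_sum_imp_summable in blast)
    then show ?thesis by (simp only: central_count_def r_def[symmetric] G_def)
  qed
  define F where "F = (\<lambda>M. of_bool (isotropic n k M \<and> k * hnf_det (Suc r) M \<le> X) :: real)"
  have "(F has_sum infsum G (hnf r)) (hnf (Suc r))"
  proof (rule has_sum_hnf_Suc[OF _ _ G])
    fix T assume T: "T \<in> hnf r"
    define y where "y = X div (k * hnf_det r T)"
    have kD: "k * hnf_det r T > 0" using hnf_det_pos[OF T] k by simp
    have F: "F (T(r := u(r := int d))) = of_bool (isotropic n k (T(r := u(r := int d)))) * of_bool (d \<le> y)" for u d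
    proof -
      have "hnf_det (Suc r) (T(r := u(r := int d))) = hnf_det r T * d" by (simp add: hnf_det_def)
      then have eq: "k * hnf_det (Suc r) (T(r := u(r := int d))) = d * (k * hnf_det r T)" by (simp only: mult_ac)
      show ?thesis unfolding F_def eq y_def less_eq_div_iff_mult_less_eq[OF kD] by (rule of_bool_conj)
    qed
    show "((\<lambda>v. F (T(r := v))) has_sum G T) (hcol r)"
    proof (rule has_sum_hcol)
      show "((\<lambda>d. \<Sum>u\<in>cube {..<r} d. F (T(r := u(r := int d)))) has_sum G T) {1..}"
      proof (rule has_sum_finite_neutralI[of "{1..y}"])
        show "G T = (\<Sum>d=1..y. \<Sum>u\<in>cube {..<r} d. F (T(r := u(r := int d))))"
          unfolding G_def last_cols_def y_def[symmetric] r_def[symmetric] F by (intro sum.cong refl) simp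
      qed (auto simp only: F, auto)
    qed (simp add: F_def)
  qed (simp add: F_def)
  then have "((\<lambda>M. of_bool (isotropic n k M \<and> k * hnf_det (2 * n) M \<le> X)) has_sum infsum G (hnf r)) (hnf (2 * n))"
    unfolding F_def N .
  from has_sum_of_bool_card[OF this]
  show "finite {M\<in>hnf (2 * n). isotropic n k M \<and> k * hnf_det (2 * n) M \<le> X}"
    and "real k ^ (2 * n) * real (card {M\<in>hnf (2 * n). isotropic n k M \<and> k * hnf_det (2 * n) M \<le> X}) = central_count n k X"
    unfolding W by simp_all
qed

lemma subgroup_data_count:
  assumes n: "n \<ge> 1"
  shows "finite (subgroup_data n m)" and "real (\<Sum>m=1..X. card (subgroup_data n m)) = (\<Sum>k=1..X. central_count n k X)"
proof -
  define B where "B = (\<lambda>X k. {M\<in>hnf (2 * n). isotropic n k M \<and> k * hnf_det (2 * n) M \<le> X})"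
  define S where "S = (\<lambda>X. SIGMA k:{1..X}. B X k \<times> cube {..<2 * n} k)"
  have B: "finite (B X k)" if "k > 0" for X k unfolding B_def by (rule card_hnf_le(1)[OF n that])
  have S: "finite (S X)" for X unfolding S_def by (intro finite_SigmaI finite_cartesian_product B finite_cube) auto
  have subgroup_data: "(k, M, t) \<in> subgroup_data n m \<longleftrightarrow> k \<ge> 1 \<and> M \<in> hnf (2 * n) \<and> isotropic n k M \<and> t \<in> cube {..<2 * n} k \<and> k * hnf_det (2 * n) M = m"
    for k M t m
  proof -
    have "int k * (\<Prod>j<2 * n. M j j) = int m \<longleftrightarrow> k * hnf_det (2 * n) M = m" if "M \<in> hnf (2 * n)"
      unfolding hnf_det_int[OF that, symmetric] by (metis of_nat_eq_iff of_nat_mult)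
    then show ?thesis unfolding subgroup_data_def by blast
  qed
  have kD: "k \<le> k * hnf_det (2 * n) M" "0 < k * hnf_det (2 * n) M" if "k \<ge> 1" "M \<in> hnf (2 * n)" for k M
    using hnf_det_pos[OF that(2)] that by auto
  have U: "(\<Union>m\<in>{1..X}. subgroup_data n m) = S X" for X
  proof (intro equalityI subsetI)
    fix x assume "x \<in> (\<Union>m\<in>{1..X}. subgroup_data n m)"
    then obtain m k M t where x: "x = (k, M, t)" "(k, M, t) \<in> subgroup_data n m" "m \<le> X" by (cases x) auto
    then show "x \<in> S X" using kD[of k M] by (auto simp: subgroup_data S_def B_def)
  next
    fix x assume "x \<in> S X"
    then obtain k M t where x: "x = (k, M, t)" "1 \<le> k" "M \<in> B X k" "t \<in> cube {..<2 * n} k" by (auto simp: S_def)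
    then have "x \<in> subgroup_data n (k * hnf_det (2 * n) M)" "k * hnf_det (2 * n) M \<in> {1..X}"
      using kD[of k M] by (auto simp: subgroup_data B_def)
    then show "x \<in> (\<Union>m\<in>{1..X}. subgroup_data n m)" by blast
  qed
  show fin: "finite (subgroup_data n m)" for m
  proof (cases "m = 0")
    case True
    have "subgroup_data n 0 = {}"
    proof (rule equals0I)
      fix x assume x: "x \<in> subgroup_data n 0"
      obtain k M t where "x = (k, M, t)" by (cases x)
      then show False using x kD(2)[of k M] by (auto simp: subgroup_data)
    qed
    then show ?thesis using True by simp
  next
    case False
    then have "subgroup_data n m \<subseteq> (\<Union>m'\<in>{1..m}. subgroup_data n m')" by (intro UN_upper) simp
    then show ?thesis unfolding U using S by (rule finite_subset)
  qed
  have "(\<Sum>m=1..X. card (subgroup_data n m)) = card (\<Union>m\<in>{1..X}. subgroup_data n m)"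
    by (rule card_UN_disjoint[symmetric]) (use fin in \<open>auto simp: subgroup_data\<close>)
  also have "\<dots> = (\<Sum>k=1..X. card (B X k \<times> cube {..<2 * n} k))"
    unfolding U S_def by (rule card_SigmaI) (auto intro!: B finite_cube)
  finally have "real (\<Sum>m=1..X. card (subgroup_data n m)) = (\<Sum>k=1..X. real (card (B X k \<times> cube {..<2 * n} k)))"
    by (simp only: of_nat_sum)
  also have "\<dots> = (\<Sum>k=1..X. central_count n k X)"
  proof (rule sum.cong)
    fix k assume "k \<in> {1..X}"
    then have "real k ^ (2 * n) * real (card (B X k)) = central_count n k X" unfolding B_def by (intro card_hnf_le(2)[OF n]) auto
    then show "real (card (B X k \<times> cube {..<2 * n} k)) = central_count n k X" by (simp add: card_cartesian_product card_cube mult.commute)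
  qed simp
  finally show "real (\<Sum>m=1..X. card (subgroup_data n m)) = (\<Sum>k=1..X. central_count n k X)" .
qed

lemma num_subgroups_upto_central_count:
  "n \<ge> 1 \<Longrightarrow> real (num_subgroups_upto_index (heisenberg n) X) = (\<Sum>k=1..X. central_count n k X)"
  using subgroup_data_count(2)[of n X] by (simp add: num_subgroups_upto_index_def num_subgroups_subgroup_data)

text \<open>Subgroups containing the centre, over the lattices whose Hermite normal form differs from the
identity only in the last column: its \<open>2 * n - 1\<close> upper entries are free modulo \<open>m\<close>.\<close>

lemma num_subgroups_lower:
  assumes n: "n \<ge> 1" and m: "m \<ge> 1"
  shows "m ^ (2 * n - 1) \<le> num_subgroups_of_index (heisenberg n) m"
proof -
  define r where "r = 2 * n - 1"
  have N: "2 * n = Suc r" using n by (simp add: r_def)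
  define Mf where "Mf = (\<lambda>u. (\<lambda>j\<in>{..<Suc r}. if j < r then (\<lambda>i. if i = j then 1 else 0) else u(r := int m)))"
  have "card (cube {..<r} m) \<le> card (subgroup_data n m)"
  proof (rule card_inj_on_le[of "\<lambda>u. (1, Mf u, \<lambda>_. 0)"])
    show "inj_on (\<lambda>u. (1 :: nat, Mf u, \<lambda>_. 0 :: int)) (cube {..<r} m)"
    proof (rule inj_onI)
      fix u u' assume u: "u \<in> cube {..<r} m" "u' \<in> cube {..<r} m" "(1 :: nat, Mf u, \<lambda>_. 0 :: int) = (1, Mf u', \<lambda>_. 0)"
      then have "Mf u r = Mf u' r" by simp
      then have "u(r := int m) = u'(r := int m)" by (simp add: Mf_def)
      moreover have "u r = 0" "u' r = 0" using u by (auto simp: cube_def)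
      ultimately show "u = u'" by (metis fun_upd_triv fun_upd_upd)
    qed
    show "(\<lambda>u. (1 :: nat, Mf u, \<lambda>_. 0 :: int)) ` cube {..<r} m \<subseteq> subgroup_data n m"
    proof clarify
      fix u assume u: "u \<in> cube {..<r} m"
      have "Mf u j \<in> hcol j" if "j < Suc r" for j
        using that u m by (cases "j < r") (auto simp: Mf_def hcol_def cube_def)
      then have "Mf u \<in> hnf (2 * n)" unfolding hnf_def N by (intro PiE_I) (auto simp: Mf_def)
      moreover have "(\<Prod>j<2 * n. Mf u j j) = int m" unfolding N lessThan_Suc by (simp add: Mf_def)
      moreover have "isotropic n 1 (Mf u)" by (simp add: isotropic_def)
      moreover have "(\<lambda>_. 0) \<in> cube {..<2 * n} 1" by (simp add: cube_def)
      ultimately show "(1, Mf u, \<lambda>_. 0) \<in> subgroup_data n m" unfolding subgroup_data_def by simp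
    qed
  qed (rule subgroup_data_count(1)[OF n])
  then show ?thesis by (simp add: card_cube num_subgroups_subgroup_data r_def)
qed

lemma subgroup_zeta_term_eq:
  "subgroup_zeta_term G s (Suc k) = of_real (real (num_subgroups_of_index G (Suc k))) * of_nat (Suc k) powr (- s)"
  by (simp add: subgroup_zeta_term_def)

text \<open>From above, \<open>central_count_upper\<close> with \<open>\<theta>\<close> close to \<open>1\<close> gives \<open>X powr (2 * n + \<epsilon>)\<close>
subgroups up to index \<open>X\<close>. From below, \<open>num_subgroups_lower\<close> makes the series diverge at \<open>2 * n\<close>.\<close>

theorem abscissa_heisenberg:
  assumes n: "n \<ge> 1"
  shows "subgroup_zeta_abscissa (heisenberg n) = ereal (2 * real n)"
proof -
  define A where "A = (\<lambda>m. real (num_subgroups_of_index (heisenberg n) m))"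
  have t: "subgroup_zeta_term (heisenberg n) s (Suc k) = of_real (A (Suc k)) * of_nat (Suc k) powr (- s)" for s k
    by (simp only: subgroup_zeta_term_eq A_def)
  have up: "summable (\<lambda>k. subgroup_zeta_term (heisenberg n) s (Suc k))" if s: "Re s > 2 * real n" for s
  proof -
    \<comment> \<open>The sum of \<open>k powr (e - 1)\<close> is bounded crudely by \<open>X powr (2 * e)\<close> times a
      convergent series, so \<open>2 * e\<close> must fit below \<open>Re s - 2 * n\<close>.\<close>
    define e where "e = min 1 ((Re s - 2 * real n) / 3)"
    have e: "0 < e" "e \<le> 1" "Re s > 2 * real n + 2 * e" 
    proof -
      have "e \<le> (Re s - 2 * real n) / 3" unfolding e_def by (rule min.cobounded2)
      then have "3 * e \<le> Re s - 2 * real n" by simp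
      moreover have "3 * a \<le> b - c \<Longrightarrow> c < b \<Longrightarrow> c + 2 * a < b" for a b c :: real by linarith
      ultimately show "Re s > 2 * real n + 2 * e" using s by blast
    qed (use s in \<open>auto simp: e_def\<close>)
    obtain C where C: "C \<ge> 0" "\<And>k X. k > 0 \<Longrightarrow> central_count n k X \<le> C * real X ^ (2 * n) * real k powr (- (1 - e) - 0)"
      using central_count_upper[OF n, of "1 - e" 0] e by auto
    define M where "M = (\<Sum>k. real (Suc k) powr (- 1 - e))"
    have Ms: "summable (\<lambda>k. real (Suc k) powr (- 1 - e))" by (rule summable_powr_Suc) (use e in simp)
    have sum_pow: "(\<Sum>k=1..Y. real k powr (- (1 - e))) \<le> M * real Y powr (2 * e)" for Y
    proof -
      have "(\<Sum>k=1..Y. real k powr (- (1 - e))) \<le> (\<Sum>k=1..Y. real k powr (- 1 - e) * real Y powr (2 * e))"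
      proof (rule sum_mono)
        fix k assume k: "k \<in> {1..Y}"
        have "real k powr (- (1 - e)) = real k powr (- 1 - e) * real k powr (2 * e)" by (simp flip: powr_add)
        also have "\<dots> \<le> real k powr (- 1 - e) * real Y powr (2 * e)"
          using k e by (intro mult_left_mono powr_mono2) auto
        finally show "real k powr (- (1 - e)) \<le> real k powr (- 1 - e) * real Y powr (2 * e)" .
      qed
      also have "\<dots> = (\<Sum>k=1..Y. real k powr (- 1 - e)) * real Y powr (2 * e)" by (simp only: sum_distrib_right)
      also have "(\<Sum>k=1..Y. real k powr (- 1 - e)) = (\<Sum>k<Y. real (Suc k) powr (- 1 - e))"
        by (rule sum.reindex_bij_witness[of _ Suc "\<lambda>k. k - 1"]) auto
      also have "(\<Sum>k<Y. real (Suc k) powr (- 1 - e)) * real Y powr (2 * e) \<le> M * real Y powr (2 * e)"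
        unfolding M_def by (intro mult_right_mono sum_le_suminf[OF Ms]) auto
      finally show ?thesis .
    qed
    show ?thesis unfolding t
    proof (rule dirichlet_summable[where b = "2 * real n + 2 * e" and K = "C * M"])
      fix X :: nat assume X: "X \<ge> 1"
      have "(\<Sum>m=1..X. A m) = (\<Sum>k=1..X. central_count n k X)"
        using num_subgroups_upto_central_count[OF n, of X] by (simp add: A_def num_subgroups_upto_index_def)
      also have "\<dots> \<le> (\<Sum>k=1..X. C * real X ^ (2 * n) * real k powr (- (1 - e)))"
        using C(2) by (intro sum_mono) auto
      also have "\<dots> = C * real X ^ (2 * n) * (\<Sum>k=1..X. real k powr (- (1 - e)))" by (simp only: sum_distrib_left)
      also have "\<dots> \<le> C * real X ^ (2 * n) * (M * real X powr (2 * e))" using C(1) by (intro mult_left_mono sum_pow) auto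
      also have "\<dots> = C * M * (real X powr real (2 * n) * real X powr (2 * e))" using X by (simp add: powr_realpow del: of_nat_mult)
      also have "real X powr real (2 * n) * real X powr (2 * e) = real X powr (2 * real n + 2 * e)" by (simp add: powr_add)
      finally show "(\<Sum>m=1..X. A m) \<le> C * M * real X powr (2 * real n + 2 * e)" .
    qed (use e in \<open>auto simp: A_def\<close>)
  qed
  have lo: "\<not> summable (\<lambda>k. subgroup_zeta_term (heisenberg n) (of_nat (2 * n)) (Suc k))"
    unfolding t
  proof (rule dirichlet_not_summable)
    show "A m \<ge> real m ^ (2 * n - 1)" if "m \<ge> 1" for m
      using num_subgroups_lower[OF n that] unfolding A_def by (metis of_nat_le_iff of_nat_power)
  qed (use n in simp)
  show ?thesis unfolding subgroup_zeta_abscissa_def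
  proof (rule antisym)
    show "Inf {ereal a |a. \<forall>s. Re s > a \<longrightarrow> summable (\<lambda>k. subgroup_zeta_term (heisenberg n) s (Suc k))} \<le> ereal (2 * real n)"
      by (rule Inf_lower) (use up in blast)
    show "ereal (2 * real n) \<le> Inf {ereal a |a. \<forall>s. Re s > a \<longrightarrow> summable (\<lambda>k. subgroup_zeta_term (heisenberg n) s (Suc k))}"
    proof (rule Inf_greatest)
      fix x assume "x \<in> {ereal a |a. \<forall>s. Re s > a \<longrightarrow> summable (\<lambda>k. subgroup_zeta_term (heisenberg n) s (Suc k))}"
      then obtain a where a: "x = ereal a" "\<And>s. Re s > a \<Longrightarrow> summable (\<lambda>k. subgroup_zeta_term (heisenberg n) s (Suc k))" by auto
      have "\<not> 2 * real n > a" using a(2)[of "of_nat (2 * n)"] lo by auto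
      then show "ereal (2 * real n) \<le> x" by (simp add: a(1))
    qed
  qed
qed

section \<open>The pole and the growth of the number of subgroups\<close>

text \<open>The common factor of all densities is the first product of zeta values in \<open>R_const\<close>. Positivity
comes from \<open>k = 1\<close>, where every matrix is isotropic.\<close>

lemma central_density_suminf:
  assumes n: "n \<ge> 2"
  shows "(\<Sum>k. central_density n (Suc k)) = R_const n" "R_const n > 0"
proof -
  have n1: "n \<ge> 1" using n by simp
  define Z where "Z = (\<Prod>j<2 * n - 1. riemann_zeta (real (2 * n - j)))"
  have Z: "Z > 0" unfolding Z_def by (intro prod_pos zeta_pos) auto
  have g: "central_density n (Suc k) = Z * iso_prob n (Suc k)" for k
    unfolding Z_def by (rule central_density_eq(1)[OF n1]) simp
  have "summable (\<lambda>k. Z * iso_prob n (Suc k))" using summable_central_density[OF n] unfolding g .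
  then have s: "summable (\<lambda>k. iso_prob n (Suc k))" using Z by (simp add: summable_cmult_iff)
  show R: "(\<Sum>k. central_density n (Suc k)) = R_const n"
    unfolding g R_const_eq[OF n s] Z_def[symmetric] by (rule suminf_mult[OF s])
  have "iso_prob n (Suc 0) \<le> (\<Sum>k. iso_prob n (Suc k))"
    using sum_le_suminf[OF s, of "{0}"] iso_prob_nonneg by simp
  then have "(\<Sum>k. iso_prob n (Suc k)) > 0" using iso_prob_1[of n] by simp
  then show "R_const n > 0" unfolding R_const_eq[OF n s] Z_def[symmetric] using Z by simp
qed

lemma subgroup_count_error:
  assumes n: "n \<ge> 2"
  shows "\<exists>K. \<forall>M\<ge>1. \<bar>real (num_subgroups_upto_index (heisenberg n) M) - R_const n / real (2 * n) * real M ^ (2 * n)\<bar>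
    \<le> K * real M powr (real (2 * n) - 1 / 24)"
  using sum_central_count_asymptotics[OF n] num_subgroups_upto_central_count[of n] n unfolding central_density_suminf(1)[OF n] by simp

theorem corollary1p3:
  fixes n :: nat
  assumes "n \<ge> 1"
  shows "subgroup_zeta_abscissa (heisenberg n) = ereal (2 * real n) \<and>
    (n \<ge> 2 \<longrightarrow>
      (\<exists>\<delta>>0. \<exists>F. meromorphic_continuation (heisenberg n) {s. Re s > 2 * real n - \<delta>} F) \<and>
      (\<forall>U F. meromorphic_continuation (heisenberg n) U F \<and> of_nat (2 * n) \<in> U \<longrightarrow>
         is_pole F (of_nat (2 * n)) \<and> zorder F (of_nat (2 * n)) = - 1) \<and>
      (\<lambda>N. real (num_subgroups_upto_index (heisenberg n) N))
        \<sim>[sequentially] (\<lambda>N. R_const n / (2 * real n) * real N ^ (2 * n)))"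
proof (intro conjI impI)
  show absc: "subgroup_zeta_abscissa (heisenberg n) = ereal (2 * real n)" by (rule abscissa_heisenberg[OF assms])
  assume n: "n \<ge> 2"
  define A where "A = (\<lambda>m. real (num_subgroups_of_index (heisenberg n) m))"
  define C where "C = R_const n / real (2 * n)"
  define d :: real where "d = 1 / 24"
  have C: "C > 0" using central_density_suminf(2)[OF n] n by (simp add: C_def)
  obtain K where K: "\<And>M. M \<ge> 1 \<Longrightarrow> \<bar>real (num_subgroups_upto_index (heisenberg n) M) - C * real M ^ (2 * n)\<bar> \<le> K * real M powr (real (2 * n) - d)"
    using subgroup_count_error[OF n] unfolding C_def d_def by blast
  have S: "\<bar>(\<Sum>m=1..M. A m) - C * real M ^ (2 * n)\<bar> \<le> K * real M powr (real (2 * n) - d)" if "M \<ge> 1" for M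
    using K[OF that] by (simp add: A_def num_subgroups_upto_index_def)
  have N: "2 * n \<ge> 1" "0 < d" "d \<le> 1" using n by (auto simp: d_def)
  define h where "h = cont_fun A (2 * n) C"
  have h: "h holomorphic_on {s. Re s > real (2 * n) - d}" unfolding h_def by (rule cont_fun_holomorphic[OF N S])
  have hN: "h (of_nat (2 * n)) = of_real C * of_nat (2 * n)" unfolding h_def by (rule cont_fun_N[OF N S])
  have zeta: "subgroup_zeta (heisenberg n) s = h s / (s - of_nat (2 * n))" if "Re s > real (2 * n)" for s
    unfolding subgroup_zeta_def subgroup_zeta_term_eq h_def A_def[symmetric]
    using dirichlet_sums[OF N S that] by (simp add: sums_iff A_def)
  have dom: "ereal (Re s) > subgroup_zeta_abscissa (heisenberg n) \<longleftrightarrow> Re s > real (2 * n)" for s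
    by (simp add: absc)
  show "\<exists>\<delta>>0. \<exists>F. meromorphic_continuation (heisenberg n) {s. Re s > 2 * real n - \<delta>} F"
  proof (intro exI conjI)
    show "d > 0" by fact
    show "meromorphic_continuation (heisenberg n) {s. Re s > 2 * real n - d} (\<lambda>s. h s / (s - of_nat (2 * n)))"
      unfolding meromorphic_continuation_def dom
    proof (intro conjI allI impI)
      show op: "open {s. Re s > 2 * real n - d}" by (rule open_halfspace_Re_gt)
      show "connected {s. Re s > 2 * real n - d}" by (rule convex_connected[OF convex_halfspace_Re_gt])
      show "{s. Re s > real (2 * n)} \<subseteq> {s. Re s > 2 * real n - d}" using N by auto
      have "h analytic_on {s. Re s > 2 * real n - d}" using h op by (simp add: analytic_on_open)
      then have "h meromorphic_on {s. Re s > 2 * real n - d}" by (rule analytic_on_imp_meromorphic_on)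
      then show "(\<lambda>s. h s / (s - of_nat (2 * n))) meromorphic_on {s. Re s > 2 * real n - d}"
        by (intro meromorphic_intros)
    qed (simp add: zeta)
  qed
  show "\<forall>U F. meromorphic_continuation (heisenberg n) U F \<and> of_nat (2 * n) \<in> U \<longrightarrow>
      is_pole F (of_nat (2 * n)) \<and> zorder F (of_nat (2 * n)) = - 1"
  proof (intro allI impI)
    fix U F assume F: "meromorphic_continuation (heisenberg n) U F \<and> of_nat (2 * n) \<in> U"
    show "is_pole F (of_nat (2 * n)) \<and> zorder F (of_nat (2 * n)) = - 1"
    proof (rule is_simple_pole_unique_continuation[OF h])
      show "open {s. Re s > real (2 * n) - d}" by (rule open_halfspace_Re_gt)
      show "of_nat (2 * n) \<in> {s. Re s > real (2 * n) - d}" using N by simp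
      show "h (of_nat (2 * n)) \<noteq> 0" unfolding hN using C n by simp
      show "F meromorphic_on U" "of_nat (2 * n) \<in> U" using F by (auto simp: meromorphic_continuation_def)
      show "F s = h s / (s - of_nat (2 * n))" if "Re s > Re (of_nat (2 * n))" for s
        using F that unfolding meromorphic_continuation_def dom by (simp add: zeta)
    qed
  qed
  show "(\<lambda>N. real (num_subgroups_upto_index (heisenberg n) N)) \<sim>[sequentially] (\<lambda>N. R_const n / (2 * real n) * real N ^ (2 * n))"
  proof -
    define a where "a = (\<lambda>N. real (num_subgroups_upto_index (heisenberg n) N))"
    have "(\<lambda>N. a N / (C * real N ^ (2 * n))) \<longlonglongrightarrow> 1"
    proof (rule LIM_zero_cancel, rule Lim_null_comparison)
      show "\<forall>\<^sub>F N in sequentially. norm (a N / (C * real N ^ (2 * n)) - 1) \<le> K / C * real N powr (- d)"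
        using eventually_ge_at_top[of 1]
      proof eventually_elim
        fix M :: nat assume M: "M \<ge> 1"
        have p: "C * real M ^ (2 * n) > 0" using M C by simp
        have "norm (a M / (C * real M ^ (2 * n)) - 1) = \<bar>a M - C * real M ^ (2 * n)\<bar> / (C * real M ^ (2 * n))"
        proof -
          have "a M / (C * real M ^ (2 * n)) - 1 = (a M - C * real M ^ (2 * n)) / (C * real M ^ (2 * n))"
            using M C by (simp add: diff_divide_distrib)
          then show ?thesis using p by (simp only: real_norm_def abs_divide abs_of_pos)
        qed
        also have "\<dots> \<le> (K * real M powr (real (2 * n) - d)) / (C * real M ^ (2 * n))"
          using K[OF M] p unfolding a_def by (intro divide_right_mono) auto
        also have "real M powr (real (2 * n) - d) = real M ^ (2 * n) * real M powr (- d)"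
        proof -
          have "real M powr (real (2 * n) + - d) = real M powr real (2 * n) * real M powr (- d)" by (rule powr_add)
          then show ?thesis using M by (simp add: powr_realpow del: of_nat_mult)
        qed
        also have "K * (real M ^ (2 * n) * real M powr (- d)) / (C * real M ^ (2 * n)) = K / C * real M powr (- d)"
          using M C by simp
        finally show "norm (a M / (C * real M ^ (2 * n)) - 1) \<le> K / C * real M powr (- d)" .
      qed
      have "(\<lambda>N. K / C * real N powr (- d)) \<longlonglongrightarrow> K / C * 0"
        by (intro tendsto_intros tendsto_neg_powr filterlim_real_sequentially) (use N in auto)
      then show "(\<lambda>N. K / C * real N powr (- d)) \<longlonglongrightarrow> 0" by simp
    qed
    then have "a \<sim>[sequentially] (\<lambda>N. C * real N ^ (2 * n))" by (rule asymp_equivI')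
    then show ?thesis unfolding a_def C_def by simp
  qed
qed

end
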